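(* Let $p>1$, $\mu_1,\mu_2\in\mathbb{R}$, $\beta>0$ and $c_1,c_2>0$, and suppose one of the following holds: (i) $\max\{\mu_1+\beta,\mu_2+\beta\}\le 0$; (ii) $1<p<2$; (iii) $p=2$ and $\min\{2-K_4(\mu_1+\beta)c_1,\ 2-K_4(\mu_2+\beta)c_2\}>0$. Then $I$ is bounded from below on $S(c_1)\times S(c_2)$, i.e. $m:=\inf_{S(c_1)\times S(c_2)} I>-\infty$, the infimum $m$ is attained, and the problem $$\begin{cases}-\Delta u+\lambda_1u+\big[\log|\cdot|\ast(u^2+v^2)\big]u=\mu_1|u|^{2p-2}u+\beta|v|^p|u|^{p-2}u & \text{in }\mathbb{R}^2,\\ -\Delta v+\lambda_2v+\big[\log|\cdot|\ast(u^2+v^2)\big]v=\mu_2|v|^{2p-2}v+\beta|u|^p|v|^{p-2}v & \text{in }\mathbb{R}^2,\\ \int_{\mathbb{R}^2}u^2\,dx=c_1,\quad \int_{\mathbb{R}^2}v^2\,dx=c_2\end{cases}$$ has a ground state solution.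
   Context: $E:=\{u\in H^1(\mathbb{R}^2):\int_{\mathbb{R}^2}\log(1+|x|^2)u^2\,dx<\infty\}$, a Hilbert space with norm $\|u\|_E^2=\|u\|_{H^1}^2+\int_{\mathbb{R}^2}\log(1+|x|)u^2dx$; $E\times E$ carries the product norm. For $c>0$, $S(c):=\{w\in E:\int_{\mathbb{R}^2}w^2dx=c\}$. Notation: $Q(u)=\int|\nabla u|^2$, $P(u)=\int|u|^{2p}$, $P_0(u,v)=\int|uv|^p$, $R(u,v)=\mu_1P(u)+\mu_2P(v)+2\beta P_0(u,v)$, $W_0(u,v)=\iint_{\mathbb{R}^2\times\mathbb{R}^2}\log|x-y|\,(u^2(x)+v^2(x))(u^2(y)+v^2(y))\,dx\,dy$, and $I(u,v)=\frac12(Q(u)+Q(v))+\frac14W_0(u,v)-\frac1{2p}R(u,v)$, a $C^1$ functional on $E\times E$. A pair $(u,v)\in S(c_1)\times S(c_2)$ is a constrained critical point of $I$ if there exist $(\lambda_1,\lambda_2)\in\mathbb{R}^2$ (Lagrange multipliers) with $dI(u,v)+\lambda_1(u,0)+\lambda_2(0,v)=0$ in $(E\times E)^*$; then $(\lambda_1,\lambda_2,u,v)$ is a (weak) solution of the problem in the claim. Let $\mathcal{K}(c_1,c_2)$ be the set of constrained critical points. A solution $(\lambda_1,\lambda_2,u,v)$ is a ground state solution if $(u,v)\in\mathcal K(c_1,c_2)$ and $I(u,v)=\inf_{\mathcal{K}(c_1,c_2)}I$. For $q>2$, $K_q>0$ is the best constant in the Gagliardo–Nirenberg inequality $\|u\|_q^q\le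 K_q\|\nabla u\|_2^{q-2}\|u\|_2^2$ for all $u\in H^1(\mathbb{R}^2)$. *)

theory Defs
  imports "HOL-Analysis.Analysis"
begin

type_synonym pt = "real^2"

text \<open>Test functions: C^1 functions with compact support (weak derivatives defined
with C_c^1 test functions coincide with the usual ones).\<close>
definition test_fun :: "(pt \<Rightarrow> real) \<Rightarrow> (pt \<Rightarrow> pt) \<Rightarrow> bool" where
  "test_fun \<phi> D\<phi> \<longleftrightarrow>
     (\<forall>x. (\<phi> has_derivative (\<lambda>h. D\<phi> x \<bullet> h)) (at x)) \<and>
     continuous_on UNIV D\<phi> \<and> compact (closure {x. \<phi> x \<noteq> 0})"

definition L2 :: "(pt \<Rightarrow> real) \<Rightarrow> bool" where
  "L2 u \<longleftrightarrow> u \<in> borel_measurable lborel \<and> integrable lborel (\<lambda>x. (u x)\<^sup>2)"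

definition is_weak_grad :: "(pt \<Rightarrow> real) \<Rightarrow> (pt \<Rightarrow> pt) \<Rightarrow> bool" where
  "is_weak_grad u g \<longleftrightarrow>
     (\<forall>\<phi> D\<phi> i. test_fun \<phi> D\<phi> \<longrightarrow>
        (\<integral>x. u x * (D\<phi> x $ i) \<partial>lborel) = - (\<integral>x. (g x $ i) * \<phi> x \<partial>lborel))"

definition H1 :: "(pt \<Rightarrow> real) set" where
  "H1 = {u. L2 u \<and> (\<exists>g. g \<in> borel_measurable lborel \<and>
                     integrable lborel (\<lambda>x. (norm (g x))\<^sup>2) \<and> is_weak_grad u g)}"

definition weak_grad :: "(pt \<Rightarrow> real) \<Rightarrow> pt \<Rightarrow> pt" where
  "weak_grad u = (SOME g. g \<in> borel_measurable lborel \<and>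
                     integrable lborel (\<lambda>x. (norm (g x))\<^sup>2) \<and> is_weak_grad u g)"

definition Esp :: "(pt \<Rightarrow> real) set" where
  "Esp = {u \<in> H1. integrable lborel (\<lambda>x. ln (1 + (norm x)\<^sup>2) * (u x)\<^sup>2)}"

definition Q :: "(pt \<Rightarrow> real) \<Rightarrow> real" where
  "Q u = (\<integral>x. (norm (weak_grad u x))\<^sup>2 \<partial>lborel)"

definition normE :: "(pt \<Rightarrow> real) \<Rightarrow> real" where
  "normE u = sqrt (Q u + (\<integral>x. (u x)\<^sup>2 \<partial>lborel)
                   + (\<integral>x. ln (1 + norm x) * (u x)\<^sup>2 \<partial>lborel))"

definition Sc :: "real \<Rightarrow> (pt \<Rightarrow> real) set" where
  "Sc c = {w \<in> Esp. (\<integral>x. (w x)\<^sup>2 \<partial>lborel) = c}"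

definition P :: "real \<Rightarrow> (pt \<Rightarrow> real) \<Rightarrow> real" where
  "P p u = (\<integral>x. \<bar>u x\<bar> powr (2 * p) \<partial>lborel)"

definition P0 :: "real \<Rightarrow> (pt \<Rightarrow> real) \<Rightarrow> (pt \<Rightarrow> real) \<Rightarrow> real" where
  "P0 p u v = (\<integral>x. \<bar>u x * v x\<bar> powr p \<partial>lborel)"

definition R :: "real \<Rightarrow> real \<Rightarrow> real \<Rightarrow> real \<Rightarrow> (pt \<Rightarrow> real) \<Rightarrow> (pt \<Rightarrow> real) \<Rightarrow> real" where
  "R p \<mu>1 \<mu>2 \<beta> u v = \<mu>1 * P p u + \<mu>2 * P p v + 2 * \<beta> * P0 p u v"

definition W0 :: "(pt \<Rightarrow> real) \<Rightarrow> (pt \<Rightarrow> real) \<Rightarrow> real" where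
  "W0 u v = (\<integral>z. ln (dist (fst z) (snd z))
                 * ((u (fst z))\<^sup>2 + (v (fst z))\<^sup>2) * ((u (snd z))\<^sup>2 + (v (snd z))\<^sup>2)
               \<partial>(lborel \<Otimes>\<^sub>M lborel))"

definition Ifun :: "real \<Rightarrow> real \<Rightarrow> real \<Rightarrow> real \<Rightarrow> (pt \<Rightarrow> real) \<Rightarrow> (pt \<Rightarrow> real) \<Rightarrow> real" where
  "Ifun p \<mu>1 \<mu>2 \<beta> u v = (Q u + Q v) / 2 + W0 u v / 4 - R p \<mu>1 \<mu>2 \<beta> u v / (2 * p)"

text \<open>Constrained critical point with Lagrange multipliers l1, l2:
  I is Frechet differentiable at (u,v) on E x E (product norm) with
  dI(u,v)[(h,k)] = - l1 \<integral> u h - l2 \<integral> v k, i.e. dI(u,v) + l1 (u,0) + l2 (0,v) = 0.\<close>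
definition crit :: "real \<Rightarrow> real \<Rightarrow> real \<Rightarrow> real \<Rightarrow> real \<Rightarrow> real \<Rightarrow> real \<Rightarrow> real
                    \<Rightarrow> (pt \<Rightarrow> real) \<Rightarrow> (pt \<Rightarrow> real) \<Rightarrow> bool" where
  "crit p \<mu>1 \<mu>2 \<beta> c1 c2 l1 l2 u v \<longleftrightarrow> u \<in> Sc c1 \<and> v \<in> Sc c2 \<and>
     (\<forall>\<epsilon>>0. \<exists>\<delta>>0. \<forall>h\<in>Esp. \<forall>k\<in>Esp.
        sqrt ((normE h)\<^sup>2 + (normE k)\<^sup>2) < \<delta> \<longrightarrow>
        \<bar>Ifun p \<mu>1 \<mu>2 \<beta> (\<lambda>x. u x + h x) (\<lambda>x. v x + k x) - Ifun p \<mu>1 \<mu>2 \<beta> u v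
          + l1 * (\<integral>x. u x * h x \<partial>lborel) + l2 * (\<integral>x. v x * k x \<partial>lborel)\<bar>
        \<le> \<epsilon> * sqrt ((normE h)\<^sup>2 + (normE k)\<^sup>2))"

definition Kset :: "real \<Rightarrow> real \<Rightarrow> real \<Rightarrow> real \<Rightarrow> real \<Rightarrow> real
                    \<Rightarrow> ((pt \<Rightarrow> real) \<times> (pt \<Rightarrow> real)) set" where
  "Kset p \<mu>1 \<mu>2 \<beta> c1 c2 = {(u, v). \<exists>l1 l2. crit p \<mu>1 \<mu>2 \<beta> c1 c2 l1 l2 u v}"

definition GN_const :: "real \<Rightarrow> real" where
  "GN_const q = Inf {K. K > 0 \<and> (\<forall>u\<in>H1.
      (\<integral>x. \<bar>u x\<bar> powr q \<partial>lborel) \<le> K * (sqrt (Q u)) powr (q - 2) * (\<integral>x. (u x)\<^sup>2 \<partial>lborel))}"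

end

theory Submission
  imports Defs "HOL-Library.Diagonal_Subsequence"
begin

text \<open>
  The positive part of the logarithmic energy controls, after a translation, the logarithmic moment
  of a pair with bounded energy: if \<open>\<integral>\<integral> log\<^sup>+|x - y| \<rho>(x) \<rho>(y) \<le> M\<close> and \<open>\<rho>\<close> has mass \<open>c\<close>, then some \<open>y\<close> satisfies
  \<open>\<integral> log\<^sup>+|x - y| \<rho>(x) \<le> M / c\<close>. The negative part and the power terms are dominated by the Dirichlet
  energy through the Gagliardo--Nirenberg inequality, so minimizing sequences are, up to translations,
  bounded in E and hence relatively compact in \<open>L\<^sup>2\<close>. Any limit is a minimizer, because the negative
  part and the power terms are continuous and the remaining terms lower semicontinuous. Since \<open>I\<close> is
  differentiable, moving along curves in the sphere \<open>S(c)\<close> produces the Lagrange multipliers; all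
  constrained critical points lie in \<open>S(c\<^sub>1) \<times> S(c\<^sub>2)\<close>, so a minimizer is a ground state.

  The Sobolev facts all follow from \<open>\<parallel>u(\<cdot> + h) - u\<parallel>\<^sub>2 \<le> |h| \<parallel>\<nabla>u\<parallel>\<^sub>2\<close>, by comparing \<open>u\<close> with its local averages.
\<close>

section \<open>Square-integrable functions\<close>

text \<open>Translations preserve the energy but not the weight in the norm of E, so bounded energy
  alone gives no bound in E. The kernel is unbounded in both directions, and its two parts behave
  differently. The negative part is a square-integrable function of x - y: its energy grows only
  like the root of the Dirichlet energy, and it is continuous along L^2-convergent sequences with
  bounded gradients. The positive part is finite only thanks to the logarithmic moment, and Fatou is
  all that is available for it. For p = 2 the hypothesis is the coefficient left by the
  Gagliardo--Nirenberg inequality at q = 4, so the infimum \<open>GN_const 4\<close> must itself be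
  an admissible constant. The inequality comes from a weak-type bound for superlevel sets; dyadic
  summation raises the exponent by less than 2, and the step is iterated. For p < 2 the coupling is
  not C^2, so differentiability rests on homogeneity and not on a Taylor expansion.\<close>

definition square_integrable :: "('a::euclidean_space \<Rightarrow> 'b::euclidean_space) \<Rightarrow> bool" where
  "square_integrable f \<longleftrightarrow> f \<in> borel_measurable borel \<and> integrable lborel (\<lambda>x. (norm (f x))\<^sup>2)"

definition l2norm :: "('a::euclidean_space \<Rightarrow> 'b::euclidean_space) \<Rightarrow> real" where
  "l2norm f = sqrt (\<integral>x. (norm (f x))\<^sup>2 \<partial>lborel)"

lemma square_integrable_measurable [measurable_dest]:
  "square_integrable f \<Longrightarrow> f \<in> borel_measurable borel"
  by (simp add: square_integrable_def)

lemma square_integrable_integrable: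
  "square_integrable f \<Longrightarrow> integrable lborel (\<lambda>x. (norm (f x))\<^sup>2)"
  by (simp add: square_integrable_def)

lemma l2norm_nonneg [simp]: "0 \<le> l2norm f"
  by (simp add: l2norm_def)

lemma l2norm_sq: "(l2norm f)\<^sup>2 = (\<integral>x. (norm (f x))\<^sup>2 \<partial>lborel)"
  by (simp add: l2norm_def)

lemma l2norm_sq_real: "(l2norm f)\<^sup>2 = (\<integral>x. (f x)\<^sup>2 \<partial>lborel)" for f :: "'a::euclidean_space \<Rightarrow> real"
  by (simp add: l2norm_sq)

lemma L2_iff: "L2 u \<longleftrightarrow> square_integrable u"
  by (simp add: L2_def square_integrable_def)

lemma square_integrable_nn:
  "square_integrable f \<Longrightarrow> (\<integral>\<^sup>+x. ennreal ((norm (f x))\<^sup>2) \<partial>lborel) = ennreal ((l2norm f)\<^sup>2)"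
  by (simp add: l2norm_sq nn_integral_eq_integral square_integrable_integrable)

lemma square_integrableI_nn:
  assumes [measurable]: "f \<in> borel_measurable borel"
    and le: "(\<integral>\<^sup>+x. ennreal ((norm (f x))\<^sup>2) \<partial>lborel) \<le> ennreal (B\<^sup>2)" and "0 \<le> B"
  shows "square_integrable f" "l2norm f \<le> B"
proof -
  have "integrable lborel (\<lambda>x. (norm (f x))\<^sup>2)"
    by (rule integrableI_nonneg) (use le in \<open>auto simp: le_less_trans\<close>)
  then show *: "square_integrable f" by (simp add: square_integrable_def)
  have "ennreal ((l2norm f)\<^sup>2) \<le> ennreal (B\<^sup>2)"
    using le square_integrable_nn[OF *] by simp
  then have "(l2norm f)\<^sup>2 \<le> B\<^sup>2" by simp
  then show "l2norm f \<le> B" using \<open>0 \<le> B\<close> by (rule power2_le_imp_le)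
qed

lemma square_integrable_dominated:
  assumes f: "square_integrable f" and [measurable]: "g \<in> borel_measurable borel"
    and le: "\<And>x. norm (g x) \<le> norm (f x)"
  shows "square_integrable g" "l2norm g \<le> l2norm f"
proof -
  have "(\<integral>\<^sup>+x. ennreal ((norm (g x))\<^sup>2) \<partial>lborel) \<le> (\<integral>\<^sup>+x. ennreal ((norm (f x))\<^sup>2) \<partial>lborel)"
    by (intro nn_integral_mono) (auto intro!: power_mono le)
  then have "(\<integral>\<^sup>+x. ennreal ((norm (g x))\<^sup>2) \<partial>lborel) \<le> ennreal ((l2norm f)\<^sup>2)"
    using square_integrable_nn[OF f] by simp
  from square_integrableI_nn[OF _ this] show "square_integrable g" "l2norm g \<le> l2norm f"
    by auto
qed

lemma square_integrable_norm_mult: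
  assumes f: "square_integrable f" and g: "square_integrable g"
  shows "integrable lborel (\<lambda>x. norm (f x) * norm (g x))"
    and "(\<integral>x. norm (f x) * norm (g x) \<partial>lborel) \<le> l2norm f * l2norm g"
proof -
  note [measurable] = square_integrable_measurable[OF f] square_integrable_measurable[OF g]
  note int = square_integrable_integrable[OF f] square_integrable_integrable[OF g]
  show i: "integrable lborel (\<lambda>x. norm (f x) * norm (g x))"
  proof (rule Bochner_Integration.integrable_bound[OF Bochner_Integration.integrable_add[OF int]])
    show "AE x in lborel. norm (norm (f x) * norm (g x)) \<le> norm ((norm (f x))\<^sup>2 + (norm (g x))\<^sup>2)"
    proof (intro AE_I2)
      fix x
      have "2 * (norm (f x) * norm (g x)) \<le> (norm (f x))\<^sup>2 + (norm (g x))\<^sup>2"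
        using sum_squares_bound[of "norm (f x)" "norm (g x)"] by (simp add: mult.assoc)
      moreover have "0 \<le> norm (f x) * norm (g x)" by simp
      ultimately have "norm (f x) * norm (g x) \<le> (norm (f x))\<^sup>2 + (norm (g x))\<^sup>2" by linarith
      then show "norm (norm (f x) * norm (g x)) \<le> norm ((norm (f x))\<^sup>2 + (norm (g x))\<^sup>2)"
        by simp
    qed
  qed measurable
  let ?X = "\<integral>x. norm (f x) * norm (g x) \<partial>lborel" and ?a = "(l2norm f)\<^sup>2" and ?b = "(l2norm g)\<^sup>2"
  \<comment> \<open>The square of t |f| - |g| has a nonnegative integral for every t;
    Cauchy--Schwarz is the sign of the discriminant.\<close>
  have q: "0 \<le> t\<^sup>2 * ?a - 2 * t * ?X + ?b" for t :: real
  proof -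
    have "0 \<le> (\<integral>x. (t * norm (f x) - norm (g x))\<^sup>2 \<partial>lborel)" by simp
    also have "\<dots> = (\<integral>x. t\<^sup>2 * (norm (f x))\<^sup>2 - 2 * t * (norm (f x) * norm (g x)) + (norm (g x))\<^sup>2 \<partial>lborel)"
      by (simp add: power2_diff power_mult_distrib algebra_simps)
    also have "\<dots> = t\<^sup>2 * ?a - 2 * t * ?X + ?b"
      using i int by (simp add: l2norm_sq)
    finally show ?thesis .
  qed
  have X: "0 \<le> ?X" by simp
  have "?X\<^sup>2 \<le> ?a * ?b"
  proof (cases "?a = 0")
    case True
    have "?X = 0"
    proof (rule ccontr)
      assume "?X \<noteq> 0"
      \<comment> \<open>For a = 0 the quadratic is affine in t, and this t gives it the value
        -1.\<close>
      with q[of "(?b + 1) / (2 * ?X)"] True show False by (simp add: field_simps)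
    qed
    then show ?thesis by simp
  next
    case False
    then have a: "0 < ?a" by (metis zero_le_power2 less_eq_real_def)
    \<comment> \<open>t = X / a is the minimum point of the quadratic.\<close>
    from q[of "?X / ?a"] a have "0 \<le> ?a * ((?X / ?a)\<^sup>2 * ?a - 2 * (?X / ?a) * ?X + ?b)"
      by (intro mult_nonneg_nonneg) auto
    also have "\<dots> = ?a * ?b - ?X\<^sup>2" using False
      by (simp add: field_simps power2_eq_square)
    finally show ?thesis by simp
  qed
  also have "\<dots> = (l2norm f * l2norm g)\<^sup>2" by (simp add: power_mult_distrib)
  finally show "?X \<le> l2norm f * l2norm g"
    by (rule power2_le_imp_le) simp
qed

lemma square_integrable_inner:
  assumes f: "square_integrable f" and g: "square_integrable g"
  shows "integrable lborel (\<lambda>x. f x \<bullet> g x)"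
    and "\<bar>\<integral>x. f x \<bullet> g x \<partial>lborel\<bar> \<le> l2norm f * l2norm g"
proof -
  note [measurable] = square_integrable_measurable[OF f] square_integrable_measurable[OF g]
  show i: "integrable lborel (\<lambda>x. f x \<bullet> g x)"
    by (rule Bochner_Integration.integrable_bound[OF square_integrable_norm_mult(1)[OF f g]])
      (auto simp: Cauchy_Schwarz_ineq2)
  have "\<bar>\<integral>x. f x \<bullet> g x \<partial>lborel\<bar> \<le> (\<integral>x. \<bar>f x \<bullet> g x\<bar> \<partial>lborel)" by simp
  also have "\<dots> \<le> (\<integral>x. norm (f x) * norm (g x) \<partial>lborel)"
    using i square_integrable_norm_mult(1)[OF f g]
    by (intro integral_mono) (auto simp: Cauchy_Schwarz_ineq2)
  also have "\<dots> \<le> l2norm f * l2norm g" by (rule square_integrable_norm_mult(2)[OF f g])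
  finally show "\<bar>\<integral>x. f x \<bullet> g x \<partial>lborel\<bar> \<le> l2norm f * l2norm g" .
qed

lemma square_integrable_mult:
  fixes f g :: "'a::euclidean_space \<Rightarrow> real"
  assumes f: "square_integrable f" and g: "square_integrable g"
  shows "integrable lborel (\<lambda>x. f x * g x)"
    and "\<bar>\<integral>x. f x * g x \<partial>lborel\<bar> \<le> l2norm f * l2norm g"
  using square_integrable_inner[OF f g] by simp_all

lemma
  assumes f: "square_integrable f" and g: "square_integrable g"
  shows square_integrable_add: "square_integrable (\<lambda>x. f x + g x)"
    and l2norm_triangle: "l2norm (\<lambda>x. f x + g x) \<le> l2norm f + l2norm g"
    and l2norm_add_sq: "(l2norm (\<lambda>x. f x + g x))\<^sup>2
        = (l2norm f)\<^sup>2 + 2 * (\<integral>x. f x \<bullet> g x \<partial>lborel) + (l2norm g)\<^sup>2"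
proof -
  note [measurable] = square_integrable_measurable[OF f] square_integrable_measurable[OF g]
  note int = square_integrable_integrable[OF f] square_integrable_integrable[OF g]
    square_integrable_inner(1)[OF f g]
  have eq: "(\<lambda>x. (norm (f x + g x))\<^sup>2) = (\<lambda>x. (norm (f x))\<^sup>2 + 2 * (f x \<bullet> g x) + (norm (g x))\<^sup>2)"
    by (simp add: power2_norm_eq_inner inner_add_left inner_add_right inner_commute algebra_simps)
  show s: "square_integrable (\<lambda>x. f x + g x)"
    unfolding square_integrable_def eq using int by auto
  show *: "(l2norm (\<lambda>x. f x + g x))\<^sup>2
        = (l2norm f)\<^sup>2 + 2 * (\<integral>x. f x \<bullet> g x \<partial>lborel) + (l2norm g)\<^sup>2"
    unfolding l2norm_sq eq using int by simp
  have "(l2norm (\<lambda>x. f x + g x))\<^sup>2 \<le> (l2norm f + l2norm g)\<^sup>2"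
    unfolding * using square_integrable_inner(2)[OF f g] by (simp add: power2_sum)
  then show "l2norm (\<lambda>x. f x + g x) \<le> l2norm f + l2norm g"
    by (rule power2_le_imp_le) simp
qed

lemma square_integrable_scaleR: "square_integrable f \<Longrightarrow> square_integrable (\<lambda>x. a *\<^sub>R f x)"
  by (auto simp: square_integrable_def power_mult_distrib)

lemma square_integrable_cmult: "square_integrable f \<Longrightarrow> square_integrable (\<lambda>x. a * f x)"
  for f :: "'a::euclidean_space \<Rightarrow> real"
  using square_integrable_scaleR[of f a] by simp

lemma l2norm_scaleR: "l2norm (\<lambda>x. a *\<^sub>R f x) = \<bar>a\<bar> * l2norm f"
  by (simp add: l2norm_def power_mult_distrib real_sqrt_mult)

lemma l2norm_cmult: "l2norm (\<lambda>x. a * f x) = \<bar>a\<bar> * l2norm f"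
  for f :: "'a::euclidean_space \<Rightarrow> real"
  using l2norm_scaleR[of a f] by simp

lemma square_integrable_minus: "square_integrable f \<Longrightarrow> square_integrable (\<lambda>x. - f x)"
  by (auto simp: square_integrable_def)

lemma l2norm_minus: "l2norm (\<lambda>x. - f x) = l2norm f"
  by (simp add: l2norm_def)

lemma square_integrable_diff:
  "square_integrable f \<Longrightarrow> square_integrable g \<Longrightarrow> square_integrable (\<lambda>x. f x - g x)"
  using square_integrable_add[of f "\<lambda>x. - g x"] by (simp add: square_integrable_minus)

lemma l2norm_diff_commute: "l2norm (\<lambda>x. f x - g x) = l2norm (\<lambda>x. g x - f x)"
  by (simp add: l2norm_def norm_minus_commute)

lemma l2norm_triangle_diff:
  assumes "square_integrable f" "square_integrable g" "square_integrable h"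
  shows "l2norm (\<lambda>x. f x - h x) \<le> l2norm (\<lambda>x. f x - g x) + l2norm (\<lambda>x. g x - h x)"
  using l2norm_triangle[OF square_integrable_diff[OF assms(1,2)] square_integrable_diff[OF assms(2,3)]]
  by simp

lemma l2norm_triangle_sub:
  assumes "square_integrable f" "square_integrable g"
  shows "l2norm f \<le> l2norm g + l2norm (\<lambda>x. f x - g x)"
  using l2norm_triangle[OF assms(2) square_integrable_diff[OF assms]] by simp

lemma square_integrable_zero [simp]: "square_integrable (\<lambda>x. 0)"
  by (simp add: square_integrable_def)

lemma l2norm_eq_0_iff:
  assumes f: "square_integrable f"
  shows "l2norm f = 0 \<longleftrightarrow> (AE x in lborel. f x = 0)"
  using integral_nonneg_eq_0_iff_AE[OF square_integrable_integrable[OF f]]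
  by (simp add: l2norm_def)

lemma l2norm_cong_AE:
  assumes [measurable]: "f \<in> borel_measurable borel" "g \<in> borel_measurable borel"
    and "AE x in lborel. f x = g x"
  shows "l2norm f = l2norm g"
  unfolding l2norm_def using assms(3) by (intro arg_cong[where f=sqrt] integral_cong_AE) auto

section \<open>Translations and averages\<close>

lemma nn_integral_lborel_shift:
  fixes h :: "'a::euclidean_space"
  assumes [measurable]: "f \<in> borel_measurable borel"
  shows "(\<integral>\<^sup>+x. f (x + h) \<partial>lborel) = (\<integral>\<^sup>+x. f x \<partial>lborel)"
proof -
  have "(\<integral>\<^sup>+x. f x \<partial>lborel) = (\<integral>\<^sup>+x. f x \<partial>(distr lborel borel ((+) h)))"
    by (simp add: lborel_distr_plus)
  also have "\<dots> = (\<integral>\<^sup>+x. f (h + x) \<partial>lborel)"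
    by (rule nn_integral_distr) auto
  finally show ?thesis by (simp add: add.commute)
qed

lemma integrable_lborel_shift:
  fixes f :: "'a::euclidean_space \<Rightarrow> 'b::{banach, second_countable_topology}"
  assumes "integrable lborel f"
  shows "integrable lborel (\<lambda>x. f (x + h))"
proof -
  have [measurable]: "f \<in> borel_measurable borel" using assms by auto
  have "integrable (distr lborel borel ((+) h)) f"
    using assms by (simp add: lborel_distr_plus)
  then show ?thesis
    by (subst (asm) integrable_distr_eq) (auto simp: add.commute)
qed

lemma integral_lborel_shift:
  fixes f :: "'a::euclidean_space \<Rightarrow> 'b::{banach, second_countable_topology}"
  assumes [measurable]: "f \<in> borel_measurable borel"
  shows "(\<integral>x. f (x + h) \<partial>lborel) = (\<integral>x. f x \<partial>lborel)"
proof -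
  have "(\<integral>x. f x \<partial>lborel) = (\<integral>x. f x \<partial>(distr lborel borel ((+) h)))"
    by (simp add: lborel_distr_plus)
  also have "\<dots> = (\<integral>x. f (h + x) \<partial>lborel)"
    by (rule integral_distr) auto
  finally show ?thesis by (simp add: add.commute)
qed

lemma
  assumes "square_integrable f"
  shows square_integrable_shift: "square_integrable (\<lambda>x. f (x + h))"
    and l2norm_shift: "l2norm (\<lambda>x. f (x + h)) = l2norm f"
proof -
  note [measurable] = square_integrable_measurable[OF assms]
  show "square_integrable (\<lambda>x. f (x + h))"
    using integrable_lborel_shift[OF square_integrable_integrable[OF assms], of h]
    by (simp add: square_integrable_def)
  show "l2norm (\<lambda>x. f (x + h)) = l2norm f"
    unfolding l2norm_def using integral_lborel_shift[of "\<lambda>x. (norm (f x))\<^sup>2" h] by simp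
qed

text \<open>Minkowski's integral inequality for averages over a probability measure: Cauchy--Schwarz
  against the constant 1 in y, then Tonelli. Mollification, averages over balls and integrals along
  a segment are all instances.\<close>

lemma square_integrable_average:
  fixes F :: "'a::euclidean_space \<Rightarrow> 'c \<Rightarrow> 'b::euclidean_space"
  assumes N: "emeasure N (space N) = 1"
    and [measurable]: "(\<lambda>(x, y). F x y) \<in> borel_measurable (borel \<Otimes>\<^sub>M N)"
    and le: "AE y in N. square_integrable (\<lambda>x. F x y) \<and> l2norm (\<lambda>x. F x y) \<le> B" and "0 \<le> B"
  shows "square_integrable (\<lambda>x. \<integral>y. F x y \<partial>N)" "l2norm (\<lambda>x. \<integral>y. F x y \<partial>N) \<le> B"
proof -
  interpret N: finite_measure N by standard (simp add: N)
  interpret P: pair_sigma_finite "lborel :: 'a measure" N ..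
  have m: "(\<lambda>x. \<integral>y. F x y \<partial>N) \<in> borel_measurable borel"
    by (rule N.borel_measurable_lebesgue_integral) simp
  have pt: "ennreal ((norm (\<integral>y. F x y \<partial>N))\<^sup>2) \<le> (\<integral>\<^sup>+y. ennreal ((norm (F x y))\<^sup>2) \<partial>N)" for x
  proof -
    \<comment> \<open>A section that is not integrable has Bochner integral 0, so the bound holds
      for every x.\<close>
    have "ennreal (norm (\<integral>y. F x y \<partial>N)) \<le> (\<integral>\<^sup>+y. ennreal (norm (F x y)) \<partial>N)"
      by (cases "integrable N (\<lambda>y. F x y)")
        (auto intro: integral_norm_bound_ennreal simp: not_integrable_integral_eq)
    then have "(ennreal (norm (\<integral>y. F x y \<partial>N)))\<^sup>2 \<le> (\<integral>\<^sup>+y. ennreal (norm (F x y)) * 1 \<partial>N)\<^sup>2"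
      by (intro power_mono) auto
    also have "\<dots> \<le> (\<integral>\<^sup>+y. (ennreal (norm (F x y)))\<^sup>2 \<partial>N) * (\<integral>\<^sup>+y. 1\<^sup>2 \<partial>N)"
      by (rule Cauchy_Schwarz_nn_integral) auto
    also have "(\<integral>\<^sup>+y. 1\<^sup>2 \<partial>N) = 1" by (simp add: N)
    finally show ?thesis by (simp add: ennreal_power)
  qed
  have "(\<integral>\<^sup>+x. ennreal ((norm (\<integral>y. F x y \<partial>N))\<^sup>2) \<partial>lborel)
      \<le> (\<integral>\<^sup>+x. (\<integral>\<^sup>+y. ennreal ((norm (F x y))\<^sup>2) \<partial>N) \<partial>lborel)"
    by (intro nn_integral_mono pt)
  also have "\<dots> = (\<integral>\<^sup>+y. (\<integral>\<^sup>+x. ennreal ((norm (F x y))\<^sup>2) \<partial>lborel) \<partial>N)"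
    by (rule P.Fubini'[symmetric]) simp
  also have "\<dots> \<le> (\<integral>\<^sup>+y. ennreal (B\<^sup>2) \<partial>N)"
  proof (rule nn_integral_mono_AE)
    show "AE y in N. (\<integral>\<^sup>+x. ennreal ((norm (F x y))\<^sup>2) \<partial>lborel) \<le> ennreal (B\<^sup>2)"
      using le
    proof eventually_elim
      case (elim y)
      then show ?case
        using square_integrable_nn[of "\<lambda>x. F x y"] power_mono[of "l2norm (\<lambda>x. F x y)" B 2] by simp
    qed
  qed
  also have "\<dots> = ennreal (B\<^sup>2)" by (simp add: N)
  finally show "square_integrable (\<lambda>x. \<integral>y. F x y \<partial>N)" "l2norm (\<lambda>x. \<integral>y. F x y \<partial>N) \<le> B"
    using square_integrableI_nn[OF m _ \<open>0 \<le> B\<close>] by blast+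
qed

section \<open>Convergence and completeness in L^2\<close>

lemma l2norm_tendsto_0I:
  assumes "\<And>n. square_integrable (f n)" "(\<lambda>n. \<integral>x. (norm (f n x))\<^sup>2 \<partial>lborel) \<longlonglongrightarrow> 0"
  shows "(\<lambda>n. l2norm (f n)) \<longlonglongrightarrow> 0"
  unfolding l2norm_def using tendsto_real_sqrt[OF assms(2)] by simp

lemma square_integrable_dominated_convergence:
  fixes f :: "nat \<Rightarrow> 'a::euclidean_space \<Rightarrow> 'b::euclidean_space"
  assumes w: "square_integrable w" and [measurable]: "\<And>n. f n \<in> borel_measurable borel"
    "g \<in> borel_measurable borel"
    and lim: "AE x in lborel. (\<lambda>n. f n x) \<longlonglongrightarrow> g x"
    and dom: "\<And>n. AE x in lborel. norm (f n x) \<le> norm (w x)"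
  shows "square_integrable g" "\<And>n. square_integrable (f n)" "(\<lambda>n. l2norm (\<lambda>x. f n x - g x)) \<longlonglongrightarrow> 0"
proof -
  have [measurable]: "w \<in> borel_measurable borel" using w by (rule square_integrable_measurable)
  have "AE x in lborel. \<forall>n. norm (f n x) \<le> norm (w x)"
    using dom by (simp add: AE_all_countable)
  with lim have AE: "AE x in lborel. (\<forall>n. norm (f n x) \<le> norm (w x)) \<and> norm (g x) \<le> norm (w x)"
  proof eventually_elim
    case (elim x)
    from tendsto_norm[OF elim(1)] have "norm (g x) \<le> norm (w x)"
      by (rule LIMSEQ_le_const2) (use elim in auto)
    with elim show ?case by auto
  qed
  have iw: "integrable lborel (\<lambda>x. (norm (w x))\<^sup>2)" by (rule square_integrable_integrable[OF w])
  show g: "square_integrable g"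
    unfolding square_integrable_def
    by (intro conjI Bochner_Integration.integrable_bound[OF iw])
      (use AE in \<open>auto elim!: eventually_mono intro!: power_mono\<close>)
  show f: "square_integrable (f n)" for n
    unfolding square_integrable_def
    by (intro conjI Bochner_Integration.integrable_bound[OF iw])
      (use AE in \<open>auto elim!: eventually_mono intro!: power_mono\<close>)
  have "(\<lambda>n. \<integral>x. (norm (f n x - g x))\<^sup>2 \<partial>lborel) \<longlonglongrightarrow> (\<integral>x. 0 \<partial>(lborel::'a measure))"
  proof (rule integral_dominated_convergence[where w="\<lambda>x. 4 * (norm (w x))\<^sup>2"])
    show "AE x in lborel. (\<lambda>n. (norm (f n x - g x))\<^sup>2) \<longlonglongrightarrow> 0"
      using lim
    proof eventually_elim
      case (elim x)
      from tendsto_power[OF tendsto_norm[OF tendsto_diff[OF elim tendsto_const[of "g x"]]], of 2]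
      show ?case by simp
    qed
    show "AE x in lborel. norm ((norm (f n x - g x))\<^sup>2) \<le> 4 * (norm (w x))\<^sup>2" for n
      using AE
    proof eventually_elim
      case (elim x)
      have "norm (f n x - g x) \<le> 2 * norm (w x)"
        using norm_triangle_ineq4[of "f n x" "g x"] elim by (smt (verit, best))
      then have "(norm (f n x - g x))\<^sup>2 \<le> (2 * norm (w x))\<^sup>2" by (intro power_mono) auto
      then show ?case by (simp add: power_mult_distrib)
    qed
  qed (use iw in auto)
  then show "(\<lambda>n. l2norm (\<lambda>x. f n x - g x)) \<longlonglongrightarrow> 0"
    by (intro l2norm_tendsto_0I square_integrable_diff f g) simp
qed

lemma LIMSEQ_lessD:
  fixes X :: "nat \<Rightarrow> real"
  assumes "X \<longlonglongrightarrow> l" "l < e"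
  obtains N where "\<And>n. N \<le> n \<Longrightarrow> X n < e"
  using order_tendstoD(2)[OF assms] by (auto simp: eventually_sequentially)

text \<open>Fatou applied to the squares: a uniform norm bound survives a.e. limits and makes the
  limit square integrable.\<close>

lemma l2norm_Fatou:
  fixes h :: "nat \<Rightarrow> 'a::euclidean_space \<Rightarrow> 'b::euclidean_space"
  assumes h: "\<And>k. square_integrable (h k)" and [measurable]: "g \<in> borel_measurable borel"
    and lim: "AE x in lborel. (\<lambda>k. h k x) \<longlonglongrightarrow> g x"
    and B: "\<And>k. l2norm (h k) \<le> B"
  shows "square_integrable g" "l2norm g \<le> B"
proof -
  note [measurable] = square_integrable_measurable[OF h]
  have "0 \<le> B" using B[of 0] l2norm_nonneg[of "h 0"] by linarith
  have "(\<integral>\<^sup>+x. ennreal ((norm (g x))\<^sup>2) \<partial>lborel)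
      = (\<integral>\<^sup>+x. liminf (\<lambda>k. ennreal ((norm (h k x))\<^sup>2)) \<partial>lborel)"
  proof (intro nn_integral_cong_AE, use lim in eventually_elim)
    fix x assume "(\<lambda>k. h k x) \<longlonglongrightarrow> g x"
    then have "(\<lambda>k. ennreal ((norm (h k x))\<^sup>2)) \<longlonglongrightarrow> ennreal ((norm (g x))\<^sup>2)"
      by (intro tendsto_ennrealI tendsto_power tendsto_norm)
    then show "ennreal ((norm (g x))\<^sup>2) = liminf (\<lambda>k. ennreal ((norm (h k x))\<^sup>2))"
      by (intro lim_imp_Liminf[symmetric]) auto
  qed
  also have "\<dots> \<le> liminf (\<lambda>k. \<integral>\<^sup>+x. ennreal ((norm (h k x))\<^sup>2) \<partial>lborel)"
    by (rule nn_integral_liminf) auto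
  also have "\<dots> \<le> liminf (\<lambda>k. ennreal (B\<^sup>2))"
    using B by (intro Liminf_mono always_eventually allI)
      (simp add: square_integrable_nn[OF h] power_mono)
  also have "\<dots> = ennreal (B\<^sup>2)" by (simp add: Liminf_const)
  finally show "square_integrable g" "l2norm g \<le> B"
    using square_integrableI_nn[of g B] \<open>0 \<le> B\<close> by auto
qed

lemma l2norm_sum_le:
  fixes f :: "nat \<Rightarrow> 'a::euclidean_space \<Rightarrow> 'b::euclidean_space"
  assumes "\<And>k. square_integrable (f k)"
  shows "square_integrable (\<lambda>x. \<Sum>k<n. f k x) \<and> l2norm (\<lambda>x. \<Sum>k<n. f k x) \<le> (\<Sum>k<n. l2norm (f k))"
proof (induction n)
  case 0
  then show ?case by (simp add: l2norm_def)
next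
  case (Suc n)
  then show ?case
    using square_integrable_add[OF _ assms, of "\<lambda>x. \<Sum>k<n. f k x" n]
      l2norm_triangle[OF _ assms, of "\<lambda>x. \<Sum>k<n. f k x" n] by auto
qed

text \<open>Riesz--Fischer: along a subsequence with increments of norm below (1/2)^k, the sum of
  the absolute increments is bounded in L^2, hence finite a.e., and the telescoping series
  converges.\<close>

lemma l2_subseq_AE:
  fixes f :: "nat \<Rightarrow> 'a::euclidean_space \<Rightarrow> 'b::euclidean_space"
  assumes f: "\<And>n. square_integrable (f n)"
    and Cauchy: "\<And>e. 0 < e \<Longrightarrow> \<exists>N. \<forall>m\<ge>N. \<forall>n\<ge>N. l2norm (\<lambda>x. f m x - f n x) < e"
  obtains r :: "nat \<Rightarrow> nat" and g where "strict_mono r" "g \<in> borel_measurable borel"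
    "AE x in lborel. (\<lambda>k. f (r k) x) \<longlonglongrightarrow> g x"
proof -
  note [measurable] = square_integrable_measurable[OF f]
  have "\<exists>N. \<forall>k. \<forall>m\<ge>N k. \<forall>n\<ge>N k. l2norm (\<lambda>x. f m x - f n x) < (1/2) ^ k"
    by (intro choice allI Cauchy) simp
  then obtain N where N: "\<And>k m n. N k \<le> m \<Longrightarrow> N k \<le> n \<Longrightarrow> l2norm (\<lambda>x. f m x - f n x) < (1/2) ^ k"
    by blast
  \<comment> \<open>Summing the \<open>N i\<close> makes \<open>r k\<close> at least
    \<open>N k\<close>; adding k makes \<open>r\<close> strictly increasing.\<close>
  define r where "r k = (\<Sum>i\<le>k. N i) + k" for k
  have r: "strict_mono r" by (auto simp: strict_mono_Suc_iff r_def)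
  have rN: "N k \<le> r k" for k
    using member_le_sum[of k "{..k}" N] by (simp add: r_def)
  define d where "d k x = norm (f (r (Suc k)) x - f (r k) x)" for k x
  have [measurable]: "d k \<in> borel_measurable borel" for k unfolding d_def[abs_def] by measurable
  have d: "square_integrable (d k)" "l2norm (d k) \<le> (1/2) ^ k" for k
  proof -
    have "N k \<le> r (Suc k)" using rN[of k] r by (meson order.trans strict_mono_less_eq le_SucI order_refl)
    then have "l2norm (\<lambda>x. f (r (Suc k)) x - f (r k) x) < (1/2) ^ k" using N rN by blast
    then show "l2norm (d k) \<le> (1/2) ^ k" by (simp add: d_def l2norm_def)
    show "square_integrable (d k)"
      using square_integrable_diff[OF f f, of "r (Suc k)" "r k"]
      by (auto simp: square_integrable_def d_def)
  qed
  note [measurable] = square_integrable_measurable[OF d(1)]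
  define S where "S n x = (\<Sum>k<n. d k x)" for n x
  have [measurable]: "S n \<in> borel_measurable borel" for n unfolding S_def by measurable
  have S: "square_integrable (S n)" "l2norm (S n) \<le> 2" for n
  proof -
    have "(\<Sum>k<n. l2norm (d k)) \<le> (\<Sum>k<n. (1/2) ^ k)" by (intro sum_mono d)
    also have "\<dots> \<le> 2" by (simp add: geometric_sum)
    finally show "square_integrable (S n)" "l2norm (S n) \<le> 2"
      using l2norm_sum_le[of d n, OF d(1)] by (auto simp: S_def[abs_def])
  qed
  have S0: "0 \<le> S n x" for n x by (simp add: S_def d_def sum_nonneg)
  have Sm: "S n x \<le> S m x" if "n \<le> m" for n m x
    unfolding S_def using that by (intro sum_mono2) (auto simp: d_def)
  have "(\<integral>\<^sup>+x. (SUP n. ennreal ((S n x)\<^sup>2)) \<partial>lborel) = (SUP n. \<integral>\<^sup>+x. ennreal ((S n x)\<^sup>2) \<partial>lborel)"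
    by (rule nn_integral_monotone_convergence_SUP)
      (auto simp: incseq_def le_fun_def intro!: ennreal_leI power_mono Sm S0)
  also have "\<dots> \<le> ennreal 4"
  proof (rule SUP_least)
    fix n
    have "(\<integral>\<^sup>+x. ennreal ((S n x)\<^sup>2) \<partial>lborel) = ennreal ((l2norm (S n))\<^sup>2)"
      using square_integrable_nn[OF S(1)[of n]] by simp
    also have "\<dots> \<le> ennreal 4"
      using power_mono[OF S(2)[of n], of 2] by (intro ennreal_leI) simp
    finally show "(\<integral>\<^sup>+x. ennreal ((S n x)\<^sup>2) \<partial>lborel) \<le> ennreal 4" .
  qed
  also have "\<dots> < \<infinity>" by simp
  finally have "AE x in lborel. (SUP n. ennreal ((S n x)\<^sup>2)) \<noteq> \<infinity>"
    by (intro nn_integral_PInf_AE) auto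
  then have conv: "AE x in lborel. convergent (\<lambda>k. f (r k) x)"
  proof eventually_elim
    case (elim x)
    then obtain C where C: "(SUP n. ennreal ((S n x)\<^sup>2)) = ennreal C" "0 \<le> C"
      by (cases "SUP n. ennreal ((S n x)\<^sup>2)") auto
    have "S n x \<le> sqrt C" for n
    proof -
      have "ennreal ((S n x)\<^sup>2) \<le> ennreal C" unfolding C(1)[symmetric] by (rule SUP_upper) simp
      then show ?thesis using C(2) by (simp add: real_le_rsqrt)
    qed
    then have "summable (\<lambda>k. d k x)"
      by (intro summableI_nonneg_bounded[where x="sqrt C"]) (auto simp: S_def d_def)
    then have "summable (\<lambda>k. f (r (Suc k)) x - f (r k) x)"
      unfolding d_def by (rule summable_norm_cancel)
    then have "convergent (\<lambda>n. \<Sum>k<n. f (r (Suc k)) x - f (r k) x)"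
      by (simp add: summable_iff_convergent)
    then have "convergent (\<lambda>n. (f (r n) x - f (r 0) x) + f (r 0) x)"
      by (intro convergent_add convergent_const)
        (simp add: sum_lessThan_telescope[where f="\<lambda>k. f (r k) x"])
    then show ?case by simp
  qed
  define g where "g x = lim (\<lambda>k. f (r k) x)" for x
  show thesis
  proof (rule that[OF r])
    show "g \<in> borel_measurable borel" unfolding g_def by measurable
    show "AE x in lborel. (\<lambda>k. f (r k) x) \<longlonglongrightarrow> g x"
      using conv by eventually_elim (simp add: g_def convergent_LIMSEQ_iff)
  qed
qed

text \<open>Fatou is applied to f n - f (r (k + N)) as k grows: the Cauchy bound passes to f n - g,
  which also shows that g is square integrable.\<close>

lemma l2_complete:
  fixes f :: "nat \<Rightarrow> 'a::euclidean_space \<Rightarrow> 'b::euclidean_space"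
  assumes f: "\<And>n. square_integrable (f n)"
    and Cauchy: "\<And>e. 0 < e \<Longrightarrow> \<exists>N. \<forall>m\<ge>N. \<forall>n\<ge>N. l2norm (\<lambda>x. f m x - f n x) < e"
  obtains g where "square_integrable g" "(\<lambda>n. l2norm (\<lambda>x. f n x - g x)) \<longlonglongrightarrow> 0"
proof -
  obtain r g where r: "strict_mono r" and [measurable]: "g \<in> borel_measurable borel"
    and lim: "AE x in lborel. (\<lambda>k. f (r k) x) \<longlonglongrightarrow> g x"
    using l2_subseq_AE[OF assms] by blast
  have *: "\<exists>N. \<forall>n\<ge>N. square_integrable (\<lambda>x. f n x - g x) \<and> l2norm (\<lambda>x. f n x - g x) \<le> e"
    if e: "0 < e" for e
  proof -
    obtain N where N: "\<And>m n. N \<le> m \<Longrightarrow> N \<le> n \<Longrightarrow> l2norm (\<lambda>x. f m x - f n x) < e"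
      using Cauchy[OF e] by blast
    show ?thesis
    proof (intro exI allI impI)
      fix n assume n: "N \<le> n"
      have "N \<le> r (k + N)" for k
        using seq_suble[OF r, of "k + N"] by linarith
      then have "l2norm (\<lambda>x. f n x - f (r (k + N)) x) \<le> e" for k
        using N[OF n] by (meson less_imp_le)
      moreover have "AE x in lborel. (\<lambda>k. f n x - f (r (k + N)) x) \<longlonglongrightarrow> f n x - g x"
        using lim by eventually_elim (intro tendsto_diff tendsto_const LIMSEQ_ignore_initial_segment)
      moreover have "(\<lambda>x. f n x - g x) \<in> borel_measurable borel"
        using square_integrable_measurable[OF f, of n] by measurable
      ultimately show "square_integrable (\<lambda>x. f n x - g x) \<and> l2norm (\<lambda>x. f n x - g x) \<le> e"
        using l2norm_Fatou[where h="\<lambda>k x. f n x - f (r (k + N)) x" and g="\<lambda>x. f n x - g x" and B=e,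
            OF square_integrable_diff[OF f f]] by blast
    qed
  qed
  obtain n where "square_integrable (\<lambda>x. f n x - g x)" using *[of 1] by auto
  from square_integrable_diff[OF f this, of n] have g: "square_integrable g" by simp
  have "(\<lambda>n. l2norm (\<lambda>x. f n x - g x)) \<longlonglongrightarrow> 0"
  proof (rule LIMSEQ_I)
    fix e :: real assume "0 < e"
    then show "\<exists>N. \<forall>n\<ge>N. norm (l2norm (\<lambda>x. f n x - g x) - 0) < e"
      using *[of "e/2"] by fastforce
  qed
  with g show thesis by (rule that)
qed

text \<open>A subsequence has some a.e. limit h; by Fatou h - g has arbitrarily small norm, so h = g
  a.e.\<close>

lemma l2_tendsto_subseq_AE:
  fixes f :: "nat \<Rightarrow> 'a::euclidean_space \<Rightarrow> 'b::euclidean_space"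
  assumes f: "\<And>n. square_integrable (f n)" and g: "square_integrable g"
    and lim: "(\<lambda>n. l2norm (\<lambda>x. f n x - g x)) \<longlonglongrightarrow> 0"
  obtains r :: "nat \<Rightarrow> nat" where "strict_mono r" "AE x in lborel. (\<lambda>k. f (r k) x) \<longlonglongrightarrow> g x"
proof -
  have "\<exists>N. \<forall>m\<ge>N. \<forall>n\<ge>N. l2norm (\<lambda>x. f m x - f n x) < e" if "0 < e" for e
  proof -
    obtain N where N: "\<And>n. N \<le> n \<Longrightarrow> l2norm (\<lambda>x. f n x - g x) < e / 2"
      by (rule LIMSEQ_lessD[OF lim, of "e/2"]) (use \<open>0 < e\<close> in auto)
    have "l2norm (\<lambda>x. f m x - f n x) < e" if "N \<le> m" "N \<le> n" for m n
      using l2norm_triangle_diff[OF f g f, of m n] N[OF that(1)] N[OF that(2)]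
        l2norm_diff_commute[of g "f n"] by linarith
    then show ?thesis by blast
  qed
  from l2_subseq_AE[OF f this] obtain r h where r: "strict_mono r"
    and [measurable]: "h \<in> borel_measurable borel"
    and h: "AE x in lborel. (\<lambda>k. f (r k) x) \<longlonglongrightarrow> h x" by blast
  have sub: "(\<lambda>n. l2norm (\<lambda>x. f (r n) x - g x)) \<longlonglongrightarrow> 0"
    using LIMSEQ_subseq_LIMSEQ[OF lim r] by (simp add: o_def)
  have hg: "l2norm (\<lambda>x. h x - g x) \<le> e \<and> square_integrable (\<lambda>x. h x - g x)" if "0 < e" for e
  proof -
    obtain N where N: "\<And>n. N \<le> n \<Longrightarrow> l2norm (\<lambda>x. f (r n) x - g x) < e"
      using LIMSEQ_lessD[OF sub \<open>0 < e\<close>] by blast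
    have "AE x in lborel. (\<lambda>k. f (r (k + N)) x - g x) \<longlonglongrightarrow> h x - g x"
      using h by eventually_elim
        (intro tendsto_diff tendsto_const LIMSEQ_ignore_initial_segment[where f="\<lambda>k. f (r k) _"])
    moreover have "(\<lambda>x. h x - g x) \<in> borel_measurable borel"
      using square_integrable_measurable[OF g] by measurable
    moreover have "l2norm (\<lambda>x. f (r (k + N)) x - g x) \<le> e" for k
      using N[of "k + N"] by simp
    ultimately show ?thesis
      using l2norm_Fatou[where h="\<lambda>k x. f (r (k + N)) x - g x" and g="\<lambda>x. h x - g x" and B=e,
          OF square_integrable_diff[OF f g]] by blast
  qed
  have "l2norm (\<lambda>x. h x - g x) \<le> 0" by (rule field_le_epsilon) (use hg in auto)
  then have "l2norm (\<lambda>x. h x - g x) = 0" using l2norm_nonneg[of "\<lambda>x. h x - g x"] by linarith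
  then have "AE x in lborel. h x - g x = 0"
    using l2norm_eq_0_iff[of "\<lambda>x. h x - g x"] hg[of 1] by simp
  with h have "AE x in lborel. (\<lambda>k. f (r k) x) \<longlonglongrightarrow> g x" by eventually_elim simp
  with r show thesis by (rule that)
qed

section \<open>Density of continuous functions and continuity of translations\<close>

lemma
  fixes f :: "'a::euclidean_space \<Rightarrow> 'b::euclidean_space" and C R :: real
  assumes [measurable]: "f \<in> borel_measurable borel"
    and le: "\<And>x. norm (f x) \<le> C" and supp: "\<And>x. x \<notin> cball a R \<Longrightarrow> f x = 0"
  shows integrable_bounded_support: "integrable lborel f"
    and square_integrable_bounded_support: "square_integrable f"
proof -
  have A: "cball a R \<in> sets lborel" "emeasure lborel (cball a R) < \<infinity>"
    using emeasure_bounded_finite[of "cball a R"] by auto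
  show "integrable lborel f"
    by (rule integrableI_bounded_set[OF A(1) _ A(2), where B=C]) (use le supp in auto)
  have "integrable lborel (\<lambda>x. (norm (f x))\<^sup>2)"
    by (rule integrableI_bounded_set[OF A(1) _ A(2), where B="C\<^sup>2"])
      (use le supp in \<open>auto intro!: power_mono\<close>)
  then show "square_integrable f" by (simp add: square_integrable_def)
qed

lemma continuous_support_bounded:
  fixes f :: "'a::euclidean_space \<Rightarrow> 'b::real_normed_vector" and R :: real
  assumes "continuous_on UNIV f" and supp: "\<And>x. x \<notin> cball a R \<Longrightarrow> f x = 0"
  obtains C where "0 \<le> C" "\<And>x. norm (f x) \<le> C"
proof -
  have "bounded (f ` cball a R)"
    by (intro compact_imp_bounded compact_continuous_image continuous_on_subset[OF assms(1)]) auto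
  then obtain C where C: "\<forall>x\<in>cball a R. norm (f x) \<le> C" by (auto simp: bounded_iff)
  have "norm (f x) \<le> max C 0" for x
    using C supp[of x] by (cases "x \<in> cball a R") (auto simp: max.coboundedI1)
  then show thesis by (intro that[of "max C 0"]) auto
qed

text \<open>Clamping the values and cutting off at infinity costs little, by dominated convergence.
  The result is the a.e. limit of continuous functions treated in the same way, and these share a
  bounded dominating function with compact support.\<close>

lemma l2_dense_continuous:
  fixes f :: "'a::euclidean_space \<Rightarrow> real"
  assumes f: "square_integrable f" and "0 < e"
  obtains \<psi> and R :: real where "continuous_on UNIV \<psi>" "\<And>x. x \<notin> cball 0 R \<Longrightarrow> \<psi> x = 0"
    "square_integrable \<psi>" "l2norm (\<lambda>x. f x - \<psi> x) < e"
proof -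
  note [measurable] = square_integrable_measurable[OF f]
  define \<kappa> :: "nat \<Rightarrow> 'a \<Rightarrow> real" where "\<kappa> N x = max 0 (min 1 (real N + 1 - norm x))" for N x
  define cl :: "nat \<Rightarrow> real \<Rightarrow> real" where "cl N t = max (- real N) (min (real N) t)" for N t
  have \<kappa>: "0 \<le> \<kappa> N x" "\<kappa> N x \<le> 1" "continuous_on UNIV (\<kappa> N)" for N x
    unfolding \<kappa>_def[abs_def] by (auto intro!: continuous_intros)
  have \<kappa>0: "\<kappa> N x = 0" if "x \<notin> cball 0 (real N + 1)" for N x using that by (simp add: \<kappa>_def)
  have cl: "\<bar>cl N t\<bar> \<le> \<bar>t\<bar>" "\<bar>cl N t\<bar> \<le> real N" "continuous_on UNIV (cl N)" for N t
    unfolding cl_def[abs_def] by (auto intro!: continuous_intros)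
  note [measurable] = borel_measurable_continuous_onI[OF \<kappa>(3)] borel_measurable_continuous_onI[OF cl(3)]
  have bound: "\<bar>\<kappa> N x * cl N t\<bar> \<le> \<bar>cl N t\<bar>" for N x t
    using \<kappa>(1,2)[of N x] by (simp add: abs_mult mult_left_le_one_le)
  let ?f = "\<lambda>N x. \<kappa> N x * cl N (f x)"
  have "(\<lambda>N. l2norm (\<lambda>x. ?f N x - f x)) \<longlonglongrightarrow> 0"
  proof (rule square_integrable_dominated_convergence(3)[OF f])
    show "AE x in lborel. (\<lambda>N. ?f N x) \<longlonglongrightarrow> f x"
    proof (intro AE_I2)
      fix x
      obtain M where M: "norm x + \<bar>f x\<bar> \<le> real M" using real_arch_simple by blast
      have "?f N x = f x" if "M \<le> N" for N
      proof -
        have "norm x + \<bar>f x\<bar> \<le> real N" using M that by (meson of_nat_le_iff order.trans)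
        then have "norm x \<le> real N" "\<bar>f x\<bar> \<le> real N" using norm_ge_zero[of x] by linarith+
        then show ?thesis by (simp add: \<kappa>_def cl_def)
      qed
      then show "(\<lambda>N. ?f N x) \<longlonglongrightarrow> f x"
        by (intro tendsto_eventually) (auto simp: eventually_sequentially)
    qed
    show "AE x in lborel. norm (?f n x) \<le> norm (f x)" for n
      using order.trans[OF bound cl(1)] by simp
  qed auto
  then obtain N where N: "l2norm (\<lambda>x. ?f N x - f x) < e / 2"
    by (rule LIMSEQ_lessD[where e="e/2"]) (use \<open>0 < e\<close> in auto)
  have sqb: "square_integrable (\<lambda>x. \<kappa> N x * cl N (h x))" if [measurable]: "h \<in> borel_measurable borel" for h
    by (rule square_integrable_bounded_support[where C="real N" and a=0 and R="real N + 1"])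
      (use order.trans[OF bound cl(2)] \<kappa>0 in auto)
  have "f \<in> borel_measurable lebesgue"
    by (intro measurable_completion) simp
  then have "f measurable_on UNIV"
    by (simp add: measurable_on_iff_borel_measurable lebesgue_on_UNIV_eq)
  \<comment> \<open>Being \<open>measurable_on\<close> means being a limit of continuous functions
    off a negligible set.\<close>
  then obtain A F where A: "negligible A" and F: "\<And>n. continuous_on UNIV (F n)"
    and lim: "\<And>x. x \<notin> A \<Longrightarrow> (\<lambda>n. F n x) \<longlonglongrightarrow> f x"
    unfolding measurable_on_def by auto
  have [measurable]: "F n \<in> borel_measurable borel" for n
    by (rule borel_measurable_continuous_onI[OF F])
  have "AE x in lebesgue. x \<notin> A"
    using A by (simp add: negligible_iff_null_sets AE_not_in)
  then have AE: "AE x in lborel. (\<lambda>n. F n x) \<longlonglongrightarrow> f x"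
    by (subst AE_completion_iff[symmetric]) (use lim in \<open>auto elim: eventually_mono\<close>)
  define w where "w x = real N * indicator (cball 0 (real N + 1)) x" for x :: 'a
  have w: "square_integrable w"
    unfolding w_def by (rule square_integrable_bounded_support[where C="real N" and a=0 and R="real N + 1"])
      (auto simp: indicator_def)
  have "(\<lambda>n. l2norm (\<lambda>x. \<kappa> N x * cl N (F n x) - ?f N x)) \<longlonglongrightarrow> 0"
  proof (rule square_integrable_dominated_convergence(3)[OF w])
    show "AE x in lborel. (\<lambda>n. \<kappa> N x * cl N (F n x)) \<longlonglongrightarrow> ?f N x"
      using AE
    proof eventually_elim
      case (elim x)
      have "isCont (cl N) (f x)" using cl(3) by (simp add: continuous_on_eq_continuous_at)
      from isCont_tendsto_compose[OF this elim] show ?case by (intro tendsto_mult tendsto_const)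
    qed
    show "AE x in lborel. norm (\<kappa> N x * cl N (F n x)) \<le> norm (w x)" for n
    proof (intro AE_I2)
      fix x
      show "norm (\<kappa> N x * cl N (F n x)) \<le> norm (w x)"
      proof (cases "x \<in> cball 0 (real N + 1)")
        case True
        then show ?thesis using order.trans[OF bound cl(2)] by (simp add: w_def)
      next
        case False
        then show ?thesis using \<kappa>0 by simp
      qed
    qed
  qed auto
  then obtain n where n: "l2norm (\<lambda>x. \<kappa> N x * cl N (F n x) - ?f N x) < e / 2"
    by (rule LIMSEQ_lessD[where e="e/2"]) (use \<open>0 < e\<close> in auto)
  show thesis
  proof (rule that)
    show "continuous_on UNIV (\<lambda>x. \<kappa> N x * cl N (F n x))"
      by (intro continuous_intros \<kappa> continuous_on_compose2[OF cl(3) F]) auto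
    show "square_integrable (\<lambda>x. \<kappa> N x * cl N (F n x))" by (rule sqb) simp
    show "\<kappa> N x * cl N (F n x) = 0" if "x \<notin> cball 0 (real N + 1)" for x
      using \<kappa>0[OF that] by simp
    have "l2norm (\<lambda>x. \<kappa> N x * cl N (F n x) - f x) < e"
      using l2norm_triangle_diff[OF sqb[of "F n"] sqb[of f] f] n N by simp
    then show "l2norm (\<lambda>x. f x - \<kappa> N x * cl N (F n x)) < e"
      by (subst l2norm_diff_commute)
  qed
qed

text \<open>For a continuous function with compact support this is uniform continuity on a ball;
  density transfers it because translations preserve the norm.\<close>

lemma l2norm_shift_diff_tendsto:
  fixes f :: "'a::euclidean_space \<Rightarrow> real"
  assumes f: "square_integrable f" and "0 < e"
  obtains d where "0 < d" "\<And>h. norm h < d \<Longrightarrow> l2norm (\<lambda>x. f (x + h) - f x) < e"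
proof -
  obtain \<psi> R where c: "continuous_on UNIV \<psi>" and s: "\<And>x. x \<notin> cball 0 R \<Longrightarrow> \<psi> x = 0"
    and \<psi>: "square_integrable \<psi>" and near: "l2norm (\<lambda>x. f x - \<psi> x) < e / 3"
    using l2_dense_continuous[OF f, of "e/3"] \<open>0 < e\<close> by auto
  note [measurable] = square_integrable_measurable[OF \<psi>] square_integrable_measurable[OF f]
  define I :: "'a \<Rightarrow> real" where "I x = indicator (cball 0 (R + 1)) x" for x
  have I: "square_integrable I" unfolding I_def[abs_def]
    by (rule square_integrable_bounded_support[where C=1 and a=0 and R="R + 1"]) (auto simp: indicator_def)
  \<comment> \<open>For shifts of length below 1 the increment of \<psi> lives in the ball of radius
    R + 1. This choice makes \<eta> times the norm of the indicator smaller than e / 3, also when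
    that norm is 0.\<close>
  define \<eta> where "\<eta> = e / (4 * (l2norm I + 1))"
  have pos: "0 < l2norm I + 1" using l2norm_nonneg[of I] by linarith
  have \<eta>: "0 < \<eta>" using \<open>0 < e\<close> pos by (simp add: \<eta>_def)
  have "t / (4 * (t + 1)) < 1 / 3" if "0 \<le> t" for t :: real
    using that by (simp add: divide_less_eq)
  from this[OF l2norm_nonneg, of I] have "l2norm I / (4 * (l2norm I + 1)) < 1 / 3" .
  from mult_strict_left_mono[OF this \<open>0 < e\<close>] have "\<eta> * l2norm I < e / 3"
    by (simp add: \<eta>_def)
  note \<eta> = \<eta> this
  have "uniformly_continuous_on (cball 0 (R + 2)) \<psi>"
    by (intro compact_uniformly_continuous continuous_on_subset[OF c]) auto
  then obtain d where d: "0 < d"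
    "\<And>x y. x \<in> cball 0 (R + 2) \<Longrightarrow> y \<in> cball 0 (R + 2) \<Longrightarrow> dist y x < d \<Longrightarrow> dist (\<psi> y) (\<psi> x) < \<eta>"
    unfolding uniformly_continuous_on_def using \<eta>(1) by metis
  show thesis
  proof (rule that[of "min d 1"])
    show "0 < min d 1" using d by simp
    fix h :: 'a assume h: "norm h < min d 1"
    have "norm (\<psi> (x + h) - \<psi> x) \<le> norm (\<eta> * I x)" for x
    proof (cases "x \<in> cball 0 (R + 1)")
      case True
      have "norm (x + h) \<le> R + 2" using True h norm_triangle_ineq[of x h] by simp
      then have "dist (\<psi> (x + h)) (\<psi> x) < \<eta>" using True h norm_minus_cancel[of "x + h"]
        by (intro d(2)) (auto simp: dist_norm simp del: norm_minus_cancel)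
      then show ?thesis using True \<eta>(1) by (simp add: I_def dist_norm)
    next
      case False
      have "norm x \<le> norm (x + h) + norm h" using norm_triangle_ineq4[of "x + h" h] by simp
      with False h have "x \<notin> cball 0 R" "x + h \<notin> cball 0 R" by auto
      then show ?thesis using s by simp
    qed
    then have "l2norm (\<lambda>x. \<psi> (x + h) - \<psi> x) \<le> l2norm (\<lambda>x. \<eta> * I x)"
      by (intro square_integrable_dominated(2) square_integrable_cmult I) auto
    also have "\<dots> < e / 3" using \<eta> by (simp add: l2norm_cmult)
    finally have 1: "l2norm (\<lambda>x. \<psi> (x + h) - \<psi> x) < e / 3" .
    have 2: "l2norm (\<lambda>x. f (x + h) - \<psi> (x + h)) < e / 3"
      using l2norm_shift[OF square_integrable_diff[OF f \<psi>], of h] near by simp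
    have 3: "l2norm (\<lambda>x. \<psi> x - f x) < e / 3" using near l2norm_diff_commute[of f \<psi>] by simp
    show "l2norm (\<lambda>x. f (x + h) - f x) < e"
      using l2norm_triangle_diff[OF square_integrable_shift[OF f] square_integrable_shift[OF \<psi>] f, of h h]
        l2norm_triangle_diff[OF square_integrable_shift[OF \<psi>] \<psi> f, of h] 1 2 3 by linarith
  qed
qed

section \<open>Mollification\<close>

lemma max_0_sq_has_derivative:
  "((\<lambda>t::real. (max 0 t)\<^sup>2) has_real_derivative 2 * max 0 t) (at t)"
proof -
  consider "t < 0" | "t = 0" | "0 < t" by linarith
  then show ?thesis
  proof cases
    case 1
    have "((\<lambda>t::real. 0) has_real_derivative 0) (at t)" by simp
    then have "((\<lambda>t::real. (max 0 t)\<^sup>2) has_real_derivative 0) (at t)"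
      by (rule has_field_derivative_transform_within_open[where S="{..<0}"]) (use 1 in auto)
    then show ?thesis using 1 by simp
  next
    case 2
    have "((\<lambda>h::real. (max 0 h)\<^sup>2 / h) \<longlongrightarrow> 0) (at 0)"
    proof (rule Lim_null_comparison)
      show "\<forall>\<^sub>F h in at 0. norm ((max 0 h)\<^sup>2 / h) \<le> \<bar>h::real\<bar>"
        by (auto simp: max_def power2_eq_square)
      show "((\<lambda>h::real. \<bar>h\<bar>) \<longlongrightarrow> 0) (at 0)"
        by (rule tendsto_rabs_zero) simp
    qed
    then show ?thesis using 2 by (simp add: DERIV_def)
  next
    case 3
    have "((\<lambda>t::real. t\<^sup>2) has_real_derivative 2 * t) (at t)"
      by (auto intro!: derivative_eq_intros)
    then have "((\<lambda>t::real. (max 0 t)\<^sup>2) has_real_derivative 2 * t) (at t)"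
      by (rule has_field_derivative_transform_within_open[where S="{0<..}"]) (use 3 in auto)
    then show ?thesis using 3 by simp
  qed
qed

text \<open>Squaring the positive part makes the function C^1, the regularity that
  \<open>test_fun\<close> demands, with an explicit gradient.\<close>

definition bump :: "real \<Rightarrow> pt \<Rightarrow> real" where
  "bump r x = (max 0 (r\<^sup>2 - x \<bullet> x))\<^sup>2"

definition bump_grad :: "real \<Rightarrow> pt \<Rightarrow> pt" where
  "bump_grad r x = - (4 * max 0 (r\<^sup>2 - x \<bullet> x)) *\<^sub>R x"

lemma bump_has_derivative: "(bump r has_derivative (\<lambda>h. bump_grad r x \<bullet> h)) (at x)"
proof -
  have "((\<lambda>x. r\<^sup>2 - x \<bullet> x) has_derivative (\<lambda>h. - (2 * (x \<bullet> h)))) (at x)"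
    by (auto intro!: derivative_eq_intros simp: inner_commute)
  from has_derivative_compose[OF this, OF has_field_derivative_imp_has_derivative[OF max_0_sq_has_derivative]]
  show ?thesis
    by (simp add: bump_def[abs_def] bump_grad_def algebra_simps)
qed

lemma continuous_bump: "continuous_on UNIV (bump r)"
  unfolding bump_def[abs_def] by (intro continuous_intros)

lemma continuous_bump_grad: "continuous_on UNIV (bump_grad r)"
  unfolding bump_grad_def[abs_def] by (intro continuous_intros)

lemma bump_nonneg: "0 \<le> bump r x"
  by (simp add: bump_def)

lemma bump_le: "bump r x \<le> r ^ 4"
  using power_mono[of "max 0 (r\<^sup>2 - x \<bullet> x)" "r\<^sup>2" 2] by (simp add: bump_def)

lemma bump_eq_0: "0 \<le> r \<Longrightarrow> r \<le> norm x \<Longrightarrow> bump r x = 0"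
  unfolding bump_def using power_mono[of r "norm x" 2] by (simp add: power2_norm_eq_inner)

lemma bump_pos: "norm x < r \<Longrightarrow> 0 < bump r x"
  unfolding bump_def using power_strict_mono[of "norm x" r 2] by (simp add: power2_norm_eq_inner)

lemma bump_grad_eq_0: "0 \<le> r \<Longrightarrow> r \<le> norm x \<Longrightarrow> bump_grad r x = 0"
  unfolding bump_grad_def using power_mono[of r "norm x" 2] by (simp add: power2_norm_eq_inner)

lemma borel_measurable_bump [measurable]: "bump r \<in> borel_measurable borel"
  by (rule borel_measurable_continuous_onI[OF continuous_bump])

lemma borel_measurable_bump_grad [measurable]: "bump_grad r \<in> borel_measurable borel"
  by (rule borel_measurable_continuous_onI[OF continuous_bump_grad])

lemma integrable_bump: "0 \<le> r \<Longrightarrow> integrable lborel (bump r)"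
  by (rule integrable_bounded_support[where C="r ^ 4" and a=0 and R=r])
    (auto simp: bump_nonneg bump_le bump_eq_0)

definition bump_mass :: "real \<Rightarrow> real" where
  "bump_mass r = (\<integral>x. bump r x \<partial>lborel)"

lemma bump_mass_pos:
  assumes "0 < r"
  shows "0 < bump_mass r"
proof -
  have "bump_mass r \<noteq> 0"
  proof
    assume "bump_mass r = 0"
    then have "AE x in lborel. bump r x = 0"
      unfolding bump_mass_def
      using integral_nonneg_eq_0_iff_AE[of lborel "bump r"] integrable_bump[of r] bump_nonneg \<open>0 < r\<close>
      by simp
    then have "AE x in lborel. x \<notin> ball (0::pt) r"
      by (rule eventually_mono) (use bump_pos[of _ r] in force)
    then have "emeasure lborel (ball (0::pt) r) = 0"
      by (subst (asm) AE_iff_measurable[where N="ball 0 r"]) auto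
    then show False using \<open>0 < r\<close> by (simp add: emeasure_ball unit_ball_vol_2)
  qed
  moreover have "0 \<le> bump_mass r" by (simp add: bump_mass_def bump_nonneg)
  ultimately show ?thesis by simp
qed

text \<open>The kernel is kept as a probability measure so that
  \<open>square_integrable_average\<close> applies to mollification.\<close>

definition mollifier :: "real \<Rightarrow> pt measure" where
  "mollifier r = density lborel (\<lambda>x. ennreal (bump r x / bump_mass r))"

text \<open>The bump is even, so averaging over x + y is the usual convolution.\<close>

definition mollify :: "real \<Rightarrow> (pt \<Rightarrow> real) \<Rightarrow> pt \<Rightarrow> real" where
  "mollify r f x = (\<integral>y. f (x + y) \<partial>mollifier r)"

lemma sets_mollifier [measurable_cong, simp]: "sets (mollifier r) = sets borel"
  by (simp add: mollifier_def)

lemma emeasure_mollifier: "0 < r \<Longrightarrow> emeasure (mollifier r) (space (mollifier r)) = 1"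
  using integrable_bump[of r] bump_mass_pos[of r]
  by (simp add: mollifier_def emeasure_density bump_nonneg nn_integral_eq_integral)
    (simp add: bump_mass_def)

lemma AE_mollifier: "0 < r \<Longrightarrow> AE y in mollifier r. norm y < r"
  unfolding mollifier_def using bump_eq_0[of r]
  by (subst AE_density) (auto intro!: AE_I2, metis div_0 less_irrefl linorder_not_less)

text \<open>Moves x into the kernel: the value at x becomes a pairing of f with a test function
  centred at x.\<close>

lemma mollify_eq:
  assumes [measurable]: "f \<in> borel_measurable borel" and "0 < r"
  shows "mollify r f x = (\<integral>z. f z * (bump r (z - x) / bump_mass r) \<partial>lborel)"
proof -
  have "mollify r f x = (\<integral>y. (bump r y / bump_mass r) *\<^sub>R f (x + y) \<partial>lborel)"
    unfolding mollify_def mollifier_def using bump_mass_pos[OF \<open>0 < r\<close>]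
    by (subst integral_density) (auto simp: bump_nonneg)
  also have "\<dots> = (\<integral>y. f (y + x) * (bump r ((y + x) - x) / bump_mass r) \<partial>lborel)"
    by (simp add: add.commute mult.commute)
  also have "\<dots> = (\<integral>z. f z * (bump r (z - x) / bump_mass r) \<partial>lborel)"
    by (rule integral_lborel_shift[where f="\<lambda>z. f z * (bump r (z - x) / bump_mass r)"]) measurable
  finally show ?thesis .
qed

lemma square_integrable_bump: "0 \<le> r \<Longrightarrow> square_integrable (\<lambda>z. bump r (z - x) / c)"
proof (rule square_integrable_bounded_support[where C="r ^ 4 / \<bar>c\<bar>" and a=x and R=r])
  show "0 \<le> r \<Longrightarrow> z \<notin> cball x r \<Longrightarrow> bump r (z - x) / c = 0" for z
    by (simp add: bump_eq_0 dist_norm norm_minus_commute)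
qed (auto simp: bump_nonneg bump_le divide_right_mono)

lemma square_integrable_mollify:
  assumes f: "square_integrable f" and "0 < r"
  shows "square_integrable (mollify r f)" "l2norm (mollify r f) \<le> l2norm f"
proof -
  note [measurable] = square_integrable_measurable[OF f]
  have "(\<lambda>(x, y). f (x + y)) \<in> borel_measurable (borel \<Otimes>\<^sub>M mollifier r)" by measurable
  moreover have "AE y in mollifier r. square_integrable (\<lambda>x. f (x + y)) \<and> l2norm (\<lambda>x. f (x + y)) \<le> l2norm f"
    by (simp add: square_integrable_shift[OF f] l2norm_shift[OF f])
  ultimately show "square_integrable (mollify r f)" "l2norm (mollify r f) \<le> l2norm f"
    using square_integrable_average[OF emeasure_mollifier[OF \<open>0 < r\<close>], of "\<lambda>x y. f (x + y)" "l2norm f"]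
    by (simp_all add: mollify_def[abs_def])
qed

lemma integrable_mollifier:
  fixes f :: "pt \<Rightarrow> real"
  assumes f: "square_integrable f" and "0 < r"
  shows "integrable (mollifier r) (\<lambda>y. f (x + y))"
proof -
  note [measurable] = square_integrable_measurable[OF f]
  have "integrable lborel (\<lambda>y. (bump r (y - 0) / bump_mass r) * f (y + x))"
    using \<open>0 < r\<close> by (intro square_integrable_mult square_integrable_bump square_integrable_shift f) auto
  then show ?thesis
    unfolding mollifier_def using bump_mass_pos[OF \<open>0 < r\<close>]
    by (subst integrable_density) (auto simp: bump_nonneg add.commute)
qed

text \<open>The kernel has mass 1, so the difference is an average of increments over shifts of
  length below r.\<close>

lemma l2norm_mollify_diff_le:
  assumes f: "square_integrable f" and "0 < r" "0 \<le> B"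
    and le: "\<And>y. norm y < r \<Longrightarrow> l2norm (\<lambda>x. f (x + y) - f x) \<le> B"
  shows "l2norm (\<lambda>x. mollify r f x - f x) \<le> B"
proof -
  note [measurable] = square_integrable_measurable[OF f]
  interpret finite_measure "mollifier r" by standard (simp add: emeasure_mollifier[OF \<open>0 < r\<close>])
  have "(\<lambda>(x, y). f (x + y) - f x) \<in> borel_measurable (borel \<Otimes>\<^sub>M mollifier r)" by measurable
  moreover have "AE y in mollifier r. square_integrable (\<lambda>x. f (x + y) - f x) \<and> l2norm (\<lambda>x. f (x + y) - f x) \<le> B"
    using AE_mollifier[OF \<open>0 < r\<close>]
    by eventually_elim (auto intro!: le square_integrable_diff[OF square_integrable_shift f] f)
  ultimately have "l2norm (\<lambda>x. \<integral>y. f (x + y) - f x \<partial>mollifier r) \<le> B"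
    using square_integrable_average(2)[OF emeasure_mollifier[OF \<open>0 < r\<close>], of "\<lambda>x y. f (x + y) - f x" B]
      \<open>0 \<le> B\<close> by simp
  moreover have "(\<integral>y. f (x + y) - f x \<partial>mollifier r) = mollify r f x - f x" for x
    using integrable_mollifier[OF f \<open>0 < r\<close>] emeasure_mollifier[OF \<open>0 < r\<close>]
    by (simp add: mollify_def measure_def)
  ultimately show ?thesis by simp
qed

lemma mollify_approximates:
  assumes f: "square_integrable f" and "0 < e"
  obtains r where "0 < r" "l2norm (\<lambda>x. mollify r f x - f x) \<le> e"
proof -
  obtain d where d: "0 < d" "\<And>h. norm h < d \<Longrightarrow> l2norm (\<lambda>x. f (x + h) - f x) < e"
    using l2norm_shift_diff_tendsto[OF f \<open>0 < e\<close>] by blast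
  show thesis
    by (rule that[OF d(1)], rule l2norm_mollify_diff_le[OF f d(1)]) (use d(2) \<open>0 < e\<close> in \<open>auto intro: less_imp_le\<close>)
qed

lemma test_fun_bump:
  assumes "0 < r"
  shows "test_fun (\<lambda>z. bump r (z - x) / c) (\<lambda>z. bump_grad r (z - x) /\<^sub>R c)"
  unfolding test_fun_def
proof (intro conjI allI)
  fix z
  have "((\<lambda>z. bump r (z - x)) has_derivative (\<lambda>h. bump_grad r (z - x) \<bullet> h)) (at z)"
    by (rule has_derivative_eq_rhs[OF has_derivative_compose[OF _ bump_has_derivative]])
      (auto intro!: derivative_eq_intros)
  from has_derivative_mult_left[OF this, of "inverse c"]
  show "((\<lambda>z. bump r (z - x) / c) has_derivative (\<lambda>h. (bump_grad r (z - x) /\<^sub>R c) \<bullet> h)) (at z)"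
    by (simp add: divide_inverse mult.commute)
  show "continuous_on UNIV (\<lambda>z. bump_grad r (z - x) /\<^sub>R c)"
    by (intro continuous_intros continuous_on_compose2[OF continuous_bump_grad]) auto
  have "{z. bump r (z - x) / c \<noteq> 0} \<subseteq> cball x r"
    using bump_eq_0[of r "_ - x"] assms by (force simp: dist_norm norm_minus_commute)
  then have "closure {z. bump r (z - x) / c \<noteq> 0} \<subseteq> cball x r" by (rule closure_minimal) simp
  then show "compact (closure {z. bump r (z - x) / c \<noteq> 0})"
    by (meson bounded_cball bounded_subset closed_closure compact_eq_bounded_closed)
qed

text \<open>The kernels centred at each point are test functions, so every mollification of f
  vanishes identically, while mollifications come arbitrarily close to f in norm.\<close>

lemma AE_eq_0_if_test_fun:
  assumes f: "square_integrable f"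
    and test: "\<And>\<phi> D. test_fun \<phi> D \<Longrightarrow> (\<integral>x. f x * \<phi> x \<partial>lborel) = 0"
  shows "AE x in lborel. f x = 0"
proof -
  have "l2norm f \<le> e" if "0 < e" for e
  proof -
    obtain r where r: "0 < r" "l2norm (\<lambda>x. mollify r f x - f x) \<le> e"
      using mollify_approximates[OF f \<open>0 < e\<close>] by blast
    have "mollify r f x = 0" for x
      unfolding mollify_eq[OF square_integrable_measurable[OF f] r(1)] by (rule test[OF test_fun_bump[OF r(1)]])
    with r show ?thesis by (simp add: l2norm_minus)
  qed
  then have "l2norm f \<le> 0" by (rule field_le_epsilon) auto
  then show ?thesis using l2norm_eq_0_iff[OF f] l2norm_nonneg[of f] by simp
qed

section \<open>Weak gradients\<close>

lemma borel_measurable_nth [measurable (raw)]: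
  fixes g :: "'a \<Rightarrow> pt"
  assumes [measurable]: "g \<in> borel_measurable M"
  shows "(\<lambda>x. g x $ i) \<in> borel_measurable M"
proof -
  have "(\<lambda>x. g x $ i) = (\<lambda>x. g x \<bullet> axis i 1)" by (simp add: inner_axis)
  then show ?thesis by simp
qed

lemma square_integrable_nth:
  fixes g :: "'a::euclidean_space \<Rightarrow> pt"
  assumes g: "square_integrable g"
  shows "square_integrable (\<lambda>x. g x $ i)"
proof -
  note [measurable] = square_integrable_measurable[OF g]
  show ?thesis
    by (rule square_integrable_dominated(1)[OF g]) (auto simp: component_le_norm_cart)
qed

lemma test_fun_support:
  assumes "test_fun \<phi> D"
  obtains r where "0 < r" "\<And>x. x \<notin> cball 0 r \<Longrightarrow> \<phi> x = 0" "\<And>x. x \<notin> cball 0 r \<Longrightarrow> D x = 0"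
proof -
  have cpt: "compact (closure {x. \<phi> x \<noteq> 0})" and der: "\<And>x. (\<phi> has_derivative (\<lambda>h. D x \<bullet> h)) (at x)"
    using assms by (auto simp: test_fun_def)
  obtain r where r: "0 < r" "closure {x. \<phi> x \<noteq> 0} \<subseteq> ball 0 r"
    using bounded_subset_ballD[OF compact_imp_bounded[OF cpt], of 0] by blast
  have z: "\<phi> x = 0" if "x \<notin> cball 0 r" for x
    using r(2) closure_subset[of "{x. \<phi> x \<noteq> 0}"] that by (force simp: ball_def)
  have zD: "D x = 0" if "x \<notin> cball 0 r" for x
  proof -
    have "((\<lambda>x. 0) has_derivative (\<lambda>h. D x \<bullet> h)) (at x)"
      by (rule has_derivative_transform_within_open[OF der, of "- cball 0 r"]) (use that z in auto)
    moreover have "((\<lambda>x. 0::real) has_derivative (\<lambda>h. 0)) (at x)" by simp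
    ultimately have "(\<lambda>h. D x \<bullet> h) = (\<lambda>h. 0)" by (rule has_derivative_unique)
    then have "D x \<bullet> D x = 0" by metis
    then show ?thesis by simp
  qed
  show thesis by (rule that[OF r(1) z zD])
qed

lemma test_fun_square_integrable:
  assumes "test_fun \<phi> D"
  shows "square_integrable \<phi>" "square_integrable D" "continuous_on UNIV \<phi>"
proof -
  have cD: "continuous_on UNIV D" and der: "\<And>x. (\<phi> has_derivative (\<lambda>h. D x \<bullet> h)) (at x)"
    using assms by (auto simp: test_fun_def)
  show c: "continuous_on UNIV \<phi>"
    using der by (meson continuous_at_imp_continuous_on has_derivative_continuous)
  obtain r where r: "0 < r" "\<And>x. x \<notin> cball 0 r \<Longrightarrow> \<phi> x = 0" "\<And>x. x \<notin> cball 0 r \<Longrightarrow> D x = 0"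
    by (rule test_fun_support[OF assms]) (rule that)
  obtain C where C: "0 \<le> C" "\<And>x. norm (\<phi> x) \<le> C"
    by (rule continuous_support_bounded[OF c, of 0 r], erule r(2), rule that)
  show "square_integrable \<phi>"
    by (rule square_integrable_bounded_support[OF _ C(2) r(2)]) (rule borel_measurable_continuous_onI[OF c])
  obtain C' where C': "0 \<le> C'" "\<And>x. norm (D x) \<le> C'"
    by (rule continuous_support_bounded[OF cD, of 0 r], erule r(3), rule that)
  show "square_integrable D"
    by (rule square_integrable_bounded_support[OF _ C'(2) r(3)]) (rule borel_measurable_continuous_onI[OF cD])
qed

definition l2_gradient :: "(pt \<Rightarrow> real) \<Rightarrow> (pt \<Rightarrow> pt) \<Rightarrow> bool" where
  "l2_gradient u g \<longleftrightarrow> square_integrable g \<and> is_weak_grad u g"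

lemma H1_iff: "u \<in> H1 \<longleftrightarrow> square_integrable u \<and> (\<exists>g. l2_gradient u g)"
  by (auto simp: H1_def L2_iff l2_gradient_def square_integrable_def)

lemma H1_square_integrable: "u \<in> H1 \<Longrightarrow> square_integrable u"
  by (simp add: H1_iff)

lemma l2_gradient_weak_grad:
  assumes "u \<in> H1"
  shows "l2_gradient u (weak_grad u)"
proof -
  obtain g where "g \<in> borel_measurable lborel \<and> integrable lborel (\<lambda>x. (norm (g x))\<^sup>2) \<and> is_weak_grad u g"
    using assms by (auto simp: H1_def)
  from someI[of "\<lambda>g. g \<in> borel_measurable lborel \<and> integrable lborel (\<lambda>x. (norm (g x))\<^sup>2) \<and> is_weak_grad u g", OF this]
  show ?thesis by (simp add: l2_gradient_def square_integrable_def weak_grad_def)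
qed

lemma l2_gradient_eq:
  assumes "l2_gradient u g" "test_fun \<phi> D"
  shows "(\<integral>x. u x * (D x $ i) \<partial>lborel) = - (\<integral>x. (g x $ i) * \<phi> x \<partial>lborel)"
  using assms by (auto simp: l2_gradient_def is_weak_grad_def)

lemma l2_gradient_unique:
  assumes "l2_gradient u g" "l2_gradient u g'"
  shows "AE x in lborel. g x = g' x"
proof -
  have sq: "square_integrable g" "square_integrable g'" using assms by (auto simp: l2_gradient_def)
  have "AE x in lborel. g x $ i - g' x $ i = 0" for i
  proof (rule AE_eq_0_if_test_fun)
    show "square_integrable (\<lambda>x. g x $ i - g' x $ i)"
      by (intro square_integrable_diff square_integrable_nth sq)
    fix \<phi> D assume t: "test_fun \<phi> D"
    have "(\<integral>x. (g x $ i - g' x $ i) * \<phi> x \<partial>lborel)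
        = (\<integral>x. g x $ i * \<phi> x \<partial>lborel) - (\<integral>x. g' x $ i * \<phi> x \<partial>lborel)"
      using square_integrable_mult(1)[OF square_integrable_nth[OF sq(1)] test_fun_square_integrable(1)[OF t]]
        square_integrable_mult(1)[OF square_integrable_nth[OF sq(2)] test_fun_square_integrable(1)[OF t]]
      by (simp add: left_diff_distrib)
    then show "(\<integral>x. (g x $ i - g' x $ i) * \<phi> x \<partial>lborel) = 0"
      using l2_gradient_eq[OF assms(1) t, of i] l2_gradient_eq[OF assms(2) t, of i] by simp
  qed
  then have "AE x in lborel. \<forall>i. g x $ i - g' x $ i = 0" by (subst AE_all_countable) auto
  then show ?thesis by eventually_elim (simp add: vec_eq_iff)
qed

text \<open>\<open>weak_grad\<close> is an arbitrary choice by \<open>SOME\<close>; uniqueness a.e.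
  lets any square-integrable weak gradient compute the Dirichlet energy.\<close>

lemma Q_eq:
  assumes "square_integrable u" "l2_gradient u g"
  shows "Q u = (l2norm g)\<^sup>2"
proof -
  have u: "u \<in> H1" using assms by (auto simp: H1_iff)
  have "l2norm (weak_grad u) = l2norm g"
    using l2_gradient_unique[OF l2_gradient_weak_grad[OF u] assms(2)] l2_gradient_weak_grad[OF u] assms(2)
    by (intro l2norm_cong_AE) (auto simp: l2_gradient_def square_integrable_def)
  then show ?thesis by (simp add: Q_def l2norm_sq[symmetric])
qed

lemma Q_nonneg: "0 \<le> Q u"
  by (simp add: Q_def)

lemma Q_eq_weak_grad: "Q u = (l2norm (weak_grad u))\<^sup>2"
  by (simp add: Q_def l2norm_sq)

lemma l2_gradient_lincomb:
  assumes u: "square_integrable u" "l2_gradient u g" and v: "square_integrable v" "l2_gradient v g'"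
  shows "l2_gradient (\<lambda>x. a * u x + b * v x) (\<lambda>x. a *\<^sub>R g x + b *\<^sub>R g' x)"
  unfolding l2_gradient_def is_weak_grad_def
proof (intro conjI allI impI)
  have sq: "square_integrable g" "square_integrable g'" using assms by (auto simp: l2_gradient_def)
  show "square_integrable (\<lambda>x. a *\<^sub>R g x + b *\<^sub>R g' x)"
    by (intro square_integrable_add square_integrable_scaleR sq)
  fix \<phi> D i assume t: "test_fun \<phi> D"
  note int = square_integrable_mult(1)[OF u(1) square_integrable_nth[OF test_fun_square_integrable(2)[OF t]]]
    square_integrable_mult(1)[OF v(1) square_integrable_nth[OF test_fun_square_integrable(2)[OF t]]]
    square_integrable_mult(1)[OF square_integrable_nth[OF sq(1)] test_fun_square_integrable(1)[OF t]]
    square_integrable_mult(1)[OF square_integrable_nth[OF sq(2)] test_fun_square_integrable(1)[OF t]]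
  have "(\<integral>x. (a * u x + b * v x) * D x $ i \<partial>lborel)
      = a * (\<integral>x. u x * D x $ i \<partial>lborel) + b * (\<integral>x. v x * D x $ i \<partial>lborel)"
    using int by (simp add: distrib_right mult.assoc)
  also have "\<dots> = - (a * (\<integral>x. g x $ i * \<phi> x \<partial>lborel) + b * (\<integral>x. g' x $ i * \<phi> x \<partial>lborel))"
    using l2_gradient_eq[OF u(2) t, of i] l2_gradient_eq[OF v(2) t, of i] by simp
  also have "\<dots> = - (\<integral>x. (a *\<^sub>R g x + b *\<^sub>R g' x) $ i * \<phi> x \<partial>lborel)"
    using int by (simp add: distrib_right mult.assoc)
  finally show "(\<integral>x. (a * u x + b * v x) * D x $ i \<partial>lborel)
      = - (\<integral>x. (a *\<^sub>R g x + b *\<^sub>R g' x) $ i * \<phi> x \<partial>lborel)" .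
qed

section \<open>Translations and increments of functions with a weak gradient\<close>

lemma test_fun_shift:
  assumes "test_fun \<phi> D"
  shows "test_fun (\<lambda>x. \<phi> (x + h)) (\<lambda>x. D (x + h))"
  unfolding test_fun_def
proof (intro conjI allI)
  have der: "\<And>x. (\<phi> has_derivative (\<lambda>h. D x \<bullet> h)) (at x)"
    and cD: "continuous_on UNIV D" and cpt: "compact (closure {x. \<phi> x \<noteq> 0})"
    using assms by (auto simp: test_fun_def)
  show "((\<lambda>x. \<phi> (x + h)) has_derivative (\<lambda>k. D (x + h) \<bullet> k)) (at x)" for x
    by (rule has_derivative_eq_rhs[OF has_derivative_compose[OF _ der]]) (auto intro!: derivative_eq_intros)
  show "continuous_on UNIV (\<lambda>x. D (x + h))"
    by (rule continuous_on_compose2[OF cD]) (auto intro!: continuous_intros)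
  have eq: "{x. \<phi> (x + h) \<noteq> 0} = (\<lambda>x. - h + x) ` {x. \<phi> x \<noteq> 0}"
    by (auto simp: image_iff algebra_simps intro!: exI[of _ "_ + h"])
  show "compact (closure {x. \<phi> (x + h) \<noteq> 0})"
    unfolding eq closure_translation by (rule compact_translation[OF cpt])
qed

lemma l2_gradient_shift:
  assumes u: "square_integrable u" "l2_gradient u g"
  shows "l2_gradient (\<lambda>x. u (x + h)) (\<lambda>x. g (x + h))"
  unfolding l2_gradient_def is_weak_grad_def
proof (intro conjI allI impI)
  have sq: "square_integrable g" using assms by (auto simp: l2_gradient_def)
  show "square_integrable (\<lambda>x. g (x + h))" by (rule square_integrable_shift[OF sq])
  fix \<phi> D i assume t: "test_fun \<phi> D"
  note [measurable] = square_integrable_measurable[OF u(1)] square_integrable_measurable[OF sq]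
    square_integrable_measurable[OF test_fun_square_integrable(1)[OF t]]
    square_integrable_measurable[OF test_fun_square_integrable(2)[OF t]]
  have "(\<integral>x. u (x + h) * D x $ i \<partial>lborel) = (\<integral>x. u x * D (x + - h) $ i \<partial>lborel)"
    using integral_lborel_shift[of "\<lambda>x. u x * D (x + - h) $ i" h] by simp
  also have "\<dots> = - (\<integral>x. g x $ i * \<phi> (x + - h) \<partial>lborel)"
    by (rule l2_gradient_eq[OF u(2) test_fun_shift[OF t]])
  also have "\<dots> = - (\<integral>x. g (x + h) $ i * \<phi> x \<partial>lborel)"
    using integral_lborel_shift[of "\<lambda>x. g x $ i * \<phi> (x + - h)" h] by simp
  finally show "(\<integral>x. u (x + h) * D x $ i \<partial>lborel) = - (\<integral>x. g (x + h) $ i * \<phi> x \<partial>lborel)" .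
qed

lemma l2_gradient_inner:
  assumes u: "square_integrable u" "l2_gradient u g" and t: "test_fun \<phi> D"
  shows "(\<integral>x. u x * (D x \<bullet> h) \<partial>lborel) = - (\<integral>x. (g x \<bullet> h) * \<phi> x \<partial>lborel)"
proof -
  have sq: "square_integrable g" using assms by (auto simp: l2_gradient_def)
  note int = square_integrable_mult(1)[OF u(1) square_integrable_nth[OF test_fun_square_integrable(2)[OF t]]]
    square_integrable_mult(1)[OF square_integrable_nth[OF sq] test_fun_square_integrable(1)[OF t]]
  have "(\<integral>x. u x * (D x \<bullet> h) \<partial>lborel) = (\<integral>x. (\<Sum>i\<in>UNIV. u x * D x $ i * h $ i) \<partial>lborel)"
    by (simp add: inner_vec_def sum_distrib_left mult.assoc)
  also have "\<dots> = (\<Sum>i\<in>UNIV. (\<integral>x. u x * D x $ i \<partial>lborel) * h $ i)"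
    using int by (subst Bochner_Integration.integral_sum) auto
  also have "\<dots> = (\<Sum>i\<in>UNIV. - (\<integral>x. g x $ i * \<phi> x \<partial>lborel) * h $ i)"
    using l2_gradient_eq[OF u(2) t] by simp
  also have "\<dots> = - (\<integral>x. (\<Sum>i\<in>UNIV. g x $ i * \<phi> x * h $ i) \<partial>lborel)"
    using int by (subst Bochner_Integration.integral_sum) (auto simp: sum_negf)
  also have "\<dots> = - (\<integral>x. (g x \<bullet> h) * \<phi> x \<partial>lborel)"
    by (simp add: inner_vec_def sum_distrib_left sum_distrib_right mult_ac)
  finally show ?thesis .
qed

text \<open>The unit interval as a probability measure: the fundamental theorem of calculus becomes
  an average, to which \<open>square_integrable_average\<close> applies.\<close>

definition unit_uniform :: "real measure" where
  "unit_uniform = density lborel (\<lambda>s. ennreal (indicator {0..1} s))"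

lemma sets_unit_uniform [measurable_cong, simp]: "sets unit_uniform = sets borel"
  by (simp add: unit_uniform_def)

lemma emeasure_unit_uniform: "emeasure unit_uniform (space unit_uniform) = 1"
  by (simp add: unit_uniform_def emeasure_density ennreal_indicator)

lemma bump_increment:
  "bump r (z - h) - bump r z = (\<integral>s. - (bump_grad r (z - s *\<^sub>R h) \<bullet> h) \<partial>unit_uniform)"
proof -
  have c: "continuous_on {0..1} (\<lambda>s. - (bump_grad r (z - s *\<^sub>R h) \<bullet> h))"
    by (intro continuous_intros continuous_on_compose2[OF continuous_bump_grad]) auto
  have d: "((\<lambda>s. bump r (z - s *\<^sub>R h)) has_vector_derivative - (bump_grad r (z - s *\<^sub>R h) \<bullet> h)) (at s within {0..1})" for s
    unfolding has_vector_derivative_def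
    by (rule has_derivative_eq_rhs[OF has_derivative_compose[OF _ bump_has_derivative]])
      (auto intro!: derivative_eq_intros)
  have [measurable]: "(\<lambda>s. - (bump_grad r (z - s *\<^sub>R h) \<bullet> h)) \<in> borel_measurable borel" by measurable
  have "(\<integral>s. - (bump_grad r (z - s *\<^sub>R h) \<bullet> h) \<partial>unit_uniform)
      = (\<integral>s. indicator {0..1} s *\<^sub>R - (bump_grad r (z - s *\<^sub>R h) \<bullet> h) \<partial>lborel)"
    unfolding unit_uniform_def by (subst integral_density) auto
  also have "\<dots> = bump r (z - 1 *\<^sub>R h) - bump r (z - 0 *\<^sub>R h)"
    by (rule integral_FTC_Icc[OF _ d c]) auto
  finally show ?thesis by simp
qed

text \<open>The increment is integrated along the segment from x to x + h with the derivative on the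
  kernel; the definition of the weak gradient, with the kernel as test function, moves it to
  u.\<close>

lemma mollify_increment:
  assumes u: "square_integrable u" "l2_gradient u g" and "0 < r"
  shows "mollify r u (x + h) - mollify r u x
    = (\<integral>s. mollify r (\<lambda>z. g z \<bullet> h) (x + s *\<^sub>R h) \<partial>unit_uniform)"
proof -
  have sq: "square_integrable g" using assms by (auto simp: l2_gradient_def)
  note [measurable] = square_integrable_measurable[OF u(1)] square_integrable_measurable[OF sq]
  interpret U: finite_measure unit_uniform by standard (simp add: emeasure_unit_uniform)
  interpret pair_sigma_finite "lborel :: pt measure" unit_uniform ..
  let ?m = "bump_mass r"
  let ?G = "\<lambda>s z. - (bump_grad r (z - (x + s *\<^sub>R h)) \<bullet> h) / ?m"
  have "mollify r u (x + h) - mollify r u x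
      = (\<integral>z. u z * (bump r (z - (x + h)) / ?m) \<partial>lborel) - (\<integral>z. u z * (bump r (z - x) / ?m) \<partial>lborel)"
    using \<open>0 < r\<close> by (simp add: mollify_eq)
  also have "\<dots> = (\<integral>z. u z * ((bump r ((z - x) - h) - bump r (z - x)) / ?m) \<partial>lborel)"
    using square_integrable_mult(1)[OF u(1) square_integrable_bump[of r "x + h" ?m]]
      square_integrable_mult(1)[OF u(1) square_integrable_bump[of r x ?m]] \<open>0 < r\<close>
    by (simp add: algebra_simps diff_divide_distrib)
  also have "\<dots> = (\<integral>z. (\<integral>s. u z * ?G s z \<partial>unit_uniform) \<partial>lborel)"
    unfolding bump_increment by (simp add: algebra_simps)
  also have "\<dots> = (\<integral>s. (\<integral>z. u z * ?G s z \<partial>lborel) \<partial>unit_uniform)"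
  proof (rule Fubini_integral[symmetric])
    have bz: "bump_grad r z = 0" if "z \<notin> cball 0 r" for z
      using that bump_grad_eq_0[of r z] \<open>0 < r\<close> by simp
    obtain C where C: "0 \<le> C" "\<And>z. norm (bump_grad r z) \<le> C"
      by (rule continuous_support_bounded[OF continuous_bump_grad, of 0 r], erule bz, rule that)
    \<comment> \<open>Bounds the directional derivative of the kernel along the whole segment, whose
      supports stay in the ball of radius r + |h| about x; this justifies exchanging the
      integrals.\<close>
    define K where "K = C * norm h / ?m"
    have K0: "0 \<le> K" using C bump_mass_pos[OF \<open>0 < r\<close>] by (simp add: K_def)
    define w where "w z = K * indicator (cball x (r + norm h)) z" for z
    have w: "square_integrable w"
      unfolding w_def using K0
      by (intro square_integrable_bounded_support[where C=K and a=x and R="r + norm h"])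
        (auto simp: indicator_def)
    have G: "\<bar>?G s z\<bar> \<le> w z" if s: "s \<in> {0..1}" for s z
    proof (cases "z \<in> cball x (r + norm h)")
      case True
      have "\<bar>bump_grad r (z - (x + s *\<^sub>R h)) \<bullet> h\<bar> \<le> C * norm h"
        by (rule order.trans[OF Cauchy_Schwarz_ineq2 mult_right_mono[OF C(2) norm_ge_zero]])
      then show ?thesis using True bump_mass_pos[OF \<open>0 < r\<close>]
        by (simp add: w_def K_def abs_div divide_right_mono)
    next
      case False
      have "norm (z - x) \<le> norm (z - (x + s *\<^sub>R h)) + norm (s *\<^sub>R h)"
        using norm_triangle_ineq[of "z - (x + s *\<^sub>R h)" "s *\<^sub>R h"] by simp
      also have "norm (s *\<^sub>R h) \<le> norm h" using s by (simp add: mult_left_le_one_le)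
      finally have "r \<le> norm (z - (x + s *\<^sub>R h))"
        using False by (simp add: dist_norm norm_minus_commute)
      then show ?thesis using \<open>0 < r\<close> K0 by (simp add: bump_grad_eq_0 w_def)
    qed
    have AEU: "AE s in unit_uniform. s \<in> {0..1}"
      unfolding unit_uniform_def by (subst AE_density) (auto simp: indicator_def)
    have iw: "integrable lborel (\<lambda>z. \<bar>u z\<bar> * w z)"
      using square_integrable_norm_mult(1)[OF u(1) w] K0 by (simp add: w_def abs_mult)
    have bnd: "\<bar>u z * ?G s z\<bar> \<le> \<bar>u z\<bar> * w z" if "s \<in> {0..1}" for s z
      using G[OF that, of z] by (simp only: abs_mult mult_left_mono abs_ge_zero)
    have iU: "integrable unit_uniform (\<lambda>s. u z * ?G s z)" for z
    proof (rule U.integrable_const_bound[where B="\<bar>u z\<bar> * w z"])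
      show "AE s in unit_uniform. norm (u z * ?G s z) \<le> \<bar>u z\<bar> * w z"
        unfolding real_norm_def by (rule eventually_mono[OF AEU bnd])
    qed measurable
    show "integrable (lborel \<Otimes>\<^sub>M unit_uniform) (\<lambda>(z, s). u z * ?G s z)"
    proof (rule Fubini_integrable)
      show "AE z in lborel. integrable unit_uniform (\<lambda>s. case (z, s) of (z, s) \<Rightarrow> u z * ?G s z)"
        using iU by simp
      show "integrable lborel (\<lambda>z. \<integral>s. norm (case (z, s) of (z, s) \<Rightarrow> u z * ?G s z) \<partial>unit_uniform)"
      proof (rule Bochner_Integration.integrable_bound[OF iw], measurable, intro AE_I2)
        fix z
        have "(\<integral>s. \<bar>u z * ?G s z\<bar> \<partial>unit_uniform) \<le> (\<integral>s. \<bar>u z\<bar> * w z \<partial>unit_uniform)"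
        proof (rule integral_mono_AE)
          show "AE s in unit_uniform. \<bar>u z * ?G s z\<bar> \<le> \<bar>u z\<bar> * w z"
            by (rule eventually_mono[OF AEU bnd])
        qed (use integrable_norm[OF iU[of z]] in auto)
        also have "\<dots> = \<bar>u z\<bar> * w z"
          using emeasure_unit_uniform by (simp add: measure_def)
        finally show "norm (\<integral>s. norm (case (z, s) of (z, s) \<Rightarrow> u z * ?G s z) \<partial>unit_uniform) \<le> norm (\<bar>u z\<bar> * w z)"
          by simp
      qed
    qed measurable
  qed
  also have "(\<lambda>s. \<integral>z. u z * ?G s z \<partial>lborel) = (\<lambda>s. mollify r (\<lambda>z. g z \<bullet> h) (x + s *\<^sub>R h))"
  proof
    fix s
    have "(\<integral>z. u z * ((bump_grad r (z - (x + s *\<^sub>R h)) /\<^sub>R ?m) \<bullet> h) \<partial>lborel)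
        = - (\<integral>z. (g z \<bullet> h) * (bump r (z - (x + s *\<^sub>R h)) / ?m) \<partial>lborel)"
      by (rule l2_gradient_inner[OF u test_fun_bump[OF \<open>0 < r\<close>]])
    then have "(\<integral>z. u z * ?G s z \<partial>lborel) = (\<integral>z. (g z \<bullet> h) * (bump r (z - (x + s *\<^sub>R h)) / ?m) \<partial>lborel)"
      by (simp add: divide_inverse mult.commute)
    also have "\<dots> = mollify r (\<lambda>z. g z \<bullet> h) (x + s *\<^sub>R h)"
      using \<open>0 < r\<close> by (simp add: mollify_eq)
    finally show "(\<integral>z. u z * ?G s z \<partial>lborel) = mollify r (\<lambda>z. g z \<bullet> h) (x + s *\<^sub>R h)" .
  qed
  finally show ?thesis .
qed

text \<open>Averaging \<open>mollify_increment\<close> over the segment bounds the increments of the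
  mollified function independently of the radius. The radius is then taken so small that passing
  back to u costs e / 2 twice.\<close>

lemma l2norm_increment_le:
  assumes u: "square_integrable u" "l2_gradient u g"
  shows "l2norm (\<lambda>x. u (x + h) - u x) \<le> norm h * l2norm g"
proof (rule field_le_epsilon)
  fix e :: real assume "0 < e"
  have sq: "square_integrable g" using assms by (auto simp: l2_gradient_def)
  note [measurable] = square_integrable_measurable[OF u(1)] square_integrable_measurable[OF sq]
  obtain r where r: "0 < r" "l2norm (\<lambda>x. mollify r u x - u x) \<le> e / 2"
    using mollify_approximates[OF u(1), of "e/2"] \<open>0 < e\<close> by auto
  let ?G = "\<lambda>z. g z \<bullet> h"
  have "\<bar>g x \<bullet> h\<bar> \<le> norm (norm h *\<^sub>R g x)" for x
    using Cauchy_Schwarz_ineq2[of "g x" h] by (simp add: mult.commute)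
  then have G: "square_integrable ?G" "l2norm ?G \<le> norm h * l2norm g"
    using square_integrable_dominated[OF square_integrable_scaleR[OF sq], of ?G "norm h"]
    by (simp_all add: l2norm_scaleR)
  note m = square_integrable_mollify[OF u(1) r(1)] square_integrable_mollify[OF G(1) r(1)]
  note [measurable] = square_integrable_measurable[OF m(3)]
  have "(\<lambda>(x, s). mollify r ?G (x + s *\<^sub>R h)) \<in> borel_measurable (borel \<Otimes>\<^sub>M unit_uniform)" by measurable
  moreover have "AE s in unit_uniform. square_integrable (\<lambda>x. mollify r ?G (x + s *\<^sub>R h)) \<and>
      l2norm (\<lambda>x. mollify r ?G (x + s *\<^sub>R h)) \<le> norm h * l2norm g"
    using m(4) G(2) by (simp add: square_integrable_shift[OF m(3)] l2norm_shift[OF m(3)])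
  ultimately have 1: "l2norm (\<lambda>x. mollify r u (x + h) - mollify r u x) \<le> norm h * l2norm g"
    using square_integrable_average(2)[OF emeasure_unit_uniform, of "\<lambda>x s. mollify r ?G (x + s *\<^sub>R h)" "norm h * l2norm g"]
    by (simp add: mollify_increment[OF u r(1)])
  have 2: "l2norm (\<lambda>x. u (x + h) - mollify r u (x + h)) \<le> e / 2"
    using r(2) l2norm_shift[OF square_integrable_diff[OF u(1) m(1)], of h]
    by (simp add: l2norm_diff_commute[of u])
  show "l2norm (\<lambda>x. u (x + h) - u x) \<le> norm h * l2norm g + e"
    using l2norm_triangle_diff[OF square_integrable_shift[OF u(1)] square_integrable_shift[OF m(1)] u(1), of h h]
      l2norm_triangle_diff[OF square_integrable_shift[OF m(1)] m(1) u(1), of h] 1 2 r(2) by linarith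
qed

section \<open>The Gagliardo--Nirenberg inequality\<close>

text \<open>Pointwise |v| <= t + t^(1-s) |v|^s. The ball has measure S t^(-s), so the average of
  |u|^s is at most t^s and each of the two terms contributes at most t.\<close>

lemma ball_average_bound:
  fixes u :: "pt \<Rightarrow> real"
  assumes [measurable]: "u \<in> borel_measurable borel" and "1 \<le> s" "0 < t" "0 < S"
    and S: "(\<integral>\<^sup>+x. ennreal (\<bar>u x\<bar> powr s) \<partial>lborel) \<le> ennreal S"
    and r: "0 < r" "pi * r\<^sup>2 = S * t powr (- s)"
  shows "(\<integral>\<^sup>+y. ennreal \<bar>u (x + y)\<bar> \<partial>uniform_measure lborel (ball 0 r)) \<le> ennreal (2 * t)"
proof -
  let ?B = "ball (0::pt) r"
  have B: "emeasure lborel ?B = ennreal (S * t powr (- s))"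
    using r by (simp add: emeasure_ball unit_ball_vol_2)
  have B0: "0 < S * t powr (- s)" using assms by simp
  have pt: "ennreal \<bar>v\<bar> \<le> ennreal t + ennreal (t powr (1 - s)) * ennreal (\<bar>v\<bar> powr s)" for v :: real
  proof -
    have "\<bar>v\<bar> \<le> t + t powr (1 - s) * \<bar>v\<bar> powr s"
    proof (cases "\<bar>v\<bar> \<le> t")
      case False
      then have v: "0 < \<bar>v\<bar>" "1 \<le> \<bar>v\<bar> / t" using \<open>0 < t\<close> by auto
      have "\<bar>v\<bar> = t * (\<bar>v\<bar> / t)" using \<open>0 < t\<close> by simp
      also have "\<dots> \<le> t * (\<bar>v\<bar> / t) powr s"
        using powr_mono[OF \<open>1 \<le> s\<close> v(2)] v(2) \<open>0 < t\<close> by (intro mult_left_mono) auto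
      also have "\<dots> = t powr (1 - s) * \<bar>v\<bar> powr s"
        using \<open>0 < t\<close> v by (simp add: powr_divide powr_diff)
      finally show ?thesis using \<open>0 < t\<close> by linarith
    qed (simp add: add_increasing2)
    then have "ennreal \<bar>v\<bar> \<le> ennreal (t + t powr (1 - s) * \<bar>v\<bar> powr s)" by (rule ennreal_leI)
    then show ?thesis using \<open>0 < t\<close> by (simp add: ennreal_mult)
  qed
  have "(\<integral>\<^sup>+y. ennreal \<bar>u (x + y)\<bar> \<partial>uniform_measure lborel ?B)
      \<le> (\<integral>\<^sup>+y. ennreal t + ennreal (t powr (1 - s)) * ennreal (\<bar>u (x + y)\<bar> powr s) \<partial>uniform_measure lborel ?B)"
    by (intro nn_integral_mono pt)
  also have "\<dots> = ennreal t * emeasure (uniform_measure lborel ?B) UNIV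
      + ennreal (t powr (1 - s)) * (\<integral>\<^sup>+y. ennreal (\<bar>u (x + y)\<bar> powr s) \<partial>uniform_measure lborel ?B)"
    by (subst nn_integral_add) (auto simp: nn_integral_cmult)
  also have "emeasure (uniform_measure lborel ?B) UNIV = 1"
    using B0 \<open>0 < S\<close> \<open>0 < t\<close> by (simp add: emeasure_uniform_measure B divide_ennreal[OF less_imp_le[OF B0] B0])
  also have "(\<integral>\<^sup>+y. ennreal (\<bar>u (x + y)\<bar> powr s) \<partial>uniform_measure lborel ?B)
      = (\<integral>\<^sup>+y. ennreal (\<bar>u (x + y)\<bar> powr s) * indicator ?B y \<partial>lborel) / emeasure lborel ?B"
    by (rule nn_integral_uniform_measure) auto
  also have "\<dots> \<le> ennreal S / ennreal (S * t powr (- s))"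
  proof -
    have "(\<integral>\<^sup>+y. ennreal (\<bar>u (x + y)\<bar> powr s) * indicator ?B y \<partial>lborel)
        \<le> (\<integral>\<^sup>+y. ennreal (\<bar>u (y + x)\<bar> powr s) \<partial>lborel)"
      by (intro nn_integral_mono) (auto simp: indicator_def add.commute)
    also have "\<dots> \<le> ennreal S"
      using S nn_integral_lborel_shift[of "\<lambda>y. ennreal (\<bar>u y\<bar> powr s)" x] by simp
    finally show ?thesis unfolding B by (rule divide_right_mono_ennreal)
  qed
  also have "\<dots> = ennreal (t powr s)"
    using B0 \<open>0 < S\<close> \<open>0 < t\<close> by (simp add: divide_ennreal powr_minus field_simps)
  finally have "(\<integral>\<^sup>+y. ennreal \<bar>u (x + y)\<bar> \<partial>uniform_measure lborel ?B)
      \<le> ennreal t * 1 + ennreal (t powr (1 - s)) * ennreal (t powr s)"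
    by (simp add: mult_left_mono add_left_mono)
  also have "\<dots> = ennreal (2 * t)"
    using \<open>0 < t\<close> by (simp add: ennreal_mult[symmetric] powr_add[symmetric] ennreal_plus[symmetric] del: ennreal_plus)
  finally show ?thesis .
qed

text \<open>The weak-type bound: compare \<open>u\<close> with its averages over balls whose radius is chosen such that
  the averages stay below half of the level; the difference is controlled by the increments of \<open>u\<close>.\<close>

lemma superlevel_measure_le:
  fixes u :: "pt \<Rightarrow> real"
  assumes u: "square_integrable u" and inc: "\<And>h. l2norm (\<lambda>x. u (x + h) - u x) \<le> norm h * G"
    and "0 \<le> G" "1 \<le> s" "0 < t" "0 < S"
    and S: "(\<integral>\<^sup>+x. ennreal (\<bar>u x\<bar> powr s) \<partial>lborel) \<le> ennreal S"
  shows "emeasure lborel {x. 4 * t < \<bar>u x\<bar>} \<le> ennreal (S * G\<^sup>2 * t powr (- s - 2))"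
proof -
  note [measurable] = square_integrable_measurable[OF u]
  define r where "r = sqrt (S * t powr (- s) / pi)"
  have r: "0 < r" "pi * r\<^sup>2 = S * t powr (- s)" using assms by (auto simp: r_def)
  let ?B = "ball (0::pt) r"
  let ?N = "uniform_measure lborel ?B"
  have B: "emeasure lborel ?B = ennreal (S * t powr (- s))"
    using r by (simp add: emeasure_ball unit_ball_vol_2)
  have B0: "0 < S * t powr (- s)" using assms by simp
  have N: "emeasure ?N (space ?N) = 1"
    using B0 \<open>0 < S\<close> \<open>0 < t\<close> by (simp add: emeasure_uniform_measure B divide_ennreal[OF less_imp_le[OF B0] B0])
  interpret N: finite_measure ?N by standard (unfold N, simp)
  note bound = ball_average_bound[OF square_integrable_measurable[OF u] \<open>1 \<le> s\<close> \<open>0 < t\<close> \<open>0 < S\<close> S r]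
  have int: "integrable ?N (\<lambda>y. u (x + y))" for x
    by (rule integrableI_bounded) (use bound[of x] in \<open>auto simp: le_less_trans\<close>)
  define a where "a x = (\<integral>y. u (x + y) \<partial>?N)" for x
  have a: "\<bar>a x\<bar> \<le> 2 * t" for x
  proof -
    have "ennreal (norm (a x)) \<le> ennreal (2 * t)"
      unfolding a_def by (rule order.trans[OF integral_norm_bound_ennreal[OF int]]) (use bound in simp)
    then show ?thesis using \<open>0 < t\<close> by (simp add: ennreal_le_iff)
  qed
  have "AE y in ?N. norm y < r"
    by (rule AE_uniform_measureI) auto
  then have AE: "AE y in ?N. square_integrable (\<lambda>x. u (x + y) - u x) \<and> l2norm (\<lambda>x. u (x + y) - u x) \<le> r * G"
  proof eventually_elim
    case (elim y)
    show ?case using inc[of y] mult_right_mono[of "norm y" r G] elim \<open>0 \<le> G\<close>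
      by (auto intro!: square_integrable_diff square_integrable_shift[OF u] u)
  qed
  have "(\<lambda>(x, y). u (x + y) - u x) \<in> borel_measurable (borel \<Otimes>\<^sub>M ?N)" by measurable
  from square_integrable_average[OF N this AE] \<open>0 \<le> G\<close> r(1)
  have d: "square_integrable (\<lambda>x. \<integral>y. u (x + y) - u x \<partial>?N)" "l2norm (\<lambda>x. \<integral>y. u (x + y) - u x \<partial>?N) \<le> r * G"
    by auto
  have eq: "(\<lambda>x. \<integral>y. u (x + y) - u x \<partial>?N) = (\<lambda>x. a x - u x)"
    using int N by (simp add: a_def measure_def fun_eq_iff)
  note d = d[unfolded eq]
  note [measurable] = square_integrable_measurable[OF d(1)]
  have "emeasure lborel {x. 4 * t < \<bar>u x\<bar>} = (\<integral>\<^sup>+x. indicator {x. 4 * t < \<bar>u x\<bar>} x \<partial>lborel)"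
    by simp
  \<comment> \<open>Chebyshev: where |u| > 4 t the average is at most 2 t, so the difference is at
    least 2 t.\<close>
  also have "\<dots> \<le> (\<integral>\<^sup>+x. ennreal (1 / (4 * t\<^sup>2)) * ennreal ((norm (a x - u x))\<^sup>2) \<partial>lborel)"
  proof (intro nn_integral_mono)
    fix x :: pt
    have "1 \<le> 1 / (4 * t\<^sup>2) * (norm (a x - u x))\<^sup>2" if "4 * t < \<bar>u x\<bar>"
    proof -
      have "2 * t \<le> norm (a x - u x)" using that a[of x] by simp
      then have "(2 * t)\<^sup>2 \<le> (norm (a x - u x))\<^sup>2" using \<open>0 < t\<close> by (intro power_mono) auto
      then show ?thesis using \<open>0 < t\<close> by (simp add: power_mult_distrib)
    qed
    then show "indicator {x. 4 * t < \<bar>u x\<bar>} x \<le> ennreal (1 / (4 * t\<^sup>2)) * ennreal ((norm (a x - u x))\<^sup>2)"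
      by (auto simp: indicator_def ennreal_mult[symmetric] simp del: real_norm_def power2_abs)
  qed
  also have "\<dots> = ennreal (1 / (4 * t\<^sup>2)) * ennreal ((l2norm (\<lambda>x. a x - u x))\<^sup>2)"
    by (subst nn_integral_cmult) (auto simp only: square_integrable_nn[OF d(1)], measurable)
  also have "\<dots> = ennreal (1 / (4 * t\<^sup>2) * (l2norm (\<lambda>x. a x - u x))\<^sup>2)"
    by (rule ennreal_mult[symmetric]) auto
  also have "\<dots> \<le> ennreal (S * G\<^sup>2 * t powr (- s - 2))"
  proof (rule ennreal_leI)
    have "1 / (4 * t\<^sup>2) * (l2norm (\<lambda>x. a x - u x))\<^sup>2 \<le> 1 / (4 * t\<^sup>2) * (r * G)\<^sup>2"
      using d(2) by (intro mult_left_mono power_mono) auto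
    also have "\<dots> = S * t powr (- s) * G\<^sup>2 / (4 * pi * t\<^sup>2)"
      using r(2) \<open>0 < t\<close> by (simp add: field_simps power_mult_distrib)
    also have "\<dots> = (S * G\<^sup>2 * t powr (- s - 2)) / (4 * pi)"
      using \<open>0 < t\<close> by (simp add: powr_diff powr_numeral mult_ac)
    also have "\<dots> \<le> (S * G\<^sup>2 * t powr (- s - 2)) / 1"
      using pi_ge_two \<open>0 < S\<close> by (intro divide_left_mono) auto
    finally show "1 / (4 * t\<^sup>2) * (l2norm (\<lambda>x. a x - u x))\<^sup>2 \<le> S * G\<^sup>2 * t powr (- s - 2)" by simp
  qed
  finally show ?thesis .
qed

lemma ennreal_le_suminf: "f k \<le> (\<Sum>k. f k)" for f :: "nat \<Rightarrow> ennreal"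
proof -
  have "(\<Sum>i\<in>{k}. f i) \<le> (\<Sum>k. f k)" by (rule sum_le_suminf) auto
  then show ?thesis by simp
qed

text \<open>Either |v| <= 4 T, or |v| lies in a dyadic shell between 4 * 2^k T and 8 * 2^k T, and
  the sum contains the term of that shell.\<close>

lemma powr_le_dyadic_sum:
  fixes v T s q :: real
  assumes "0 < T" "0 \<le> s" "s \<le> q"
  shows "ennreal (\<bar>v\<bar> powr q) \<le> ennreal ((4 * T) powr (q - s)) * ennreal (\<bar>v\<bar> powr s)
    + (\<Sum>k. ennreal ((8 * (2 ^ k * T)) powr q) * indicator {v. 4 * (2 ^ k * T) < \<bar>v\<bar>} v)"
proof (cases "\<bar>v\<bar> \<le> 4 * T")
  case True
  have "\<bar>v\<bar> powr q \<le> (4 * T) powr (q - s) * \<bar>v\<bar> powr s"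
  proof (cases "v = 0")
    case False
    then have "\<bar>v\<bar> powr q = \<bar>v\<bar> powr (q - s) * \<bar>v\<bar> powr s" by (simp add: powr_add[symmetric])
    also have "\<dots> \<le> (4 * T) powr (q - s) * \<bar>v\<bar> powr s"
      using True assms by (intro mult_right_mono powr_mono2) auto
    finally show ?thesis .
  qed simp
  then have "ennreal (\<bar>v\<bar> powr q) \<le> ennreal ((4 * T) powr (q - s)) * ennreal (\<bar>v\<bar> powr s)"
    by (simp add: ennreal_mult[symmetric] ennreal_leI)
  then show ?thesis by (rule add_increasing2[OF zero_le])
next
  case False
  have ex: "\<exists>j. \<bar>v\<bar> \<le> 4 * (2 ^ j * T)"
  proof -
    obtain j where "\<bar>v\<bar> / (4 * T) < 2 ^ j" using real_arch_pow[of 2 "\<bar>v\<bar> / (4 * T)"] by auto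
    then show ?thesis using \<open>0 < T\<close> by (intro exI[of _ j]) (simp add: field_simps)
  qed
  \<comment> \<open>Since |v| > 4 T the least j is positive, and its predecessor indexes the
    shell.\<close>
  define j where "j = (LEAST j. \<bar>v\<bar> \<le> 4 * (2 ^ j * T))"
  have j: "\<bar>v\<bar> \<le> 4 * (2 ^ j * T)" unfolding j_def by (rule LeastI_ex[OF ex])
  with False obtain k where k: "j = Suc k" by (cases j) auto
  have low: "4 * (2 ^ k * T) < \<bar>v\<bar>"
    using not_less_Least[of k "\<lambda>j. \<bar>v\<bar> \<le> 4 * (2 ^ j * T)"] k by (simp add: j_def[symmetric])
  let ?f = "\<lambda>k. ennreal ((8 * (2 ^ k * T)) powr q) * indicator {v. 4 * (2 ^ k * T) < \<bar>v\<bar>} v"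
  have "ennreal (\<bar>v\<bar> powr q) \<le> ?f k"
    using j low assms by (auto simp: k intro!: ennreal_leI powr_mono2)
  also have "\<dots> \<le> (\<Sum>k. ?f k)" by (rule ennreal_le_suminf)
  finally show ?thesis by (rule add_increasing[OF zero_le])
qed

text \<open>What the power estimates and the compactness argument retain of the gradient;
  \<open>G\<close> stands for a bound on its norm.\<close>

definition shift_Lipschitz :: "real \<Rightarrow> (pt \<Rightarrow> real) \<Rightarrow> bool" where
  "shift_Lipschitz G u \<longleftrightarrow> square_integrable u \<and> (\<forall>h. l2norm (\<lambda>x. u (x + h) - u x) \<le> norm h * G)"

text \<open>The weak-type bound is summed over dyadic levels: the k-th shell contributes a multiple
  of 2^(k (q - s - 2)), a convergent geometric series because q < s + 2.\<close>

lemma power_integral_step: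
  fixes s q :: real
  assumes "1 \<le> s" "s \<le> q" "q < s + 2"
  obtains C where "0 < C" "\<And>u T S. shift_Lipschitz T u \<Longrightarrow> 0 < T \<Longrightarrow> 0 < S \<Longrightarrow>
    (\<integral>\<^sup>+x. ennreal (\<bar>u x\<bar> powr s) \<partial>lborel) \<le> ennreal S \<Longrightarrow>
    (\<integral>\<^sup>+x. ennreal (\<bar>u x\<bar> powr q) \<partial>lborel) \<le> ennreal (C * S * T powr (q - s))"
proof -
  define \<theta> where "\<theta> = (2::real) powr (q - s - 2)"
  have \<theta>: "0 < \<theta>" "\<theta> < 1" using assms powr_less_mono[of "q - s - 2" 0 "2::real"] by (auto simp: \<theta>_def)
  \<comment> \<open>The first summand pays for values up to 4 T, the second for the geometric series
    of the shells.\<close>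
  define C where "C = 4 powr (q - s) + 8 powr q / (1 - \<theta>)"
  have C: "0 < C" using \<theta> by (auto simp: C_def intro!: add_pos_pos divide_pos_pos)
  show thesis
  proof (rule that[OF C])
    fix u :: "pt \<Rightarrow> real" and T S :: real
    assume u: "shift_Lipschitz T u" and T: "0 < T" and "0 < S"
      and S: "(\<integral>\<^sup>+x. ennreal (\<bar>u x\<bar> powr s) \<partial>lborel) \<le> ennreal S"
    have sq: "square_integrable u" and inc: "\<And>h. l2norm (\<lambda>x. u (x + h) - u x) \<le> norm h * T"
      using u by (auto simp: shift_Lipschitz_def)
    note [measurable] = square_integrable_measurable[OF sq]
    have level: "ennreal ((8 * (2 ^ k * T)) powr q) * emeasure lborel {x. 4 * (2 ^ k * T) < \<bar>u x\<bar>}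
        \<le> ennreal (8 powr q * S * T powr (q - s) * \<theta> ^ k)" for k
    proof -
      have "ennreal ((8 * (2 ^ k * T)) powr q) * emeasure lborel {x. 4 * (2 ^ k * T) < \<bar>u x\<bar>}
          \<le> ennreal ((8 * (2 ^ k * T)) powr q) * ennreal (S * T\<^sup>2 * (2 ^ k * T) powr (- s - 2))"
        using superlevel_measure_le[OF sq inc _ \<open>1 \<le> s\<close> _ \<open>0 < S\<close> S, of "2 ^ k * T"] T
        by (intro mult_left_mono) auto
      also have "\<dots> = ennreal (8 powr q * S * T\<^sup>2 * ((2 ^ k * T) powr q * (2 ^ k * T) powr (- s - 2)))"
        using T \<open>0 < S\<close> by (simp add: ennreal_mult[symmetric] powr_mult mult_ac)
      also have "(2 ^ k * T) powr q * (2 ^ k * T) powr (- s - 2) = (2 ^ k * T) powr (q - s - 2)"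
      proof -
        have "q + (- s - 2) = q - s - 2" by simp
        then show ?thesis by (simp only: powr_add[symmetric])
      qed
      also have "\<dots> = \<theta> ^ k * T powr (q - s - 2)"
      proof -
        have "(2 ^ k) powr (q - s - 2) = \<theta> ^ k"
          by (simp add: \<theta>_def powr_realpow[symmetric] powr_powr mult.commute)
        then show ?thesis using T by (simp add: powr_mult)
      qed
      also have "T powr (q - s - 2) = T powr (q - s) / T\<^sup>2"
        using T by (simp add: powr_diff powr_numeral)
      finally show ?thesis using T by (simp add: mult_ac)
    qed
    have "(\<integral>\<^sup>+x. ennreal (\<bar>u x\<bar> powr q) \<partial>lborel)
        \<le> (\<integral>\<^sup>+x. ennreal ((4 * T) powr (q - s)) * ennreal (\<bar>u x\<bar> powr s)
          + (\<Sum>k. ennreal ((8 * (2 ^ k * T)) powr q) * indicator {x. 4 * (2 ^ k * T) < \<bar>u x\<bar>} x) \<partial>lborel)"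
    proof (intro nn_integral_mono)
      fix x
      show "ennreal (\<bar>u x\<bar> powr q) \<le> ennreal ((4 * T) powr (q - s)) * ennreal (\<bar>u x\<bar> powr s)
          + (\<Sum>k. ennreal ((8 * (2 ^ k * T)) powr q) * indicator {x. 4 * (2 ^ k * T) < \<bar>u x\<bar>} x)"
        using powr_le_dyadic_sum[OF T _ \<open>s \<le> q\<close>, of "u x"] \<open>1 \<le> s\<close> by (simp add: indicator_def)
    qed
    also have "\<dots> = ennreal ((4 * T) powr (q - s)) * (\<integral>\<^sup>+x. ennreal (\<bar>u x\<bar> powr s) \<partial>lborel)
        + (\<Sum>k. ennreal ((8 * (2 ^ k * T)) powr q) * emeasure lborel {x. 4 * (2 ^ k * T) < \<bar>u x\<bar>})"
      by (subst nn_integral_add) (auto simp: nn_integral_cmult nn_integral_suminf)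
    also have "\<dots> \<le> ennreal ((4 * T) powr (q - s)) * ennreal S
        + (\<Sum>k. ennreal (8 powr q * S * T powr (q - s) * \<theta> ^ k))"
      by (intro add_mono mult_left_mono S suminf_le level) auto
    also have "(\<Sum>k. ennreal (8 powr q * S * T powr (q - s) * \<theta> ^ k))
        = ennreal (8 powr q * S * T powr (q - s) * (1 / (1 - \<theta>)))"
      using \<theta> \<open>0 < S\<close> by (subst suminf_ennreal2) (auto simp: suminf_mult suminf_geometric)
    also have "ennreal ((4 * T) powr (q - s)) * ennreal S + \<dots> = ennreal (C * S * T powr (q - s))"
      using \<theta> \<open>0 < S\<close> T
      by (simp add: ennreal_mult[symmetric] ennreal_plus[symmetric] powr_mult C_def algebra_simps del: ennreal_plus)
    finally show "(\<integral>\<^sup>+x. ennreal (\<bar>u x\<bar> powr q) \<partial>lborel) \<le> ennreal (C * S * T powr (q - s))" .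
  qed
qed

text \<open>Starting from the mass, at q = 2, each round raises the exponent by at most 1, within
  the gain below 2 that \<open>power_integral_step\<close> allows; the powers of T add up.\<close>

lemma power_integral_le_aux:
  fixes q :: real
  assumes "2 \<le> q" "q \<le> 2 + real n"
  shows "\<exists>C>0. \<forall>u T S. shift_Lipschitz T u \<longrightarrow> 0 < T \<longrightarrow> 0 < S \<longrightarrow>
    (\<integral>\<^sup>+x. ennreal (\<bar>u x\<bar> powr 2) \<partial>lborel) \<le> ennreal S \<longrightarrow>
    (\<integral>\<^sup>+x. ennreal (\<bar>u x\<bar> powr q) \<partial>lborel) \<le> ennreal (C * S * T powr (q - 2))"
  using assms
proof (induction n arbitrary: q)
  case 0
  then have "q = 2" by simp
  then show ?case by (intro exI[of _ 1]) auto
next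
  case (Suc n)
  \<comment> \<open>The maximum keeps s in the range of the induction hypothesis and q below s +
    2.\<close>
  define s where "s = max 2 (q - 1)"
  have s: "2 \<le> s" "s \<le> 2 + real n" "1 \<le> s" "s \<le> q" "q < s + 2" using Suc.prems by (auto simp: s_def)
  from Suc.IH[OF s(1,2)] obtain C1 where C1: "0 < C1" and *: "\<And>u T S. shift_Lipschitz T u \<Longrightarrow> 0 < T \<Longrightarrow> 0 < S \<Longrightarrow>
    (\<integral>\<^sup>+x. ennreal (\<bar>u x\<bar> powr 2) \<partial>lborel) \<le> ennreal S \<Longrightarrow>
    (\<integral>\<^sup>+x. ennreal (\<bar>u x\<bar> powr s) \<partial>lborel) \<le> ennreal (C1 * S * T powr (s - 2))"
    by blast
  obtain C2 where C2: "0 < C2" and **: "\<And>u T S. shift_Lipschitz T u \<Longrightarrow> 0 < T \<Longrightarrow> 0 < S \<Longrightarrow>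
    (\<integral>\<^sup>+x. ennreal (\<bar>u x\<bar> powr s) \<partial>lborel) \<le> ennreal S \<Longrightarrow>
    (\<integral>\<^sup>+x. ennreal (\<bar>u x\<bar> powr q) \<partial>lborel) \<le> ennreal (C2 * S * T powr (q - s))"
    using power_integral_step[OF s(3-5)] by blast
  show ?case
  proof (intro exI[of _ "C2 * C1"] conjI allI impI)
    fix u :: "pt \<Rightarrow> real" and T S :: real
    assume A: "shift_Lipschitz T u" "0 < T" "0 < S"
      "(\<integral>\<^sup>+x. ennreal (\<bar>u x\<bar> powr 2) \<partial>lborel) \<le> ennreal S"
    have "(\<integral>\<^sup>+x. ennreal (\<bar>u x\<bar> powr q) \<partial>lborel) \<le> ennreal (C2 * (C1 * S * T powr (s - 2)) * T powr (q - s))"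
      by (rule **[OF A(1,2) _ *[OF A]]) (use A C1 in simp)
    also have "C2 * (C1 * S * T powr (s - 2)) * T powr (q - s) = C2 * C1 * S * (T powr (s - 2) * T powr (q - s))"
      by (simp only: mult_ac)
    also have "T powr (s - 2) * T powr (q - s) = T powr (q - 2)" by (simp add: powr_add[symmetric])
    finally show "(\<integral>\<^sup>+x. ennreal (\<bar>u x\<bar> powr q) \<partial>lborel) \<le> ennreal (C2 * C1 * S * T powr (q - 2))" .
  qed (use C1 C2 in simp)
qed

lemma H1_shift_Lipschitz:
  assumes "u \<in> H1" "Q u \<le> T\<^sup>2" "0 \<le> T"
  shows "shift_Lipschitz T u"
proof -
  have g: "l2_gradient u (weak_grad u)" by (rule l2_gradient_weak_grad[OF assms(1)])
  have "l2norm (weak_grad u) \<le> T"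
    using assms(2,3) by (auto simp: Q_eq_weak_grad intro: power2_le_imp_le)
  then show ?thesis
    using l2norm_increment_le[OF H1_square_integrable[OF assms(1)] g] assms(1)
      mult_left_mono[of "l2norm (weak_grad u)" T "norm _"]
    by (auto simp: shift_Lipschitz_def H1_square_integrable intro: order.trans)
qed

text \<open>T is a positive upper bound for the root of \<open>Q u\<close> and not the root itself,
  so that the estimate covers vanishing gradients and can be used uniformly along sequences.\<close>

lemma power_integral_le:
  fixes q :: real
  assumes "2 \<le> q"
  obtains C where "0 < C" "\<And>u T. u \<in> H1 \<Longrightarrow> Q u \<le> T\<^sup>2 \<Longrightarrow> 0 < T \<Longrightarrow>
      integrable lborel (\<lambda>x. \<bar>u x\<bar> powr q) \<and>
      (\<integral>x. \<bar>u x\<bar> powr q \<partial>lborel) \<le> C * T powr (q - 2) * (\<integral>x. (u x)\<^sup>2 \<partial>lborel)"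
proof -
  obtain n where "q \<le> real n" using real_arch_simple by blast
  then have "q \<le> 2 + real n" by simp
  from power_integral_le_aux[OF assms this] obtain C where C: "0 < C" and *: "\<And>u T S. shift_Lipschitz T u \<Longrightarrow> 0 < T \<Longrightarrow> 0 < S \<Longrightarrow>
    (\<integral>\<^sup>+x. ennreal (\<bar>u x\<bar> powr 2) \<partial>lborel) \<le> ennreal S \<Longrightarrow>
    (\<integral>\<^sup>+x. ennreal (\<bar>u x\<bar> powr q) \<partial>lborel) \<le> ennreal (C * S * T powr (q - 2))" by blast
  show thesis
  proof (rule that[OF C])
    fix u T assume u: "u \<in> H1" "Q u \<le> T\<^sup>2" and T: "0 < (T::real)"
    have sq: "square_integrable u" by (rule H1_square_integrable[OF u(1)])
    note [measurable] = square_integrable_measurable[OF sq]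
    let ?S = "\<integral>x. (u x)\<^sup>2 \<partial>lborel" and ?X = "\<integral>x. \<bar>u x\<bar> powr q \<partial>lborel"
    have S0: "0 \<le> ?S" by simp
    have S: "(\<integral>\<^sup>+x. ennreal (\<bar>u x\<bar> powr 2) \<partial>lborel) = ennreal ?S"
      using square_integrable_nn[OF sq] by (simp add: powr_numeral l2norm_sq)
    have bd: "(\<integral>\<^sup>+x. ennreal (\<bar>u x\<bar> powr q) \<partial>lborel) \<le> ennreal (C * (?S + \<epsilon>) * T powr (q - 2))"
      if "0 < \<epsilon>" for \<epsilon>
    proof (rule *[OF H1_shift_Lipschitz[OF u] T])
      show "0 < ?S + \<epsilon>" using that S0 by linarith
      show "(\<integral>\<^sup>+x. ennreal (\<bar>u x\<bar> powr 2) \<partial>lborel) \<le> ennreal (?S + \<epsilon>)"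
        unfolding S using that by (intro ennreal_leI) simp
    qed (use T in simp)
    have int: "integrable lborel (\<lambda>x. \<bar>u x\<bar> powr q)"
      by (rule integrableI_nonneg) (use bd[of 1] in \<open>auto simp: le_less_trans\<close>)
    have "?X \<le> C * T powr (q - 2) * ?S + e" if "0 < e" for e
    proof -
      \<comment> \<open>The auxiliary estimate wants a positive S; adding this amount to the mass
        raises the bound by exactly e.\<close>
      define \<epsilon> where "\<epsilon> = e / (C * T powr (q - 2))"
      have \<epsilon>: "0 < \<epsilon>" using that C T by (simp add: \<epsilon>_def)
      have "ennreal ?X \<le> ennreal (C * (?S + \<epsilon>) * T powr (q - 2))"
        using bd[OF \<epsilon>] int by (simp add: nn_integral_eq_integral)
      then have "?X \<le> C * (?S + \<epsilon>) * T powr (q - 2)"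
        using C T \<epsilon> S0 by (subst (asm) ennreal_le_iff) auto
      also have "\<dots> = C * T powr (q - 2) * ?S + e"
        using C T by (simp add: \<epsilon>_def field_simps)
      finally show ?thesis .
    qed
    then show "integrable lborel (\<lambda>x. \<bar>u x\<bar> powr q) \<and> ?X \<le> C * T powr (q - 2) * ?S"
      using int by (blast intro: field_le_epsilon)
  qed
qed

lemma H1_powr_integrable: "u \<in> H1 \<Longrightarrow> 2 \<le> q \<Longrightarrow> integrable lborel (\<lambda>x. \<bar>u x\<bar> powr q)"
proof (rule power_integral_le[of q], assumption)
  fix C assume "u \<in> H1" and *: "\<And>u T. u \<in> H1 \<Longrightarrow> Q u \<le> T\<^sup>2 \<Longrightarrow> 0 < T \<Longrightarrow>
      integrable lborel (\<lambda>x. \<bar>u x\<bar> powr q) \<and>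
      (\<integral>x. \<bar>u x\<bar> powr q \<partial>lborel) \<le> C * T powr (q - 2) * (\<integral>x. (u x)\<^sup>2 \<partial>lborel)"
  have "Q u \<le> (sqrt (Q u) + 1)\<^sup>2"
    using Q_nonneg[of u] by (simp add: power2_sum)
  from *[OF \<open>u \<in> H1\<close> this] show "integrable lborel (\<lambda>x. \<bar>u x\<bar> powr q)"
    using Q_nonneg[of u] by (simp add: add_nonneg_pos)
qed

text \<open>Let T decrease to the root of \<open>Q u\<close>. The exponent q - 2 has to be positive
  for continuity at 0, since \<open>0 powr 0 = 0\<close>.\<close>

lemma Gagliardo_Nirenberg:
  fixes q :: real
  assumes "2 < q"
  obtains C where "0 < C" "\<And>u. u \<in> H1 \<Longrightarrow>
    (\<integral>x. \<bar>u x\<bar> powr q \<partial>lborel) \<le> C * sqrt (Q u) powr (q - 2) * (\<integral>x. (u x)\<^sup>2 \<partial>lborel)"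
proof -
  obtain C where C: "0 < C" and *: "\<And>u T. u \<in> H1 \<Longrightarrow> Q u \<le> T\<^sup>2 \<Longrightarrow> 0 < T \<Longrightarrow>
      integrable lborel (\<lambda>x. \<bar>u x\<bar> powr q) \<and>
      (\<integral>x. \<bar>u x\<bar> powr q \<partial>lborel) \<le> C * T powr (q - 2) * (\<integral>x. (u x)\<^sup>2 \<partial>lborel)"
    using power_integral_le[of q] assms by auto
  show thesis
  proof (rule that[OF C])
    fix u assume u: "u \<in> H1"
    let ?S = "\<integral>x. (u x)\<^sup>2 \<partial>lborel" and ?X = "\<integral>x. \<bar>u x\<bar> powr q \<partial>lborel"
    let ?T = "\<lambda>n. sqrt (Q u) + 1 / real (Suc n)"
    have T: "0 < ?T n" "Q u \<le> (?T n)\<^sup>2" for n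
      using Q_nonneg[of u] by (auto simp: power2_sum intro!: add_nonneg_pos)
    have "(\<lambda>n. ?T n) \<longlonglongrightarrow> sqrt (Q u) + 0"
      by (intro tendsto_add tendsto_const LIMSEQ_Suc[OF lim_1_over_n])
    then have "(\<lambda>n. C * ?T n powr (q - 2) * ?S) \<longlonglongrightarrow> C * sqrt (Q u) powr (q - 2) * ?S"
      using assms T(1) by (intro tendsto_intros tendsto_powr') (auto simp: less_imp_le)
    then show "?X \<le> C * sqrt (Q u) powr (q - 2) * ?S"
      by (rule LIMSEQ_le_const) (use *[OF u T(2) T(1)] in auto)
  qed
qed

text \<open>The inequality is linear in K, so the infimum of the admissible constants is again
  admissible; \<open>Gagliardo_Nirenberg\<close> makes the set nonempty. A vanishing factor of K
  cannot be divided by and is treated separately.\<close>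

lemma GN_const_inequality:
  fixes q :: real
  assumes "2 < q" "u \<in> H1"
  shows "(\<integral>x. \<bar>u x\<bar> powr q \<partial>lborel) \<le> GN_const q * sqrt (Q u) powr (q - 2) * (\<integral>x. (u x)\<^sup>2 \<partial>lborel)"
proof -
  let ?A = "{K. K > 0 \<and> (\<forall>u\<in>H1.
      (\<integral>x. \<bar>u x\<bar> powr q \<partial>lborel) \<le> K * (sqrt (Q u)) powr (q - 2) * (\<integral>x. (u x)\<^sup>2 \<partial>lborel))}"
  let ?X = "\<integral>x. \<bar>u x\<bar> powr q \<partial>lborel" and ?Y = "sqrt (Q u) powr (q - 2) * (\<integral>x. (u x)\<^sup>2 \<partial>lborel)"
  obtain C where "0 < C" "\<And>u. u \<in> H1 \<Longrightarrow>
    (\<integral>x. \<bar>u x\<bar> powr q \<partial>lborel) \<le> C * sqrt (Q u) powr (q - 2) * (\<integral>x. (u x)\<^sup>2 \<partial>lborel)"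
    using Gagliardo_Nirenberg[OF assms(1)] by blast
  then have C: "C \<in> ?A" by blast
  have A: "?X \<le> K * ?Y" if "K \<in> ?A" for K using that assms(2) by (auto simp: mult.assoc)
  have Y: "0 \<le> ?Y" by simp
  have "?X \<le> Inf ?A * ?Y"
  proof (cases "?Y = 0")
    case True
    then show ?thesis using A[OF C] by (simp only: mult_zero_right)
  next
    case False
    then have Y: "0 < ?Y" using Y by linarith
    have "?X / ?Y \<le> Inf ?A"
      using C A Y by (intro cInf_greatest) (auto simp: pos_divide_le_eq)
    then show ?thesis using Y by (simp only: pos_divide_le_eq)
  qed
  then show ?thesis by (simp add: GN_const_def mult.assoc)
qed

section \<open>Lower semicontinuity and compactness\<close>

lemma l2norm_triangle_minus:
  assumes "square_integrable f" "square_integrable g"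
  shows "l2norm (\<lambda>x. f x - g x) \<le> l2norm f + l2norm g"
  using l2norm_triangle[OF assms(1) square_integrable_minus[OF assms(2)]] by (simp add: l2norm_minus)

lemma l2norm_parallelogram:
  assumes f: "square_integrable f" and g: "square_integrable g"
  shows "(l2norm (\<lambda>x. f x - g x))\<^sup>2 + (l2norm (\<lambda>x. f x + g x))\<^sup>2 = 2 * (l2norm f)\<^sup>2 + 2 * (l2norm g)\<^sup>2"
  using l2norm_add_sq[OF f g] l2norm_add_sq[OF f square_integrable_minus[OF g]]
  by (simp add: l2norm_minus)

lemma l2_tendsto_integral_mult:
  fixes f :: "nat \<Rightarrow> 'a::euclidean_space \<Rightarrow> real"
  assumes f: "\<And>n. square_integrable (f n)" and g: "square_integrable g" and h: "square_integrable h"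
    and lim: "(\<lambda>n. l2norm (\<lambda>x. f n x - g x)) \<longlonglongrightarrow> 0"
  shows "(\<lambda>n. \<integral>x. f n x * h x \<partial>lborel) \<longlonglongrightarrow> (\<integral>x. g x * h x \<partial>lborel)"
proof (rule LIM_zero_cancel, rule Lim_null_comparison)
  show "\<forall>\<^sub>F n in sequentially. norm ((\<integral>x. f n x * h x \<partial>lborel) - (\<integral>x. g x * h x \<partial>lborel))
      \<le> l2norm (\<lambda>x. f n x - g x) * l2norm h"
  proof (intro always_eventually allI)
    fix n
    have "(\<integral>x. f n x * h x \<partial>lborel) - (\<integral>x. g x * h x \<partial>lborel) = (\<integral>x. (f n x - g x) * h x \<partial>lborel)"
      using square_integrable_mult(1)[OF f h] square_integrable_mult(1)[OF g h]
      by (simp add: left_diff_distrib)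
    then show "norm ((\<integral>x. f n x * h x \<partial>lborel) - (\<integral>x. g x * h x \<partial>lborel)) \<le> l2norm (\<lambda>x. f n x - g x) * l2norm h"
      using square_integrable_mult(2)[OF square_integrable_diff[OF f g] h] by simp
  qed
  show "(\<lambda>n. l2norm (\<lambda>x. f n x - g x) * l2norm h) \<longlonglongrightarrow> 0"
    using tendsto_mult_right[OF lim, of "l2norm h"] by simp
qed

text \<open>Both sides of the weak identity are L^2 pairings with a fixed function, hence continuous
  under norm convergence of function and gradient.\<close>

lemma l2_gradient_closed:
  assumes w: "\<And>n. square_integrable (w n)" "\<And>n. l2_gradient (w n) (h n)"
    and u: "square_integrable u" "(\<lambda>n. l2norm (\<lambda>x. w n x - u x)) \<longlonglongrightarrow> 0"
    and g: "square_integrable g" "(\<lambda>n. l2norm (\<lambda>x. h n x - g x)) \<longlonglongrightarrow> 0"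
  shows "l2_gradient u g"
  unfolding l2_gradient_def is_weak_grad_def
proof (intro conjI allI impI g(1))
  fix \<phi> D i assume t: "test_fun \<phi> D"
  have h: "square_integrable (h n)" for n using w(2)[of n] by (simp add: l2_gradient_def)
  have comp: "(\<lambda>n. l2norm (\<lambda>x. h n x $ i - g x $ i)) \<longlonglongrightarrow> 0"
  proof (rule Lim_null_comparison[OF _ g(2)], intro always_eventually allI)
    fix n
    have "norm (h n x $ i - g x $ i) \<le> norm (h n x - g x)" for x
      using component_le_norm_cart[of "h n x - g x" i] by simp
    then show "norm (l2norm (\<lambda>x. h n x $ i - g x $ i)) \<le> l2norm (\<lambda>x. h n x - g x)"
      using square_integrable_dominated(2)[OF square_integrable_diff[OF h g(1)],
        OF square_integrable_measurable[OF square_integrable_diff[OF square_integrable_nth[OF h] square_integrable_nth[OF g(1)]]], of n i]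
      by simp
  qed
  have 1: "(\<lambda>n. \<integral>x. w n x * D x $ i \<partial>lborel) \<longlonglongrightarrow> (\<integral>x. u x * D x $ i \<partial>lborel)"
    by (rule l2_tendsto_integral_mult[OF w(1) u(1) _ u(2)])
      (rule square_integrable_nth[OF test_fun_square_integrable(2)[OF t]])
  have 2: "(\<lambda>n. \<integral>x. h n x $ i * \<phi> x \<partial>lborel) \<longlonglongrightarrow> (\<integral>x. g x $ i * \<phi> x \<partial>lborel)"
    by (rule l2_tendsto_integral_mult[OF _ _ test_fun_square_integrable(1)[OF t] comp])
      (intro square_integrable_nth h g)+
  have "(\<lambda>n. \<integral>x. w n x * D x $ i \<partial>lborel) \<longlonglongrightarrow> - (\<integral>x. g x $ i * \<phi> x \<partial>lborel)"
    unfolding l2_gradient_eq[OF w(2) t] by (rule tendsto_minus[OF 2])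
  with 1 show "(\<integral>x. u x * D x $ i \<partial>lborel) = - (\<integral>x. g x $ i * \<phi> x \<partial>lborel)"
    by (rule LIMSEQ_unique)
qed

text \<open>Among all pairs of a function within distance \<open>1 / (n + 1)\<close> of \<open>u\<close> and its gradient, take one
  with almost minimal gradient. By the parallelogram law these gradients form a Cauchy sequence, which
  replaces the extraction of a weakly convergent subsequence.\<close>

lemma H1_lower_semicontinuous:
  assumes un: "\<And>n. un n \<in> H1" and u: "square_integrable u"
    and lim: "(\<lambda>n. l2norm (\<lambda>x. un n x - u x)) \<longlonglongrightarrow> 0" and Qlim: "(\<lambda>n. Q (un n)) \<longlonglongrightarrow> q"
  shows "u \<in> H1" "Q u \<le> q"
proof -
  define X where "X n = {(w, g). square_integrable w \<and> l2_gradient w g \<and> l2norm (\<lambda>x. w x - u x) \<le> 1 / real (Suc n)}" for n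
  define V where "V n = (\<lambda>p. (l2norm (snd p))\<^sup>2) ` X n" for n
  define d where "d n = Inf (V n)" for n
  have bdd: "bdd_below (V n)" for n by (intro bdd_belowI[of _ 0]) (auto simp: V_def)
  have near: "\<exists>v\<in>V n. v \<le> q + e" if "0 < e" for n e
  proof -
    obtain N1 where N1: "\<And>k. N1 \<le> k \<Longrightarrow> l2norm (\<lambda>x. un k x - u x) < 1 / real (Suc n)"
      by (rule LIMSEQ_lessD[OF lim]) (auto simp del: of_nat_Suc)
    obtain N2 where N2: "\<And>k. N2 \<le> k \<Longrightarrow> Q (un k) < q + e"
      by (rule LIMSEQ_lessD[OF Qlim, of "q + e"]) (use \<open>0 < e\<close> in auto)
    let ?k = "max N1 N2"
    have "(un ?k, weak_grad (un ?k)) \<in> X n"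
      using N1[of ?k] l2_gradient_weak_grad[OF un] H1_square_integrable[OF un]
      by (auto simp: X_def simp del: of_nat_Suc)
    then have "Q (un ?k) \<in> V n" unfolding V_def Q_eq_weak_grad by force
    then show ?thesis using N2[of ?k] by (intro bexI[of _ "Q (un ?k)"]) auto
  qed
  have ne: "V n \<noteq> {}" for n using near[of 1 n] by auto
  have dq: "d n \<le> q" for n
  proof (rule field_le_epsilon)
    fix e :: real assume "0 < e"
    then show "d n \<le> q + e"
      using near[of e n] cInf_lower2[OF _ _ bdd[of n]] by (auto simp: d_def)
  qed
  have X_anti: "X m \<subseteq> X n" if "n \<le> m" for n m
  proof -
    have "1 / real (Suc m) \<le> 1 / real (Suc n)" using that by (simp add: frac_le)
    then show ?thesis by (auto simp: X_def)
  qed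
  \<comment> \<open>The sets \<open>X n\<close> shrink, so their infima increase; bounded by q, they
    have a limit.\<close>
  then have d_mono: "d n \<le> d m" if "n \<le> m" for n m
    unfolding d_def using X_anti[OF that] by (intro cInf_superset_mono ne bdd) (auto simp: V_def image_mono)
  obtain L where L: "d \<longlonglongrightarrow> L" and dL: "\<And>n. d n \<le> L"
    using incseq_convergent[of d q] d_mono dq by (auto simp: incseq_def)
  have "\<exists>p\<in>X n. (l2norm (snd p))\<^sup>2 < d n + 1 / real (Suc n)" for n
    using cInf_lessD[OF ne, of n "d n + 1 / real (Suc n)"] by (auto simp: d_def V_def simp del: of_nat_Suc)
  then obtain p where p: "\<And>n. p n \<in> X n" "\<And>n. (l2norm (snd (p n)))\<^sup>2 < d n + 1 / real (Suc n)" by metis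
  define w where "w n = fst (p n)" for n
  define h where "h n = snd (p n)" for n
  have w: "square_integrable (w n)" "l2_gradient (w n) (h n)" "l2norm (\<lambda>x. w n x - u x) \<le> 1 / real (Suc n)" for n
    using p(1)[of n] by (auto simp: X_def w_def h_def split: prod.splits)
  have h: "square_integrable (h n)" "(l2norm (h n))\<^sup>2 < d n + 1 / real (Suc n)" for n
    using w(2)[of n] p(2)[of n] by (auto simp: l2_gradient_def h_def)
  have est: "(l2norm (\<lambda>x. h n x - h m x))\<^sup>2 \<le> 2 * (L - d n) + 4 / real (Suc n)" if "n \<le> m" for n m
  proof -
    \<comment> \<open>\<open>X n\<close> is convex: the midpoint belongs to it, so its gradient has
      squared norm at least \<open>d n\<close>. This is the lower bound that the parallelogram law
      needs.\<close>
    let ?w = "\<lambda>x. (1/2) * w n x + (1/2) * w m x" and ?h = "\<lambda>x. (1/2) *\<^sub>R h n x + (1/2) *\<^sub>R h m x"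
    have le: "1 / real (Suc m) \<le> 1 / real (Suc n)" using that by (simp add: frac_le)
    have "l2norm (\<lambda>x. ?w x - u x) = l2norm (\<lambda>x. (1/2) * (w n x - u x) + (1/2) * (w m x - u x))"
      by (simp add: algebra_simps)
    also have "\<dots> \<le> l2norm (\<lambda>x. (1/2) * (w n x - u x)) + l2norm (\<lambda>x. (1/2) * (w m x - u x))"
      by (intro l2norm_triangle square_integrable_cmult square_integrable_diff w u)
    also have "\<dots> \<le> 1 / real (Suc n)"
      unfolding l2norm_cmult using w(3)[of n] w(3)[of m] le by simp
    finally have "l2norm (\<lambda>x. ?w x - u x) \<le> 1 / real (Suc n)" .
    moreover have "square_integrable ?w" by (intro square_integrable_add square_integrable_cmult w)
    ultimately have "(?w, ?h) \<in> X n"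
      using l2_gradient_lincomb[OF w(1,2) w(1,2), of "1/2" n "1/2" m] by (simp add: X_def)
    then have "(l2norm ?h)\<^sup>2 \<in> V n" by (force simp: V_def)
    then have "d n \<le> (l2norm ?h)\<^sup>2" unfolding d_def by (rule cInf_lower[OF _ bdd])
    also have "l2norm ?h = 1/2 * l2norm (\<lambda>x. h n x + h m x)"
      by (simp add: scaleR_add_right[symmetric] l2norm_scaleR del: scaleR_add_right)
    finally have "4 * d n \<le> (l2norm (\<lambda>x. h n x + h m x))\<^sup>2" by (simp add: power_divide)
    then show ?thesis
      using l2norm_parallelogram[OF h(1)[of n] h(1)[of m]] h(2)[of n] h(2)[of m] dL[of m] le by argo
  qed
  have "\<exists>N. \<forall>m\<ge>N. \<forall>n\<ge>N. l2norm (\<lambda>x. h m x - h n x) < e" if "0 < e" for e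
  proof -
    have "(\<lambda>n. 2 * (L - d n) + 4 * (1 / real (Suc n))) \<longlonglongrightarrow> 2 * (L - L) + 4 * 0"
      by (intro tendsto_intros L LIMSEQ_Suc[OF lim_1_over_n])
    then obtain N where N: "\<And>n. N \<le> n \<Longrightarrow> 2 * (L - d n) + 4 * (1 / real (Suc n)) < e\<^sup>2"
      by (rule LIMSEQ_lessD[where e="e\<^sup>2"]) (use \<open>0 < e\<close> in auto)
    have ord: "l2norm (\<lambda>x. h n x - h m x) < e" if "N \<le> n" "n \<le> m" for n m
    proof -
      have "(l2norm (\<lambda>x. h n x - h m x))\<^sup>2 < e\<^sup>2" using est[OF that(2)] N[OF that(1)] by simp
      then show ?thesis using \<open>0 < e\<close> by (simp add: power2_less_imp_less)
    qed
    have "l2norm (\<lambda>x. h m x - h n x) < e" if "N \<le> m" "N \<le> n" for m n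
      using ord[of m n] ord[of n m] that l2norm_diff_commute[of "h m" "h n"] by (cases "m \<le> n") auto
    then show ?thesis by blast
  qed
  from l2_complete[OF h(1) this] obtain g where g: "square_integrable g" "(\<lambda>n. l2norm (\<lambda>x. h n x - g x)) \<longlonglongrightarrow> 0"
    by blast
  have "(\<lambda>n. l2norm (\<lambda>x. w n x - u x)) \<longlonglongrightarrow> 0"
    by (rule Lim_null_comparison[OF _ LIMSEQ_Suc[OF lim_1_over_n]])
      (use w(3) in \<open>auto simp del: of_nat_Suc\<close>)
  from l2_gradient_closed[OF w(1,2) u this g] have ug: "l2_gradient u g" .
  then show "u \<in> H1" using u by (auto simp: H1_iff)
  have q0: "0 \<le> q" using Qlim by (rule LIMSEQ_le_const) (auto simp: Q_nonneg)
  have "l2norm g \<le> sqrt q"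
  proof (rule LIMSEQ_le_const)
    have "(\<lambda>n. sqrt (q + 1 / real (Suc n)) + l2norm (\<lambda>x. h n x - g x)) \<longlonglongrightarrow> sqrt (q + 0) + 0"
      by (intro tendsto_intros g LIMSEQ_Suc[OF lim_1_over_n])
    then show "(\<lambda>n. sqrt (q + 1 / real (Suc n)) + l2norm (\<lambda>x. h n x - g x)) \<longlonglongrightarrow> sqrt q" by simp
    have "l2norm g \<le> sqrt (q + 1 / real (Suc n)) + l2norm (\<lambda>x. h n x - g x)" for n
    proof -
      have "l2norm (h n) \<le> sqrt (q + 1 / real (Suc n))"
        using h(2)[of n] dq[of n] by (intro real_le_rsqrt) linarith
      then show ?thesis
        using l2norm_triangle_sub[OF g(1) h(1)[of n]] l2norm_diff_commute[of g "h n"] by linarith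
    qed
    then show "\<exists>N. \<forall>n\<ge>N. l2norm g \<le> sqrt (q + 1 / real (Suc n)) + l2norm (\<lambda>x. h n x - g x)" by blast
  qed
  then have "(l2norm g)\<^sup>2 \<le> (sqrt q)\<^sup>2" by (intro power_mono) auto
  then show "Q u \<le> q" using q0 by (simp add: Q_eq[OF u ug])
qed

text \<open>Bolzano--Weierstrass with Cantor's diagonal. It serves for the values at countably many
  points and again for the energies of a minimizing sequence.\<close>

lemma bounded_sequences_common_subseq:
  fixes c :: "nat \<Rightarrow> nat \<Rightarrow> real"
  assumes bd: "\<And>k n. \<bar>c k n\<bar> \<le> b k"
  obtains r :: "nat \<Rightarrow> nat" where "strict_mono r" "\<And>k. convergent (\<lambda>n. c k (r n))"
proof -
  interpret subseqs "\<lambda>k s. convergent (\<lambda>n. c k (s n))"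
  proof
    fix k and s :: "nat \<Rightarrow> nat" assume "strict_mono s"
    have "bounded (range (\<lambda>n. c k (s n)))" using bd by (auto simp: bounded_iff)
    from bounded_imp_convergent_subsequence[OF this]
    show "\<exists>r'. strict_mono r' \<and> convergent (\<lambda>n. c k ((s \<circ> r') n))"
      by (auto simp: o_def convergent_def)
  qed
  have "convergent (\<lambda>n. c k (diagseq n))" for k
  proof -
    have "convergent (\<lambda>n. c k ((diagseq \<circ> (+) (Suc k)) n))"
    proof (rule diagseq_holds)
      fix r s :: "nat \<Rightarrow> nat" and n
      assume "strict_mono r" "convergent (\<lambda>m. c n (s m))"
      then show "convergent (\<lambda>m. c n ((s \<circ> r) m))"
        using convergent_subseq_convergent[of "\<lambda>m. c n (s m)" r] by (simp add: o_def)
    qed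
    then have "convergent (\<lambda>n. c k (diagseq (n + Suc k)))" by (simp add: o_def add.commute)
    then show ?thesis by (simp only: convergent_ignore_initial_segment[of "\<lambda>n. c k (diagseq n)"])
  qed
  with subseq_diagseq show thesis by (rule that)
qed

text \<open>Closeness to u, a Lipschitz bound and a uniform bound, all depending on u only through T
  and its norm: the input of an Arzela--Ascoli argument at fixed r.\<close>

lemma mollify_shift_Lipschitz:
  assumes u: "shift_Lipschitz T u" and "0 < r"
  shows "l2norm (\<lambda>x. mollify r u x - u x) \<le> r * T"
    and "\<bar>mollify r u x - mollify r u y\<bar> \<le> norm (x - y) * T * l2norm (\<lambda>z. bump r z / bump_mass r)"
    and "\<bar>mollify r u x\<bar> \<le> l2norm u * l2norm (\<lambda>z. bump r z / bump_mass r)"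
proof -
  have sq: "square_integrable u" and inc: "\<And>h. l2norm (\<lambda>x. u (x + h) - u x) \<le> norm h * T"
    using u by (auto simp: shift_Lipschitz_def)
  have T: "0 \<le> T"
  proof -
    have "0 \<le> norm (axis 1 1 :: pt) * T" by (rule order.trans[OF l2norm_nonneg inc])
    then show ?thesis by (simp add: norm_axis_1)
  qed
  note [measurable] = square_integrable_measurable[OF sq]
  let ?K = "l2norm (\<lambda>z. bump r z / bump_mass r)"
  have k: "square_integrable (\<lambda>z. bump r (z - x) / bump_mass r)" "l2norm (\<lambda>z. bump r (z - x) / bump_mass r) = ?K" for x
    using square_integrable_bump[of r x "bump_mass r"] \<open>0 < r\<close>
      l2norm_shift[OF square_integrable_bump[of r 0 "bump_mass r"], of "- x"] by auto
  have bd: "\<bar>mollify r v x\<bar> \<le> l2norm v * ?K" if v: "square_integrable v" for v x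
    unfolding mollify_eq[OF square_integrable_measurable[OF v] \<open>0 < r\<close>]
    using square_integrable_mult(2)[OF v k(1)[of x]] by (simp only: k(2))
  show "\<bar>mollify r u x\<bar> \<le> l2norm u * ?K" by (rule bd[OF sq])
  have "mollify r (\<lambda>z. u (z + (x - y)) - u z) y = mollify r u x - mollify r u y"
    using integrable_mollifier[OF sq \<open>0 < r\<close>, of x] integrable_mollifier[OF sq \<open>0 < r\<close>, of y]
    by (simp add: mollify_def algebra_simps)
  moreover have "\<bar>mollify r (\<lambda>z. u (z + (x - y)) - u z) y\<bar> \<le> l2norm (\<lambda>z. u (z + (x - y)) - u z) * ?K"
    by (intro bd square_integrable_diff square_integrable_shift sq)
  moreover have "\<dots> \<le> norm (x - y) * T * ?K"
    by (intro mult_right_mono inc) simp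
  ultimately show "\<bar>mollify r u x - mollify r u y\<bar> \<le> norm (x - y) * T * ?K" by simp
  show "l2norm (\<lambda>x. mollify r u x - u x) \<le> r * T"
  proof (rule l2norm_mollify_diff_le[OF sq \<open>0 < r\<close>])
    show "l2norm (\<lambda>x. u (x + y) - u x) \<le> r * T" if "norm y < r" for y
      using inc[of y] mult_right_mono[of "norm y" r T] that T by simp
  qed (use \<open>0 < r\<close> T in simp)
qed

lemma square_integrable_indicator_mult:
  fixes f :: "'a::euclidean_space \<Rightarrow> real"
  assumes f: "square_integrable f" and [measurable]: "A \<in> sets borel"
  shows "square_integrable (\<lambda>x. indicator A x * f x)" "l2norm (\<lambda>x. indicator A x * f x) \<le> l2norm f"
proof -
  note [measurable] = square_integrable_measurable[OF f]
  show "square_integrable (\<lambda>x. indicator A x * f x)" "l2norm (\<lambda>x. indicator A x * f x) \<le> l2norm f"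
    by (rule square_integrable_dominated[OF f]; simp add: indicator_def)+
qed

text \<open>Outside the ball of radius e^K - 1 the weight ln (1 + |x|) is at least K, so a bounded
  logarithmic moment prevents mass from escaping to infinity.\<close>

lemma l2norm_tail_le:
  fixes u :: "pt \<Rightarrow> real"
  assumes u: "square_integrable u" and int: "integrable lborel (\<lambda>x. ln (1 + norm x) * (u x)\<^sup>2)"
    and M: "(\<integral>x. ln (1 + norm x) * (u x)\<^sup>2 \<partial>lborel) \<le> M" and "0 < K"
  shows "(l2norm (\<lambda>x. indicator (- cball 0 (exp K - 1)) x * u x))\<^sup>2 \<le> M / K"
proof -
  let ?J = "indicator (- cball 0 (exp K - 1)) :: pt \<Rightarrow> real"
  have le: "(?J x * u x)\<^sup>2 \<le> ln (1 + norm x) * (u x)\<^sup>2 / K" for x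
  proof (cases "x \<in> cball 0 (exp K - 1)")
    case True
    then show ?thesis using \<open>0 < K\<close> by simp
  next
    case False
    then have "exp K \<le> 1 + norm x" by simp
    then have "K \<le> ln (1 + norm x)" using ln_mono[of "exp K" "1 + norm x"] by simp
    then have "1 \<le> ln (1 + norm x) / K" using \<open>0 < K\<close> by simp
    then have "1 * (u x)\<^sup>2 \<le> ln (1 + norm x) / K * (u x)\<^sup>2" by (intro mult_right_mono) auto
    then show ?thesis using False by simp
  qed
  have "(l2norm (\<lambda>x. ?J x * u x))\<^sup>2 = (\<integral>x. (?J x * u x)\<^sup>2 \<partial>lborel)"
    by (simp add: l2norm_sq_real)
  also have "\<dots> \<le> (\<integral>x. ln (1 + norm x) * (u x)\<^sup>2 / K \<partial>lborel)"
    using square_integrable_integrable[OF square_integrable_indicator_mult(1)[OF u, of "- cball 0 (exp K - 1)"]] int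
    by (intro integral_mono le) (auto simp: real_norm_def)
  also have "\<dots> \<le> M / K" using M \<open>0 < K\<close> by (simp add: divide_right_mono)
  finally show ?thesis .
qed

text \<open>Mollified at a fixed scale the sequence is equi-Lipschitz and bounded, so convergence on
  a countable dense set gives convergence everywhere and, by domination, in L^2 of each ball. The
  mollification error and the tails are small uniformly in n.\<close>

lemma Rellich_compactness:
  fixes un :: "nat \<Rightarrow> pt \<Rightarrow> real"
  assumes un: "\<And>n. shift_Lipschitz M (un n)" and bd: "\<And>n. l2norm (un n) \<le> M"
    and int: "\<And>n. integrable lborel (\<lambda>x. ln (1 + norm x) * (un n x)\<^sup>2)"
    and tail: "\<And>n. (\<integral>x. ln (1 + norm x) * (un n x)\<^sup>2 \<partial>lborel) \<le> M"
  obtains r u where "strict_mono (r :: nat \<Rightarrow> nat)" "square_integrable u"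
    "(\<lambda>n. l2norm (\<lambda>x. un (r n) x - u x)) \<longlonglongrightarrow> 0"
proof -
  have sq: "square_integrable (un n)" for n using un[of n] by (simp add: shift_Lipschitz_def)
  have M: "0 \<le> M" using bd[of 0] l2norm_nonneg[of "un 0"] by linarith
  obtain D :: "pt set" where D: "countable D" "\<And>X. open X \<Longrightarrow> X \<noteq> {} \<Longrightarrow> \<exists>d\<in>D. d \<in> X"
    using countable_dense_exists by blast
  have Dne: "D \<noteq> {}" using D(2)[of UNIV] by auto
  define \<rho> where "\<rho> j = 1 / real (Suc j)" for j
  have \<rho>: "0 < \<rho> j" for j by (simp add: \<rho>_def)
  define K where "K j = l2norm (\<lambda>z. bump (\<rho> j) z / bump_mass (\<rho> j))" for j
  have K: "0 \<le> K j" for j by (simp add: K_def)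
  define a where "a j n x = mollify (\<rho> j) (un n) x" for j n x
  have a: "l2norm (\<lambda>x. a j n x - un n x) \<le> \<rho> j * M" "\<bar>a j n x - a j n y\<bar> \<le> norm (x - y) * M * K j"
    "\<bar>a j n x\<bar> \<le> M * K j" "square_integrable (a j n)" for j n x y
  proof -
    show "\<bar>a j n x\<bar> \<le> M * K j"
      using mollify_shift_Lipschitz(3)[OF un \<rho>, of j n x] mult_right_mono[OF bd[of n] K[of j]]
      by (simp add: a_def K_def)
  qed (use mollify_shift_Lipschitz[OF un \<rho>] square_integrable_mollify(1)[OF sq \<rho>] in \<open>auto simp: a_def[abs_def] K_def\<close>)
  \<comment> \<open>One subsequence for all pairs of a scale and a dense point, numbered by
    \<open>prod_decode\<close>.\<close>
  obtain r where r: "strict_mono (r :: nat \<Rightarrow> nat)"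
    and conv: "\<And>k. convergent (\<lambda>n. a (fst (prod_decode k)) (r n) (from_nat_into D (snd (prod_decode k))))"
    using bounded_sequences_common_subseq[of "\<lambda>k n. a (fst (prod_decode k)) n (from_nat_into D (snd (prod_decode k)))"
      "\<lambda>k. M * K (fst (prod_decode k))"] a(3) by metis
  have convD: "convergent (\<lambda>n. a j (r n) d)" if "d \<in> D" for j d
    using conv[of "prod_encode (j, to_nat_on D d)"] that D(1) by simp
  have convA: "convergent (\<lambda>n. a j (r n) x)" for j x
  proof -
    have "Cauchy (\<lambda>n. a j (r n) x)"
    proof (rule CauchyI)
      fix e :: real assume e: "0 < e"
      \<comment> \<open>A dense point within this distance changes each \<open>a j n\<close> by at
        most e / 4; the + 1 covers a zero Lipschitz constant.\<close>
      define \<delta> where "\<delta> = e / (4 * (M * K j + 1))"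
      have MK: "0 \<le> M * K j" using M K by simp
      have \<delta>: "0 < \<delta>" using e MK by (simp add: \<delta>_def)
      obtain d where d: "d \<in> D" "d \<in> ball x \<delta>" using D(2)[of "ball x \<delta>"] \<delta> by auto
      have "norm (x - d) * (M * K j) \<le> \<delta> * (M * K j + 1)"
        using d(2) \<delta> MK by (intro mult_mono) (auto simp: dist_norm)
      also have "\<delta> * (M * K j + 1) = e / 4"
      proof -
        have "e / (4 * c) * c = e / 4" if "0 < c" for c using that by simp
        from this[of "M * K j + 1"] show ?thesis using MK unfolding \<delta>_def by linarith
      qed
      finally have near: "\<bar>a j n x - a j n d\<bar> \<le> e / 4" for n
        using a(2)[of j n x d] by (simp add: mult.assoc)
      obtain N where N: "\<And>m n. N \<le> m \<Longrightarrow> N \<le> n \<Longrightarrow> norm (a j (r m) d - a j (r n) d) < e / 4"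
        using CauchyD[OF convergent_Cauchy[OF convD[OF d(1)]], of "e/4" j] e by auto
      have "norm (a j (r m) x - a j (r n) x) < e" if "N \<le> m" "N \<le> n" for m n
        using N[OF that] near[of "r m"] near[of "r n"] e unfolding real_norm_def by linarith
      then show "\<exists>M. \<forall>m\<ge>M. \<forall>n\<ge>M. norm (a j (r m) x - a j (r n) x) < e" by blast
    qed
    then show ?thesis by (simp add: Cauchy_convergent_iff)
  qed
  define al where "al j x = lim (\<lambda>n. a j (r n) x)" for j x
  have al: "(\<lambda>n. a j (r n) x) \<longlonglongrightarrow> al j x" for j x
    using convA by (simp add: al_def convergent_LIMSEQ_iff)
  note [measurable] = square_integrable_measurable[OF a(4)]
  have [measurable]: "al j \<in> borel_measurable borel" for j
    by (rule borel_measurable_LIMSEQ_real[OF al]) simp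
  have loc: "(\<lambda>n. l2norm (\<lambda>x. indicator (cball 0 t) x * a j (r n) x - indicator (cball 0 t) x * al j x)) \<longlonglongrightarrow> 0"
    "square_integrable (\<lambda>x. indicator (cball 0 t) x * al j x)" for j t
  proof -
    have w: "square_integrable (\<lambda>x::pt. M * K j * indicator (cball 0 t) x :: real)"
      using M K by (intro square_integrable_bounded_support[where C="M * K j" and a="0::pt" and R=t]) (auto simp: indicator_def)
    have lim: "AE x in lborel. (\<lambda>n. indicator (cball 0 t) x * a j (r n) x) \<longlonglongrightarrow> indicator (cball 0 t) x * al j x"
      by (intro AE_I2 tendsto_intros al)
    have dom: "AE x in lborel. norm (indicator (cball 0 t) x * a j (r n) x) \<le> norm (M * K j * indicator (cball 0 t) x :: real)" for n
      using a(3) M K by (intro AE_I2) (auto simp: indicator_def)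
    have m: "(\<lambda>x. indicator (cball 0 t) x * f x :: real) \<in> borel_measurable borel"
      if "f \<in> borel_measurable borel" for f :: "pt \<Rightarrow> real"
      using that by (intro borel_measurable_times borel_measurable_indicator) auto
    have ma: "(\<lambda>x. indicator (cball 0 t) x * a j (r n) x) \<in> borel_measurable borel" for n
      by (rule m) simp
    have mal: "(\<lambda>x. indicator (cball 0 t) x * al j x) \<in> borel_measurable borel"
      by (rule m) simp
    show "(\<lambda>n. l2norm (\<lambda>x. indicator (cball 0 t) x * a j (r n) x - indicator (cball 0 t) x * al j x)) \<longlonglongrightarrow> 0"
      by (rule square_integrable_dominated_convergence(3)[OF w ma mal lim dom])
    show "square_integrable (\<lambda>x. indicator (cball 0 t) x * al j x)"
      by (rule square_integrable_dominated_convergence(1)[OF w ma mal lim dom])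
  qed
  have "\<exists>N. \<forall>m\<ge>N. \<forall>n\<ge>N. l2norm (\<lambda>x. un (r m) x - un (r n) x) < e" if "0 < e" for e
  proof -
    have "(\<lambda>j. \<rho> j * M) \<longlonglongrightarrow> 0 * M"
      unfolding \<rho>_def by (intro tendsto_intros LIMSEQ_Suc[OF lim_1_over_n])
    then obtain j0 where "\<And>j. j0 \<le> j \<Longrightarrow> \<rho> j * M < e / 8"
      by (rule LIMSEQ_lessD[where e="e/8"]) (use \<open>0 < e\<close> in auto)
    then obtain j where j: "\<rho> j * M < e / 8" by blast
    \<comment> \<open>Makes the tail norm at most e / 8; M + 1 keeps \<open>L\<close> positive when
      M = 0.\<close>
    define L where "L = (M + 1) / (e / 8)\<^sup>2"
    have L: "0 < L" "M / L \<le> (e / 8)\<^sup>2" using M \<open>0 < e\<close> by (auto simp: L_def field_simps)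
    define t where "t = exp L - 1"
    let ?I = "indicator (cball 0 t) :: pt \<Rightarrow> real" and ?J = "indicator (- cball 0 t) :: pt \<Rightarrow> real"
    obtain N where N: "\<And>n. N \<le> n \<Longrightarrow> l2norm (\<lambda>x. ?I x * a j (r n) x - ?I x * al j x) < e / 8"
      by (rule LIMSEQ_lessD[OF loc(1), where e="e/8"]) (use \<open>0 < e\<close> in auto)
    \<comment> \<open>\<open>v n\<close> collapses to \<open>un (r n)\<close> minus the cut-off
      limit \<open>al j\<close>, which does not depend on n. So differences of \<open>v\<close> are
      differences of the original functions, while each \<open>v n\<close> is a sum of three small
      terms.\<close>
    define v where "v n x = (?J x * un (r n) x) - (?I x * (a j (r n) x - un (r n) x)) + (?I x * a j (r n) x - ?I x * al j x)" for n x
    have v: "square_integrable (v n) \<and> l2norm (v n) < 3 * e / 8" if n: "N \<le> n" for n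
    proof -
      have 1: "l2norm (\<lambda>x. ?J x * un (r n) x) \<le> e / 8"
      proof (rule power2_le_imp_le)
        show "(l2norm (\<lambda>x. ?J x * un (r n) x))\<^sup>2 \<le> (e / 8)\<^sup>2"
          unfolding t_def by (rule order.trans[OF l2norm_tail_le[OF sq int tail L(1)] L(2)])
      qed (use \<open>0 < e\<close> in simp)
      have 2: "l2norm (\<lambda>x. ?I x * (a j (r n) x - un (r n) x)) \<le> e / 8"
        using square_integrable_indicator_mult(2)[OF square_integrable_diff[OF a(4) sq], of "cball 0 t" j "r n" "r n"]
          a(1)[of j "r n"] j by simp
      note s = square_integrable_indicator_mult(1)[OF sq, of "- cball 0 t" "r n"]
        square_integrable_indicator_mult(1)[OF square_integrable_diff[OF a(4) sq], of "cball 0 t" j "r n" "r n"]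
        square_integrable_diff[OF square_integrable_indicator_mult(1)[OF a(4), of "cball 0 t" j "r n"] loc(2)[of t j]]
      have s: "square_integrable (\<lambda>x. ?J x * un (r n) x)" "square_integrable (\<lambda>x. ?I x * (a j (r n) x - un (r n) x))"
        "square_integrable (\<lambda>x. ?I x * a j (r n) x - ?I x * al j x)" using s by auto
      show ?thesis
        using l2norm_triangle[OF square_integrable_diff[OF s(1,2)] s(3)] l2norm_triangle_minus[OF s(1,2)] 1 2 N[OF n]
          square_integrable_add[OF square_integrable_diff[OF s(1,2)] s(3)]
        by (auto simp: v_def[abs_def])
    qed
    have "l2norm (\<lambda>x. un (r m) x - un (r n) x) < e" if "N \<le> m" "N \<le> n" for m n
    proof -
      have "(\<lambda>x. un (r m) x - un (r n) x) = (\<lambda>x. v m x - v n x)"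
        by (auto simp: v_def indicator_def)
      then show ?thesis
        using l2norm_triangle_minus[of "v m" "v n"] v[OF that(1)] v[OF that(2)] \<open>0 < e\<close> by simp
    qed
    then show ?thesis by blast
  qed
  from l2_complete[of "\<lambda>n. un (r n)", OF sq this] obtain u
    where "square_integrable u" "(\<lambda>n. l2norm (\<lambda>x. un (r n) x - u x)) \<longlonglongrightarrow> 0" by blast
  with r show thesis by (rule that)
qed

section \<open>The logarithmic kernel\<close>

definition ln_pos :: "real \<Rightarrow> real" where "ln_pos d = max 0 (ln d)"

definition ln_neg :: "real \<Rightarrow> real" where "ln_neg d = max 0 (- ln d)"

lemma ln_pos_nonneg [simp]: "0 \<le> ln_pos d" and ln_neg_nonneg [simp]: "0 \<le> ln_neg d"
  by (auto simp: ln_pos_def ln_neg_def)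

lemma ln_eq_pos_neg: "ln d = ln_pos d - ln_neg d"
  by (auto simp: ln_pos_def ln_neg_def)

lemma borel_measurable_ln_pos [measurable]: "ln_pos \<in> borel_measurable borel"
  and borel_measurable_ln_neg [measurable]: "ln_neg \<in> borel_measurable borel"
  unfolding ln_pos_def[abs_def] ln_neg_def[abs_def] by measurable

text \<open>For r < 1, - ln r = 2 ln (1 / sqrt r) <= 2 / sqrt r. The crude power 1 / r is integrable
  near the origin of the plane.\<close>

lemma ln_neg_sq_le:
  assumes "0 < r"
  shows "(ln_neg r)\<^sup>2 \<le> 4 / r"
proof (cases "r < 1")
  case True
  have "- ln r / 2 = ln (1 / sqrt r)" using assms by (simp add: ln_div ln_sqrt)
  also have "\<dots> \<le> 1 / sqrt r - 1" using assms by (intro ln_le_minus_one) simp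
  also have "\<dots> \<le> 1 / sqrt r" by simp
  finally have le: "- ln r \<le> 2 / sqrt r" by simp
  have "ln_neg r = - ln r" using True assms by (simp add: ln_neg_def)
  then have "(ln_neg r)\<^sup>2 \<le> (2 / sqrt r)\<^sup>2"
    using le ln_neg_nonneg[of r] by (intro power_mono) auto
  then show ?thesis using assms by (simp add: power_divide)
next
  case False
  then show ?thesis using assms by (simp add: ln_neg_def)
qed

text \<open>On the shell between 2^(-k-1) and 2^(-k) the bound 4 / |z| is at most 8 * 2^k. At z = 0
  the convention ln 0 = 0 makes the left-hand side vanish.\<close>

lemma ln_neg_sq_le_dyadic_sum:
  "ennreal ((ln_neg (norm z))\<^sup>2) \<le> (\<Sum>k. ennreal (8 * 2 ^ k) * indicator (ball 0 ((1/2) ^ k)) z)" for z :: pt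
proof -
  let ?f = "\<lambda>k. ennreal (8 * 2 ^ k) * indicator (ball 0 ((1/2) ^ k)) z :: ennreal"
  consider "norm z = 0" | "1 \<le> norm z" | "0 < norm z" "norm z < 1"
    using norm_ge_zero[of z] by linarith
  then show ?thesis
  proof cases
    case 3
    have ex: "\<exists>j. (1/2) ^ j \<le> norm z"
      using real_arch_pow_inv[of "norm z" "1/2"] 3 less_imp_le by auto
    define j where "j = (LEAST j. (1/2) ^ j \<le> norm z)"
    have j: "(1/2) ^ j \<le> norm z" unfolding j_def by (rule LeastI_ex[OF ex])
    with 3 obtain k where k: "j = Suc k" by (cases j) auto
    have low: "norm z < (1/2) ^ k"
      using not_less_Least[of k "\<lambda>j. (1/2) ^ j \<le> norm z"] k by (simp add: j_def[symmetric])
    have "(ln_neg (norm z))\<^sup>2 \<le> 4 / norm z" using 3 by (intro ln_neg_sq_le)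
    also have "\<dots> \<le> 4 / (1/2) ^ Suc k" using j 3 by (intro divide_left_mono) (auto simp: k)
    also have "\<dots> = 8 * 2 ^ k" by (simp add: power_divide)
    finally have "ennreal ((ln_neg (norm z))\<^sup>2) \<le> ?f k"
      using low by (auto intro: ennreal_leI)
    also have "\<dots> \<le> (\<Sum>k. ?f k)" by (rule ennreal_le_suminf)
    finally show ?thesis .
  qed (auto simp: ln_neg_def)
qed

text \<open>The k-th ball has area pi 4^(-k), which beats the height 8 * 2^k; the sum is 16 pi. This
  is what makes the singular part of the kernel harmless.\<close>

lemma square_integrable_ln_neg: "square_integrable (\<lambda>z::pt. ln_neg (norm z))"
proof -
  have "(\<integral>\<^sup>+z. ennreal ((norm (ln_neg (norm (z::pt))))\<^sup>2) \<partial>lborel)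
      \<le> (\<integral>\<^sup>+z. (\<Sum>k. ennreal (8 * 2 ^ k) * indicator (ball (0::pt) ((1/2) ^ k)) z) \<partial>lborel)"
    by (intro nn_integral_mono) (simp add: ln_neg_sq_le_dyadic_sum)
  also have "\<dots> = (\<Sum>k. ennreal (8 * 2 ^ k) * emeasure lborel (ball (0::pt) ((1/2) ^ k)))"
  proof -
    have "(\<lambda>z. ennreal (8 * 2 ^ k) * indicator (ball (0::pt) ((1/2) ^ k)) z) \<in> borel_measurable lborel" for k
      by (intro borel_measurable_times_ennreal borel_measurable_const borel_measurable_indicator) auto
    then show ?thesis
      by (subst nn_integral_suminf) (auto simp: nn_integral_cmult_indicator)
  qed
  also have "\<dots> = (\<Sum>k. ennreal (8 * pi * (1/2) ^ k))"
  proof (intro suminf_cong)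
    fix k
    have "8 * 2 ^ k * (pi * ((1/2) ^ k)\<^sup>2) = 8 * pi * (2 ^ k * ((1/2) ^ k * (1/2) ^ k))"
      by (simp add: power2_eq_square)
    also have "(2::real) ^ k * ((1/2) ^ k * (1/2) ^ k) = (1/2) ^ k"
      by (simp add: power_mult_distrib[symmetric])
    finally show "ennreal (8 * 2 ^ k) * emeasure lborel (ball (0::pt) ((1/2) ^ k)) = ennreal (8 * pi * (1/2) ^ k)"
      by (simp add: emeasure_ball unit_ball_vol_2 ennreal_mult[symmetric])
  qed
  also have "\<dots> = ennreal (8 * pi * 2)"
    by (subst suminf_ennreal2) (auto simp: suminf_mult suminf_geometric)
  also have "\<dots> = ennreal ((sqrt (16 * pi))\<^sup>2)" by simp
  finally show ?thesis by (intro square_integrableI_nn(1)[where B="sqrt (16 * pi)"]) auto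
qed

definition ln_neg_norm :: real where "ln_neg_norm = l2norm (\<lambda>z::pt. ln_neg (norm z))"

lemma ln_neg_norm_nonneg [simp]: "0 \<le> ln_neg_norm"
  by (simp add: ln_neg_norm_def)

lemma nn_integral_ln_neg_le:
  fixes g :: "pt \<Rightarrow> real"
  assumes g: "square_integrable g"
  shows "(\<integral>\<^sup>+y. ennreal (ln_neg (dist x y) * \<bar>g y\<bar>) \<partial>lborel) \<le> ennreal (ln_neg_norm * l2norm g)"
proof -
  have s: "square_integrable (\<lambda>y. ln_neg (norm (y + - x)))"
    by (rule square_integrable_shift[OF square_integrable_ln_neg])
  have eq: "(\<lambda>y. ln_neg (dist x y) * \<bar>g y\<bar>) = (\<lambda>y. norm (ln_neg (norm (y + - x))) * norm (g y))"
    by (simp add: dist_norm norm_minus_commute)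
  have "(\<integral>y. ln_neg (dist x y) * \<bar>g y\<bar> \<partial>lborel) \<le> ln_neg_norm * l2norm g"
    unfolding eq ln_neg_norm_def
    using square_integrable_norm_mult(2)[OF s g] l2norm_shift[OF square_integrable_ln_neg, of "- x"] by simp
  moreover have "integrable lborel (\<lambda>y. ln_neg (dist x y) * \<bar>g y\<bar>)"
    unfolding eq by (rule square_integrable_norm_mult(1)[OF s g])
  ultimately show ?thesis by (simp add: nn_integral_eq_integral ennreal_leI)
qed

text \<open>The potential of an L^2 function under the negative kernel is uniformly bounded, so only
  the L^1 norm of the other factor enters. Both orders are recorded, for increments of the form in
  either argument.\<close>

lemma nn_integral_ln_neg_pair_le:
  fixes f g :: "pt \<Rightarrow> real"
  assumes f: "integrable lborel f" and g: "square_integrable g"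
  shows "(\<integral>\<^sup>+z. ennreal (ln_neg (dist (fst z) (snd z)) * \<bar>f (fst z)\<bar> * \<bar>g (snd z)\<bar>) \<partial>(lborel \<Otimes>\<^sub>M lborel))
      \<le> ennreal (ln_neg_norm * (\<integral>x. \<bar>f x\<bar> \<partial>lborel) * l2norm g)" (is ?A)
    and "(\<integral>\<^sup>+z. ennreal (ln_neg (dist (fst z) (snd z)) * \<bar>g (fst z)\<bar> * \<bar>f (snd z)\<bar>) \<partial>(lborel \<Otimes>\<^sub>M lborel))
      \<le> ennreal (ln_neg_norm * (\<integral>x. \<bar>f x\<bar> \<partial>lborel) * l2norm g)" (is ?B)
proof -
  have [measurable]: "f \<in> borel_measurable borel" "g \<in> borel_measurable borel"
    using f square_integrable_measurable[OF g] by auto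
  have le: "(\<integral>\<^sup>+x. \<integral>\<^sup>+y. ennreal (ln_neg (dist x y) * \<bar>f x\<bar> * \<bar>g y\<bar>) \<partial>lborel \<partial>lborel)
      \<le> ennreal (ln_neg_norm * (\<integral>x. \<bar>f x\<bar> \<partial>lborel) * l2norm g)"
  proof -
    have "(\<integral>\<^sup>+x. \<integral>\<^sup>+y. ennreal (ln_neg (dist x y) * \<bar>f x\<bar> * \<bar>g y\<bar>) \<partial>lborel \<partial>lborel)
        = (\<integral>\<^sup>+x. ennreal \<bar>f x\<bar> * (\<integral>\<^sup>+y. ennreal (ln_neg (dist x y) * \<bar>g y\<bar>) \<partial>lborel) \<partial>lborel)"
      by (intro nn_integral_cong, subst nn_integral_cmult[symmetric])
        (auto simp: ennreal_mult[symmetric] mult_ac)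
    also have "\<dots> \<le> (\<integral>\<^sup>+x. ennreal \<bar>f x\<bar> * ennreal (ln_neg_norm * l2norm g) \<partial>lborel)"
      by (intro nn_integral_mono mult_left_mono nn_integral_ln_neg_le[OF g]) simp
    also have "\<dots> = ennreal (\<integral>x. \<bar>f x\<bar> \<partial>lborel) * ennreal (ln_neg_norm * l2norm g)"
      using f by (simp add: nn_integral_multc nn_integral_eq_integral)
    also have "\<dots> = ennreal (ln_neg_norm * (\<integral>x. \<bar>f x\<bar> \<partial>lborel) * l2norm g)"
      by (simp add: ennreal_mult[symmetric] mult_ac)
    finally show ?thesis .
  qed
  show ?A
    by (subst lborel.nn_integral_fst[symmetric]) (use le in auto)
  show ?B
    by (subst lborel_pair.nn_integral_snd[symmetric])
      (use le in \<open>auto simp: dist_commute mult_ac\<close>)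
qed

text \<open>|x| + |y| <= (1 + |x|) (1 + |y|): the logarithm separates the variables, so logarithmic
  moments control the positive kernel.\<close>

lemma ln_pos_dist_le: "ln_pos (dist x y) \<le> ln (1 + norm x) + ln (1 + norm y)" for x y :: "'a::real_normed_vector"
proof (cases "dist x y \<le> 1")
  case True
  then have "ln_pos (dist x y) = 0"
    by (cases "dist x y = 0") (auto simp: ln_pos_def)
  then show ?thesis by simp
next
  case False
  have "dist x y \<le> norm x + norm y" using norm_triangle_ineq4 by (simp add: dist_norm)
  also have "\<dots> \<le> (1 + norm x) * (1 + norm y)" by (simp add: algebra_simps)
  finally have "ln (dist x y) \<le> ln ((1 + norm x) * (1 + norm y))"
    using False by (subst ln_le_cancel_iff) (auto intro!: mult_pos_pos add_pos_nonneg)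
  also have "\<dots> = ln (1 + norm x) + ln (1 + norm y)"
    by (rule ln_mult_pos) (auto intro: add_pos_nonneg)
  finally show ?thesis by (simp add: ln_pos_def)
qed

text \<open>L^1 with its logarithmic weight controls the positive kernel, L^2 the negative one; on
  this class the bilinear form with kernel \<open>ln\<close> is finite.\<close>

definition log_admissible :: "(pt \<Rightarrow> real) \<Rightarrow> bool" where
  "log_admissible f \<longleftrightarrow> integrable lborel f \<and> integrable lborel (\<lambda>x. ln (1 + norm x) * f x) \<and> square_integrable f"

definition log_norm :: "(pt \<Rightarrow> real) \<Rightarrow> real" where
  "log_norm f = (\<integral>x. \<bar>f x\<bar> \<partial>lborel) + (\<integral>x. ln (1 + norm x) * \<bar>f x\<bar> \<partial>lborel) + l2norm f"

lemma log_norm_nonneg [simp]: "0 \<le> log_norm f"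
  by (auto simp: log_norm_def intro!: add_nonneg_nonneg Bochner_Integration.integral_nonneg)

lemma log_admissible_abs:
  assumes "log_admissible f"
  shows "integrable lborel (\<lambda>x. \<bar>f x\<bar>)" "integrable lborel (\<lambda>x. ln (1 + norm x) * \<bar>f x\<bar>)"
proof -
  show "integrable lborel (\<lambda>x. \<bar>f x\<bar>)" using assms by (auto simp: log_admissible_def)
  have "integrable lborel (\<lambda>x. ln (1 + norm x) * f x)" using assms by (auto simp: log_admissible_def)
  from integrable_abs[OF this] show "integrable lborel (\<lambda>x. ln (1 + norm x) * \<bar>f x\<bar>)" by (simp add: abs_mult)
qed

lemma nn_integral_ln_pos_pair_le:
  assumes f: "log_admissible f" and g: "log_admissible g"
  shows "(\<integral>\<^sup>+z. ennreal (ln_pos (dist (fst z) (snd z)) * \<bar>f (fst z)\<bar> * \<bar>g (snd z)\<bar>) \<partial>(lborel \<Otimes>\<^sub>M lborel))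
      \<le> ennreal ((\<integral>x. ln (1 + norm x) * \<bar>f x\<bar> \<partial>lborel) * (\<integral>x. \<bar>g x\<bar> \<partial>lborel)
        + (\<integral>x. \<bar>f x\<bar> \<partial>lborel) * (\<integral>x. ln (1 + norm x) * \<bar>g x\<bar> \<partial>lborel))"
proof -
  have [measurable]: "f \<in> borel_measurable borel" "g \<in> borel_measurable borel"
    using f g by (auto simp: log_admissible_def)
  let ?w = "\<lambda>x::pt. ln (1 + norm x)"
  note i = log_admissible_abs[OF f] log_admissible_abs[OF g]
  have "(\<integral>\<^sup>+z. ennreal (ln_pos (dist (fst z) (snd z)) * \<bar>f (fst z)\<bar> * \<bar>g (snd z)\<bar>) \<partial>(lborel \<Otimes>\<^sub>M lborel))
      \<le> (\<integral>\<^sup>+z. ennreal (?w (fst z) * \<bar>f (fst z)\<bar>) * ennreal \<bar>g (snd z)\<bar>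
        + ennreal \<bar>f (fst z)\<bar> * ennreal (?w (snd z) * \<bar>g (snd z)\<bar>) \<partial>(lborel \<Otimes>\<^sub>M lborel))"
  proof (intro nn_integral_mono)
    fix z :: "pt \<times> pt"
    have "ln_pos (dist (fst z) (snd z)) * \<bar>f (fst z)\<bar> * \<bar>g (snd z)\<bar>
        \<le> (?w (fst z) + ?w (snd z)) * \<bar>f (fst z)\<bar> * \<bar>g (snd z)\<bar>"
      by (intro mult_right_mono ln_pos_dist_le) auto
    then show "ennreal (ln_pos (dist (fst z) (snd z)) * \<bar>f (fst z)\<bar> * \<bar>g (snd z)\<bar>)
        \<le> ennreal (?w (fst z) * \<bar>f (fst z)\<bar>) * ennreal \<bar>g (snd z)\<bar>
        + ennreal \<bar>f (fst z)\<bar> * ennreal (?w (snd z) * \<bar>g (snd z)\<bar>)"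
      by (simp add: ennreal_mult[symmetric] ennreal_plus[symmetric] ennreal_leI algebra_simps del: ennreal_plus)
  qed
  also have "\<dots> = (\<integral>\<^sup>+x. ennreal (?w x * \<bar>f x\<bar>) \<partial>lborel) * (\<integral>\<^sup>+y. ennreal \<bar>g y\<bar> \<partial>lborel)
      + (\<integral>\<^sup>+x. ennreal \<bar>f x\<bar> \<partial>lborel) * (\<integral>\<^sup>+y. ennreal (?w y * \<bar>g y\<bar>) \<partial>lborel)"
    by (subst lborel.nn_integral_fst[symmetric])
      (auto simp: nn_integral_add nn_integral_cmult nn_integral_multc)
  also have "\<dots> = ennreal ((\<integral>x. ?w x * \<bar>f x\<bar> \<partial>lborel) * (\<integral>x. \<bar>g x\<bar> \<partial>lborel)
        + (\<integral>x. \<bar>f x\<bar> \<partial>lborel) * (\<integral>x. ?w x * \<bar>g x\<bar> \<partial>lborel))"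
    using i by (simp add: nn_integral_eq_integral ennreal_mult[symmetric] ennreal_plus[symmetric]
        Bochner_Integration.integral_nonneg del: ennreal_plus)
  finally show ?thesis .
qed

section \<open>Bilinear forms with a logarithmic kernel\<close>

definition kernel_form :: "(real \<Rightarrow> real) \<Rightarrow> (pt \<Rightarrow> real) \<Rightarrow> (pt \<Rightarrow> real) \<Rightarrow> real" where
  "kernel_form K f g = (\<integral>z. K (dist (fst z) (snd z)) * f (fst z) * g (snd z) \<partial>(lborel \<Otimes>\<^sub>M lborel))"

lemma W0_eq: "W0 u v = kernel_form ln (\<lambda>x. (u x)\<^sup>2 + (v x)\<^sup>2) (\<lambda>x. (u x)\<^sup>2 + (v x)\<^sup>2)"
  by (simp add: W0_def kernel_form_def)

lemma kernel_form_bound: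
  assumes [measurable]: "K \<in> borel_measurable borel" "f \<in> borel_measurable borel" "g \<in> borel_measurable borel"
    and le: "(\<integral>\<^sup>+z. ennreal (\<bar>K (dist (fst z) (snd z))\<bar> * \<bar>f (fst z)\<bar> * \<bar>g (snd z)\<bar>) \<partial>(lborel \<Otimes>\<^sub>M lborel)) \<le> ennreal c"
    and "0 \<le> c"
  shows "integrable (lborel \<Otimes>\<^sub>M lborel) (\<lambda>z. K (dist (fst z) (snd z)) * f (fst z) * g (snd z))"
    and "\<bar>kernel_form K f g\<bar> \<le> c"
proof -
  have le': "(\<integral>\<^sup>+z. ennreal (norm (K (dist (fst z) (snd z)) * f (fst z) * g (snd z))) \<partial>(lborel \<Otimes>\<^sub>M lborel)) \<le> ennreal c"
    using le by (simp add: abs_mult)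
  show i: "integrable (lborel \<Otimes>\<^sub>M lborel) (\<lambda>z. K (dist (fst z) (snd z)) * f (fst z) * g (snd z))"
    by (rule integrableI_bounded) (measurable, rule le_less_trans[OF le'], simp)
  have "ennreal (norm (kernel_form K f g)) \<le> ennreal c"
    unfolding kernel_form_def by (rule order.trans[OF integral_norm_bound_ennreal[OF i] le'])
  then show "\<bar>kernel_form K f g\<bar> \<le> c" using \<open>0 \<le> c\<close> by simp
qed

lemma kernel_form_ln_neg:
  fixes f g :: "pt \<Rightarrow> real"
  assumes f: "integrable lborel f" and g: "square_integrable g"
  shows "integrable (lborel \<Otimes>\<^sub>M lborel) (\<lambda>z. ln_neg (dist (fst z) (snd z)) * f (fst z) * g (snd z))"
    and "\<bar>kernel_form ln_neg f g\<bar> \<le> ln_neg_norm * (\<integral>x. \<bar>f x\<bar> \<partial>lborel) * l2norm g"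
    and "integrable (lborel \<Otimes>\<^sub>M lborel) (\<lambda>z. ln_neg (dist (fst z) (snd z)) * g (fst z) * f (snd z))"
    and "\<bar>kernel_form ln_neg g f\<bar> \<le> ln_neg_norm * (\<integral>x. \<bar>f x\<bar> \<partial>lborel) * l2norm g"
proof -
  have m: "ln_neg \<in> borel_measurable borel" "f \<in> borel_measurable borel" "g \<in> borel_measurable borel"
    using f square_integrable_measurable[OF g] by auto
  have c: "0 \<le> ln_neg_norm * (\<integral>x. \<bar>f x\<bar> \<partial>lborel) * l2norm g" by simp
  show "integrable (lborel \<Otimes>\<^sub>M lborel) (\<lambda>z. ln_neg (dist (fst z) (snd z)) * f (fst z) * g (snd z))"
    "\<bar>kernel_form ln_neg f g\<bar> \<le> ln_neg_norm * (\<integral>x. \<bar>f x\<bar> \<partial>lborel) * l2norm g"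
    using kernel_form_bound[OF m _ c] nn_integral_ln_neg_pair_le(1)[OF f g] by simp_all
  show "integrable (lborel \<Otimes>\<^sub>M lborel) (\<lambda>z. ln_neg (dist (fst z) (snd z)) * g (fst z) * f (snd z))"
    "\<bar>kernel_form ln_neg g f\<bar> \<le> ln_neg_norm * (\<integral>x. \<bar>f x\<bar> \<partial>lborel) * l2norm g"
    using kernel_form_bound[OF m(1,3,2) _ c] nn_integral_ln_neg_pair_le(2)[OF f g] by simp_all
qed

text \<open>The 2 counts the two products that come from splitting the positive kernel, each at most
  the product of the norms; the negative kernel adds \<open>ln_neg_norm\<close>.\<close>

lemma kernel_form_ln:
  assumes f: "log_admissible f" and g: "log_admissible g"
  shows "integrable (lborel \<Otimes>\<^sub>M lborel) (\<lambda>z. ln (dist (fst z) (snd z)) * f (fst z) * g (snd z))"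
    and "\<bar>kernel_form ln f g\<bar> \<le> (2 + ln_neg_norm) * log_norm f * log_norm g"
    and "integrable (lborel \<Otimes>\<^sub>M lborel) (\<lambda>z. ln_pos (dist (fst z) (snd z)) * f (fst z) * g (snd z))"
    and "kernel_form ln f g = kernel_form ln_pos f g - kernel_form ln_neg f g"
proof -
  have m: "f \<in> borel_measurable borel" "g \<in> borel_measurable borel"
    and s: "integrable lborel f" "square_integrable g"
    using f g by (auto simp: log_admissible_def)
  note [measurable] = m
  let ?f1 = "\<integral>x. \<bar>f x\<bar> \<partial>lborel" and ?g1 = "\<integral>x. \<bar>g x\<bar> \<partial>lborel"
  let ?fw = "\<integral>x. ln (1 + norm x) * \<bar>f x\<bar> \<partial>lborel" and ?gw = "\<integral>x. ln (1 + norm x) * \<bar>g x\<bar> \<partial>lborel"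
  have nn: "0 \<le> ?f1" "0 \<le> ?g1" "0 \<le> ?fw" "0 \<le> ?gw"
    by (auto intro!: Bochner_Integration.integral_nonneg)
  have ln: "\<bar>kernel_form ln_pos f g\<bar> \<le> ?fw * ?g1 + ?f1 * ?gw"
    "integrable (lborel \<Otimes>\<^sub>M lborel) (\<lambda>z. ln_pos (dist (fst z) (snd z)) * f (fst z) * g (snd z))"
    using kernel_form_bound[OF borel_measurable_ln_pos m, of "?fw * ?g1 + ?f1 * ?gw"]
      nn_integral_ln_pos_pair_le[OF f g] nn by simp_all
  then show p: "integrable (lborel \<Otimes>\<^sub>M lborel) (\<lambda>z. ln_pos (dist (fst z) (snd z)) * f (fst z) * g (snd z))"
    by simp
  note n = kernel_form_ln_neg(1,2)[OF s]
  have eq: "(\<lambda>z. ln (dist (fst z) (snd z)) * f (fst z) * g (snd z))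
    = (\<lambda>z. ln_pos (dist (fst z) (snd z)) * f (fst z) * g (snd z) - ln_neg (dist (fst z) (snd z)) * f (fst z) * g (snd z))"
    unfolding ln_eq_pos_neg by (simp add: algebra_simps)
  show "integrable (lborel \<Otimes>\<^sub>M lborel) (\<lambda>z. ln (dist (fst z) (snd z)) * f (fst z) * g (snd z))"
    unfolding eq using p n by simp
  show d: "kernel_form ln f g = kernel_form ln_pos f g - kernel_form ln_neg f g"
    unfolding kernel_form_def eq using p n by simp
  have le: "?fw \<le> log_norm f" "?f1 \<le> log_norm f" "?gw \<le> log_norm g" "?g1 \<le> log_norm g" "l2norm g \<le> log_norm g"
    using nn by (auto simp: log_norm_def)
  have "?fw * ?g1 + ?f1 * ?gw + ln_neg_norm * ?f1 * l2norm g
      \<le> log_norm f * log_norm g + log_norm f * log_norm g + ln_neg_norm * log_norm f * log_norm g"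
    using nn le by (intro add_mono mult_mono mult_nonneg_nonneg) auto
  then show "\<bar>kernel_form ln f g\<bar> \<le> (2 + ln_neg_norm) * log_norm f * log_norm g"
    using ln(1) n(2) unfolding d by (simp add: algebra_simps)
qed

lemma log_admissible_add:
  assumes "log_admissible f" "log_admissible g"
  shows "log_admissible (\<lambda>x. f x + g x)" "log_norm (\<lambda>x. f x + g x) \<le> log_norm f + log_norm g"
proof -
  show a: "log_admissible (\<lambda>x. f x + g x)"
    using assms square_integrable_add by (auto simp: log_admissible_def distrib_left)
  have "(\<integral>x. \<bar>f x + g x\<bar> \<partial>lborel) \<le> (\<integral>x. \<bar>f x\<bar> + \<bar>g x\<bar> \<partial>lborel)"
    using log_admissible_abs[OF assms(1)] log_admissible_abs[OF assms(2)] log_admissible_abs[OF a]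
    by (intro integral_mono) auto
  moreover have "(\<integral>x. ln (1 + norm x) * \<bar>f x + g x\<bar> \<partial>lborel)
      \<le> (\<integral>x. ln (1 + norm x) * \<bar>f x\<bar> + ln (1 + norm x) * \<bar>g x\<bar> \<partial>lborel)"
    using log_admissible_abs[OF assms(1)] log_admissible_abs[OF assms(2)] log_admissible_abs[OF a]
  proof (intro integral_mono)
    show "ln (1 + norm x) * \<bar>f x + g x\<bar> \<le> ln (1 + norm x) * \<bar>f x\<bar> + ln (1 + norm x) * \<bar>g x\<bar>" for x :: pt
      unfolding distrib_left[symmetric] by (intro mult_left_mono) auto
  qed auto
  moreover have "l2norm (\<lambda>x. f x + g x) \<le> l2norm f + l2norm g"
    using assms by (intro l2norm_triangle) (auto simp: log_admissible_def)
  ultimately show "log_norm (\<lambda>x. f x + g x) \<le> log_norm f + log_norm g"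
    using log_admissible_abs[OF assms(1)] log_admissible_abs[OF assms(2)] by (simp add: log_norm_def)
qed

lemma log_admissible_cmult:
  assumes "log_admissible f"
  shows "log_admissible (\<lambda>x. a * f x)" "log_norm (\<lambda>x. a * f x) = \<bar>a\<bar> * log_norm f"
proof -
  have "(\<lambda>x. ln (1 + norm x) * (a * f x)) = (\<lambda>x. a * (ln (1 + norm x) * f x))"
    by (simp add: mult_ac)
  then show "log_admissible (\<lambda>x. a * f x)"
    using assms square_integrable_cmult by (auto simp: log_admissible_def)
  have "(\<lambda>x. ln (1 + norm x) * \<bar>a * f x\<bar>) = (\<lambda>x. \<bar>a\<bar> * (ln (1 + norm x) * \<bar>f x\<bar>))"
    by (simp add: abs_mult mult_ac)
  then show "log_norm (\<lambda>x. a * f x) = \<bar>a\<bar> * log_norm f"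
    by (simp add: log_norm_def abs_mult l2norm_cmult distrib_left)
qed

lemma kernel_form_ln_add:
  assumes "log_admissible f" "log_admissible g" "log_admissible h"
  shows "kernel_form ln (\<lambda>x. f x + g x) h = kernel_form ln f h + kernel_form ln g h"
    and "kernel_form ln h (\<lambda>x. f x + g x) = kernel_form ln h f + kernel_form ln h g"
  unfolding kernel_form_def
  using kernel_form_ln(1)[OF assms(1,3)] kernel_form_ln(1)[OF assms(2,3)]
    kernel_form_ln(1)[OF assms(3,1)] kernel_form_ln(1)[OF assms(3,2)]
  by (simp_all add: algebra_simps)

lemma kernel_form_cmult:
  "kernel_form K (\<lambda>x. a * f x) h = a * kernel_form K f h"
  "kernel_form K h (\<lambda>x. a * f x) = a * kernel_form K h f"
proof -
  have "(\<lambda>z. K (dist (fst z) (snd z)) * (a * f (fst z)) * h (snd z))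
      = (\<lambda>z. a * (K (dist (fst z) (snd z)) * f (fst z) * h (snd z)))"
    "(\<lambda>z. K (dist (fst z) (snd z)) * h (fst z) * (a * f (snd z)))
      = (\<lambda>z. a * (K (dist (fst z) (snd z)) * h (fst z) * f (snd z)))"
    by (simp_all add: mult_ac)
  then show "kernel_form K (\<lambda>x. a * f x) h = a * kernel_form K f h"
    "kernel_form K h (\<lambda>x. a * f x) = a * kernel_form K h f"
    by (simp_all add: kernel_form_def)
qed

section \<open>The space E\<close>

text \<open>The definition of E weights by ln (1 + |x|^2), its norm by ln (1 + |x|). They are
  comparable through 1 + t <= 2 (1 + t^2) and 1 + t^2 <= (1 + t)^2, the constant ln 2 being absorbed
  by the mass.\<close>

lemma Esp_iff: "u \<in> Esp \<longleftrightarrow> u \<in> H1 \<and> integrable lborel (\<lambda>x. ln (1 + norm x) * (u x)\<^sup>2)"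
proof (cases "u \<in> H1")
  case True
  note sq = H1_square_integrable[OF True]
  note [measurable] = square_integrable_measurable[OF sq]
  have i: "integrable lborel (\<lambda>x. (u x)\<^sup>2)" using square_integrable_integrable[OF sq] by simp
  have le1: "ln (1 + t) \<le> ln 2 + ln (1 + t\<^sup>2)" if "0 \<le> t" for t :: real
  proof -
    have "1 + t \<le> 2 * (1 + t\<^sup>2)" using zero_le_power2[of "t - 1"] by (simp add: power2_diff) (use zero_le_power2[of t] in linarith)
    then have "ln (1 + t) \<le> ln (2 * (1 + t\<^sup>2))"
      using that by (subst ln_le_cancel_iff) (auto simp: add_pos_nonneg)
    also have "\<dots> = ln 2 + ln (1 + t\<^sup>2)" by (rule ln_mult_pos) (auto simp: add_pos_nonneg)
    finally show ?thesis .
  qed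
  have le2: "ln (1 + t\<^sup>2) \<le> 2 * ln (1 + t)" if "0 \<le> t" for t :: real
  proof -
    have "1 + t\<^sup>2 \<le> (1 + t)\<^sup>2" using that by (simp add: power2_sum)
    then have "ln (1 + t\<^sup>2) \<le> ln ((1 + t)\<^sup>2)"
      using that by (subst ln_le_cancel_iff) (auto simp: add_pos_nonneg)
    also have "\<dots> = 2 * ln (1 + t)" using that by (simp add: ln_realpow)
    finally show ?thesis .
  qed
  have "integrable lborel (\<lambda>x. ln (1 + norm x) * (u x)\<^sup>2)"
    if "integrable lborel (\<lambda>x. ln (1 + (norm x)\<^sup>2) * (u x)\<^sup>2)"
  proof (rule Bochner_Integration.integrable_bound)
    show "integrable lborel (\<lambda>x. ln 2 * (u x)\<^sup>2 + ln (1 + (norm x)\<^sup>2) * (u x)\<^sup>2)" using i that by simp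
    show "AE x in lborel. norm (ln (1 + norm x) * (u x)\<^sup>2) \<le> norm (ln 2 * (u x)\<^sup>2 + ln (1 + (norm x)\<^sup>2) * (u x)\<^sup>2)"
    proof (intro AE_I2)
      fix x :: pt
      show "norm (ln (1 + norm x) * (u x)\<^sup>2) \<le> norm (ln 2 * (u x)\<^sup>2 + ln (1 + (norm x)\<^sup>2) * (u x)\<^sup>2)"
        using mult_right_mono[OF le1[of "norm x"], of "(u x)\<^sup>2"] by (simp add: distrib_right)
    qed
  qed measurable
  moreover have "integrable lborel (\<lambda>x. ln (1 + (norm x)\<^sup>2) * (u x)\<^sup>2)"
    if "integrable lborel (\<lambda>x. ln (1 + norm x) * (u x)\<^sup>2)"
  proof (rule Bochner_Integration.integrable_bound)
    show "integrable lborel (\<lambda>x. 2 * (ln (1 + norm x) * (u x)\<^sup>2))" using that by simp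
    show "AE x in lborel. norm (ln (1 + (norm x)\<^sup>2) * (u x)\<^sup>2) \<le> norm (2 * (ln (1 + norm x) * (u x)\<^sup>2))"
    proof (intro AE_I2)
      fix x :: pt
      show "norm (ln (1 + (norm x)\<^sup>2) * (u x)\<^sup>2) \<le> norm (2 * (ln (1 + norm x) * (u x)\<^sup>2))"
        using mult_right_mono[OF le2[of "norm x"], of "(u x)\<^sup>2"] by (simp add: mult.assoc)
    qed
  qed measurable
  ultimately show ?thesis using True by (auto simp: Esp_def)
qed (simp add: Esp_def)

lemma Esp_H1: "u \<in> Esp \<Longrightarrow> u \<in> H1"
  by (simp add: Esp_iff)

lemma Esp_square_integrable: "u \<in> Esp \<Longrightarrow> square_integrable u"
  by (simp add: Esp_iff H1_square_integrable)

lemma Sc_Esp: "u \<in> Sc c \<Longrightarrow> u \<in> Esp"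
  by (simp add: Sc_def)

lemma Sc_l2norm: "u \<in> Sc c \<Longrightarrow> (l2norm u)\<^sup>2 = c"
  by (simp add: Sc_def l2norm_sq_real)

text \<open>Turns the logarithmic moment into an L^2 norm, so that the square of
  \<open>normE\<close> is a sum of three squared L^2 norms.\<close>

definition weighted :: "(pt \<Rightarrow> real) \<Rightarrow> pt \<Rightarrow> real" where
  "weighted u x = sqrt (ln (1 + norm x)) * u x"

lemma weighted_sq: "(weighted u x)\<^sup>2 = ln (1 + norm x) * (u x)\<^sup>2"
  by (simp add: weighted_def power_mult_distrib)

lemma square_integrable_weighted:
  assumes "u \<in> Esp"
  shows "square_integrable (weighted u)"
proof -
  note [measurable] = square_integrable_measurable[OF Esp_square_integrable[OF assms]]
  have "weighted u \<in> borel_measurable borel" unfolding weighted_def[abs_def] by measurable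
  then show ?thesis using assms by (simp add: square_integrable_def weighted_sq Esp_iff)
qed

lemma normE_sq: "(normE u)\<^sup>2 = Q u + (l2norm u)\<^sup>2 + (l2norm (weighted u))\<^sup>2"
  by (simp add: normE_def l2norm_sq_real weighted_sq Q_nonneg Bochner_Integration.integral_nonneg)

lemma normE_nonneg [simp]: "0 \<le> normE u"
  by (simp add: normE_def Q_nonneg Bochner_Integration.integral_nonneg)

lemma normE_ge:
  shows "Q u \<le> (normE u)\<^sup>2" "l2norm u \<le> normE u" "l2norm (weighted u) \<le> normE u" "sqrt (Q u) \<le> normE u"
proof -
  show "Q u \<le> (normE u)\<^sup>2" by (simp add: normE_sq)
  then show "sqrt (Q u) \<le> normE u" by (intro real_le_lsqrt) (auto simp: Q_nonneg)
  show "l2norm u \<le> normE u" "l2norm (weighted u) \<le> normE u"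
    by (rule power2_le_imp_le; simp add: normE_sq Q_nonneg)+
qed

lemma l2norm_lincomb_sq:
  assumes "square_integrable f" "square_integrable g"
  shows "(l2norm (\<lambda>x. a *\<^sub>R f x + b *\<^sub>R g x))\<^sup>2 \<le> 2 * a\<^sup>2 * (l2norm f)\<^sup>2 + 2 * b\<^sup>2 * (l2norm g)\<^sup>2"
proof -
  have "(l2norm (\<lambda>x. a *\<^sub>R f x + b *\<^sub>R g x))\<^sup>2 \<le> (\<bar>a\<bar> * l2norm f + \<bar>b\<bar> * l2norm g)\<^sup>2"
    using l2norm_triangle[OF square_integrable_scaleR[OF assms(1)] square_integrable_scaleR[OF assms(2)], of a b]
    by (intro power_mono) (auto simp: l2norm_scaleR)
  also have "\<dots> \<le> 2 * (\<bar>a\<bar> * l2norm f)\<^sup>2 + 2 * (\<bar>b\<bar> * l2norm g)\<^sup>2"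
    using zero_le_power2[of "\<bar>a\<bar> * l2norm f - \<bar>b\<bar> * l2norm g"] unfolding power2_diff power2_sum by linarith
  finally show ?thesis by (simp add: power_mult_distrib mult.assoc)
qed

text \<open>(s + t)^2 <= 2 s^2 + 2 t^2 in each of the three parts of the norm; this stands in for
  the triangle inequality of \<open>normE\<close>.\<close>

lemma Esp_lincomb:
  assumes u: "u \<in> Esp" and v: "v \<in> Esp"
  shows "(\<lambda>x. a * u x + b * v x) \<in> Esp"
    and "(normE (\<lambda>x. a * u x + b * v x))\<^sup>2 \<le> 2 * a\<^sup>2 * (normE u)\<^sup>2 + 2 * b\<^sup>2 * (normE v)\<^sup>2"
proof -
  note s = Esp_square_integrable[OF u] Esp_square_integrable[OF v]
  note g = l2_gradient_weak_grad[OF Esp_H1[OF u]] l2_gradient_weak_grad[OF Esp_H1[OF v]]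
  note w = square_integrable_weighted[OF u] square_integrable_weighted[OF v]
  have sg: "square_integrable (weak_grad u)" "square_integrable (weak_grad v)"
    using g by (auto simp: l2_gradient_def)
  let ?f = "\<lambda>x. a * u x + b * v x"
  have sf: "square_integrable ?f" by (intro square_integrable_add square_integrable_cmult s)
  have gf: "l2_gradient ?f (\<lambda>x. a *\<^sub>R weak_grad u x + b *\<^sub>R weak_grad v x)"
    by (rule l2_gradient_lincomb[OF s(1) g(1) s(2) g(2)])
  have wf: "weighted ?f = (\<lambda>x. a *\<^sub>R weighted u x + b *\<^sub>R weighted v x)"
    by (simp add: weighted_def fun_eq_iff algebra_simps)
  have "square_integrable (weighted ?f)"
    unfolding wf by (intro square_integrable_add square_integrable_scaleR w)
  then show "?f \<in> Esp"
    using sf gf by (auto simp: Esp_iff H1_iff square_integrable_def weighted_sq)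
  show "(normE ?f)\<^sup>2 \<le> 2 * a\<^sup>2 * (normE u)\<^sup>2 + 2 * b\<^sup>2 * (normE v)\<^sup>2"
    using l2norm_lincomb_sq[OF sg, of a b] l2norm_lincomb_sq[OF s, of a b] l2norm_lincomb_sq[OF w, of a b]
    by (simp add: normE_sq Q_eq[OF sf gf] Q_eq_weak_grad[of u] Q_eq_weak_grad[of v] wf algebra_simps)
qed

lemma Esp_cmult: "u \<in> Esp \<Longrightarrow> (\<lambda>x. a * u x) \<in> Esp"
  using Esp_lincomb(1)[of u u a 0] by simp

lemma l2_gradient_zero: "l2_gradient (\<lambda>x. 0) (\<lambda>x. 0)"
  by (simp add: l2_gradient_def is_weak_grad_def)

lemma Q_zero: "Q (\<lambda>x. 0) = 0"
  by (simp add: Q_eq[OF square_integrable_zero l2_gradient_zero] l2norm_def)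

lemma Esp_zero: "(\<lambda>x. 0) \<in> Esp"
  using l2_gradient_zero by (auto simp: Esp_iff H1_iff)

lemma normE_zero: "normE (\<lambda>x. 0) = 0"
  by (simp add: normE_def Q_zero)

lemma Esp_powr_bound:
  fixes q :: real
  assumes "2 < q"
  obtains C where "0 < C" "\<And>u. u \<in> Esp \<Longrightarrow> (\<integral>x. \<bar>u x\<bar> powr q \<partial>lborel) \<le> C * normE u powr q"
proof -
  obtain C where C: "0 < C" and *: "\<And>u. u \<in> H1 \<Longrightarrow>
    (\<integral>x. \<bar>u x\<bar> powr q \<partial>lborel) \<le> C * sqrt (Q u) powr (q - 2) * (\<integral>x. (u x)\<^sup>2 \<partial>lborel)"
    using Gagliardo_Nirenberg[OF assms] by blast
  show thesis
  proof (rule that[OF C])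
    fix u assume u: "u \<in> Esp"
    have "(\<integral>x. \<bar>u x\<bar> powr q \<partial>lborel) \<le> C * (sqrt (Q u) powr (q - 2) * (l2norm u)\<^sup>2)"
      using *[OF Esp_H1[OF u]] by (simp add: l2norm_sq_real mult.assoc)
    also have "\<dots> \<le> C * (normE u powr (q - 2) * (normE u)\<^sup>2)"
      using C assms normE_ge[of u] by (intro mult_left_mono mult_mono powr_mono2 power_mono) (auto simp: Q_nonneg)
    also have "normE u powr (q - 2) * (normE u)\<^sup>2 = normE u powr q"
      by (cases "normE u = 0") (auto simp: powr_diff powr_numeral less_le)
    finally show "(\<integral>x. \<bar>u x\<bar> powr q \<partial>lborel) \<le> C * normE u powr q" .
  qed
qed

lemma H1_fourth_power:
  assumes "u \<in> H1"
  shows "square_integrable (\<lambda>x. (u x)\<^sup>2)" "(l2norm (\<lambda>x. (u x)\<^sup>2))\<^sup>2 = (\<integral>x. \<bar>u x\<bar> powr 4 \<partial>lborel)"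
proof -
  note [measurable] = square_integrable_measurable[OF H1_square_integrable[OF assms]]
  have eq: "(norm ((u x)\<^sup>2))\<^sup>2 = \<bar>u x\<bar> powr 4" for x
    by (simp add: powr_numeral)
  show "square_integrable (\<lambda>x. (u x)\<^sup>2)"
    using H1_powr_integrable[OF assms, of 4] by (simp add: square_integrable_def eq[simplified])
  show "(l2norm (\<lambda>x. (u x)\<^sup>2))\<^sup>2 = (\<integral>x. \<bar>u x\<bar> powr 4 \<partial>lborel)"
    unfolding l2norm_sq eq ..
qed

text \<open>Cauchy--Schwarz three times: in L^2, in the weighted L^2, and for the squares of the
  functions, where the fourth-power bound supplies sqrt A.\<close>

lemma Esp_mult_log_admissible:
  obtains C where "0 < C" "\<And>u v. u \<in> Esp \<Longrightarrow> v \<in> Esp \<Longrightarrow>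
    log_admissible (\<lambda>x. u x * v x) \<and> log_norm (\<lambda>x. u x * v x) \<le> C * normE u * normE v"
proof -
  obtain A where A: "0 < A" "\<And>u. u \<in> Esp \<Longrightarrow> (\<integral>x. \<bar>u x\<bar> powr 4 \<partial>lborel) \<le> A * normE u powr 4"
    using Esp_powr_bound[of 4] by auto
  define C where "C = 2 + sqrt A"
  have C: "0 < C" using A(1) by (simp add: C_def add_pos_pos)
  show thesis
  proof (rule that[OF C], intro conjI)
    fix u v assume u: "u \<in> Esp" and v: "v \<in> Esp"
    note s = Esp_square_integrable[OF u] Esp_square_integrable[OF v]
    note w = square_integrable_weighted[OF u] square_integrable_weighted[OF v]
    note f = H1_fourth_power[OF Esp_H1[OF u]] H1_fourth_power[OF Esp_H1[OF v]]
    note [measurable] = square_integrable_measurable[OF s(1)] square_integrable_measurable[OF s(2)]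
    have four: "l2norm (\<lambda>x. (h x)\<^sup>2) \<le> sqrt A * (normE h)\<^sup>2" if h: "h \<in> Esp" for h
    proof (rule power2_le_imp_le)
      have "(l2norm (\<lambda>x. (h x)\<^sup>2))\<^sup>2 \<le> A * normE h powr 4"
        using H1_fourth_power(2)[OF Esp_H1[OF h]] A(2)[OF h] by simp
      also have "\<dots> = (sqrt A * (normE h)\<^sup>2)\<^sup>2"
        using A(1) by (simp add: power_mult_distrib powr_numeral)
      finally show "(l2norm (\<lambda>x. (h x)\<^sup>2))\<^sup>2 \<le> (sqrt A * (normE h)\<^sup>2)\<^sup>2" .
    qed (use A in simp)
    have prod_sq: "(\<lambda>x. (norm (u x * v x))\<^sup>2) = (\<lambda>x. (u x)\<^sup>2 * (v x)\<^sup>2)"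
      by (simp add: power_mult_distrib)
    have sq: "square_integrable (\<lambda>x. u x * v x)"
      unfolding square_integrable_def prod_sq using square_integrable_mult(1)[OF f(1,3)] by simp
    have i: "integrable lborel (\<lambda>x. u x * v x)" by (rule square_integrable_mult(1)[OF s])
    have eqw: "ln (1 + norm x) * (u x * v x) = weighted u x * weighted v x" for x
      by (simp add: weighted_def mult_ac flip: mult.assoc)
    have iw: "integrable lborel (\<lambda>x. ln (1 + norm x) * (u x * v x))"
      unfolding eqw by (rule square_integrable_mult(1)[OF w])
    show "log_admissible (\<lambda>x. u x * v x)" using sq i iw by (simp add: log_admissible_def)
    have 1: "(\<integral>x. \<bar>u x * v x\<bar> \<partial>lborel) \<le> normE u * normE v"
    proof -
      have "(\<integral>x. \<bar>u x * v x\<bar> \<partial>lborel) \<le> l2norm u * l2norm v"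
        using square_integrable_norm_mult(2)[OF s] by (simp add: abs_mult)
      also have "\<dots> \<le> normE u * normE v" by (intro mult_mono normE_ge) auto
      finally show ?thesis .
    qed
    have 2: "(\<integral>x. ln (1 + norm x) * \<bar>u x * v x\<bar> \<partial>lborel) \<le> normE u * normE v"
    proof -
      have "ln (1 + norm x) * \<bar>u x * v x\<bar> = norm (weighted u x) * norm (weighted v x)" for x
        unfolding real_norm_def abs_mult[symmetric] eqw[symmetric] by (simp add: abs_mult)
      then have "(\<integral>x. ln (1 + norm x) * \<bar>u x * v x\<bar> \<partial>lborel) \<le> l2norm (weighted u) * l2norm (weighted v)"
        using square_integrable_norm_mult(2)[OF w] by simp
      also have "\<dots> \<le> normE u * normE v" by (intro mult_mono normE_ge) auto
      finally show ?thesis .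
    qed
    have 3: "l2norm (\<lambda>x. u x * v x) \<le> sqrt A * (normE u * normE v)"
    proof (rule power2_le_imp_le)
      have "(l2norm (\<lambda>x. u x * v x))\<^sup>2 = (\<integral>x. (u x)\<^sup>2 * (v x)\<^sup>2 \<partial>lborel)"
        unfolding l2norm_sq prod_sq ..
      also have "\<dots> \<le> l2norm (\<lambda>x. (u x)\<^sup>2) * l2norm (\<lambda>x. (v x)\<^sup>2)"
        using square_integrable_mult(2)[OF f(1,3)] by linarith
      also have "\<dots> \<le> (sqrt A * (normE u)\<^sup>2) * (sqrt A * (normE v)\<^sup>2)"
        using A(1) by (intro mult_mono four u v) auto
      also have "\<dots> = (sqrt A * (normE u * normE v))\<^sup>2"
        by (simp add: power_mult_distrib power2_eq_square)
      finally show "(l2norm (\<lambda>x. u x * v x))\<^sup>2 \<le> (sqrt A * (normE u * normE v))\<^sup>2" .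
    qed (use A in simp)
    show "log_norm (\<lambda>x. u x * v x) \<le> C * normE u * normE v"
      using 1 2 3 unfolding log_norm_def C_def by (simp add: algebra_simps)
  qed
qed

lemma Esp_log_admissible:
  assumes "u \<in> Esp" "v \<in> Esp"
  shows "log_admissible (\<lambda>x. u x * v x)" "log_admissible (\<lambda>x. (u x)\<^sup>2)"
  using Esp_mult_log_admissible assms by (metis, metis (no_types, lifting) power2_eq_square ext)

section \<open>The superposition term\<close>

text \<open>This is |a|^(q-2) a, whose exponent is negative for q < 2; the exponent in the form
  chosen is positive for all q > 1.\<close>

definition sgn_powr :: "real \<Rightarrow> real \<Rightarrow> real" where
  "sgn_powr q a = sgn a * \<bar>a\<bar> powr (q - 1)"

lemma abs_powr_has_derivative:
  assumes "1 < q"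
  shows "((\<lambda>a::real. \<bar>a\<bar> powr q) has_real_derivative q * sgn_powr q a) (at a)"
proof -
  consider "a < 0" | "a = 0" | "0 < a" by linarith
  then show ?thesis
  proof cases
    case 1
    have "((\<lambda>a. (- a) powr q) has_real_derivative - (q * (- a) powr (q - 1))) (at a)"
      using 1 by (auto intro!: derivative_eq_intros simp: powr_diff)
    then have "((\<lambda>a. \<bar>a\<bar> powr q) has_real_derivative - (q * (- a) powr (q - 1))) (at a)"
      by (rule has_field_derivative_transform_within_open[where S="{..<0}"]) (use 1 in auto)
    then show ?thesis using 1 by (simp add: sgn_powr_def)
  next
    case 2
    have "((\<lambda>h::real. \<bar>h\<bar> powr q / h) \<longlongrightarrow> 0) (at 0)"
    proof (rule Lim_null_comparison)
      have "norm (\<bar>h\<bar> powr q / h) \<le> \<bar>h\<bar> powr (q - 1)" for h :: real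
        by (cases "h = 0") (auto simp: abs_divide powr_diff)
      then show "\<forall>\<^sub>F h in at 0. norm (\<bar>h\<bar> powr q / h) \<le> \<bar>h::real\<bar> powr (q - 1)"
        by (intro always_eventually) auto
      have "((\<lambda>h::real. \<bar>h\<bar> powr (q - 1)) \<longlongrightarrow> \<bar>0\<bar> powr (q - 1)) (at 0)"
        using assms by (intro tendsto_powr' tendsto_intros) auto
      then show "((\<lambda>h::real. \<bar>h\<bar> powr (q - 1)) \<longlongrightarrow> 0) (at 0)" by simp
    qed
    then show ?thesis using 2 assms by (simp add: DERIV_def sgn_powr_def)
  next
    case 3
    have "((\<lambda>a. a powr q) has_real_derivative q * a powr (q - 1)) (at a)"
      using 3 by (auto intro!: derivative_eq_intros simp: powr_diff)
    then have "((\<lambda>a. \<bar>a\<bar> powr q) has_real_derivative q * a powr (q - 1)) (at a)"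
      by (rule has_field_derivative_transform_within_open[where S="{0<..}"]) (use 3 in auto)
    then show ?thesis using 3 by (simp add: sgn_powr_def)
  qed
qed

lemma continuous_sgn_powr:
  assumes "1 < q"
  shows "continuous_on UNIV (sgn_powr q)"
proof -
  have "sgn_powr q = (\<lambda>a. (max 0 a) powr (q - 1) - (max 0 (- a)) powr (q - 1))"
  proof
    fix a :: real
    show "sgn_powr q a = (max 0 a) powr (q - 1) - (max 0 (- a)) powr (q - 1)"
      using assms by (cases a "0::real" rule: linorder_cases) (auto simp: sgn_powr_def)
  qed
  then show ?thesis using assms by (auto intro!: continuous_intros continuous_on_powr')
qed

lemma sgn_powr_mult: "0 < t \<Longrightarrow> sgn_powr q (t * a) = t powr (q - 1) * sgn_powr q a"
  by (simp add: sgn_powr_def abs_mult sgn_mult powr_mult)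

text \<open>Compactness of the unit sphere gives the bounds there and homogeneity spreads them. At
  the origin both values vanish, as scaling by 2 shows.\<close>

lemma homogeneous_bound:
  fixes F :: "real \<times> real \<Rightarrow> real" and F' :: "real \<times> real \<Rightarrow> real \<times> real"
  assumes "1 < q"
    and der: "\<And>z. (F has_derivative (\<lambda>w. F' z \<bullet> w)) (at z)" and cont: "continuous_on UNIV F'"
    and hom: "\<And>t z. 0 < t \<Longrightarrow> F (t *\<^sub>R z) = t powr q * F z"
    and hom': "\<And>t z. 0 < t \<Longrightarrow> F' (t *\<^sub>R z) = t powr (q - 1) *\<^sub>R F' z"
  obtains M where "0 \<le> M" "\<And>z. \<bar>F z\<bar> \<le> M * norm z powr q" "\<And>z. norm (F' z) \<le> M * norm z powr (q - 1)"
proof -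
  have cF: "continuous_on UNIV F"
    using der by (meson continuous_at_imp_continuous_on has_derivative_continuous)
  have "bounded (F ` sphere 0 1)" "bounded (F' ` sphere 0 1)"
    by (intro compact_imp_bounded compact_continuous_image continuous_on_subset[OF cF]
        continuous_on_subset[OF cont]; simp)+
  then obtain M1 M2 where M1: "\<forall>z\<in>sphere 0 1. norm (F z) \<le> M1" and M2: "\<forall>z\<in>sphere 0 1. norm (F' z) \<le> M2"
    unfolding bounded_iff by blast
  define M where "M = max 0 (max M1 M2)"
  have z0: "F 0 = 0" "F' 0 = 0"
  proof -
    have "2 powr q \<noteq> (1::real)" "2 powr (q - 1) \<noteq> (1::real)" using assms(1) by auto
    moreover have "(1 - 2 powr (q - 1)) *\<^sub>R F' 0 = 0"
      using hom'[of 2 0] by (simp add: scaleR_diff_left)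
    ultimately show "F 0 = 0" "F' 0 = 0" using hom[of 2 0] by auto
  qed
  have *: "\<bar>F z\<bar> \<le> M * norm z powr q \<and> norm (F' z) \<le> M * norm z powr (q - 1)" for z
  proof (cases "z = 0")
    case False
    define e where "e = z /\<^sub>R norm z"
    have e: "e \<in> sphere 0 1" "z = norm z *\<^sub>R e" using False by (auto simp: e_def)
    have "\<bar>F z\<bar> = norm z powr q * norm (F e)"
      using hom[of "norm z" e] False e(2) by (simp add: abs_mult)
    moreover have "norm (F' z) = norm z powr (q - 1) * norm (F' e)"
      using hom'[of "norm z" e] False e(2) by simp
    moreover have "norm (F e) \<le> M" "norm (F' e) \<le> M" using bspec[OF M1 e(1)] bspec[OF M2 e(1)] by (auto simp: M_def)
    ultimately show ?thesis by (simp add: mult.commute mult_right_mono)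
  qed (simp add: z0)
  show thesis by (rule that[of M]) (use * in \<open>auto simp: M_def\<close>)
qed

text \<open>If |w| <= \<delta> |z|, scale z to the unit sphere and use the mean value theorem with
  the uniform continuity of the gradient. Otherwise |w| dominates |z| and all three terms are of
  order |w|^q.\<close>

lemma homogeneous_remainder:
  fixes F :: "real \<times> real \<Rightarrow> real" and F' :: "real \<times> real \<Rightarrow> real \<times> real"
  assumes q: "1 < q"
    and der: "\<And>z. (F has_derivative (\<lambda>w. F' z \<bullet> w)) (at z)" and cont: "continuous_on UNIV F'"
    and hom: "\<And>t z. 0 < t \<Longrightarrow> F (t *\<^sub>R z) = t powr q * F z"
    and hom': "\<And>t z. 0 < t \<Longrightarrow> F' (t *\<^sub>R z) = t powr (q - 1) *\<^sub>R F' z"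
    and "0 < \<eta>"
  obtains C where "0 \<le> C"
    "\<And>z w. \<bar>F (z + w) - F z - F' z \<bullet> w\<bar> \<le> \<eta> * (norm z powr (q - 1) * norm w) + C * norm w powr q"
proof -
  obtain M where M: "0 \<le> M" "\<And>z. \<bar>F z\<bar> \<le> M * norm z powr q" "\<And>z. norm (F' z) \<le> M * norm z powr (q - 1)"
    using homogeneous_bound[OF q der cont hom hom'] by blast
  have "uniformly_continuous_on (cball 0 2) F'"
    by (intro compact_uniformly_continuous continuous_on_subset[OF cont]) auto
  then obtain d where d: "0 < d"
    "\<And>x y. x \<in> cball 0 2 \<Longrightarrow> y \<in> cball 0 2 \<Longrightarrow> dist y x < d \<Longrightarrow> dist (F' y) (F' x) < \<eta>"
    unfolding uniformly_continuous_on_def using \<open>0 < \<eta>\<close> by metis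
  \<comment> \<open>Strictly below d, and at most 1 so that the segment from e to e + v stays in the
    ball of radius 2.\<close>
  define \<delta> where "\<delta> = min d 1 / 2"
  have \<delta>: "0 < \<delta>" "\<delta> < d" "\<delta> \<le> 1" using d(1) by (auto simp: \<delta>_def)
  \<comment> \<open>If |w| > \<delta> |z|, then |z|, |z + w| and |w| are all at most k |w|; the 3 in
    \<open>C\<close> counts the three terms.\<close>
  define k where "k = 1 + 1 / \<delta>"
  have k: "1 \<le> k" using \<delta> by (simp add: k_def)
  define C where "C = 3 * M * k powr q"
  have unit: "\<bar>F (e + v) - F e - F' e \<bullet> v\<bar> \<le> \<eta> * norm v" if e: "norm e = 1" and v: "norm v \<le> \<delta>" for e v
  proof -
    have "((\<lambda>s. F (e + s *\<^sub>R v)) has_derivative (\<lambda>h. F' (e + s *\<^sub>R v) \<bullet> (h *\<^sub>R v))) (at s within {0..1})" for s :: real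
      by (rule has_derivative_compose[OF _ der]) (auto intro!: derivative_eq_intros)
    from mvt_simple[where a=0 and b=1, OF _ this] obtain s :: real where s: "s \<in> {0<..<1}"
      "F (e + v) - F e = F' (e + s *\<^sub>R v) \<bullet> v" by auto
    have sv: "norm (s *\<^sub>R v) \<le> norm v" using s by (simp add: mult_left_le_one_le)
    have "dist (F' (e + s *\<^sub>R v)) (F' e) < \<eta>"
    proof (rule d(2))
      show "e \<in> cball 0 2" using e by simp
      show "e + s *\<^sub>R v \<in> cball 0 2"
        using norm_triangle_ineq[of e "s *\<^sub>R v"] sv v \<delta> e by simp
      show "dist (e + s *\<^sub>R v) e < d" using sv v \<delta> by (simp add: dist_norm)
    qed
    then have "\<bar>(F' (e + s *\<^sub>R v) - F' e) \<bullet> v\<bar> \<le> \<eta> * norm v"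
      by (intro order.trans[OF Cauchy_Schwarz_ineq2] mult_right_mono) (auto simp: dist_norm)
    then show ?thesis using s(2) by (simp add: inner_diff_left)
  qed
  have main: "\<bar>F (z + w) - F z - F' z \<bullet> w\<bar> \<le> \<eta> * (norm z powr (q - 1) * norm w) + C * norm w powr q" for z w
  proof (cases "norm w \<le> \<delta> * norm z")
    case True
    show ?thesis
    proof (cases "z = 0")
      case False
      define a where "a = norm z"
      have a: "0 < a" using False by (simp add: a_def)
      define e where "e = z /\<^sub>R a"
      define v where "v = w /\<^sub>R a"
      have ev: "z = a *\<^sub>R e" "w = a *\<^sub>R v" "norm e = 1" "norm v = norm w / a"
        using a by (auto simp: e_def v_def a_def divide_inverse mult.commute)
      then have ev': "norm v \<le> \<delta>" using a True by (simp add: pos_divide_le_eq a_def)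
      have "F (z + w) - F z - F' z \<bullet> w = a powr q * F (e + v) - a powr q * F e - a powr (q - 1) * a * (F' e \<bullet> v)"
        unfolding ev(1,2) scaleR_add_right[symmetric] using a by (simp add: hom hom' mult_ac)
      also have "a powr (q - 1) * a = a powr q" using a by (simp add: powr_diff)
      finally have "\<bar>F (z + w) - F z - F' z \<bullet> w\<bar> = a powr q * \<bar>F (e + v) - F e - F' e \<bullet> v\<bar>"
        by (simp add: abs_mult flip: right_diff_distrib)
      also have "\<dots> \<le> a powr q * (\<eta> * (norm w / a))"
        using unit[OF ev(3) ev'] ev(4) by (intro mult_left_mono) auto
      also have "\<dots> = \<eta> * (norm z powr (q - 1) * norm w)"
        using a by (simp add: a_def[symmetric] powr_diff)
      finally show ?thesis using M(1) by (simp add: C_def add_increasing2)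
    qed (use True M in \<open>simp add: C_def\<close>)
  next
    case False
    then have zw: "norm z \<le> norm w / \<delta>" using \<delta> by (simp add: pos_le_divide_eq mult.commute)
    have kw: "norm z \<le> k * norm w" "norm (z + w) \<le> k * norm w" "norm w \<le> k * norm w"
    proof -
      have "k * norm w = norm w + norm w / \<delta>" by (simp add: k_def distrib_right)
      moreover have "0 \<le> norm w / \<delta>" using \<delta> by simp
      ultimately show "norm z \<le> k * norm w" "norm (z + w) \<le> k * norm w" "norm w \<le> k * norm w"
        using zw norm_triangle_ineq[of z w] norm_ge_zero[of w] by linarith+
    qed
    have 1: "\<bar>F (z + w)\<bar> \<le> M * (k * norm w) powr q"
      using q M(1) kw k by (intro order.trans[OF M(2)] mult_left_mono powr_mono2) auto
    have 2: "\<bar>F z\<bar> \<le> M * (k * norm w) powr q"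
      using q M(1) kw k by (intro order.trans[OF M(2)] mult_left_mono powr_mono2) auto
    have "\<bar>F' z \<bullet> w\<bar> \<le> norm (F' z) * norm w" by (rule Cauchy_Schwarz_ineq2)
    also have "\<dots> \<le> (M * (k * norm w) powr (q - 1)) * (k * norm w)"
      using q M(1) kw k by (intro mult_mono order.trans[OF M(3)] mult_left_mono powr_mono2) auto
    also have "\<dots> = M * (k * norm w) powr q"
      using k by (cases "w = 0") (auto simp: powr_diff)
    finally have 3: "\<bar>F' z \<bullet> w\<bar> \<le> M * (k * norm w) powr q" .
    have "\<bar>F (z + w) - F z - F' z \<bullet> w\<bar> \<le> 3 * M * (k * norm w) powr q" using 1 2 3 by linarith
    also have "\<dots> = C * norm w powr q" using k by (simp add: C_def powr_mult)
    finally show ?thesis using \<open>0 < \<eta>\<close> by (simp add: add_increasing)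
  qed
  show thesis by (rule that[OF _ main]) (use M in \<open>simp add: C_def\<close>)
qed

text \<open>The integrand of \<open>R\<close> as one function of the pair (u, v), homogeneous of
  degree 2 p including the coupling.\<close>

definition nlin :: "real \<Rightarrow> real \<Rightarrow> real \<Rightarrow> real \<Rightarrow> real \<times> real \<Rightarrow> real" where
  "nlin p \<mu>1 \<mu>2 \<beta> z = \<mu>1 * \<bar>fst z\<bar> powr (2 * p) + \<mu>2 * \<bar>snd z\<bar> powr (2 * p)
    + 2 * \<beta> * (\<bar>fst z\<bar> powr p * \<bar>snd z\<bar> powr p)"

definition nlin_grad :: "real \<Rightarrow> real \<Rightarrow> real \<Rightarrow> real \<Rightarrow> real \<times> real \<Rightarrow> real \<times> real" where
  "nlin_grad p \<mu>1 \<mu>2 \<beta> z =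
    (\<mu>1 * (2 * p * sgn_powr (2 * p) (fst z)) + 2 * \<beta> * (p * sgn_powr p (fst z) * \<bar>snd z\<bar> powr p),
     \<mu>2 * (2 * p * sgn_powr (2 * p) (snd z)) + 2 * \<beta> * (\<bar>fst z\<bar> powr p * (p * sgn_powr p (snd z))))"

lemma nlin_has_derivative:
  assumes "1 < p"
  shows "(nlin p \<mu>1 \<mu>2 \<beta> has_derivative (\<lambda>w. nlin_grad p \<mu>1 \<mu>2 \<beta> z \<bullet> w)) (at z)"
proof -
  have d: "((\<lambda>z. \<bar>fst z\<bar> powr q) has_derivative (\<lambda>w. q * sgn_powr q (fst z) * fst w)) (at z)"
    "((\<lambda>z. \<bar>snd z\<bar> powr q) has_derivative (\<lambda>w. q * sgn_powr q (snd z) * snd w)) (at z)"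
    if "1 < q" for q and z :: "real \<times> real"
    by (rule has_derivative_compose[OF has_derivative_fst[OF has_derivative_ident]
          abs_powr_has_derivative[OF that, unfolded has_field_derivative_def]])
      (rule has_derivative_compose[OF has_derivative_snd[OF has_derivative_ident]
        abs_powr_has_derivative[OF that, unfolded has_field_derivative_def]])
  have q: "1 < 2 * p" using assms by simp
  have "((\<lambda>z. \<mu>1 * \<bar>fst z\<bar> powr (2 * p) + \<mu>2 * \<bar>snd z\<bar> powr (2 * p)
      + 2 * \<beta> * (\<bar>fst z\<bar> powr p * \<bar>snd z\<bar> powr p)) has_derivative
    (\<lambda>w. \<mu>1 * (2 * p * sgn_powr (2 * p) (fst z) * fst w) + \<mu>2 * (2 * p * sgn_powr (2 * p) (snd z) * snd w)
      + 2 * \<beta> * (\<bar>fst z\<bar> powr p * (p * sgn_powr p (snd z) * snd w)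
        + p * sgn_powr p (fst z) * fst w * \<bar>snd z\<bar> powr p))) (at z)"
    by (rule has_derivative_add[OF has_derivative_add[OF has_derivative_mult_right[OF d(1)[OF q]]
            has_derivative_mult_right[OF d(2)[OF q]]]
          has_derivative_mult_right[OF has_derivative_mult[OF d(1)[OF assms] d(2)[OF assms]]]])
  then show ?thesis
    unfolding nlin_def[abs_def]
    by (rule has_derivative_eq_rhs) (simp add: nlin_grad_def inner_prod_def fun_eq_iff algebra_simps)
qed

lemma continuous_nlin_grad:
  assumes "1 < p"
  shows "continuous_on UNIV (nlin_grad p \<mu>1 \<mu>2 \<beta>)"
proof -
  have c: "continuous_on UNIV (\<lambda>z::real \<times> real. sgn_powr q (fst z))" "continuous_on UNIV (\<lambda>z::real \<times> real. sgn_powr q (snd z))"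
    if "1 < q" for q
    using continuous_on_compose2[OF continuous_sgn_powr[OF that] continuous_on_fst[OF continuous_on_id]]
      continuous_on_compose2[OF continuous_sgn_powr[OF that] continuous_on_snd[OF continuous_on_id]]
    by simp_all
  have a: "continuous_on UNIV (\<lambda>z::real \<times> real. \<bar>fst z\<bar> powr p)" "continuous_on UNIV (\<lambda>z::real \<times> real. \<bar>snd z\<bar> powr p)"
    using assms by (auto intro!: continuous_on_powr' continuous_on_rabs continuous_on_fst continuous_on_snd)
  have q: "1 < 2 * p" using assms by simp
  show ?thesis
    unfolding nlin_grad_def[abs_def]
    by (intro continuous_on_Pair continuous_on_add continuous_on_mult continuous_on_const a c[OF q] c[OF assms])
qed

lemma nlin_homogeneous:
  assumes "0 < t"
  shows "nlin p \<mu>1 \<mu>2 \<beta> (t *\<^sub>R z) = t powr (2 * p) * nlin p \<mu>1 \<mu>2 \<beta> z"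
    and "nlin_grad p \<mu>1 \<mu>2 \<beta> (t *\<^sub>R z) = t powr (2 * p - 1) *\<^sub>R nlin_grad p \<mu>1 \<mu>2 \<beta> z"
proof -
  have e: "t powr (2 * p) = t powr p * t powr p" "t powr (p * 2) = t powr p * t powr p"
    "t powr (2 * p - 1) = t powr (p - 1) * t powr p" "t powr (p * 2 - 1) = t powr (p - 1) * t powr p"
    by (simp_all add: powr_add[symmetric] mult.commute)
  show "nlin p \<mu>1 \<mu>2 \<beta> (t *\<^sub>R z) = t powr (2 * p) * nlin p \<mu>1 \<mu>2 \<beta> z"
    using assms by (simp add: nlin_def abs_mult powr_mult e algebra_simps)
  show "nlin_grad p \<mu>1 \<mu>2 \<beta> (t *\<^sub>R z) = t powr (2 * p - 1) *\<^sub>R nlin_grad p \<mu>1 \<mu>2 \<beta> z"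
    using assms by (simp add: nlin_grad_def abs_mult powr_mult sgn_powr_mult e algebra_simps)
qed

lemma nlin_bound:
  assumes "1 < p"
  obtains M where "0 \<le> M" "\<And>z. \<bar>nlin p \<mu>1 \<mu>2 \<beta> z\<bar> \<le> M * norm z powr (2 * p)"
    "\<And>z. norm (nlin_grad p \<mu>1 \<mu>2 \<beta> z) \<le> M * norm z powr (2 * p - 1)"
proof -
  have q: "1 < 2 * p" using assms by simp
  show thesis
    by (rule homogeneous_bound[OF q nlin_has_derivative[OF assms] continuous_nlin_grad[OF assms] nlin_homogeneous])
      (assumption | rule that)+
qed

lemma nlin_remainder:
  assumes "1 < p" "0 < \<eta>"
  obtains C where "0 \<le> C" "\<And>z w. \<bar>nlin p \<mu>1 \<mu>2 \<beta> (z + w) - nlin p \<mu>1 \<mu>2 \<beta> z - nlin_grad p \<mu>1 \<mu>2 \<beta> z \<bullet> w\<bar>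
    \<le> \<eta> * (norm z powr (2 * p - 1) * norm w) + C * norm w powr (2 * p)"
proof -
  have q: "1 < 2 * p" using assms by simp
  show thesis
    by (rule homogeneous_remainder[OF q nlin_has_derivative[OF assms(1)] continuous_nlin_grad[OF assms(1)]
          nlin_homogeneous assms(2)])
      (assumption | rule that)+
qed

section \<open>Integral estimates for the superposition term\<close>

lemma norm_Pair_powr_le:
  fixes a b :: real
  assumes "0 \<le> q"
  shows "norm (a, b) powr q \<le> 2 powr q * (\<bar>a\<bar> powr q + \<bar>b\<bar> powr q)"
proof -
  have "norm (a, b) \<le> \<bar>a\<bar> + \<bar>b\<bar>" using norm_Pair_le[of a b] by simp
  also have "\<dots> \<le> 2 * max \<bar>a\<bar> \<bar>b\<bar>" by simp
  finally have "norm (a, b) powr q \<le> (2 * max \<bar>a\<bar> \<bar>b\<bar>) powr q"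
    using assms by (intro powr_mono2) auto
  also have "\<dots> = 2 powr q * max \<bar>a\<bar> \<bar>b\<bar> powr q" by (simp add: powr_mult)
  also have "\<dots> \<le> 2 powr q * (\<bar>a\<bar> powr q + \<bar>b\<bar> powr q)"
    by (intro mult_left_mono) (auto simp: max_def)
  finally show ?thesis .
qed

text \<open>Compare b with T a. The weight T stays free: it will be the size of the increment in the
  differentiability proof and a small constant in the continuity proof.\<close>

lemma Young_powr:
  fixes a b T q :: real
  assumes "0 \<le> a" "0 \<le> b" "0 < T" "1 < q"
  shows "a powr (q - 1) * b \<le> T * a powr q + T powr (1 - q) * b powr q"
proof (cases "b \<le> T * a")
  case True
  have "a powr (q - 1) * b \<le> a powr (q - 1) * (T * a)" using True by (intro mult_left_mono) auto
  also have "\<dots> = T * a powr q" using assms(1) by (cases "a = 0") (auto simp: powr_diff)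
  finally show ?thesis by (simp add: add_increasing2)
next
  case False
  then have ab: "a \<le> b / T" using assms by (simp add: pos_le_divide_eq mult.commute)
  have "a powr (q - 1) * b \<le> (b / T) powr (q - 1) * b"
    using ab assms by (intro mult_right_mono powr_mono2) auto
  also have "\<dots> = T powr (1 - q) * b powr q"
    using assms by (cases "b = 0") (auto simp: powr_divide powr_diff field_simps)
  finally show ?thesis using assms by (simp add: add_increasing)
qed

lemma Pair_powr_integral:
  assumes h: "h \<in> H1" and k: "k \<in> H1" and "2 \<le> q"
  shows "integrable lborel (\<lambda>x. norm (h x, k x) powr q)"
    and "(\<integral>x. norm (h x, k x) powr q \<partial>lborel)
      \<le> 2 powr q * ((\<integral>x. \<bar>h x\<bar> powr q \<partial>lborel) + (\<integral>x. \<bar>k x\<bar> powr q \<partial>lborel))"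
proof -
  note [measurable] = square_integrable_measurable[OF H1_square_integrable[OF h]]
    square_integrable_measurable[OF H1_square_integrable[OF k]]
  note i = H1_powr_integrable[OF h \<open>2 \<le> q\<close>] H1_powr_integrable[OF k \<open>2 \<le> q\<close>]
  have dom: "integrable lborel (\<lambda>x. 2 powr q * (\<bar>h x\<bar> powr q + \<bar>k x\<bar> powr q))" using i by simp
  show int: "integrable lborel (\<lambda>x. norm (h x, k x) powr q)"
    by (rule Bochner_Integration.integrable_bound[OF dom])
      (use norm_Pair_powr_le[of q] \<open>2 \<le> q\<close> in auto)
  have "(\<integral>x. norm (h x, k x) powr q \<partial>lborel) \<le> (\<integral>x. 2 powr q * (\<bar>h x\<bar> powr q + \<bar>k x\<bar> powr q) \<partial>lborel)"
    using \<open>2 \<le> q\<close> by (intro integral_mono int dom norm_Pair_powr_le) auto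
  also have "\<dots> = 2 powr q * ((\<integral>x. \<bar>h x\<bar> powr q \<partial>lborel) + (\<integral>x. \<bar>k x\<bar> powr q \<partial>lborel))"
    using i by simp
  finally show "(\<integral>x. norm (h x, k x) powr q \<partial>lborel)
      \<le> 2 powr q * ((\<integral>x. \<bar>h x\<bar> powr q \<partial>lborel) + (\<integral>x. \<bar>k x\<bar> powr q \<partial>lborel))" .
qed

lemma borel_measurable_nlin_grad [measurable]: "1 < p \<Longrightarrow> nlin_grad p \<mu>1 \<mu>2 \<beta> \<in> borel_measurable borel"
  by (rule borel_measurable_continuous_onI[OF continuous_nlin_grad])

lemma R_eq_integral:
  assumes p: "1 < p" and u: "u \<in> H1" and v: "v \<in> H1"
  shows "integrable lborel (\<lambda>x. nlin p \<mu>1 \<mu>2 \<beta> (u x, v x))"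
    and "R p \<mu>1 \<mu>2 \<beta> u v = (\<integral>x. nlin p \<mu>1 \<mu>2 \<beta> (u x, v x) \<partial>lborel)"
proof -
  note [measurable] = square_integrable_measurable[OF H1_square_integrable[OF u]]
    square_integrable_measurable[OF H1_square_integrable[OF v]]
  have q: "2 \<le> 2 * p" using p by simp
  note i = H1_powr_integrable[OF u q] H1_powr_integrable[OF v q]
  have i0: "integrable lborel (\<lambda>x. \<bar>u x\<bar> powr p * \<bar>v x\<bar> powr p)"
  proof (rule Bochner_Integration.integrable_bound)
    show "integrable lborel (\<lambda>x. \<bar>u x\<bar> powr (2 * p) + \<bar>v x\<bar> powr (2 * p))" using i by simp
    show "AE x in lborel. norm (\<bar>u x\<bar> powr p * \<bar>v x\<bar> powr p) \<le> norm (\<bar>u x\<bar> powr (2 * p) + \<bar>v x\<bar> powr (2 * p))"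
    proof (intro AE_I2)
      fix x
      have e: "t powr (2 * p) = (t powr p)\<^sup>2" for t :: real
        by (simp add: power2_eq_square powr_add[symmetric])
      have "2 * (\<bar>u x\<bar> powr p * \<bar>v x\<bar> powr p) \<le> \<bar>u x\<bar> powr (2 * p) + \<bar>v x\<bar> powr (2 * p)"
        using sum_squares_bound[of "\<bar>u x\<bar> powr p" "\<bar>v x\<bar> powr p"] by (simp add: e mult.assoc)
      moreover have "0 \<le> \<bar>u x\<bar> powr p * \<bar>v x\<bar> powr p" by simp
      ultimately show "norm (\<bar>u x\<bar> powr p * \<bar>v x\<bar> powr p) \<le> norm (\<bar>u x\<bar> powr (2 * p) + \<bar>v x\<bar> powr (2 * p))"
        unfolding real_norm_def by linarith
    qed
  qed measurable
  show "integrable lborel (\<lambda>x. nlin p \<mu>1 \<mu>2 \<beta> (u x, v x))" using i i0 by (simp add: nlin_def)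
  show "R p \<mu>1 \<mu>2 \<beta> u v = (\<integral>x. nlin p \<mu>1 \<mu>2 \<beta> (u x, v x) \<partial>lborel)"
    using i i0 by (simp add: nlin_def R_def P_def P0_def abs_mult powr_mult)
qed

lemma integrable_nlin_grad:
  assumes p: "1 < p" and u: "u \<in> H1" "v \<in> H1" and h: "h \<in> H1" "k \<in> H1"
  shows "integrable lborel (\<lambda>x. nlin_grad p \<mu>1 \<mu>2 \<beta> (u x, v x) \<bullet> (h x, k x))"
proof -
  note [measurable] = square_integrable_measurable[OF H1_square_integrable[OF u(1)]]
    square_integrable_measurable[OF H1_square_integrable[OF u(2)]]
    square_integrable_measurable[OF H1_square_integrable[OF h(1)]]
    square_integrable_measurable[OF H1_square_integrable[OF h(2)]] borel_measurable_nlin_grad[OF p]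
  have q: "2 \<le> 2 * p" "1 < 2 * p" using p by auto
  obtain M where M: "0 \<le> M" "\<And>z. norm (nlin_grad p \<mu>1 \<mu>2 \<beta> z) \<le> M * norm z powr (2 * p - 1)"
    by (rule nlin_bound[of p \<mu>1 \<mu>2 \<beta>, OF p]) (rule that)
  show ?thesis
  proof (rule Bochner_Integration.integrable_bound)
    show "integrable lborel (\<lambda>x. M * (norm (u x, v x) powr (2 * p) + norm (h x, k x) powr (2 * p)))"
      using Pair_powr_integral(1)[OF u q(1)] Pair_powr_integral(1)[OF h q(1)] by simp
    show "AE x in lborel. norm (nlin_grad p \<mu>1 \<mu>2 \<beta> (u x, v x) \<bullet> (h x, k x))
        \<le> norm (M * (norm (u x, v x) powr (2 * p) + norm (h x, k x) powr (2 * p)))"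
    proof (intro AE_I2)
      fix x
      have "norm (nlin_grad p \<mu>1 \<mu>2 \<beta> (u x, v x) \<bullet> (h x, k x))
          \<le> norm (nlin_grad p \<mu>1 \<mu>2 \<beta> (u x, v x)) * norm (h x, k x)"
        unfolding real_norm_def by (rule Cauchy_Schwarz_ineq2)
      also have "\<dots> \<le> M * norm (u x, v x) powr (2 * p - 1) * norm (h x, k x)"
        by (intro mult_right_mono M) auto
      also have "\<dots> \<le> M * (norm (u x, v x) powr (2 * p) + norm (h x, k x) powr (2 * p))"
        using Young_powr[of "norm (u x, v x)" "norm (h x, k x)" 1 "2 * p"] q M(1)
        by (simp add: mult.assoc mult_left_mono)
      finally show "norm (nlin_grad p \<mu>1 \<mu>2 \<beta> (u x, v x) \<bullet> (h x, k x))
        \<le> norm (M * (norm (u x, v x) powr (2 * p) + norm (h x, k x) powr (2 * p)))"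
        by (rule order.trans) simp
    qed
  qed measurable
qed

text \<open>The pointwise expansion, integrated after \<open>Young_powr\<close> has split the mixed
  term. For increments of size T the factor T^(1 - 2 p) meets an integral of order T^(2 p), so both
  \<eta> terms are of order \<eta> T.\<close>

lemma R_remainder_bound:
  assumes p: "1 < p" and "0 < \<eta>"
  obtains C where "0 \<le> C" "\<And>u v h k T. u \<in> H1 \<Longrightarrow> v \<in> H1 \<Longrightarrow> h \<in> H1 \<Longrightarrow> k \<in> H1 \<Longrightarrow> 0 < T \<Longrightarrow>
    \<bar>R p \<mu>1 \<mu>2 \<beta> (\<lambda>x. u x + h x) (\<lambda>x. v x + k x) - R p \<mu>1 \<mu>2 \<beta> u v
      - (\<integral>x. nlin_grad p \<mu>1 \<mu>2 \<beta> (u x, v x) \<bullet> (h x, k x) \<partial>lborel)\<bar>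
    \<le> \<eta> * T * (\<integral>x. norm (u x, v x) powr (2 * p) \<partial>lborel)
      + (\<eta> * T powr (1 - 2 * p) + C) * (\<integral>x. norm (h x, k x) powr (2 * p) \<partial>lborel)"
proof -
  have q: "2 \<le> 2 * p" "1 < 2 * p" using p by auto
  obtain C where C: "0 \<le> C" "\<And>z w. \<bar>nlin p \<mu>1 \<mu>2 \<beta> (z + w) - nlin p \<mu>1 \<mu>2 \<beta> z - nlin_grad p \<mu>1 \<mu>2 \<beta> z \<bullet> w\<bar>
      \<le> \<eta> * (norm z powr (2 * p - 1) * norm w) + C * norm w powr (2 * p)"
    by (rule nlin_remainder[of p \<eta> \<mu>1 \<mu>2 \<beta>, OF p \<open>0 < \<eta>\<close>]) (rule that)
  show thesis
  proof (rule that[OF C(1)])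
    fix u v h k :: "pt \<Rightarrow> real" and T :: real
    assume H: "u \<in> H1" "v \<in> H1" "h \<in> H1" "k \<in> H1" and T: "0 < T"
    have s: "(\<lambda>x. u x + h x) \<in> H1" "(\<lambda>x. v x + k x) \<in> H1"
      using H l2_gradient_lincomb[of u _ h _ 1 1] l2_gradient_lincomb[of v _ k _ 1 1] square_integrable_add
      by (auto simp: H1_iff; blast)+
    let ?N = "nlin p \<mu>1 \<mu>2 \<beta>" and ?D = "\<lambda>x. nlin_grad p \<mu>1 \<mu>2 \<beta> (u x, v x) \<bullet> (h x, k x)"
    note i = R_eq_integral(1)[OF p s, of \<mu>1 \<mu>2 \<beta>] R_eq_integral(1)[OF p H(1,2), of \<mu>1 \<mu>2 \<beta>]
      integrable_nlin_grad[OF p H, of \<mu>1 \<mu>2 \<beta>]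
    note j = Pair_powr_integral(1)[OF H(1,2) q(1)] Pair_powr_integral(1)[OF H(3,4) q(1)]
    let ?A = "\<eta> * T" and ?B = "\<eta> * T powr (1 - 2 * p) + C"
    have pt: "\<bar>?N (u x + h x, v x + k x) - ?N (u x, v x) - ?D x\<bar>
        \<le> ?A * norm (u x, v x) powr (2 * p) + ?B * norm (h x, k x) powr (2 * p)" for x
    proof -
      have "\<bar>?N (u x + h x, v x + k x) - ?N (u x, v x) - ?D x\<bar>
          \<le> \<eta> * (norm (u x, v x) powr (2 * p - 1) * norm (h x, k x)) + C * norm (h x, k x) powr (2 * p)"
        using C(2)[of "(u x, v x)" "(h x, k x)"] by simp
      also have "\<dots> \<le> \<eta> * (T * norm (u x, v x) powr (2 * p) + T powr (1 - 2 * p) * norm (h x, k x) powr (2 * p))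
          + C * norm (h x, k x) powr (2 * p)"
        using \<open>0 < \<eta>\<close> T q by (intro add_right_mono mult_left_mono Young_powr) auto
      finally show ?thesis by (simp add: algebra_simps)
    qed
    have eq: "R p \<mu>1 \<mu>2 \<beta> (\<lambda>x. u x + h x) (\<lambda>x. v x + k x) - R p \<mu>1 \<mu>2 \<beta> u v - (\<integral>x. ?D x \<partial>lborel)
        = (\<integral>x. ?N (u x + h x, v x + k x) - ?N (u x, v x) - ?D x \<partial>lborel)"
      using i by (simp add: R_eq_integral(2)[OF p s] R_eq_integral(2)[OF p H(1,2)])
    have "\<bar>R p \<mu>1 \<mu>2 \<beta> (\<lambda>x. u x + h x) (\<lambda>x. v x + k x) - R p \<mu>1 \<mu>2 \<beta> u v - (\<integral>x. ?D x \<partial>lborel)\<bar>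
        \<le> (\<integral>x. \<bar>?N (u x + h x, v x + k x) - ?N (u x, v x) - ?D x\<bar> \<partial>lborel)"
      unfolding eq by simp
    also have "\<dots> \<le> (\<integral>x. ?A * norm (u x, v x) powr (2 * p) + ?B * norm (h x, k x) powr (2 * p) \<partial>lborel)"
      using i j by (intro integral_mono pt) auto
    also have "\<dots> = ?A * (\<integral>x. norm (u x, v x) powr (2 * p) \<partial>lborel) + ?B * (\<integral>x. norm (h x, k x) powr (2 * p) \<partial>lborel)"
      using j by simp
    finally show "\<bar>R p \<mu>1 \<mu>2 \<beta> (\<lambda>x. u x + h x) (\<lambda>x. v x + k x) - R p \<mu>1 \<mu>2 \<beta> u v - (\<integral>x. ?D x \<partial>lborel)\<bar>
      \<le> ?A * (\<integral>x. norm (u x, v x) powr (2 * p) \<partial>lborel) + ?B * (\<integral>x. norm (h x, k x) powr (2 * p) \<partial>lborel)" .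
  qed
qed

section \<open>Differentiability and Lagrange multipliers\<close>

text \<open>Little-o in the size of the pair, measured by any positive common bound T of the two
  norms. This postpones the product norm, and its possible value 0, to the end.\<close>

definition small_o :: "((pt \<Rightarrow> real) \<Rightarrow> (pt \<Rightarrow> real) \<Rightarrow> real) \<Rightarrow> bool" where
  "small_o r \<longleftrightarrow> (\<forall>\<epsilon>>0. \<exists>\<delta>>0. \<forall>h\<in>Esp. \<forall>k\<in>Esp. \<forall>T.
    normE h \<le> T \<longrightarrow> normE k \<le> T \<longrightarrow> 0 < T \<longrightarrow> T < \<delta> \<longrightarrow> \<bar>r h k\<bar> \<le> \<epsilon> * T)"

lemma small_oD:
  assumes "small_o r" "0 < \<epsilon>"
  obtains \<delta> where "0 < \<delta>" "\<And>h k T. h \<in> Esp \<Longrightarrow> k \<in> Esp \<Longrightarrow> normE h \<le> T \<Longrightarrow> normE k \<le> T \<Longrightarrow>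
    0 < T \<Longrightarrow> T < \<delta> \<Longrightarrow> \<bar>r h k\<bar> \<le> \<epsilon> * T"
proof -
  have "\<exists>\<delta>>0. \<forall>h\<in>Esp. \<forall>k\<in>Esp. \<forall>T. normE h \<le> T \<longrightarrow> normE k \<le> T \<longrightarrow> 0 < T \<longrightarrow> T < \<delta> \<longrightarrow> \<bar>r h k\<bar> \<le> \<epsilon> * T"
    using assms by (simp add: small_o_def)
  then obtain \<delta> where \<delta>: "0 < \<delta>" "\<forall>h\<in>Esp. \<forall>k\<in>Esp. \<forall>T. normE h \<le> T \<longrightarrow> normE k \<le> T \<longrightarrow> 0 < T \<longrightarrow> T < \<delta> \<longrightarrow> \<bar>r h k\<bar> \<le> \<epsilon> * T"
    by (elim exE conjE)
  show thesis by (rule that[OF \<delta>(1)]) (use \<delta>(2) in simp)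
qed

lemma small_o_add:
  assumes "small_o r" "small_o s"
  shows "small_o (\<lambda>h k. r h k + s h k)"
  unfolding small_o_def
proof (intro allI impI)
  fix \<epsilon> :: real assume "0 < \<epsilon>"
  then have e: "0 < \<epsilon> / 2" by simp
  obtain d1 where d1: "0 < d1" "\<And>h k T. h \<in> Esp \<Longrightarrow> k \<in> Esp \<Longrightarrow> normE h \<le> T \<Longrightarrow> normE k \<le> T \<Longrightarrow>
    0 < T \<Longrightarrow> T < d1 \<Longrightarrow> \<bar>r h k\<bar> \<le> \<epsilon> / 2 * T" by (rule small_oD[OF assms(1) e]) (rule that)
  obtain d2 where d2: "0 < d2" "\<And>h k T. h \<in> Esp \<Longrightarrow> k \<in> Esp \<Longrightarrow> normE h \<le> T \<Longrightarrow> normE k \<le> T \<Longrightarrow>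
    0 < T \<Longrightarrow> T < d2 \<Longrightarrow> \<bar>s h k\<bar> \<le> \<epsilon> / 2 * T" by (rule small_oD[OF assms(2) e]) (rule that)
  have "\<bar>r h k + s h k\<bar> \<le> \<epsilon> * T"
    if "h \<in> Esp" "k \<in> Esp" "normE h \<le> T" "normE k \<le> T" "0 < T" "T < min d1 d2" for h k T
    using d1(2)[OF that(1-5)] d2(2)[OF that(1-5)] that(6) by simp
  then show "\<exists>\<delta>>0. \<forall>h\<in>Esp. \<forall>k\<in>Esp. \<forall>T. normE h \<le> T \<longrightarrow> normE k \<le> T \<longrightarrow> 0 < T \<longrightarrow> T < \<delta> \<longrightarrow>
      \<bar>r h k + s h k\<bar> \<le> \<epsilon> * T"
    using d1(1) d2(1) by (intro exI[of _ "min d1 d2"]) auto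
qed

lemma small_o_cmult:
  assumes "small_o r"
  shows "small_o (\<lambda>h k. c * r h k)"
  unfolding small_o_def
proof (intro allI impI)
  fix \<epsilon> :: real assume "0 < \<epsilon>"
  then have e: "0 < \<epsilon> / (\<bar>c\<bar> + 1)" by simp
  obtain d where d: "0 < d" "\<And>h k T. h \<in> Esp \<Longrightarrow> k \<in> Esp \<Longrightarrow> normE h \<le> T \<Longrightarrow> normE k \<le> T \<Longrightarrow>
    0 < T \<Longrightarrow> T < d \<Longrightarrow> \<bar>r h k\<bar> \<le> \<epsilon> / (\<bar>c\<bar> + 1) * T" by (rule small_oD[OF assms e]) (rule that)
  have "\<bar>c * r h k\<bar> \<le> \<epsilon> * T"
    if "h \<in> Esp" "k \<in> Esp" "normE h \<le> T" "normE k \<le> T" "0 < T" "T < d" for h k T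
  proof -
    have "\<bar>c * r h k\<bar> \<le> (\<bar>c\<bar> + 1) * (\<epsilon> / (\<bar>c\<bar> + 1) * T)"
      unfolding abs_mult using d(2)[OF that] by (intro mult_mono) auto
    also have "\<dots> = \<epsilon> * T" by simp
    finally show ?thesis .
  qed
  then show "\<exists>\<delta>>0. \<forall>h\<in>Esp. \<forall>k\<in>Esp. \<forall>T. normE h \<le> T \<longrightarrow> normE k \<le> T \<longrightarrow> 0 < T \<longrightarrow> T < \<delta> \<longrightarrow>
      \<bar>c * r h k\<bar> \<le> \<epsilon> * T"
    using d(1) by blast
qed

lemma small_o_quadratic:
  assumes "\<And>h k T. h \<in> Esp \<Longrightarrow> k \<in> Esp \<Longrightarrow> normE h \<le> T \<Longrightarrow> normE k \<le> T \<Longrightarrow> 0 < T \<Longrightarrow> T < 1 \<Longrightarrow>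
    \<bar>r h k\<bar> \<le> C * T\<^sup>2"
  shows "small_o r"
  unfolding small_o_def
proof (intro allI impI)
  fix \<epsilon> :: real assume \<epsilon>: "0 < \<epsilon>"
  define d where "d = min 1 (\<epsilon> / (\<bar>C\<bar> + 1))"
  have d: "0 < d" using \<epsilon> by (simp add: d_def)
  have "\<bar>r h k\<bar> \<le> \<epsilon> * T"
    if "h \<in> Esp" "k \<in> Esp" "normE h \<le> T" "normE k \<le> T" "0 < T" "T < d" for h k T
  proof -
    have "\<bar>r h k\<bar> \<le> C * T\<^sup>2" using that by (intro assms) (auto simp: d_def)
    also have "\<dots> \<le> (\<bar>C\<bar> + 1) * T * T"
      using that by (auto simp: power2_eq_square mult.assoc intro!: mult_right_mono)
    also have "(\<bar>C\<bar> + 1) * T \<le> \<epsilon>"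
      using that(6) by (simp add: d_def pos_less_divide_eq mult.commute)
    finally show ?thesis using that(5) by simp
  qed
  then show "\<exists>\<delta>>0. \<forall>h\<in>Esp. \<forall>k\<in>Esp. \<forall>T. normE h \<le> T \<longrightarrow> normE k \<le> T \<longrightarrow> 0 < T \<longrightarrow> T < \<delta> \<longrightarrow> \<bar>r h k\<bar> \<le> \<epsilon> * T"
    using d by blast
qed

section \<open>Derivatives of the three energy terms\<close>

definition grad_form :: "(pt \<Rightarrow> real) \<Rightarrow> (pt \<Rightarrow> real) \<Rightarrow> real" where
  "grad_form u h = (\<integral>x. weak_grad u x \<bullet> weak_grad h x \<partial>lborel)"

lemma H1_lincomb:
  assumes "u \<in> H1" "v \<in> H1"
  shows "(\<lambda>x. a * u x + b * v x) \<in> H1"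
    and "AE x in lborel. weak_grad (\<lambda>x. a * u x + b * v x) x = a *\<^sub>R weak_grad u x + b *\<^sub>R weak_grad v x"
proof -
  note g = l2_gradient_lincomb[OF H1_square_integrable[OF assms(1)] l2_gradient_weak_grad[OF assms(1)]
      H1_square_integrable[OF assms(2)] l2_gradient_weak_grad[OF assms(2)], of a b]
  show H: "(\<lambda>x. a * u x + b * v x) \<in> H1"
    using g square_integrable_add[OF square_integrable_cmult[OF H1_square_integrable[OF assms(1)], of a]
      square_integrable_cmult[OF H1_square_integrable[OF assms(2)], of b]] by (auto simp: H1_iff)
  show "AE x in lborel. weak_grad (\<lambda>x. a * u x + b * v x) x = a *\<^sub>R weak_grad u x + b *\<^sub>R weak_grad v x"
    by (rule l2_gradient_unique[OF l2_gradient_weak_grad[OF H] g])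
qed

lemma weak_grad_square_integrable: "u \<in> H1 \<Longrightarrow> square_integrable (weak_grad u)"
  using l2_gradient_weak_grad by (simp add: l2_gradient_def)

lemma grad_form_lincomb:
  assumes "u \<in> H1" "h \<in> H1" "k \<in> H1"
  shows "grad_form u (\<lambda>x. a * h x + b * k x) = a * grad_form u h + b * grad_form u k"
proof -
  note s = weak_grad_square_integrable[OF assms(1)] weak_grad_square_integrable[OF assms(2)]
    weak_grad_square_integrable[OF assms(3)] weak_grad_square_integrable[OF H1_lincomb(1)[OF assms(2,3), of a b]]
  note [measurable] = square_integrable_measurable[OF s(1)] square_integrable_measurable[OF s(2)]
    square_integrable_measurable[OF s(3)] square_integrable_measurable[OF s(4)]
  have "grad_form u (\<lambda>x. a * h x + b * k x)
      = (\<integral>x. a * (weak_grad u x \<bullet> weak_grad h x) + b * (weak_grad u x \<bullet> weak_grad k x) \<partial>lborel)"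
    unfolding grad_form_def
    by (rule integral_cong_AE, measurable)
      (use H1_lincomb(2)[OF assms(2,3), of a b] in \<open>eventually_elim, simp add: inner_add_right\<close>)
  also have "\<dots> = a * grad_form u h + b * grad_form u k"
    using square_integrable_inner(1)[OF s(1,2)] square_integrable_inner(1)[OF s(1,3)] by (simp add: grad_form_def)
  finally show ?thesis .
qed

lemma Q_add:
  assumes "u \<in> H1" "h \<in> H1"
  shows "Q (\<lambda>x. u x + h x) = Q u + 2 * grad_form u h + Q h"
proof -
  have "Q (\<lambda>x. u x + h x) = (l2norm (\<lambda>x. weak_grad u x + weak_grad h x))\<^sup>2"
    using Q_eq[of "\<lambda>x. u x + h x" "\<lambda>x. weak_grad u x + weak_grad h x"]
      square_integrable_add[OF H1_square_integrable[OF assms(1)] H1_square_integrable[OF assms(2)]]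
      l2_gradient_lincomb[OF H1_square_integrable[OF assms(1)] l2_gradient_weak_grad[OF assms(1)]
      H1_square_integrable[OF assms(2)] l2_gradient_weak_grad[OF assms(2)], of 1 1] by simp
  also have "\<dots> = Q u + 2 * grad_form u h + Q h"
    unfolding l2norm_add_sq[OF weak_grad_square_integrable[OF assms(1)] weak_grad_square_integrable[OF assms(2)]]
    by (simp add: grad_form_def Q_eq_weak_grad)
  finally show ?thesis .
qed

definition mass_density_incr :: "(pt \<Rightarrow> real) \<Rightarrow> (pt \<Rightarrow> real) \<Rightarrow> (pt \<Rightarrow> real) \<Rightarrow> (pt \<Rightarrow> real) \<Rightarrow> pt \<Rightarrow> real" where
  "mass_density_incr u v h k x = 2 * (u x * h x + v x * k x)"

definition mass_density :: "(pt \<Rightarrow> real) \<Rightarrow> (pt \<Rightarrow> real) \<Rightarrow> pt \<Rightarrow> real" where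
  "mass_density u v x = (u x)\<^sup>2 + (v x)\<^sup>2"

lemma mass_density_add: "mass_density (\<lambda>x. u x + h x) (\<lambda>x. v x + k x) = (\<lambda>x. mass_density u v x + (mass_density_incr u v h k x + mass_density h k x))"
  by (simp add: mass_density_def mass_density_incr_def fun_eq_iff power2_sum algebra_simps)

lemma W0_density: "W0 u v = kernel_form ln (mass_density u v) (mass_density u v)"
  by (simp add: W0_eq mass_density_def[abs_def])

lemma mass_density_log_norm:
  obtains C where "0 < C"
    "\<And>u v. u \<in> Esp \<Longrightarrow> v \<in> Esp \<Longrightarrow> log_admissible (mass_density u v)"
    "\<And>u v h k. u \<in> Esp \<Longrightarrow> v \<in> Esp \<Longrightarrow> h \<in> Esp \<Longrightarrow> k \<in> Esp \<Longrightarrow> log_admissible (mass_density_incr u v h k)"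
    "\<And>u v. u \<in> Esp \<Longrightarrow> v \<in> Esp \<Longrightarrow> log_norm (mass_density u v) \<le> C * ((normE u)\<^sup>2 + (normE v)\<^sup>2)"
    "\<And>u v h k. u \<in> Esp \<Longrightarrow> v \<in> Esp \<Longrightarrow> h \<in> Esp \<Longrightarrow> k \<in> Esp \<Longrightarrow>
      log_norm (mass_density_incr u v h k) \<le> 2 * C * (normE u * normE h + normE v * normE k)"
proof -
  obtain C where C: "0 < C" and *: "\<And>u v. u \<in> Esp \<Longrightarrow> v \<in> Esp \<Longrightarrow>
    log_admissible (\<lambda>x. u x * v x) \<and> log_norm (\<lambda>x. u x * v x) \<le> C * normE u * normE v"
    by (rule Esp_mult_log_admissible) (rule that)
  have d: "mass_density u v = (\<lambda>x. u x * u x + v x * v x)" for u v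
    by (simp add: mass_density_def fun_eq_iff power2_eq_square)
  show thesis
  proof (rule that[OF C])
    fix u v h k assume E: "u \<in> Esp" "v \<in> Esp"
    note uu = *[OF E(1) E(1)] and vv = *[OF E(2) E(2)]
    show "log_admissible (mass_density u v)" unfolding d by (rule log_admissible_add(1)) (use uu vv in auto)
    show "log_norm (mass_density u v) \<le> C * ((normE u)\<^sup>2 + (normE v)\<^sup>2)"
      unfolding d using uu vv log_admissible_add(2)[of "\<lambda>x. u x * u x" "\<lambda>x. v x * v x"]
      by (simp add: power2_eq_square algebra_simps)
  next
    fix u v h k assume E: "u \<in> Esp" "v \<in> Esp" "h \<in> Esp" "k \<in> Esp"
    note uh = *[OF E(1) E(3)] and vk = *[OF E(2) E(4)]
    have a: "log_admissible (\<lambda>x. u x * h x + v x * k x)" by (rule log_admissible_add(1)) (use uh vk in auto)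
    show "log_admissible (mass_density_incr u v h k)"
      unfolding mass_density_incr_def[abs_def] by (rule log_admissible_cmult(1)[OF a])
    show "log_norm (mass_density_incr u v h k) \<le> 2 * C * (normE u * normE h + normE v * normE k)"
      unfolding mass_density_incr_def[abs_def] log_admissible_cmult(2)[OF a]
      using uh vk log_admissible_add(2)[of "\<lambda>x. u x * h x" "\<lambda>x. v x * k x"] by (simp add: algebra_simps)
  qed
qed

text \<open>The derivative of a bilinear form along the diagonal, composed with the linear part of
  the density increment.\<close>

definition W0_deriv :: "(pt \<Rightarrow> real) \<Rightarrow> (pt \<Rightarrow> real) \<Rightarrow> (pt \<Rightarrow> real) \<Rightarrow> (pt \<Rightarrow> real) \<Rightarrow> real" where
  "W0_deriv u v h k = kernel_form ln (mass_density u v) (mass_density_incr u v h k)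
    + kernel_form ln (mass_density_incr u v h k) (mass_density u v)"

lemma W0_deriv_lincomb:
  assumes "u \<in> Esp" "v \<in> Esp" "h \<in> Esp" "k \<in> Esp" "h' \<in> Esp" "k' \<in> Esp"
  shows "W0_deriv u v (\<lambda>x. a * h x + b * h' x) (\<lambda>x. a * k x + b * k' x)
    = a * W0_deriv u v h k + b * W0_deriv u v h' k'"
proof -
  obtain C where "0 < C"
    and ad: "\<And>u v. u \<in> Esp \<Longrightarrow> v \<in> Esp \<Longrightarrow> log_admissible (mass_density u v)"
    and ai: "\<And>u v h k. u \<in> Esp \<Longrightarrow> v \<in> Esp \<Longrightarrow> h \<in> Esp \<Longrightarrow> k \<in> Esp \<Longrightarrow> log_admissible (mass_density_incr u v h k)"
    and "\<And>u v. u \<in> Esp \<Longrightarrow> v \<in> Esp \<Longrightarrow> log_norm (mass_density u v) \<le> C * ((normE u)\<^sup>2 + (normE v)\<^sup>2)"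
    and "\<And>u v h k. u \<in> Esp \<Longrightarrow> v \<in> Esp \<Longrightarrow> h \<in> Esp \<Longrightarrow> k \<in> Esp \<Longrightarrow>
      log_norm (mass_density_incr u v h k) \<le> 2 * C * (normE u * normE h + normE v * normE k)"
    by (rule mass_density_log_norm) (rule that)
  have eq: "mass_density_incr u v (\<lambda>x. a * h x + b * h' x) (\<lambda>x. a * k x + b * k' x)
      = (\<lambda>x. a * mass_density_incr u v h k x + b * mass_density_incr u v h' k' x)"
    by (simp add: mass_density_incr_def fun_eq_iff algebra_simps)
  note A = ad[OF assms(1,2)] log_admissible_cmult(1)[OF ai[OF assms(1-4)], of a]
    log_admissible_cmult(1)[OF ai[OF assms(1,2,5,6)], of b]
  show ?thesis
    unfolding W0_deriv_def eq kernel_form_ln_add[OF A(2,3,1)] kernel_form_cmult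
    by (simp add: algebra_simps)
qed

text \<open>The density increment is a linear part plus a quadratic part. Once the derivative is
  removed, what remains pairs the quadratic part with the old density, or the whole increment with
  itself, and all of this is of order T^2.\<close>

lemma W0_small_o:
  assumes u: "u \<in> Esp" and v: "v \<in> Esp"
  shows "small_o (\<lambda>h k. W0 (\<lambda>x. u x + h x) (\<lambda>x. v x + k x) - W0 u v - W0_deriv u v h k)"
proof -
  obtain C where C: "0 < C"
    and ad: "\<And>u v. u \<in> Esp \<Longrightarrow> v \<in> Esp \<Longrightarrow> log_admissible (mass_density u v)"
    and ai: "\<And>u v h k. u \<in> Esp \<Longrightarrow> v \<in> Esp \<Longrightarrow> h \<in> Esp \<Longrightarrow> k \<in> Esp \<Longrightarrow> log_admissible (mass_density_incr u v h k)"
    and nd: "\<And>u v. u \<in> Esp \<Longrightarrow> v \<in> Esp \<Longrightarrow> log_norm (mass_density u v) \<le> C * ((normE u)\<^sup>2 + (normE v)\<^sup>2)"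
    and ni: "\<And>u v h k. u \<in> Esp \<Longrightarrow> v \<in> Esp \<Longrightarrow> h \<in> Esp \<Longrightarrow> k \<in> Esp \<Longrightarrow>
      log_norm (mass_density_incr u v h k) \<le> 2 * C * (normE u * normE h + normE v * normE k)"
    by (rule mass_density_log_norm) (rule that)
  define K where "K = 2 + ln_neg_norm"
  have K: "0 \<le> K" using ln_neg_norm_nonneg by (simp add: K_def del: ln_neg_norm_nonneg)
  define n where "n = log_norm (mass_density u v)"
  have n: "0 \<le> n" by (simp add: n_def)
  \<comment> \<open>A T will bound the norm of the whole density increment; the summand 2 C absorbs
    the quadratic part because T < 1.\<close>
  define A where "A = 2 * C * (normE u + normE v) + 2 * C"
  have A: "0 \<le> A" using C by (simp add: A_def)
  show ?thesis
  proof (rule small_o_quadratic)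
    fix h k T assume H: "h \<in> Esp" "k \<in> Esp" "normE h \<le> T" "normE k \<le> T" "0 < T" "T < 1"
    let ?\<rho> = "mass_density u v" and ?\<sigma> = "mass_density_incr u v h k" and ?\<tau> = "mass_density h k"
    note r = ad[OF u v] and s = ai[OF u v H(1,2)] and t = ad[OF H(1,2)]
    note st = log_admissible_add[OF s t]
    have eq: "W0 (\<lambda>x. u x + h x) (\<lambda>x. v x + k x) - W0 u v - W0_deriv u v h k
        = kernel_form ln ?\<rho> ?\<tau> + kernel_form ln ?\<tau> ?\<rho>
          + kernel_form ln (\<lambda>x. ?\<sigma> x + ?\<tau> x) (\<lambda>x. ?\<sigma> x + ?\<tau> x)"
      unfolding W0_density mass_density_add W0_deriv_def
      using kernel_form_ln_add(1)[OF r st(1) log_admissible_add(1)[OF r st(1)]]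
        kernel_form_ln_add(2)[OF r st(1) r] kernel_form_ln_add(2)[OF r st(1) st(1)]
        kernel_form_ln_add(2)[OF s t r] kernel_form_ln_add(1)[OF s t r] by simp
    have nt: "log_norm ?\<tau> \<le> 2 * C * T\<^sup>2"
    proof -
      have "log_norm ?\<tau> \<le> C * ((normE h)\<^sup>2 + (normE k)\<^sup>2)" by (rule nd[OF H(1,2)])
      also have "\<dots> \<le> C * (T\<^sup>2 + T\<^sup>2)" using C H by (intro mult_left_mono add_mono power_mono) auto
      finally show ?thesis by simp
    qed
    have "log_norm ?\<sigma> \<le> 2 * C * (normE u * T + normE v * T)"
      using C H by (intro order.trans[OF ni[OF u v H(1,2)]] mult_left_mono add_mono) auto
    moreover have "2 * C * T\<^sup>2 \<le> 2 * C * T" using C H by (simp add: power2_eq_square)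
    ultimately have nst: "log_norm (\<lambda>x. ?\<sigma> x + ?\<tau> x) \<le> A * T"
      using st(2) nt by (simp add: A_def algebra_simps)
    have 1: "\<bar>kernel_form ln ?\<rho> ?\<tau>\<bar> \<le> K * n * (2 * C * T\<^sup>2)"
      using K n nt by (intro order.trans[OF kernel_form_ln(2)[OF r t, folded K_def n_def]] mult_left_mono) auto
    have 2: "\<bar>kernel_form ln ?\<tau> ?\<rho>\<bar> \<le> K * n * (2 * C * T\<^sup>2)"
      using kernel_form_ln(2)[OF t r, folded K_def n_def] mult_left_mono[OF nt, of "K * n"] K n
      by (simp add: mult_ac)
    have 3: "\<bar>kernel_form ln (\<lambda>x. ?\<sigma> x + ?\<tau> x) (\<lambda>x. ?\<sigma> x + ?\<tau> x)\<bar> \<le> K * (A * T) * (A * T)"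
      using K A H(5) nst
      by (intro order.trans[OF kernel_form_ln(2)[OF st(1) st(1), folded K_def]] mult_mono) auto
    have "\<bar>kernel_form ln ?\<rho> ?\<tau> + kernel_form ln ?\<tau> ?\<rho>
        + kernel_form ln (\<lambda>x. ?\<sigma> x + ?\<tau> x) (\<lambda>x. ?\<sigma> x + ?\<tau> x)\<bar>
        \<le> K * n * (2 * C * T\<^sup>2) + K * n * (2 * C * T\<^sup>2) + K * (A * T) * (A * T)"
      using 1 2 3 by linarith
    also have "\<dots> = (4 * K * n * C + K * A\<^sup>2) * T\<^sup>2" by (simp add: power2_eq_square algebra_simps)
    finally show "\<bar>W0 (\<lambda>x. u x + h x) (\<lambda>x. v x + k x) - W0 u v - W0_deriv u v h k\<bar>
        \<le> (4 * K * n * C + K * A\<^sup>2) * T\<^sup>2" unfolding eq .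
  qed
qed

definition R_deriv :: "real \<Rightarrow> real \<Rightarrow> real \<Rightarrow> real \<Rightarrow> (pt \<Rightarrow> real) \<Rightarrow> (pt \<Rightarrow> real) \<Rightarrow> (pt \<Rightarrow> real) \<Rightarrow> (pt \<Rightarrow> real) \<Rightarrow> real" where
  "R_deriv p \<mu>1 \<mu>2 \<beta> u v h k = (\<integral>x. nlin_grad p \<mu>1 \<mu>2 \<beta> (u x, v x) \<bullet> (h x, k x) \<partial>lborel)"

lemma R_deriv_lincomb:
  assumes "1 < p" "u \<in> H1" "v \<in> H1" "h \<in> H1" "k \<in> H1" "h' \<in> H1" "k' \<in> H1"
  shows "R_deriv p \<mu>1 \<mu>2 \<beta> u v (\<lambda>x. a * h x + b * h' x) (\<lambda>x. a * k x + b * k' x)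
    = a * R_deriv p \<mu>1 \<mu>2 \<beta> u v h k + b * R_deriv p \<mu>1 \<mu>2 \<beta> u v h' k'"
proof -
  have "nlin_grad p \<mu>1 \<mu>2 \<beta> (u x, v x) \<bullet> (a * h x + b * h' x, a * k x + b * k' x)
      = a * (nlin_grad p \<mu>1 \<mu>2 \<beta> (u x, v x) \<bullet> (h x, k x)) + b * (nlin_grad p \<mu>1 \<mu>2 \<beta> (u x, v x) \<bullet> (h' x, k' x))" for x
    by (simp add: inner_prod_def algebra_simps)
  then show ?thesis
    unfolding R_deriv_def
    using integrable_nlin_grad[OF assms(1-5), of \<mu>1 \<mu>2 \<beta>] integrable_nlin_grad[OF assms(1-3,6,7), of \<mu>1 \<mu>2 \<beta>]
    by simp
qed

lemma R_small_o:
  assumes p: "1 < p" and u: "u \<in> Esp" and v: "v \<in> Esp"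
  shows "small_o (\<lambda>h k. R p \<mu>1 \<mu>2 \<beta> (\<lambda>x. u x + h x) (\<lambda>x. v x + k x) - R p \<mu>1 \<mu>2 \<beta> u v - R_deriv p \<mu>1 \<mu>2 \<beta> u v h k)"
  unfolding small_o_def
proof (intro allI impI)
  fix \<epsilon> :: real assume \<epsilon>: "0 < \<epsilon>"
  have q: "2 < 2 * p" "2 \<le> 2 * p" using p by auto
  obtain D where D: "0 < D" "\<And>u. u \<in> Esp \<Longrightarrow> (\<integral>x. \<bar>u x\<bar> powr (2 * p) \<partial>lborel) \<le> D * normE u powr (2 * p)"
    by (rule Esp_powr_bound[OF q(1)]) (rule that)
  define A where "A = (\<integral>x. norm (u x, v x) powr (2 * p) \<partial>lborel)"
  have A: "0 \<le> A" by (simp add: A_def)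
  define B where "B = 2 powr (2 * p) * (2 * D)"
  have B: "0 < B" using D by (simp add: B_def)
  \<comment> \<open>The \<eta> terms add up to \<eta> (A + B) T, half of the allowed error.\<close>
  define \<eta> where "\<eta> = \<epsilon> / (2 * (A + B))"
  have "\<epsilon> / (2 * c) * c = \<epsilon> / 2" if "0 < c" for c using that by simp
  from this[of "A + B"] have \<eta>: "0 < \<eta>" "\<eta> * (A + B) = \<epsilon> / 2"
    unfolding \<eta>_def using A B \<epsilon> by auto
  obtain C where C: "0 \<le> C" "\<And>u v h k T. u \<in> H1 \<Longrightarrow> v \<in> H1 \<Longrightarrow> h \<in> H1 \<Longrightarrow> k \<in> H1 \<Longrightarrow> 0 < T \<Longrightarrow>
    \<bar>R p \<mu>1 \<mu>2 \<beta> (\<lambda>x. u x + h x) (\<lambda>x. v x + k x) - R p \<mu>1 \<mu>2 \<beta> u v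
      - (\<integral>x. nlin_grad p \<mu>1 \<mu>2 \<beta> (u x, v x) \<bullet> (h x, k x) \<partial>lborel)\<bar>
    \<le> \<eta> * T * (\<integral>x. norm (u x, v x) powr (2 * p) \<partial>lborel)
      + (\<eta> * T powr (1 - 2 * p) + C) * (\<integral>x. norm (h x, k x) powr (2 * p) \<partial>lborel)"
    by (rule R_remainder_bound[of p \<eta> \<mu>1 \<mu>2 \<beta>, OF p \<eta>(1)]) (rule that)
  \<comment> \<open>The term left over is C B T^(2 p); below d it is at most \<epsilon> T / 2. The +
    1 covers C = 0.\<close>
  define d where "d = (\<epsilon> / (2 * (C * B + 1))) powr (1 / (2 * p - 1))"
  have CB: "0 < C * B + 1" using C B by (simp add: add_nonneg_pos)
  have d: "0 < d" using \<epsilon> CB by (simp add: d_def)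
  have "\<bar>R p \<mu>1 \<mu>2 \<beta> (\<lambda>x. u x + h x) (\<lambda>x. v x + k x) - R p \<mu>1 \<mu>2 \<beta> u v - R_deriv p \<mu>1 \<mu>2 \<beta> u v h k\<bar> \<le> \<epsilon> * T"
    if H: "h \<in> Esp" "k \<in> Esp" "normE h \<le> T" "normE k \<le> T" "0 < T" "T < d" for h k T
  proof -
    have int: "(\<integral>x. norm (h x, k x) powr (2 * p) \<partial>lborel) \<le> B * T powr (2 * p)"
    proof -
      have "(\<integral>x. norm (h x, k x) powr (2 * p) \<partial>lborel)
          \<le> 2 powr (2 * p) * ((\<integral>x. \<bar>h x\<bar> powr (2 * p) \<partial>lborel) + (\<integral>x. \<bar>k x\<bar> powr (2 * p) \<partial>lborel))"
        by (rule Pair_powr_integral(2)[OF Esp_H1[OF H(1)] Esp_H1[OF H(2)] q(2)])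
      also have "\<dots> \<le> 2 powr (2 * p) * (D * T powr (2 * p) + D * T powr (2 * p))"
        using D H q by (intro mult_left_mono add_mono order.trans[OF D(2)] powr_mono2) auto
      finally show ?thesis by (simp add: B_def)
    qed
    have "T powr (2 * p - 1) \<le> d powr (2 * p - 1)" using H p by (intro powr_mono2) auto
    also have "\<dots> = \<epsilon> / (2 * (C * B + 1))" using p \<epsilon> CB by (simp add: d_def powr_powr)
    finally have T1: "T powr (2 * p - 1) * (C * B + 1) \<le> \<epsilon> / 2" using CB by (simp add: pos_le_divide_eq algebra_simps)
    have T2: "T powr (2 * p) = T * T powr (2 * p - 1)" "T powr (1 - 2 * p) * T powr (2 * p) = T"
      using H(5) by (simp_all add: powr_diff powr_add[symmetric])
    have "\<bar>R p \<mu>1 \<mu>2 \<beta> (\<lambda>x. u x + h x) (\<lambda>x. v x + k x) - R p \<mu>1 \<mu>2 \<beta> u v - R_deriv p \<mu>1 \<mu>2 \<beta> u v h k\<bar>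
        \<le> \<eta> * T * A + (\<eta> * T powr (1 - 2 * p) + C) * (\<integral>x. norm (h x, k x) powr (2 * p) \<partial>lborel)"
      unfolding R_deriv_def A_def by (rule C(2)) (use H u v Esp_H1 in auto)
    also have "\<dots> \<le> \<eta> * T * A + (\<eta> * T powr (1 - 2 * p) + C) * (B * T powr (2 * p))"
      using \<eta> C int by (intro add_left_mono mult_left_mono) auto
    also have "\<dots> = \<eta> * T * A + \<eta> * B * (T powr (1 - 2 * p) * T powr (2 * p)) + C * B * T powr (2 * p)"
      by (simp add: algebra_simps)
    also have "\<dots> = (\<eta> * (A + B)) * T + T * (T powr (2 * p - 1) * (C * B))"
      unfolding T2(2) unfolding T2(1) by (simp add: algebra_simps)
    also have "\<dots> \<le> \<epsilon> / 2 * T + T * (\<epsilon> / 2)"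
    proof -
      have "T powr (2 * p - 1) * (C * B) \<le> \<epsilon> / 2"
        by (rule order.trans[OF _ T1]) (intro mult_left_mono, auto)
      then show ?thesis unfolding \<eta>(2) using H(5) by (intro add_left_mono mult_left_mono) auto
    qed
    finally show ?thesis by (simp add: field_simps)
  qed
  then show "\<exists>\<delta>>0. \<forall>h\<in>Esp. \<forall>k\<in>Esp. \<forall>T. normE h \<le> T \<longrightarrow> normE k \<le> T \<longrightarrow> 0 < T \<longrightarrow> T < \<delta> \<longrightarrow>
      \<bar>R p \<mu>1 \<mu>2 \<beta> (\<lambda>x. u x + h x) (\<lambda>x. v x + k x) - R p \<mu>1 \<mu>2 \<beta> u v - R_deriv p \<mu>1 \<mu>2 \<beta> u v h k\<bar> \<le> \<epsilon> * T"
    using d by blast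
qed

definition I_deriv :: "real \<Rightarrow> real \<Rightarrow> real \<Rightarrow> real \<Rightarrow> (pt \<Rightarrow> real) \<Rightarrow> (pt \<Rightarrow> real) \<Rightarrow> (pt \<Rightarrow> real) \<Rightarrow> (pt \<Rightarrow> real) \<Rightarrow> real" where
  "I_deriv p \<mu>1 \<mu>2 \<beta> u v h k = grad_form u h + grad_form v k + W0_deriv u v h k / 4 - R_deriv p \<mu>1 \<mu>2 \<beta> u v h k / (2 * p)"

lemma I_deriv_lincomb:
  assumes "1 < p" "u \<in> Esp" "v \<in> Esp" "h \<in> Esp" "k \<in> Esp" "h' \<in> Esp" "k' \<in> Esp"
  shows "I_deriv p \<mu>1 \<mu>2 \<beta> u v (\<lambda>x. a * h x + b * h' x) (\<lambda>x. a * k x + b * k' x)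
    = a * I_deriv p \<mu>1 \<mu>2 \<beta> u v h k + b * I_deriv p \<mu>1 \<mu>2 \<beta> u v h' k'"
  unfolding I_deriv_def W0_deriv_lincomb[OF assms(2-7)]
    R_deriv_lincomb[OF assms(1) assms(2-7)[THEN Esp_H1]]
    grad_form_lincomb[OF assms(2,4,6)[THEN Esp_H1]] grad_form_lincomb[OF assms(3,5,7)[THEN Esp_H1]]
  by (simp add: algebra_simps add_divide_distrib diff_divide_distrib)

lemma Ifun_small_o:
  assumes p: "1 < p" and u: "u \<in> Esp" and v: "v \<in> Esp"
  shows "small_o (\<lambda>h k. Ifun p \<mu>1 \<mu>2 \<beta> (\<lambda>x. u x + h x) (\<lambda>x. v x + k x) - Ifun p \<mu>1 \<mu>2 \<beta> u v - I_deriv p \<mu>1 \<mu>2 \<beta> u v h k)"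
proof -
  have "small_o (\<lambda>h k. (Q h + Q k) / 2)"
  proof (rule small_o_quadratic[where C=1])
    fix h k T assume H: "h \<in> Esp" "k \<in> Esp" "normE h \<le> T" "normE k \<le> T" "0 < T" "T < (1::real)"
    have "Q h \<le> T\<^sup>2" "Q k \<le> T\<^sup>2"
      using normE_ge(1)[of h] normE_ge(1)[of k] power_mono[OF H(3), of 2] power_mono[OF H(4), of 2] by auto
    then show "\<bar>(Q h + Q k) / 2\<bar> \<le> 1 * T\<^sup>2" using Q_nonneg[of h] Q_nonneg[of k] by simp
  qed
  from small_o_add[OF this small_o_add[OF small_o_cmult[OF W0_small_o[OF u v], of "1/4"]
      small_o_cmult[OF R_small_o[OF p u v, of \<mu>1 \<mu>2 \<beta>], of "- 1 / (2 * p)"]]]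
  have *: "small_o (\<lambda>h k. (Q h + Q k) / 2 + (1 / 4 * (W0 (\<lambda>x. u x + h x) (\<lambda>x. v x + k x) - W0 u v - W0_deriv u v h k)
    + - 1 / (2 * p) * (R p \<mu>1 \<mu>2 \<beta> (\<lambda>x. u x + h x) (\<lambda>x. v x + k x) - R p \<mu>1 \<mu>2 \<beta> u v - R_deriv p \<mu>1 \<mu>2 \<beta> u v h k)))" .
  have eq: "Ifun p \<mu>1 \<mu>2 \<beta> (\<lambda>x. u x + h x) (\<lambda>x. v x + k x) - Ifun p \<mu>1 \<mu>2 \<beta> u v - I_deriv p \<mu>1 \<mu>2 \<beta> u v h k
    = (Q h + Q k) / 2 + (1 / 4 * (W0 (\<lambda>x. u x + h x) (\<lambda>x. v x + k x) - W0 u v - W0_deriv u v h k)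
    + - 1 / (2 * p) * (R p \<mu>1 \<mu>2 \<beta> (\<lambda>x. u x + h x) (\<lambda>x. v x + k x) - R p \<mu>1 \<mu>2 \<beta> u v - R_deriv p \<mu>1 \<mu>2 \<beta> u v h k))"
    if "h \<in> Esp" "k \<in> Esp" for h k
    using Q_add[OF Esp_H1[OF u] Esp_H1[OF that(1)]] Q_add[OF Esp_H1[OF v] Esp_H1[OF that(2)]]
    by (simp add: Ifun_def I_deriv_def diff_divide_distrib add_divide_distrib)
  show ?thesis using * unfolding small_o_def by (simp only: eq cong: ball_cong)
qed

text \<open>For g orthogonal to u the curve sqrt (1 - s t^2) u + t g, with s = |g|^2 / c in the L^2
  norm, stays on the sphere. Minimality along it gives \<Lambda> g >= 0, and - g gives equality. A
  general h differs from such a g by a multiple of u. The curve is evaluated at one small t instead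
  of being differentiated.\<close>

lemma tangent_derivative:
  fixes J \<Lambda> :: "(pt \<Rightarrow> real) \<Rightarrow> real"
  assumes c: "0 < c" and u: "u \<in> Sc c" and min: "\<And>w. w \<in> Sc c \<Longrightarrow> J u \<le> J w"
    and lin: "\<And>h k a b. h \<in> Esp \<Longrightarrow> k \<in> Esp \<Longrightarrow> \<Lambda> (\<lambda>x. a * h x + b * k x) = a * \<Lambda> h + b * \<Lambda> k"
    and small: "\<And>\<epsilon>. 0 < \<epsilon> \<Longrightarrow> \<exists>\<delta>>0. \<forall>h\<in>Esp. \<forall>T. normE h \<le> T \<longrightarrow> 0 < T \<longrightarrow> T < \<delta> \<longrightarrow>
      \<bar>J (\<lambda>x. u x + h x) - J u - \<Lambda> h\<bar> \<le> \<epsilon> * T"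
    and h: "h \<in> Esp"
  shows "\<Lambda> h = \<Lambda> u / c * (\<integral>x. u x * h x \<partial>lborel)"
proof -
  have uE: "u \<in> Esp" and uc: "(l2norm u)\<^sup>2 = c" using u by (auto simp: Sc_Esp Sc_l2norm)
  have nonneg: "0 \<le> \<Lambda> g" if g: "g \<in> Esp" and orth: "(\<integral>x. u x * g x \<partial>lborel) = 0" for g
  proof (rule field_le_epsilon)
    fix e :: real assume e: "0 < e"
    define s where "s = (l2norm g)\<^sup>2 / c"
    have s: "0 \<le> s" using c by (simp add: s_def)
    define a where "a t = sqrt (1 - s * t\<^sup>2)" for t
    \<comment> \<open>K t bounds the E-norm of the displacement from u, whose coefficient of u is at
      most s t^2 <= s t in absolute value.\<close>
    define K where "K = sqrt (2 * s\<^sup>2 * (normE u)\<^sup>2 + 2 * (normE g)\<^sup>2) + 1"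
    have K: "0 < K" by (simp add: K_def add_nonneg_pos)
    define \<epsilon> where "\<epsilon> = e / (2 * K)"
    have \<epsilon>: "0 < \<epsilon>" "\<epsilon> * K = e / 2" using e K by (auto simp: \<epsilon>_def)
    obtain \<delta> where \<delta>: "0 < \<delta>" "\<And>h T. h \<in> Esp \<Longrightarrow> normE h \<le> T \<Longrightarrow> 0 < T \<Longrightarrow> T < \<delta> \<Longrightarrow>
      \<bar>J (\<lambda>x. u x + h x) - J u - \<Lambda> h\<bar> \<le> \<epsilon> * T" using small[OF \<epsilon>(1)] by blast
    \<comment> \<open>The three bounds keep the root real, keep the displacement below \<delta>, and
      make the effect of the second-order shrinking of u at most e / 2.\<close>
    define t where "t = min (min (1 / (s + 1)) (\<delta> / (2 * K))) (e / (2 * (s * \<bar>\<Lambda> u\<bar> + 1)))"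
    have sL: "0 < s * \<bar>\<Lambda> u\<bar> + 1" using s by (simp add: add_nonneg_pos)
    have t: "0 < t" using \<delta>(1) K e s sL by (simp add: t_def)
    have t1: "t * (s + 1) \<le> 1"
    proof -
      have "t \<le> 1 / (s + 1)" by (simp add: t_def)
      then show ?thesis using s by (simp add: pos_le_divide_eq)
    qed
    have t2: "K * t < \<delta>"
    proof -
      have "t \<le> \<delta> / (2 * K)" by (simp add: t_def)
      then have "t * (2 * K) \<le> \<delta>" using K by (simp add: pos_le_divide_eq)
      moreover have "t * (2 * K) = 2 * (K * t)" by simp
      ultimately show ?thesis using mult_pos_pos[OF K t] by linarith
    qed
    have t3: "t * (s * \<bar>\<Lambda> u\<bar>) \<le> e / 2"
    proof -
      have "t \<le> e / (2 * (s * \<bar>\<Lambda> u\<bar> + 1))" by (simp add: t_def)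
      then have "t * (s * \<bar>\<Lambda> u\<bar> + 1) \<le> e / 2" using sL by (simp add: pos_le_divide_eq mult_ac)
      then show ?thesis using t by (simp add: distrib_left)
    qed
    have tle: "t \<le> 1" using t1 s t by (smt (verit) mult_left_mono mult_cancel_left1)
    have st: "s * t\<^sup>2 \<le> 1"
    proof -
      have "s * t\<^sup>2 \<le> s * t" using s t tle by (simp add: power2_eq_square mult_left_mono mult_left_le)
      then show ?thesis using t1 t by (simp add: algebra_simps)
    qed
    have a: "0 \<le> a t" "a t \<le> 1" "(a t)\<^sup>2 = 1 - s * t\<^sup>2" "1 - a t \<le> s * t\<^sup>2"
    proof -
      show a0: "0 \<le> a t" and a1: "a t \<le> 1" and a2: "(a t)\<^sup>2 = 1 - s * t\<^sup>2" using st s by (auto simp: a_def)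
      have "(a t)\<^sup>2 \<le> a t" using a0 a1 by (simp add: power2_eq_square mult_left_le)
      then show "1 - a t \<le> s * t\<^sup>2" using a2 by linarith
    qed
    let ?w = "\<lambda>x. (a t - 1) * u x + t * g x"
    have wE: "?w \<in> Esp" by (rule Esp_lincomb(1)[OF uE g])
    have eqw: "(\<lambda>x. u x + ?w x) = (\<lambda>x. a t * u x + t * g x)" by (simp add: fun_eq_iff algebra_simps)
    have "(l2norm (\<lambda>x. a t * u x + t * g x))\<^sup>2 = c"
    proof -
      have "(\<integral>x. (a t * u x) \<bullet> (t * g x) \<partial>lborel) = a t * t * (\<integral>x. u x * g x \<partial>lborel)"
        by (simp add: mult_ac flip: integral_mult_right_zero)
      then have "(l2norm (\<lambda>x. a t * u x + t * g x))\<^sup>2 = (a t)\<^sup>2 * c + t\<^sup>2 * (l2norm g)\<^sup>2"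
        using l2norm_add_sq[OF square_integrable_cmult[OF Esp_square_integrable[OF uE], of "a t"]
            square_integrable_cmult[OF Esp_square_integrable[OF g], of t]] orth uc
        by (simp add: l2norm_cmult power_mult_distrib)
      then show ?thesis using c by (simp add: a(3) s_def algebra_simps)
    qed
    then have "(\<lambda>x. u x + ?w x) \<in> Sc c"
      unfolding eqw using Esp_lincomb(1)[OF uE g, of "a t" t] by (simp add: Sc_def l2norm_sq_real)
    then have min': "J u \<le> J (\<lambda>x. u x + ?w x)" by (rule min)
    have nw: "normE ?w \<le> K * t"
    proof -
      have "(a t - 1)\<^sup>2 \<le> (s * t)\<^sup>2"
      proof -
        have "\<bar>a t - 1\<bar> \<le> s * t\<^sup>2" using a by simp
        also have "\<dots> \<le> s * t" using s t tle by (simp add: power2_eq_square mult_left_mono mult_left_le)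
        finally show ?thesis using s t by (subst abs_le_square_iff[symmetric]) simp
      qed
      then have "2 * (a t - 1)\<^sup>2 * (normE u)\<^sup>2 \<le> 2 * (s * t)\<^sup>2 * (normE u)\<^sup>2"
        by (intro mult_right_mono mult_left_mono) auto
      then have "(normE ?w)\<^sup>2 \<le> 2 * (s * t)\<^sup>2 * (normE u)\<^sup>2 + 2 * t\<^sup>2 * (normE g)\<^sup>2"
        using Esp_lincomb(2)[OF uE g, of "a t - 1" t] by linarith
      also have "\<dots> = (sqrt (2 * s\<^sup>2 * (normE u)\<^sup>2 + 2 * (normE g)\<^sup>2) * t)\<^sup>2"
        by (simp add: power_mult_distrib algebra_simps)
      also have "\<dots> \<le> (K * t)\<^sup>2"
        using t by (intro power_mono mult_right_mono) (auto simp: K_def)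
      finally show ?thesis by (rule power2_le_imp_le) (use K t in auto)
    qed
    have "\<bar>J (\<lambda>x. u x + ?w x) - J u - \<Lambda> ?w\<bar> \<le> \<epsilon> * (K * t)"
      by (rule \<delta>(2)[OF wE nw _ t2]) (use K t in simp)
    then have "- (\<epsilon> * K) * t \<le> \<Lambda> ?w" using min' by (simp add: mult.assoc)
    also have "\<Lambda> ?w = (a t - 1) * \<Lambda> u + t * \<Lambda> g" by (rule lin[OF uE g])
    also have "(a t - 1) * \<Lambda> u \<le> (s * t\<^sup>2) * \<bar>\<Lambda> u\<bar>"
    proof -
      have "(a t - 1) * \<Lambda> u \<le> \<bar>a t - 1\<bar> * \<bar>\<Lambda> u\<bar>" by (metis abs_ge_self abs_mult)
      also have "\<dots> \<le> (s * t\<^sup>2) * \<bar>\<Lambda> u\<bar>" using a by (intro mult_right_mono) auto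
      finally show ?thesis .
    qed
    finally have "0 \<le> t * (\<Lambda> g + \<epsilon> * K + t * (s * \<bar>\<Lambda> u\<bar>))" by (simp add: algebra_simps power2_eq_square)
    then have "0 \<le> \<Lambda> g + \<epsilon> * K + t * (s * \<bar>\<Lambda> u\<bar>)" using t by (simp add: zero_le_mult_iff)
    then show "0 \<le> \<Lambda> g + e" using t3 \<epsilon>(2) by linarith
  qed
  have zero: "\<Lambda> g = 0" if g: "g \<in> Esp" and orth: "(\<integral>x. u x * g x \<partial>lborel) = 0" for g
  proof -
    have "0 \<le> \<Lambda> (\<lambda>x. (-1) * g x + 0 * g x)"
      by (rule nonneg[OF Esp_lincomb(1)[OF g g]]) (simp add: orth)
    then show ?thesis using nonneg[OF g orth] lin[OF g g, of "-1" 0] by simp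
  qed
  \<comment> \<open>Adding b u removes the component of h along u.\<close>
  define b where "b = - (\<integral>x. u x * h x \<partial>lborel) / c"
  have "(\<integral>x. u x * (1 * h x + b * u x) \<partial>lborel) = (\<integral>x. u x * h x + b * (u x)\<^sup>2 \<partial>lborel)"
    by (simp add: algebra_simps power2_eq_square)
  also have "\<dots> = (\<integral>x. u x * h x \<partial>lborel) + b * c"
    using square_integrable_mult(1)[OF Esp_square_integrable[OF uE] Esp_square_integrable[OF h]]
      square_integrable_integrable[OF Esp_square_integrable[OF uE]] uc by (simp add: l2norm_sq_real)
  also have "\<dots> = 0" using c by (simp add: b_def)
  finally have "\<Lambda> (\<lambda>x. 1 * h x + b * u x) = 0" by (rule zero[OF Esp_lincomb(1)[OF h uE]])
  then show ?thesis using lin[OF h uE, of 1 b] c by (simp add: b_def field_simps)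
qed

text \<open>Each component minimises with the other one frozen, so \<open>tangent_derivative\<close>
  gives one multiplier per sphere; linearity of the derivative in (h, k) adds the two
  identities.\<close>

lemma minimizer_crit:
  assumes p: "1 < p" and c: "0 < c1" "0 < c2" and u: "u \<in> Sc c1" and v: "v \<in> Sc c2"
    and min: "\<And>w z. w \<in> Sc c1 \<Longrightarrow> z \<in> Sc c2 \<Longrightarrow> Ifun p \<mu>1 \<mu>2 \<beta> u v \<le> Ifun p \<mu>1 \<mu>2 \<beta> w z"
  obtains l1 l2 where "crit p \<mu>1 \<mu>2 \<beta> c1 c2 l1 l2 u v"
proof -
  note E = Sc_Esp[OF u] Sc_Esp[OF v]
  let ?I = "Ifun p \<mu>1 \<mu>2 \<beta>" and ?D = "I_deriv p \<mu>1 \<mu>2 \<beta> u v"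
  note so = Ifun_small_o[OF p E, of \<mu>1 \<mu>2 \<beta>]
  define l1 where "l1 = - ?D u (\<lambda>x. 0) / c1"
  define l2 where "l2 = - ?D (\<lambda>x. 0) v / c2"
  have D1: "?D h (\<lambda>x. 0) = - l1 * (\<integral>x. u x * h x \<partial>lborel)" if h: "h \<in> Esp" for h
  proof -
    have "?D h (\<lambda>x. 0) = ?D u (\<lambda>x. 0) / c1 * (\<integral>x. u x * h x \<partial>lborel)"
    proof (rule tangent_derivative[OF c(1) u _ _ _ h, where J="\<lambda>w. ?I w v"])
      show "?I u v \<le> ?I w v" if "w \<in> Sc c1" for w by (rule min[OF that v])
      show "?D (\<lambda>x. a * h x + b * k x) (\<lambda>x. 0) = a * ?D h (\<lambda>x. 0) + b * ?D k (\<lambda>x. 0)"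
        if "h \<in> Esp" "k \<in> Esp" for h k a b
        using I_deriv_lincomb[OF p E that(1) Esp_zero that(2) Esp_zero, of \<mu>1 \<mu>2 \<beta> a b] by simp
      fix \<epsilon> :: real assume "0 < \<epsilon>"
      then obtain \<delta> where \<delta>: "0 < \<delta>" "\<And>h k T. h \<in> Esp \<Longrightarrow> k \<in> Esp \<Longrightarrow> normE h \<le> T \<Longrightarrow> normE k \<le> T \<Longrightarrow>
        0 < T \<Longrightarrow> T < \<delta> \<Longrightarrow> \<bar>?I (\<lambda>x. u x + h x) (\<lambda>x. v x + k x) - ?I u v - ?D h k\<bar> \<le> \<epsilon> * T"
        by (rule small_oD[OF so]) (rule that)
      show "\<exists>\<delta>>0. \<forall>h\<in>Esp. \<forall>T. normE h \<le> T \<longrightarrow> 0 < T \<longrightarrow> T < \<delta> \<longrightarrow>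
          \<bar>?I (\<lambda>x. u x + h x) v - ?I u v - ?D h (\<lambda>x. 0)\<bar> \<le> \<epsilon> * T"
        using \<delta>(1) \<delta>(2)[OF _ Esp_zero] by (intro exI[of _ \<delta>]) (simp add: normE_zero less_imp_le)
    qed
    then show ?thesis by (simp add: l1_def)
  qed
  have D2: "?D (\<lambda>x. 0) k = - l2 * (\<integral>x. v x * k x \<partial>lborel)" if k: "k \<in> Esp" for k
  proof -
    have "?D (\<lambda>x. 0) k = ?D (\<lambda>x. 0) v / c2 * (\<integral>x. v x * k x \<partial>lborel)"
    proof (rule tangent_derivative[OF c(2) v _ _ _ k, where J="\<lambda>z. ?I u z"])
      show "?I u v \<le> ?I u w" if "w \<in> Sc c2" for w by (rule min[OF u that])
      show "?D (\<lambda>x. 0) (\<lambda>x. a * h x + b * k x) = a * ?D (\<lambda>x. 0) h + b * ?D (\<lambda>x. 0) k"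
        if "h \<in> Esp" "k \<in> Esp" for h k a b
        using I_deriv_lincomb[OF p E Esp_zero that(1) Esp_zero that(2), of \<mu>1 \<mu>2 \<beta> a b] by simp
      fix \<epsilon> :: real assume "0 < \<epsilon>"
      then obtain \<delta> where \<delta>: "0 < \<delta>" "\<And>h k T. h \<in> Esp \<Longrightarrow> k \<in> Esp \<Longrightarrow> normE h \<le> T \<Longrightarrow> normE k \<le> T \<Longrightarrow>
        0 < T \<Longrightarrow> T < \<delta> \<Longrightarrow> \<bar>?I (\<lambda>x. u x + h x) (\<lambda>x. v x + k x) - ?I u v - ?D h k\<bar> \<le> \<epsilon> * T"
        by (rule small_oD[OF so]) (rule that)
      show "\<exists>\<delta>>0. \<forall>h\<in>Esp. \<forall>T. normE h \<le> T \<longrightarrow> 0 < T \<longrightarrow> T < \<delta> \<longrightarrow>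
          \<bar>?I u (\<lambda>x. v x + h x) - ?I u v - ?D (\<lambda>x. 0) h\<bar> \<le> \<epsilon> * T"
        using \<delta>(1) \<delta>(2)[OF Esp_zero] by (intro exI[of _ \<delta>]) (simp add: normE_zero less_imp_le)
    qed
    then show ?thesis by (simp add: l2_def)
  qed
  have D: "?D h k = - l1 * (\<integral>x. u x * h x \<partial>lborel) - l2 * (\<integral>x. v x * k x \<partial>lborel)"
    if "h \<in> Esp" "k \<in> Esp" for h k
    using I_deriv_lincomb[OF p E that(1) Esp_zero Esp_zero that(2), of \<mu>1 \<mu>2 \<beta> 1 1]
      D1[OF that(1)] D2[OF that(2)] by simp
  show thesis
  proof (rule that[of l1 l2], unfold crit_def, intro conjI u v allI impI)
    fix \<epsilon> :: real assume \<epsilon>: "0 < \<epsilon>"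
    obtain \<delta> where \<delta>: "0 < \<delta>" "\<And>h k T. h \<in> Esp \<Longrightarrow> k \<in> Esp \<Longrightarrow> normE h \<le> T \<Longrightarrow> normE k \<le> T \<Longrightarrow>
        0 < T \<Longrightarrow> T < \<delta> \<Longrightarrow> \<bar>?I (\<lambda>x. u x + h x) (\<lambda>x. v x + k x) - ?I u v - ?D h k\<bar> \<le> \<epsilon> * T"
      by (rule small_oD[OF so \<epsilon>]) (rule that)
    show "\<exists>\<delta>>0. \<forall>h\<in>Esp. \<forall>k\<in>Esp. sqrt ((normE h)\<^sup>2 + (normE k)\<^sup>2) < \<delta> \<longrightarrow>
        \<bar>?I (\<lambda>x. u x + h x) (\<lambda>x. v x + k x) - ?I u v + l1 * (\<integral>x. u x * h x \<partial>lborel) + l2 * (\<integral>x. v x * k x \<partial>lborel)\<bar>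
        \<le> \<epsilon> * sqrt ((normE h)\<^sup>2 + (normE k)\<^sup>2)"
    proof (intro exI[of _ \<delta>] conjI \<delta>(1) ballI impI)
      fix h k assume H: "h \<in> Esp" "k \<in> Esp" and lt: "sqrt ((normE h)\<^sup>2 + (normE k)\<^sup>2) < \<delta>"
      let ?t = "sqrt ((normE h)\<^sup>2 + (normE k)\<^sup>2)"
      let ?r = "?I (\<lambda>x. u x + h x) (\<lambda>x. v x + k x) - ?I u v - ?D h k"
      have le: "normE h \<le> ?t" "normE k \<le> ?t" by (auto intro!: real_le_rsqrt)
      have "0 \<le> ?t" by simp
      have bd: "\<bar>?r\<bar> \<le> \<epsilon> * T" if "?t \<le> T" "0 < T" "T < \<delta>" for T
        by (rule \<delta>(2)[OF H order.trans[OF le(1) that(1)] order.trans[OF le(2) that(1)] that(2,3)])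
      have "\<bar>?r\<bar> \<le> \<epsilon> * ?t"
      \<comment> \<open>Smallness was stated for positive bounds only; when the product norm is 0,
        arbitrarily small T force the remainder to vanish.\<close>
      proof (cases "0 < ?t")
        case True
        then show ?thesis using bd[of ?t] lt by simp
      next
        case False
        then have t0: "?t = 0" using \<open>0 \<le> ?t\<close> by linarith
        have "\<bar>?r\<bar> \<le> 0"
        proof (rule field_le_epsilon)
          fix e :: real assume e: "0 < e"
          define T where "T = min (\<delta> / 2) (e / \<epsilon>)"
          have T: "0 < T" "T < \<delta>" "\<epsilon> * T \<le> e" using \<delta>(1) e \<epsilon> by (auto simp: T_def min_def field_simps)
          show "\<bar>?r\<bar> \<le> 0 + e" using bd[OF _ T(1,2)] T t0 by simp
        qed
        then show ?thesis using t0 by simp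
      qed
      then show "\<bar>?I (\<lambda>x. u x + h x) (\<lambda>x. v x + k x) - ?I u v + l1 * (\<integral>x. u x * h x \<partial>lborel) + l2 * (\<integral>x. v x * k x \<partial>lborel)\<bar>
        \<le> \<epsilon> * ?t" unfolding D[OF H] by (simp add: algebra_simps)
    qed
  qed
qed

section \<open>Coercivity\<close>

text \<open>The difference quotients integrate to 0 by translation invariance and converge,
  dominated, to the directional derivative.\<close>

lemma test_fun_integral_grad:
  assumes t: "test_fun \<phi> D"
  shows "(\<integral>x. D x \<bullet> e \<partial>lborel) = 0"
proof -
  obtain r where r0: "0 < r" "\<And>x. x \<notin> cball 0 r \<Longrightarrow> \<phi> x = 0" "\<And>x. x \<notin> cball 0 r \<Longrightarrow> D x = 0"
    by (rule test_fun_support[OF t]) (rule that)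
  have cD: "continuous_on UNIV D" using t by (simp add: test_fun_def)
  obtain C where "0 \<le> C" "\<And>x. norm (D x) \<le> C"
    by (rule continuous_support_bounded[OF cD, of 0 r], erule r0(3), rule that)
  with r0 have r: "0 < r" "0 \<le> C" "\<And>x. x \<notin> cball 0 r \<Longrightarrow> \<phi> x = 0" "\<And>x. norm (D x) \<le> C" by auto
  have der: "\<And>x. (\<phi> has_derivative (\<lambda>h. D x \<bullet> h)) (at x)" using t by (auto simp: test_fun_def)
  note [measurable] = square_integrable_measurable[OF test_fun_square_integrable(1)[OF t]]
    square_integrable_measurable[OF test_fun_square_integrable(2)[OF t]]
  obtain B where B: "0 \<le> B" "\<And>x. norm (\<phi> x) \<le> B"
    by (rule continuous_support_bounded[OF test_fun_square_integrable(3)[OF t], of 0 r], erule r(3), rule that)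
  have \<phi>: "integrable lborel \<phi>"
    by (intro integrable_bounded_support[where C=B and a=0 and R=r] r(3) B(2)) auto
  have line: "((\<lambda>s. \<phi> (x + s *\<^sub>R h)) has_derivative (\<lambda>k. D (x + s *\<^sub>R h) \<bullet> (k *\<^sub>R h))) (at s within A)" for x h s A
    by (rule has_derivative_compose[OF _ der]) (auto intro!: derivative_eq_intros)
  have lip: "\<bar>\<phi> (x + h) - \<phi> x\<bar> \<le> C * norm h" for x h
  proof -
    have "\<exists>s\<in>{0<..<1::real}. \<phi> (x + 1 *\<^sub>R h) - \<phi> (x + 0 *\<^sub>R h) = D (x + s *\<^sub>R h) \<bullet> ((1 - 0) *\<^sub>R h)"
      by (rule mvt_simple[OF zero_less_one line])
    then obtain s :: real where "\<phi> (x + h) - \<phi> x = D (x + s *\<^sub>R h) \<bullet> h" by auto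
    then show ?thesis
      using order.trans[OF Cauchy_Schwarz_ineq2 mult_right_mono[OF r(4) norm_ge_zero]] by simp
  qed
  define f where "f n x = real (Suc n) * (\<phi> (x + (1 / real (Suc n)) *\<^sub>R e) - \<phi> x)" for n x
  have "(\<lambda>n. \<integral>x. f n x \<partial>lborel) \<longlonglongrightarrow> (\<integral>x. D x \<bullet> e \<partial>lborel)"
  proof (rule integral_dominated_convergence[where w="\<lambda>x. C * norm e * indicator (cball 0 (r + norm e)) x"])
    show "integrable lborel (\<lambda>x::pt. C * norm e * indicator (cball 0 (r + norm e)) x :: real)"
      using r by (intro integrable_bounded_support[where C="C * norm e" and a=0 and R="r + norm e"]) (auto simp: indicator_def)
    show "AE x in lborel. (\<lambda>n. f n x) \<longlonglongrightarrow> D x \<bullet> e"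
    proof (intro AE_I2)
      fix x
      have "((\<lambda>s. \<phi> (x + s *\<^sub>R e)) has_real_derivative D x \<bullet> e) (at 0)"
        unfolding has_field_derivative_def
        by (rule has_derivative_eq_rhs[OF line[of x e 0 UNIV]]) (simp add: fun_eq_iff mult.commute)
      then have "((\<lambda>h. (\<phi> (x + h *\<^sub>R e) - \<phi> x) / h) \<longlongrightarrow> D x \<bullet> e) (at 0)" by (simp add: DERIV_def)
      moreover have "filterlim (\<lambda>n. 1 / real (Suc n)) (at 0) sequentially"
        by (rule filterlim_atI[OF LIMSEQ_Suc[OF lim_1_over_n]]) auto
      ultimately have "(\<lambda>n. (\<phi> (x + (1 / real (Suc n)) *\<^sub>R e) - \<phi> x) / (1 / real (Suc n))) \<longlonglongrightarrow> D x \<bullet> e"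
        by (rule filterlim_compose)
      then show "(\<lambda>n. f n x) \<longlonglongrightarrow> D x \<bullet> e" by (simp add: f_def mult.commute)
    qed
    show "AE x in lborel. norm (f n x) \<le> C * norm e * indicator (cball 0 (r + norm e)) x" for n
    proof (intro AE_I2)
      fix x
      let ?h = "(1 / real (Suc n)) *\<^sub>R e"
      have hn: "norm ?h \<le> norm e"
        using mult_left_le_one_le[of "norm e" "1 / real (Suc n)"] by (simp del: of_nat_Suc)
      show "norm (f n x) \<le> C * norm e * indicator (cball 0 (r + norm e)) x"
      proof (cases "x \<in> cball 0 (r + norm e)")
        case True
        have "norm (f n x) \<le> real (Suc n) * (C * norm ?h)"
          using mult_left_mono[OF lip[of x ?h], of "real (Suc n)"]
          by (simp only: f_def real_norm_def abs_mult abs_of_nat of_nat_0_le_iff)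
        also have "\<dots> = C * norm e" by (simp del: of_nat_Suc)
        finally show ?thesis using True by simp
      next
        case False
        have "norm x \<le> norm (x + ?h) + norm ?h" using norm_triangle_ineq4[of "x + ?h" ?h] by simp
        then have "x \<notin> cball 0 r" "x + ?h \<notin> cball 0 r"
          using False hn norm_ge_zero[of e] by (auto simp del: norm_ge_zero)
        then show ?thesis using False r(3) by (simp add: f_def)
      qed
    qed
  qed (auto simp: f_def)
  moreover have "(\<integral>x. f n x \<partial>lborel) = 0" for n
    unfolding f_def using integrable_lborel_shift[OF \<phi>, of "(1 / real (Suc n)) *\<^sub>R e"] \<phi>
      integral_lborel_shift[of \<phi> "(1 / real (Suc n)) *\<^sub>R e"] by simp
  ultimately show ?thesis by (simp add: LIMSEQ_const_iff)
qed

text \<open>Integration by parts is the vanishing integral of the gradient of a product: f times a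
  test function is again a test function.\<close>

lemma l2_gradient_test_fun:
  assumes f: "test_fun f g"
  shows "l2_gradient f g"
  unfolding l2_gradient_def is_weak_grad_def
proof (intro conjI allI impI)
  show "square_integrable g" by (rule test_fun_square_integrable(2)[OF f])
  fix \<phi> D i assume t: "test_fun \<phi> D"
  have prod: "test_fun (\<lambda>x. f x * \<phi> x) (\<lambda>x. f x *\<^sub>R D x + \<phi> x *\<^sub>R g x)"
    unfolding test_fun_def
  proof (intro conjI allI)
    have df: "(f has_derivative (\<lambda>h. g x \<bullet> h)) (at x)" and d\<phi>: "(\<phi> has_derivative (\<lambda>h. D x \<bullet> h)) (at x)" for x
      using f t by (auto simp: test_fun_def)
    show "((\<lambda>x. f x * \<phi> x) has_derivative (\<lambda>h. (f x *\<^sub>R D x + \<phi> x *\<^sub>R g x) \<bullet> h)) (at x)" for x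
      by (rule has_derivative_eq_rhs[OF has_derivative_mult[OF df d\<phi>]]) (simp add: fun_eq_iff inner_add_left)
    show "continuous_on UNIV (\<lambda>x. f x *\<^sub>R D x + \<phi> x *\<^sub>R g x)"
      using f t test_fun_square_integrable(3)[OF f] test_fun_square_integrable(3)[OF t]
      by (auto intro!: continuous_intros simp: test_fun_def)
    have "closure {x. f x * \<phi> x \<noteq> 0} \<subseteq> closure {x. f x \<noteq> 0}" by (intro closure_mono) auto
    then show "compact (closure {x. f x * \<phi> x \<noteq> 0})"
      using f unfolding test_fun_def by (meson bounded_subset closed_closure compact_eq_bounded_closed)
  qed
  have int: "integrable lborel (\<lambda>x. f x * D x $ i)" "integrable lborel (\<lambda>x. g x $ i * \<phi> x)"
    using test_fun_square_integrable[OF f] test_fun_square_integrable[OF t]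
    by (auto intro!: square_integrable_mult(1) square_integrable_nth)
  have "(\<integral>x. (f x *\<^sub>R D x + \<phi> x *\<^sub>R g x) \<bullet> axis i 1 \<partial>lborel) = 0"
    by (rule test_fun_integral_grad[OF prod])
  then have "(\<integral>x. f x * D x $ i + g x $ i * \<phi> x \<partial>lborel) = 0"
    by (simp add: inner_axis mult.commute)
  then show "(\<integral>x. f x * D x $ i \<partial>lborel) = - (\<integral>x. g x $ i * \<phi> x \<partial>lborel)"
    using int by simp
qed

text \<open>A scaled bump is a member; the infimum of the energy is meaningful only over a nonempty
  set.\<close>

lemma Sc_nonempty:
  assumes "0 < c"
  shows "Sc c \<noteq> {}"
proof -
  let ?f = "bump 1"
  have t: "test_fun ?f (bump_grad 1)" using test_fun_bump[of 1 0 1] by simp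
  have s: "square_integrable ?f" by (rule test_fun_square_integrable(1)[OF t])
  have H: "?f \<in> H1" using s l2_gradient_test_fun[OF t] by (auto simp: H1_iff)
  have "integrable lborel (\<lambda>x. ln (1 + norm x) * (?f x)\<^sup>2)"
  proof (rule integrable_bounded_support[where C="ln 2" and a=0 and R=1])
    show "norm (ln (1 + norm x) * (?f x)\<^sup>2) \<le> ln 2" for x
    proof (cases "norm x \<le> 1")
      case True
      have "ln (1 + norm x) \<le> ln 2" using True by (subst ln_le_cancel_iff) (auto simp: add_pos_nonneg)
      moreover have "(?f x)\<^sup>2 \<le> 1" using bump_le[of 1 x] bump_nonneg[of 1 x] by (simp add: power_le_one)
      ultimately have "ln (1 + norm x) * (?f x)\<^sup>2 \<le> ln 2 * 1" by (intro mult_mono) auto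
      then show ?thesis by simp
    next
      case False
      then show ?thesis using bump_eq_0[of 1 x] by simp
    qed
    show "ln (1 + norm x) * (?f x)\<^sup>2 = 0" if "x \<notin> cball 0 1" for x
      using that bump_eq_0[of 1 x] by simp
  qed measurable
  then have E: "?f \<in> Esp" using H by (simp add: Esp_iff)
  have "l2norm ?f \<noteq> 0"
  proof
    assume "l2norm ?f = 0"
    then have "AE x in lborel. ?f x = 0" by (simp add: l2norm_eq_0_iff[OF s])
    then have "bump_mass 1 = 0"
      unfolding bump_mass_def by (subst integral_cong_AE[where g="\<lambda>x. 0"]) auto
    then show False using bump_mass_pos[of 1] by simp
  qed
  define a where "a = sqrt c / l2norm ?f"
  have "(l2norm (\<lambda>x. a * ?f x))\<^sup>2 = c"
    unfolding l2norm_cmult using \<open>l2norm ?f \<noteq> 0\<close> assms by (simp add: a_def power_mult_distrib power_divide)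
  then have "(\<lambda>x. a * ?f x) \<in> Sc c" using Esp_cmult[OF E] by (simp add: Sc_def l2norm_sq_real)
  then show ?thesis by blast
qed

section \<open>Lower bounds for the energy\<close>

lemma P_nonneg: "0 \<le> P p u"
  by (simp add: P_def)

text \<open>2 |u v|^p <= |u|^(2 p) + |v|^(2 p) splits the coupling evenly; this is the origin of the
  sums \<open>\<mu>1 + \<beta>\<close> and \<open>\<mu>2 + \<beta>\<close> in the
  hypotheses.\<close>

lemma R_le:
  assumes p: "1 < p" and "0 < \<beta>" and u: "u \<in> H1" and v: "v \<in> H1"
  shows "R p \<mu>1 \<mu>2 \<beta> u v \<le> (\<mu>1 + \<beta>) * P p u + (\<mu>2 + \<beta>) * P p v"
proof -
  have q: "2 \<le> 2 * p" using p by simp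
  note i = H1_powr_integrable[OF u q] H1_powr_integrable[OF v q]
  have "P0 p u v \<le> (\<integral>x. (\<bar>u x\<bar> powr (2 * p) + \<bar>v x\<bar> powr (2 * p)) / 2 \<partial>lborel)"
    unfolding P0_def
  proof (rule integral_mono')
    show "integrable lborel (\<lambda>x. (\<bar>u x\<bar> powr (2 * p) + \<bar>v x\<bar> powr (2 * p)) / 2)" using i by simp
    fix x
    have e: "t powr (2 * p) = (t powr p)\<^sup>2" for t :: real
      by (simp add: power2_eq_square powr_add[symmetric])
    have "2 * (\<bar>u x\<bar> powr p * \<bar>v x\<bar> powr p) \<le> \<bar>u x\<bar> powr (2 * p) + \<bar>v x\<bar> powr (2 * p)"
      using sum_squares_bound[of "\<bar>u x\<bar> powr p" "\<bar>v x\<bar> powr p"] by (simp add: e mult.assoc)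
    then show "\<bar>u x * v x\<bar> powr p \<le> (\<bar>u x\<bar> powr (2 * p) + \<bar>v x\<bar> powr (2 * p)) / 2"
      by (simp add: abs_mult powr_mult)
  qed simp
  also have "\<dots> = (P p u + P p v) / 2" using i by (simp add: P_def)
  finally have "2 * P0 p u v \<le> P p u + P p v" by simp
  then have "\<beta> * (2 * P0 p u v) \<le> \<beta> * (P p u + P p v)" using \<open>0 < \<beta>\<close> by (intro mult_left_mono) auto
  then show ?thesis by (simp add: R_def algebra_simps)
qed

lemma powr_le_linear:
  fixes a K :: real
  assumes "0 < a" "a < 1" "0 \<le> K"
  obtains D where "\<And>x. 0 \<le> x \<Longrightarrow> K * x powr a \<le> x / 4 + D"
proof (rule that)
  fix x :: real assume x: "0 \<le> x"
  \<comment> \<open>Chosen so that K X^(a - 1) <= 1 / 4: beyond X the term is at most x / 4, before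
    it the constant K X^a suffices.\<close>
  define X where "X = (4 * (K + 1)) powr (1 / (1 - a))"
  have X: "0 < X" using assms by (simp add: X_def)
  have XK: "K * X powr (a - 1) \<le> 1 / 4"
  proof -
    have "1 / (1 - a) * (a - 1) = - 1" using assms by (simp add: field_simps)
    then have "X powr (a - 1) = (4 * (K + 1)) powr (- 1)" by (simp add: X_def powr_powr)
    also have "\<dots> = 1 / (4 * (K + 1))" using assms by (simp add: powr_minus divide_inverse)
    finally show ?thesis using assms by (simp add: divide_le_eq)
  qed
  show "K * x powr a \<le> x / 4 + K * X powr a"
  proof (cases "x \<le> X")
    case True
    have "K * x powr a \<le> K * X powr a" using True x assms by (intro mult_left_mono powr_mono2) auto
    then show ?thesis using x by linarith
  next
    case False
    have "K * x powr a = x * (K * x powr (a - 1))" using False X by (simp add: powr_diff)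
    also have "\<dots> \<le> x * (K * X powr (a - 1))"
      using False X assms x by (intro mult_left_mono powr_mono2') auto
    also have "\<dots> \<le> x * (1 / 4)" using XK x by (intro mult_left_mono) auto
    finally show ?thesis using assms by (simp add: add_increasing2)
  qed
qed

text \<open>If \<nu> <= 0 the power term only helps. If p < 2, Gagliardo--Nirenberg bounds it by the
  power p - 1 < 1 of Q. If p = 2 it is linear in Q, and the sharp constant leaves a quarter of 2 -
  \<open>GN_const 4\<close> \<nu> c as coefficient.\<close>

lemma component_coercive:
  fixes p \<nu> c :: real
  assumes p: "1 < p" and c: "0 < c"
    and cond: "\<nu> \<le> 0 \<or> p < 2 \<or> (p = 2 \<and> 0 < 2 - GN_const 4 * \<nu> * c)"
  obtains \<kappa> D where "0 < \<kappa>" "\<And>u. u \<in> Sc c \<Longrightarrow> \<kappa> * Q u - D \<le> Q u / 2 - \<nu> * P p u / (2 * p)"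
proof -
  consider "\<nu> \<le> 0" | "0 < \<nu>" "p < 2" | "0 < \<nu>" "p = 2" "0 < 2 - GN_const 4 * \<nu> * c" using cond by linarith
  then show thesis
  proof cases
    case 1
    have "1 / 2 * Q u - 0 \<le> Q u / 2 - \<nu> * P p u / (2 * p)" for u
    proof -
      have "\<nu> * P p u / (2 * p) \<le> 0" using 1 p P_nonneg[of p u] by (simp add: divide_nonpos_nonneg mult_nonpos_nonneg)
      then show ?thesis by simp
    qed
    then show thesis using that[of "1/2" 0] by simp
  next
    case 2
    have q: "2 < 2 * p" using p by simp
    obtain C where C: "0 < C" and *: "\<And>u. u \<in> H1 \<Longrightarrow>
      (\<integral>x. \<bar>u x\<bar> powr (2 * p) \<partial>lborel) \<le> C * sqrt (Q u) powr (2 * p - 2) * (\<integral>x. (u x)\<^sup>2 \<partial>lborel)"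
      by (rule Gagliardo_Nirenberg[OF q]) (rule that)
    define K where "K = \<nu> * (C * c) / (2 * p)"
    have K: "0 \<le> K" using 2 C c p by (simp add: K_def)
    have a: "0 < p - 1" "p - 1 < 1" using p 2 by auto
    obtain D where D: "\<And>x. 0 \<le> x \<Longrightarrow> K * x powr (p - 1) \<le> x / 4 + D"
      by (rule powr_le_linear[OF a K]) (rule that)
    have "1 / 4 * Q u - D \<le> Q u / 2 - \<nu> * P p u / (2 * p)" if u: "u \<in> Sc c" for u
    proof -
      have "sqrt (Q u) powr (2 * p - 2) = Q u powr (p - 1)"
        using Q_nonneg[of u] by (simp add: powr_half_sqrt[symmetric] powr_powr diff_divide_distrib)
      then have "P p u \<le> C * c * Q u powr (p - 1)"
        using *[OF Esp_H1[OF Sc_Esp[OF u]]] u by (simp add: P_def Sc_def mult_ac)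
      then have "\<nu> * P p u / (2 * p) \<le> \<nu> * (C * c * Q u powr (p - 1)) / (2 * p)"
        using 2 p by (intro divide_right_mono mult_left_mono) auto
      also have "\<dots> = K * Q u powr (p - 1)" by (simp add: K_def)
      finally show ?thesis using D[OF Q_nonneg[of u]] by linarith
    qed
    then show thesis using that[of "1/4" D] by simp
  next
    case 3
    define \<kappa> where "\<kappa> = (2 - GN_const 4 * \<nu> * c) / 4"
    have \<kappa>: "0 < \<kappa>" using 3 by (simp add: \<kappa>_def)
    have "\<kappa> * Q u - 0 \<le> Q u / 2 - \<nu> * P p u / (2 * p)" if u: "u \<in> Sc c" for u
    proof -
      have "sqrt (Q u) powr (4 - 2) = Q u"
        using Q_nonneg[of u] by (simp add: powr_numeral)
      then have "P p u \<le> GN_const 4 * Q u * c"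
        using GN_const_inequality[of 4 u] Esp_H1[OF Sc_Esp[OF u]] u 3(2) by (simp add: P_def Sc_def)
      then have "\<nu> * P p u \<le> \<nu> * (GN_const 4 * Q u * c)" using 3 by (intro mult_left_mono) auto
      then show ?thesis using 3(2) by (simp add: \<kappa>_def field_simps)
    qed
    then show thesis using that[of \<kappa> 0] \<kappa> by simp
  qed
qed

section \<open>Positive and negative parts of the logarithmic energy\<close>

lemma mass_density_square_integrable:
  assumes "u \<in> H1" "v \<in> H1"
  shows "square_integrable (mass_density u v)" "integrable lborel (mass_density u v)"
    "(\<integral>x. \<bar>mass_density u v x\<bar> \<partial>lborel) = (l2norm u)\<^sup>2 + (l2norm v)\<^sup>2"
    "l2norm (mass_density u v) \<le> l2norm (\<lambda>x. (u x)\<^sup>2) + l2norm (\<lambda>x. (v x)\<^sup>2)"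
proof -
  note s = H1_fourth_power(1)[OF assms(1)] H1_fourth_power(1)[OF assms(2)]
  have d: "mass_density u v = (\<lambda>x. (u x)\<^sup>2 + (v x)\<^sup>2)" by (simp add: mass_density_def fun_eq_iff)
  show "square_integrable (mass_density u v)" "l2norm (mass_density u v) \<le> l2norm (\<lambda>x. (u x)\<^sup>2) + l2norm (\<lambda>x. (v x)\<^sup>2)"
    unfolding d by (rule square_integrable_add[OF s], rule l2norm_triangle[OF s])
  have i: "integrable lborel (\<lambda>x. (u x)\<^sup>2)" "integrable lborel (\<lambda>x. (v x)\<^sup>2)"
    using square_integrable_integrable[OF H1_square_integrable[OF assms(1)]]
      square_integrable_integrable[OF H1_square_integrable[OF assms(2)]] by simp_all
  then show "integrable lborel (mass_density u v)"
    "(\<integral>x. \<bar>mass_density u v x\<bar> \<partial>lborel) = (l2norm u)\<^sup>2 + (l2norm v)\<^sup>2"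
    by (simp_all add: d l2norm_sq_real)
qed

definition W_pos :: "(pt \<Rightarrow> real) \<Rightarrow> (pt \<Rightarrow> real) \<Rightarrow> real" where
  "W_pos u v = kernel_form ln_pos (mass_density u v) (mass_density u v)"

definition W_neg :: "(pt \<Rightarrow> real) \<Rightarrow> (pt \<Rightarrow> real) \<Rightarrow> real" where
  "W_neg u v = kernel_form ln_neg (mass_density u v) (mass_density u v)"

lemma mass_density_nonneg [simp]: "0 \<le> mass_density u v x"
  by (simp add: mass_density_def)

lemma W_pos_nonneg: "0 \<le> W_pos u v"
  unfolding W_pos_def kernel_form_def by (intro Bochner_Integration.integral_nonneg) simp

lemma mass_density_admissible:
  assumes "u \<in> Esp" "v \<in> Esp"
  shows "log_admissible (mass_density u v)"
  unfolding mass_density_def[abs_def]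
  by (rule log_admissible_add(1)[OF Esp_log_admissible(2)[OF assms(1,1)] Esp_log_admissible(2)[OF assms(2,2)]])

lemma W0_eq_pos_neg:
  assumes "u \<in> Esp" "v \<in> Esp"
  shows "W0 u v = W_pos u v - W_neg u v"
  unfolding W0_density W_pos_def W_neg_def
  by (rule kernel_form_ln(4)[OF mass_density_admissible[OF assms] mass_density_admissible[OF assms]])

text \<open>The L^2 norm of the density is controlled by the L^4 norms of u and v, and
  Gagliardo--Nirenberg bounds each contribution by a multiple of sqrt (Q c). The negative part thus
  grows only like the root of the Dirichlet energy.\<close>

lemma W_neg_le:
  obtains C where "0 < C" "\<And>u v c1 c2. u \<in> Sc c1 \<Longrightarrow> v \<in> Sc c2 \<Longrightarrow>
    W_neg u v \<le> C * (c1 + c2) * (sqrt (Q u * c1) + sqrt (Q v * c2))"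
    "\<And>u v c1 c2. u \<in> Sc c1 \<Longrightarrow> v \<in> Sc c2 \<Longrightarrow> l2norm (mass_density u v) \<le> C * (sqrt (Q u * c1) + sqrt (Q v * c2))"
proof -
  obtain A where A: "0 < A" and *: "\<And>u. u \<in> H1 \<Longrightarrow>
    (\<integral>x. \<bar>u x\<bar> powr 4 \<partial>lborel) \<le> A * sqrt (Q u) powr (4 - 2) * (\<integral>x. (u x)\<^sup>2 \<partial>lborel)"
    by (rule Gagliardo_Nirenberg[of 4]) (simp, rule that)
  have four: "l2norm (\<lambda>x. (u x)\<^sup>2) \<le> sqrt A * sqrt (Q u * c)" if u: "u \<in> Sc c" for u c
  proof -
    note H = Esp_H1[OF Sc_Esp[OF u]]
    have "sqrt (Q u) powr (4 - 2) = Q u" using Q_nonneg[of u] by (simp add: powr_numeral)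
    then have "(l2norm (\<lambda>x. (u x)\<^sup>2))\<^sup>2 \<le> A * (Q u * c)"
      using *[OF H] u unfolding H1_fourth_power(2)[OF H] by (simp add: Sc_def mult.assoc)
    then show ?thesis unfolding real_sqrt_mult[symmetric] by (rule real_le_rsqrt)
  qed
  \<comment> \<open>Large enough to dominate both sqrt A and its multiple by
    \<open>ln_neg_norm\<close>, and positive in any case.\<close>
  define C where "C = (ln_neg_norm + 1) * (sqrt A + 1)"
  have L: "0 \<le> ln_neg_norm" by simp
  have C: "0 < C" using L A by (auto simp: C_def intro!: mult_pos_pos add_nonneg_pos)
  have CA: "sqrt A \<le> C" "ln_neg_norm * sqrt A \<le> C"
    using L A by (auto simp: C_def algebra_simps add_nonneg_nonneg)
  show thesis
  proof (rule that[OF C])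
    fix u v c1 c2 assume uv: "u \<in> Sc c1" "v \<in> Sc c2"
    note H = Esp_H1[OF Sc_Esp[OF uv(1)]] Esp_H1[OF Sc_Esp[OF uv(2)]]
    let ?S = "sqrt (Q u * c1) + sqrt (Q v * c2)"
    have c: "0 \<le> c1" "0 \<le> c2" using Sc_l2norm[OF uv(1)] Sc_l2norm[OF uv(2)] by auto
    then have S: "0 \<le> ?S" by (simp add: Q_nonneg)
    have l: "l2norm (mass_density u v) \<le> sqrt A * ?S"
      using mass_density_square_integrable(4)[OF H] four[OF uv(1)] four[OF uv(2)] by (simp add: distrib_left)
    also have "\<dots> \<le> C * ?S" using CA S by (intro mult_right_mono) auto
    finally show "l2norm (mass_density u v) \<le> C * ?S" .
    have "W_neg u v \<le> ln_neg_norm * (c1 + c2) * l2norm (mass_density u v)"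
      unfolding W_neg_def
      using kernel_form_ln_neg(2)[OF mass_density_square_integrable(2)[OF H] mass_density_square_integrable(1)[OF H]]
        Sc_l2norm[OF uv(1)] Sc_l2norm[OF uv(2)] mass_density_square_integrable(3)[OF H] by simp
    also have "\<dots> \<le> ln_neg_norm * (c1 + c2) * (sqrt A * ?S)"
      using l L c by (intro mult_left_mono) auto
    also have "\<dots> = ln_neg_norm * sqrt A * (c1 + c2) * ?S" by (simp only: mult_ac)
    also have "\<dots> \<le> C * (c1 + c2) * ?S"
      using CA S c by (intro mult_right_mono) auto
    finally show "W_neg u v \<le> C * (c1 + c2) * ?S" .
  qed
qed

lemma sqrt_le_linear:
  fixes x \<kappa> b :: real
  assumes "0 \<le> x" "0 < \<kappa>"
  shows "b * sqrt x \<le> \<kappa> / 2 * x + b\<^sup>2 / (2 * \<kappa>)"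
proof -
  have "0 \<le> (\<kappa> * sqrt x - b)\<^sup>2" by simp
  then have "2 * \<kappa> * (b * sqrt x) \<le> \<kappa>\<^sup>2 * x + b\<^sup>2"
    using assms by (simp add: power2_diff power_mult_distrib algebra_simps)
  then show ?thesis using assms by (simp add: field_simps power2_eq_square)
qed

text \<open>Half of the Dirichlet energy kept by \<open>component_coercive\<close> absorbs the
  negative logarithmic part. The positive part stays in the bound because the recentring needs
  it.\<close>

lemma Ifun_coercive:
  assumes p: "1 < p" and \<beta>: "0 < \<beta>" and c: "0 < c1" "0 < c2"
    and cond: "max (\<mu>1 + \<beta>) (\<mu>2 + \<beta>) \<le> 0 \<or> p < 2 \<or>
      (p = 2 \<and> min (2 - GN_const 4 * (\<mu>1 + \<beta>) * c1) (2 - GN_const 4 * (\<mu>2 + \<beta>) * c2) > 0)"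
  obtains \<kappa> D where "0 < \<kappa>" "\<And>u v. u \<in> Sc c1 \<Longrightarrow> v \<in> Sc c2 \<Longrightarrow>
    \<kappa> * (Q u + Q v) + W_pos u v / 4 - D \<le> Ifun p \<mu>1 \<mu>2 \<beta> u v"
proof -
  have cond1: "\<mu>1 + \<beta> \<le> 0 \<or> p < 2 \<or> (p = 2 \<and> 0 < 2 - GN_const 4 * (\<mu>1 + \<beta>) * c1)"
    and cond2: "\<mu>2 + \<beta> \<le> 0 \<or> p < 2 \<or> (p = 2 \<and> 0 < 2 - GN_const 4 * (\<mu>2 + \<beta>) * c2)"
    using cond by auto
  obtain k1 D1 where k1: "0 < k1" "\<And>u. u \<in> Sc c1 \<Longrightarrow> k1 * Q u - D1 \<le> Q u / 2 - (\<mu>1 + \<beta>) * P p u / (2 * p)"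
    by (rule component_coercive[OF p c(1) cond1]) (rule that)
  obtain k2 D2 where k2: "0 < k2" "\<And>u. u \<in> Sc c2 \<Longrightarrow> k2 * Q u - D2 \<le> Q u / 2 - (\<mu>2 + \<beta>) * P p u / (2 * p)"
    by (rule component_coercive[OF p c(2) cond2]) (rule that)
  obtain C where C: "0 < C" "\<And>u v c1 c2. u \<in> Sc c1 \<Longrightarrow> v \<in> Sc c2 \<Longrightarrow>
    W_neg u v \<le> C * (c1 + c2) * (sqrt (Q u * c1) + sqrt (Q v * c2))"
    "\<And>u v c1 c2. u \<in> Sc c1 \<Longrightarrow> v \<in> Sc c2 \<Longrightarrow> l2norm (mass_density u v) \<le> C * (sqrt (Q u * c1) + sqrt (Q v * c2))"
    by (rule W_neg_le) (rule that)
  define k where "k = min k1 k2"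
  have k: "0 < k" "k \<le> k1" "k \<le> k2" using k1 k2 by (auto simp: k_def)
  \<comment> \<open>\<open>b1\<close> and \<open>b2\<close> are the coefficients of sqrt (Q u) and
    sqrt (Q v) in the bound for a quarter of the negative part.\<close>
  define b1 where "b1 = C * (c1 + c2) * sqrt c1 / 4"
  define b2 where "b2 = C * (c1 + c2) * sqrt c2 / 4"
  show thesis
  proof (rule that[of "k / 2" "D1 + D2 + b1\<^sup>2 / (2 * k) + b2\<^sup>2 / (2 * k)"])
    show "0 < k / 2" using k by simp
    fix u v assume uv: "u \<in> Sc c1" "v \<in> Sc c2"
    note E = Sc_Esp[OF uv(1)] Sc_Esp[OF uv(2)]
    have "R p \<mu>1 \<mu>2 \<beta> u v / (2 * p) \<le> ((\<mu>1 + \<beta>) * P p u + (\<mu>2 + \<beta>) * P p v) / (2 * p)"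
      using p by (intro divide_right_mono R_le[OF p \<beta> Esp_H1[OF E(1)] Esp_H1[OF E(2)]]) auto
    then have 1: "R p \<mu>1 \<mu>2 \<beta> u v / (2 * p) \<le> (\<mu>1 + \<beta>) * P p u / (2 * p) + (\<mu>2 + \<beta>) * P p v / (2 * p)"
      by (simp add: add_divide_distrib)
    have 2: "k * Q u \<le> k1 * Q u" "k * Q v \<le> k2 * Q v"
      using k Q_nonneg by (auto intro!: mult_right_mono)
    have "W_neg u v / 4 \<le> C * (c1 + c2) * (sqrt (Q u * c1) + sqrt (Q v * c2)) / 4"
      using C(2)[OF uv] by simp
    also have "\<dots> = b1 * sqrt (Q u) + b2 * sqrt (Q v)"
      by (simp add: b1_def b2_def real_sqrt_mult algebra_simps add_divide_distrib)
    finally have 3: "W_neg u v / 4 \<le> (k / 2 * Q u + b1\<^sup>2 / (2 * k)) + (k / 2 * Q v + b2\<^sup>2 / (2 * k))"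
      using sqrt_le_linear[OF Q_nonneg[of u] k(1), of b1] sqrt_le_linear[OF Q_nonneg[of v] k(1), of b2] by linarith
    have 4: "Ifun p \<mu>1 \<mu>2 \<beta> u v = Q u / 2 + Q v / 2 + W_pos u v / 4 - W_neg u v / 4 - R p \<mu>1 \<mu>2 \<beta> u v / (2 * p)"
      unfolding Ifun_def W0_eq_pos_neg[OF E] by (simp add: add_divide_distrib diff_divide_distrib)
    have 5: "k / 2 * (Q u + Q v) = k * Q u - k / 2 * Q u + (k * Q v - k / 2 * Q v)"
      by (simp add: algebra_simps)
    show "k / 2 * (Q u + Q v) + W_pos u v / 4 - (D1 + D2 + b1\<^sup>2 / (2 * k) + b2\<^sup>2 / (2 * k)) \<le> Ifun p \<mu>1 \<mu>2 \<beta> u v"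
      unfolding 4 5 using 1 2 3 k1(2)[OF uv(1)] k2(2)[OF uv(2)] by linarith
  qed
qed

section \<open>Existence of a minimizer\<close>

text \<open>The weight changes by a bounded amount only: ln (1 + |x|) <= ln (1 + |x + y|) + ln (1 +
  |y|). So E is invariant under translations although its norm is not.\<close>

lemma
  assumes u: "u \<in> Esp"
  shows Esp_shift: "(\<lambda>x. u (x + y)) \<in> Esp" and Q_shift: "Q (\<lambda>x. u (x + y)) = Q u"
proof -
  note s = Esp_square_integrable[OF u]
  note g = l2_gradient_weak_grad[OF Esp_H1[OF u]]
  note [measurable] = square_integrable_measurable[OF s]
  have H: "(\<lambda>x. u (x + y)) \<in> H1"
    using square_integrable_shift[OF s] l2_gradient_shift[OF s g] by (auto simp: H1_iff)
  show "Q (\<lambda>x. u (x + y)) = Q u"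
    using Q_eq[OF square_integrable_shift[OF s] l2_gradient_shift[OF s g]]
      l2norm_shift[OF weak_grad_square_integrable[OF Esp_H1[OF u]]] by (simp add: Q_eq_weak_grad)
  have i: "integrable lborel (\<lambda>x. ln (1 + norm x) * (u x)\<^sup>2 + ln (1 + norm y) * (u x)\<^sup>2)"
    using u square_integrable_integrable[OF s] by (simp add: Esp_iff)
  have "integrable lborel (\<lambda>x. ln (1 + norm x) * (u (x + y))\<^sup>2)"
  proof (rule Bochner_Integration.integrable_bound[OF integrable_lborel_shift[OF i, of y]])
    show "AE x in lborel. norm (ln (1 + norm x) * (u (x + y))\<^sup>2)
      \<le> norm (ln (1 + norm (x + y)) * (u (x + y))\<^sup>2 + ln (1 + norm y) * (u (x + y))\<^sup>2)"
    proof (intro AE_I2)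
      fix x
      have "1 + norm x \<le> (1 + norm (x + y)) * (1 + norm y)"
      proof -
        have "(1 + norm (x + y)) * (1 + norm y) = 1 + norm (x + y) + norm y + norm (x + y) * norm y"
          by (simp add: algebra_simps)
        moreover have "0 \<le> norm (x + y) * norm y" by simp
        moreover have "norm x \<le> norm (x + y) + norm y" using norm_triangle_ineq4[of "x + y" y] by simp
        ultimately show ?thesis by linarith
      qed
      then have "ln (1 + norm x) \<le> ln ((1 + norm (x + y)) * (1 + norm y))"
        by (subst ln_le_cancel_iff) (auto intro!: add_pos_nonneg mult_pos_pos)
      also have "\<dots> = ln (1 + norm (x + y)) + ln (1 + norm y)"
        by (rule ln_mult_pos) (auto intro: add_pos_nonneg)
      finally have "ln (1 + norm x) * (u (x + y))\<^sup>2 \<le> (ln (1 + norm (x + y)) + ln (1 + norm y)) * (u (x + y))\<^sup>2"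
        by (rule mult_right_mono) simp
      then show "norm (ln (1 + norm x) * (u (x + y))\<^sup>2)
        \<le> norm (ln (1 + norm (x + y)) * (u (x + y))\<^sup>2 + ln (1 + norm y) * (u (x + y))\<^sup>2)"
        by (simp add: distrib_right)
    qed
  qed measurable
  with H show "(\<lambda>x. u (x + y)) \<in> Esp" by (simp add: Esp_iff)
qed

lemma Sc_shift:
  assumes "u \<in> Sc c"
  shows "(\<lambda>x. u (x + y)) \<in> Sc c"
  using Esp_shift[OF Sc_Esp[OF assms], of y] l2norm_shift[OF Esp_square_integrable[OF Sc_Esp[OF assms]], of y]
    Sc_l2norm[OF assms] by (simp add: Sc_def l2norm_sq_real[symmetric])

text \<open>The kernel depends on the distance, so it is invariant under the diagonal translation
  (y, y) of the product space.\<close>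

lemma kernel_form_shift:
  assumes [measurable]: "K \<in> borel_measurable borel" "f \<in> borel_measurable borel" "g \<in> borel_measurable borel"
  shows "kernel_form K (\<lambda>x. f (x + y)) (\<lambda>x. g (x + y)) = kernel_form K f g"
proof -
  let ?F = "\<lambda>z. K (dist (fst z) (snd z)) * f (fst z) * g (snd z)"
  have "?F \<in> borel_measurable (lborel \<Otimes>\<^sub>M lborel)" by measurable
  then have m: "?F \<in> borel_measurable borel" unfolding lborel_prod by simp
  have "kernel_form K f g = (\<integral>z. ?F z \<partial>lborel)" by (simp add: kernel_form_def lborel_prod)
  also have "\<dots> = (\<integral>z. ?F (z + (y, y)) \<partial>lborel)" by (rule integral_lborel_shift[OF m, symmetric])
  also have "\<dots> = kernel_form K (\<lambda>x. f (x + y)) (\<lambda>x. g (x + y))"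
    by (simp add: kernel_form_def lborel_prod)
  finally show ?thesis by simp
qed

lemma
  assumes u: "u \<in> Esp" and v: "v \<in> Esp"
  shows Ifun_shift: "Ifun p \<mu>1 \<mu>2 \<beta> (\<lambda>x. u (x + y)) (\<lambda>x. v (x + y)) = Ifun p \<mu>1 \<mu>2 \<beta> u v"
    and W_pos_shift: "W_pos (\<lambda>x. u (x + y)) (\<lambda>x. v (x + y)) = W_pos u v"
proof -
  note [measurable] = square_integrable_measurable[OF Esp_square_integrable[OF u]]
    square_integrable_measurable[OF Esp_square_integrable[OF v]]
  have d: "mass_density (\<lambda>x. u (x + y)) (\<lambda>x. v (x + y)) = (\<lambda>x. mass_density u v (x + y))"
    by (simp add: mass_density_def fun_eq_iff)
  have [measurable]: "mass_density u v \<in> borel_measurable borel" unfolding mass_density_def[abs_def] by measurable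
  show "W_pos (\<lambda>x. u (x + y)) (\<lambda>x. v (x + y)) = W_pos u v"
    unfolding W_pos_def d by (rule kernel_form_shift) measurable
  have "W0 (\<lambda>x. u (x + y)) (\<lambda>x. v (x + y)) = W0 u v"
    unfolding W0_density d by (rule kernel_form_shift) measurable
  moreover have "R p \<mu>1 \<mu>2 \<beta> (\<lambda>x. u (x + y)) (\<lambda>x. v (x + y)) = R p \<mu>1 \<mu>2 \<beta> u v"
    using integral_lborel_shift[of "\<lambda>x. \<bar>u x\<bar> powr (2 * p)" y] integral_lborel_shift[of "\<lambda>x. \<bar>v x\<bar> powr (2 * p)" y]
      integral_lborel_shift[of "\<lambda>x. \<bar>u x * v x\<bar> powr p" y] by (simp add: R_def P_def P0_def)
  ultimately show "Ifun p \<mu>1 \<mu>2 \<beta> (\<lambda>x. u (x + y)) (\<lambda>x. v (x + y)) = Ifun p \<mu>1 \<mu>2 \<beta> u v"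
    by (simp add: Ifun_def Q_shift[OF u] Q_shift[OF v])
qed

lemma W_pos_nn_integral:
  assumes "u \<in> Esp" "v \<in> Esp"
  shows "ennreal (W_pos u v) = (\<integral>\<^sup>+z. ennreal (ln_pos (dist (fst z) (snd z)) * mass_density u v (fst z) * mass_density u v (snd z)) \<partial>(lborel \<Otimes>\<^sub>M lborel))"
  unfolding W_pos_def kernel_form_def
  using kernel_form_ln(3)[OF mass_density_admissible[OF assms] mass_density_admissible[OF assms]]
  by (intro nn_integral_eq_integral[symmetric]) auto

lemma recenter:
  assumes u: "u \<in> Sc c1" and v: "v \<in> Sc c2" and c: "0 < c1" "0 < c2" and M: "W_pos u v \<le> M"
  obtains y where "(\<integral>x. ln (1 + norm x) * (u (x + y))\<^sup>2 \<partial>lborel) \<le> ln 2 * (c1 + c2) + (M + 1) / (c1 + c2)"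
    "(\<integral>x. ln (1 + norm x) * (v (x + y))\<^sup>2 \<partial>lborel) \<le> ln 2 * (c1 + c2) + (M + 1) / (c1 + c2)"
proof -
  note E = Sc_Esp[OF u] Sc_Esp[OF v]
  note H = Esp_H1[OF E(1)] Esp_H1[OF E(2)]
  let ?\<rho> = "mass_density u v" and ?c = "c1 + c2"
  have cpos: "0 < ?c" using c by simp
  have M0: "0 \<le> M" using M W_pos_nonneg[of u v] by linarith
  note [measurable] = square_integrable_measurable[OF mass_density_square_integrable(1)[OF H]]
    square_integrable_measurable[OF H1_square_integrable[OF H(1)]] square_integrable_measurable[OF H1_square_integrable[OF H(2)]]
  have mass: "(\<integral>\<^sup>+x. ennreal (?\<rho> x) \<partial>lborel) = ennreal ?c"
    using mass_density_square_integrable(2,3)[OF H] Sc_l2norm[OF u] Sc_l2norm[OF v]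
    by (simp add: nn_integral_eq_integral)
  define g where "g y = (\<integral>\<^sup>+x. ennreal (ln_pos (dist x y) * ?\<rho> x) \<partial>lborel)" for y
  have gm [measurable]: "g \<in> borel_measurable borel" unfolding g_def by measurable
  \<comment> \<open>If the potential were at least (M + 1) / c everywhere, its integral against the
    density would be at least M + 1; the + 1 makes the contradiction strict.\<close>
  have "\<exists>y. g y \<le> ennreal ((M + 1) / ?c)"
  proof (rule ccontr)
    assume "\<nexists>y. g y \<le> ennreal ((M + 1) / ?c)"
    then have gt: "ennreal ((M + 1) / ?c) \<le> g y" for y by (meson linear)
    have "ennreal (M + 1) = ennreal ((M + 1) / ?c) * (\<integral>\<^sup>+y. ennreal (?\<rho> y) \<partial>lborel)"
      unfolding mass using cpos M0 by (simp add: ennreal_mult[symmetric])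
    also have "\<dots> = (\<integral>\<^sup>+y. ennreal ((M + 1) / ?c) * ennreal (?\<rho> y) \<partial>lborel)"
      by (rule nn_integral_cmult[symmetric]) simp
    also have "\<dots> \<le> (\<integral>\<^sup>+y. g y * ennreal (?\<rho> y) \<partial>lborel)"
      by (intro nn_integral_mono mult_right_mono gt) simp
    also have "\<dots> = (\<integral>\<^sup>+y. \<integral>\<^sup>+x. ennreal (ln_pos (dist x y) * ?\<rho> x * ?\<rho> y) \<partial>lborel \<partial>lborel)"
      unfolding g_def
      by (intro nn_integral_cong, subst nn_integral_multc[symmetric]) (auto simp: ennreal_mult[symmetric])
    also have "\<dots> = ennreal (W_pos u v)"
      unfolding W_pos_nn_integral[OF E]
      by (subst lborel_pair.nn_integral_snd[symmetric]) auto
    also have "\<dots> \<le> ennreal M" by (rule ennreal_leI[OF M])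
    finally show False using M0 by simp
  qed
  then obtain y where y: "g y \<le> ennreal ((M + 1) / ?c)" by blast
  \<comment> \<open>Compares the weight of E with the positive kernel; the loss ln 2 is paid by the
    mass.\<close>
  have ln2: "ln (1 + t) \<le> ln 2 + ln_pos t" if "0 \<le> t" for t :: real
  proof (cases "t \<le> 1")
    case True
    then have "ln (1 + t) \<le> ln 2" using that by (subst ln_le_cancel_iff) auto
    then show ?thesis by (simp add: add_increasing2)
  next
    case False
    then have "ln (1 + t) \<le> ln (2 * t)" by (subst ln_le_cancel_iff) auto
    also have "\<dots> = ln 2 + ln t" using False by (intro ln_mult_pos) auto
    finally show ?thesis using ln_eq_pos_neg[of t] ln_neg_nonneg[of t] by linarith
  qed
  have le: "(\<integral>\<^sup>+x. ennreal (ln (1 + norm x) * ?\<rho> (x + y)) \<partial>lborel) \<le> ennreal (ln 2 * ?c + (M + 1) / ?c)"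
  proof -
    have "(\<integral>\<^sup>+x. ennreal (ln (1 + norm x) * ?\<rho> (x + y)) \<partial>lborel)
        \<le> (\<integral>\<^sup>+x. ennreal (ln 2) * ennreal (?\<rho> (x + y)) + ennreal (ln_pos (dist (x + y) y) * ?\<rho> (x + y)) \<partial>lborel)"
    proof (intro nn_integral_mono)
      fix x
      have "ln (1 + norm x) * ?\<rho> (x + y) \<le> (ln 2 + ln_pos (norm x)) * ?\<rho> (x + y)"
        by (intro mult_right_mono ln2) auto
      then have "ennreal (ln (1 + norm x) * ?\<rho> (x + y)) \<le> ennreal (ln 2 * ?\<rho> (x + y) + ln_pos (norm x) * ?\<rho> (x + y))"
        by (intro ennreal_leI) (simp add: distrib_right)
      then show "ennreal (ln (1 + norm x) * ?\<rho> (x + y))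
          \<le> ennreal (ln 2) * ennreal (?\<rho> (x + y)) + ennreal (ln_pos (dist (x + y) y) * ?\<rho> (x + y))"
        by (simp add: ennreal_mult dist_norm)
    qed
    also have "\<dots> = ennreal (ln 2) * (\<integral>\<^sup>+x. ennreal (?\<rho> (x + y)) \<partial>lborel)
        + (\<integral>\<^sup>+x. ennreal (ln_pos (dist (x + y) y) * ?\<rho> (x + y)) \<partial>lborel)"
      by (subst nn_integral_add) (auto simp: nn_integral_cmult)
    also have "(\<integral>\<^sup>+x. ennreal (?\<rho> (x + y)) \<partial>lborel) = ennreal ?c"
      using nn_integral_lborel_shift[of "\<lambda>x. ennreal (?\<rho> x)" y] mass by simp
    also have "(\<integral>\<^sup>+x. ennreal (ln_pos (dist (x + y) y) * ?\<rho> (x + y)) \<partial>lborel) = g y"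
      unfolding g_def by (rule nn_integral_lborel_shift[where f="\<lambda>x. ennreal (ln_pos (dist x y) * ?\<rho> x)"]) measurable
    also have "ennreal (ln 2) * ennreal ?c + g y \<le> ennreal (ln 2) * ennreal ?c + ennreal ((M + 1) / ?c)"
      by (intro add_left_mono y)
    also have "\<dots> = ennreal (ln 2 * ?c + (M + 1) / ?c)"
      using cpos M0 by (simp add: ennreal_mult[symmetric] ennreal_plus[symmetric] del: ennreal_plus)
    finally show ?thesis .
  qed
  have part: "(\<integral>x. ln (1 + norm x) * (h (x + y))\<^sup>2 \<partial>lborel) \<le> ln 2 * ?c + (M + 1) / ?c"
    if h: "h \<in> Esp" and hle: "\<And>x. (h x)\<^sup>2 \<le> ?\<rho> x" for h
  proof -
    have "ennreal (\<integral>x. ln (1 + norm x) * (h (x + y))\<^sup>2 \<partial>lborel) = (\<integral>\<^sup>+x. ennreal (ln (1 + norm x) * (h (x + y))\<^sup>2) \<partial>lborel)"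
      using Esp_shift[OF h, of y] by (intro nn_integral_eq_integral[symmetric]) (auto simp: Esp_iff)
    also have "\<dots> \<le> (\<integral>\<^sup>+x. ennreal (ln (1 + norm x) * ?\<rho> (x + y)) \<partial>lborel)"
      by (intro nn_integral_mono ennreal_leI mult_left_mono hle) auto
    also note le
    finally show ?thesis using cpos M0 by (subst (asm) ennreal_le_iff) auto
  qed
  show thesis
    by (rule that; rule part) (use E in \<open>auto simp: mass_density_def\<close>)
qed

section \<open>Limits of the energy terms\<close>

lemma Q_diff_le:
  assumes "u \<in> H1" "v \<in> H1"
  shows "(\<lambda>x. u x - v x) \<in> H1" "Q (\<lambda>x. u x - v x) \<le> 2 * Q u + 2 * Q v"
proof -
  note s = H1_square_integrable[OF assms(1)] H1_square_integrable[OF assms(2)]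
  note g = l2_gradient_weak_grad[OF assms(1)] l2_gradient_weak_grad[OF assms(2)]
  have l: "l2_gradient (\<lambda>x. u x - v x) (\<lambda>x. 1 *\<^sub>R weak_grad u x + (- 1) *\<^sub>R weak_grad v x)"
    using l2_gradient_lincomb[OF s(1) g(1) s(2) g(2), of 1 "-1"] by simp
  show "(\<lambda>x. u x - v x) \<in> H1" using l square_integrable_diff[OF s] by (auto simp: H1_iff)
  show "Q (\<lambda>x. u x - v x) \<le> 2 * Q u + 2 * Q v"
    using l2norm_lincomb_sq[OF weak_grad_square_integrable[OF assms(1)] weak_grad_square_integrable[OF assms(2)], of 1 "-1"]
    unfolding Q_eq[OF square_integrable_diff[OF s] l] by (simp add: Q_eq_weak_grad)
qed

text \<open>The power estimate is linear in the mass: with bounded gradients, a vanishing L^2 norm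
  forces the higher power integrals to vanish.\<close>

lemma powr_integral_tendsto_0:
  assumes h: "\<And>n. h n \<in> H1" and Qb: "\<And>n. Q (h n) \<le> B" and lim: "(\<lambda>n. l2norm (h n)) \<longlonglongrightarrow> 0" and q: "2 \<le> (q::real)"
  shows "(\<lambda>n. \<integral>x. \<bar>h n x\<bar> powr q \<partial>lborel) \<longlonglongrightarrow> 0"
proof -
  define T where "T = sqrt B + 1"
  have B: "0 \<le> B" using Qb[of 0] Q_nonneg[of "h 0"] by linarith
  have T: "0 < T" "B \<le> T\<^sup>2" using B by (auto simp: T_def power2_sum intro!: add_nonneg_pos)
  obtain C where C: "0 < C" "\<And>u T. u \<in> H1 \<Longrightarrow> Q u \<le> T\<^sup>2 \<Longrightarrow> 0 < T \<Longrightarrow>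
      integrable lborel (\<lambda>x. \<bar>u x\<bar> powr q) \<and>
      (\<integral>x. \<bar>u x\<bar> powr q \<partial>lborel) \<le> C * T powr (q - 2) * (\<integral>x. (u x)\<^sup>2 \<partial>lborel)"
    by (rule power_integral_le[OF q]) (rule that)
  have bd: "norm (\<integral>x. \<bar>h n x\<bar> powr q \<partial>lborel) \<le> C * T powr (q - 2) * (l2norm (h n))\<^sup>2" for n
    using C(2)[OF h order.trans[OF Qb T(2)] T(1), of n] by (simp add: l2norm_sq_real)
  have "(\<lambda>n. C * T powr (q - 2) * (l2norm (h n))\<^sup>2) \<longlonglongrightarrow> C * T powr (q - 2) * 0\<^sup>2"
    by (intro tendsto_intros lim)
  then show ?thesis by (intro Lim_null_comparison[OF always_eventually[OF allI[OF bd]]]) simp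
qed

text \<open>\<open>R_remainder_bound\<close> with \<eta> = 1 is applied at the limit pair, and the
  derivative term is split by Young in the same way. First T is taken small, then n large.\<close>

lemma R_tendsto:
  assumes p: "1 < p" and a: "\<And>n. a n \<in> H1" "\<And>n. Q (a n) \<le> B" and b: "\<And>n. b n \<in> H1" "\<And>n. Q (b n) \<le> B"
    and u: "u \<in> H1" and v: "v \<in> H1"
    and lim: "(\<lambda>n. l2norm (\<lambda>x. a n x - u x)) \<longlonglongrightarrow> 0" "(\<lambda>n. l2norm (\<lambda>x. b n x - v x)) \<longlonglongrightarrow> 0"
  shows "(\<lambda>n. R p \<mu>1 \<mu>2 \<beta> (a n) (b n)) \<longlonglongrightarrow> R p \<mu>1 \<mu>2 \<beta> u v"
proof -
  have q: "2 \<le> 2 * p" "1 < 2 * p" using p by auto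
  obtain M where M: "0 \<le> M" "\<And>z. \<bar>nlin p \<mu>1 \<mu>2 \<beta> z\<bar> \<le> M * norm z powr (2 * p)"
    "\<And>z. norm (nlin_grad p \<mu>1 \<mu>2 \<beta> z) \<le> M * norm z powr (2 * p - 1)"
    by (rule nlin_bound[of p \<mu>1 \<mu>2 \<beta>, OF p]) (rule that)
  obtain C where C: "0 \<le> C" "\<And>u v h k T. u \<in> H1 \<Longrightarrow> v \<in> H1 \<Longrightarrow> h \<in> H1 \<Longrightarrow> k \<in> H1 \<Longrightarrow> 0 < T \<Longrightarrow>
    \<bar>R p \<mu>1 \<mu>2 \<beta> (\<lambda>x. u x + h x) (\<lambda>x. v x + k x) - R p \<mu>1 \<mu>2 \<beta> u v
      - (\<integral>x. nlin_grad p \<mu>1 \<mu>2 \<beta> (u x, v x) \<bullet> (h x, k x) \<partial>lborel)\<bar>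
    \<le> 1 * T * (\<integral>x. norm (u x, v x) powr (2 * p) \<partial>lborel)
      + (1 * T powr (1 - 2 * p) + C) * (\<integral>x. norm (h x, k x) powr (2 * p) \<partial>lborel)"
    by (rule R_remainder_bound[of p 1 \<mu>1 \<mu>2 \<beta>, OF p zero_less_one]) (rule that)
  define h where "h n x = a n x - u x" for n x
  define k where "k n x = b n x - v x" for n x
  have hk: "h n \<in> H1" "k n \<in> H1" "Q (h n) \<le> 2 * B + 2 * Q u" "Q (k n) \<le> 2 * B + 2 * Q v" for n
    using Q_diff_le[OF a(1) u, of n] Q_diff_le[OF b(1) v, of n] a(2)[of n] b(2)[of n]
    unfolding h_def[abs_def] k_def[abs_def] by auto
  define A where "A = (\<integral>x. norm (u x, v x) powr (2 * p) \<partial>lborel)"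
  define X where "X n = (\<integral>x. norm (h n x, k n x) powr (2 * p) \<partial>lborel)" for n
  have A: "0 \<le> A" and X: "0 \<le> X n" for n by (auto simp: A_def X_def)
  have bound: "\<bar>R p \<mu>1 \<mu>2 \<beta> (a n) (b n) - R p \<mu>1 \<mu>2 \<beta> u v\<bar> \<le> (1 + M) * T * A + ((1 + M) * T powr (1 - 2 * p) + C) * X n"
    if T: "0 < T" for n T
  proof -
    let ?D = "\<lambda>x. nlin_grad p \<mu>1 \<mu>2 \<beta> (u x, v x) \<bullet> (h n x, k n x)"
    have eq: "(\<lambda>x. u x + h n x) = a n" "(\<lambda>x. v x + k n x) = b n" by (auto simp: h_def k_def)
    have 1: "\<bar>R p \<mu>1 \<mu>2 \<beta> (a n) (b n) - R p \<mu>1 \<mu>2 \<beta> u v - (\<integral>x. ?D x \<partial>lborel)\<bar> \<le> T * A + (T powr (1 - 2 * p) + C) * X n"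
      using C(2)[OF u v hk(1,2) T, of n n] by (simp add: eq A_def X_def)
    have "\<bar>\<integral>x. ?D x \<partial>lborel\<bar> \<le> (\<integral>x. \<bar>?D x\<bar> \<partial>lborel)" by simp
    also have "\<dots> \<le> (\<integral>x. M * (T * norm (u x, v x) powr (2 * p) + T powr (1 - 2 * p) * norm (h n x, k n x) powr (2 * p)) \<partial>lborel)"
    proof (rule integral_mono)
      show "integrable lborel (\<lambda>x. \<bar>?D x\<bar>)" using integrable_nlin_grad[OF p u v hk(1,2)] by auto
      show "integrable lborel (\<lambda>x. M * (T * norm (u x, v x) powr (2 * p) + T powr (1 - 2 * p) * norm (h n x, k n x) powr (2 * p)))"
        using Pair_powr_integral(1)[OF u v q(1)] Pair_powr_integral(1)[OF hk(1,2) q(1), of n n] by simp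
      fix x
      have "\<bar>?D x\<bar> \<le> norm (nlin_grad p \<mu>1 \<mu>2 \<beta> (u x, v x)) * norm (h n x, k n x)" by (rule Cauchy_Schwarz_ineq2)
      also have "\<dots> \<le> M * norm (u x, v x) powr (2 * p - 1) * norm (h n x, k n x)" by (intro mult_right_mono M) auto
      also have "\<dots> \<le> M * (T * norm (u x, v x) powr (2 * p) + T powr (1 - 2 * p) * norm (h n x, k n x) powr (2 * p))"
        unfolding mult.assoc using M(1) T q by (intro mult_left_mono Young_powr) auto
      finally show "\<bar>?D x\<bar> \<le> M * (T * norm (u x, v x) powr (2 * p) + T powr (1 - 2 * p) * norm (h n x, k n x) powr (2 * p))" .
    qed
    also have "\<dots> = M * (T * A + T powr (1 - 2 * p) * X n)"
      using Pair_powr_integral(1)[OF u v q(1)] Pair_powr_integral(1)[OF hk(1,2) q(1), of n n] by (simp add: A_def X_def)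
    finally show ?thesis using 1 by (simp add: algebra_simps)
  qed
  have X0: "X \<longlonglongrightarrow> 0"
  proof (rule Lim_null_comparison)
    show "\<forall>\<^sub>F n in sequentially. norm (X n) \<le> 2 powr (2 * p) * ((\<integral>x. \<bar>h n x\<bar> powr (2 * p) \<partial>lborel) + (\<integral>x. \<bar>k n x\<bar> powr (2 * p) \<partial>lborel))"
      using Pair_powr_integral(2)[OF hk(1,2) q(1)] X by (auto simp: X_def intro!: always_eventually)
    have "(\<lambda>n. 2 powr (2 * p) * ((\<integral>x. \<bar>h n x\<bar> powr (2 * p) \<partial>lborel) + (\<integral>x. \<bar>k n x\<bar> powr (2 * p) \<partial>lborel)))
        \<longlonglongrightarrow> 2 powr (2 * p) * (0 + 0)"
      using lim by (intro tendsto_intros powr_integral_tendsto_0[OF hk(1,3) _ q(1)] powr_integral_tendsto_0[OF hk(2,4) _ q(1)])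
        (auto simp: h_def[abs_def] k_def[abs_def])
    then show "(\<lambda>n. 2 powr (2 * p) * ((\<integral>x. \<bar>h n x\<bar> powr (2 * p) \<partial>lborel) + (\<integral>x. \<bar>k n x\<bar> powr (2 * p) \<partial>lborel))) \<longlonglongrightarrow> 0"
      by simp
  qed
  show ?thesis
  proof (rule LIMSEQ_I)
    fix e :: real assume e: "0 < e"
    \<comment> \<open>Makes the part independent of n at most e / 2; the + 1 covers a zero
      factor.\<close>
    define T where "T = e / (2 * ((1 + M) * A + 1))"
    have pos: "0 < (1 + M) * A + 1" using M(1) A by (simp add: add_nonneg_pos)
    have T: "0 < T" using e pos by (simp add: T_def)
    have "t / (2 * (s + 1)) * s \<le> t / 2" if "0 < t" "0 \<le> s" for t s :: real
      using that by (simp add: field_simps)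
    from this[OF e, of "(1 + M) * A"] have TA: "(1 + M) * T * A \<le> e / 2"
      using M(1) A by (simp add: T_def mult_ac)
    have "(\<lambda>n. ((1 + M) * T powr (1 - 2 * p) + C) * X n) \<longlonglongrightarrow> ((1 + M) * T powr (1 - 2 * p) + C) * 0"
      by (intro tendsto_intros X0)
    then obtain N where N: "\<And>n. N \<le> n \<Longrightarrow> ((1 + M) * T powr (1 - 2 * p) + C) * X n < e / 2"
      by (rule LIMSEQ_lessD[where e="e/2"]) (use e in auto)
    have "norm (R p \<mu>1 \<mu>2 \<beta> (a n) (b n) - R p \<mu>1 \<mu>2 \<beta> u v) < e" if "N \<le> n" for n
      using bound[OF T, of n] TA N[OF that] unfolding real_norm_def by linarith
    then show "\<exists>N. \<forall>n\<ge>N. norm (R p \<mu>1 \<mu>2 \<beta> (a n) (b n) - R p \<mu>1 \<mu>2 \<beta> u v) < e" by blast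
  qed
qed

lemma square_diff_integral_le:
  fixes f g :: "pt \<Rightarrow> real"
  assumes f: "square_integrable f" and g: "square_integrable g"
  shows "integrable lborel (\<lambda>x. \<bar>(f x)\<^sup>2 - (g x)\<^sup>2\<bar>)"
    "(\<integral>x. \<bar>(f x)\<^sup>2 - (g x)\<^sup>2\<bar> \<partial>lborel) \<le> l2norm (\<lambda>x. f x - g x) * (l2norm f + l2norm g)"
proof -
  have eq: "\<bar>(f x)\<^sup>2 - (g x)\<^sup>2\<bar> = norm (f x - g x) * norm (f x + g x)" for x
    by (simp add: power2_eq_square square_diff_square_factored abs_mult mult.commute)
  note s = square_integrable_diff[OF f g] square_integrable_add[OF f g]
  show "integrable lborel (\<lambda>x. \<bar>(f x)\<^sup>2 - (g x)\<^sup>2\<bar>)" unfolding eq by (rule square_integrable_norm_mult(1)[OF s])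
  have "(\<integral>x. \<bar>(f x)\<^sup>2 - (g x)\<^sup>2\<bar> \<partial>lborel) \<le> l2norm (\<lambda>x. f x - g x) * l2norm (\<lambda>x. f x + g x)"
    unfolding eq by (rule square_integrable_norm_mult(2)[OF s])
  also have "\<dots> \<le> l2norm (\<lambda>x. f x - g x) * (l2norm f + l2norm g)"
    by (intro mult_left_mono l2norm_triangle f g) simp
  finally show "(\<integral>x. \<bar>(f x)\<^sup>2 - (g x)\<^sup>2\<bar> \<partial>lborel) \<le> l2norm (\<lambda>x. f x - g x) * (l2norm f + l2norm g)" .
qed

text \<open>The densities converge in L^1 and stay bounded in L^2; the negative form needs only one
  factor to be small in L^1.\<close>

lemma W_neg_tendsto:
  assumes a: "\<And>n. a n \<in> H1" "\<And>n. l2norm (a n) \<le> S" and b: "\<And>n. b n \<in> H1" "\<And>n. l2norm (b n) \<le> S"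
    and u: "u \<in> H1" and v: "v \<in> H1"
    and lim: "(\<lambda>n. l2norm (\<lambda>x. a n x - u x)) \<longlonglongrightarrow> 0" "(\<lambda>n. l2norm (\<lambda>x. b n x - v x)) \<longlonglongrightarrow> 0"
    and B: "\<And>n. l2norm (mass_density (a n) (b n)) \<le> B"
  shows "(\<lambda>n. W_neg (a n) (b n)) \<longlonglongrightarrow> W_neg u v"
proof (rule LIM_zero_cancel)
  let ?\<rho> = "mass_density u v" and ?\<rho>n = "\<lambda>n. mass_density (a n) (b n)"
  define f where "f n x = ?\<rho>n n x - ?\<rho> x" for n x
  note sa = H1_square_integrable[OF a(1)] and sb = H1_square_integrable[OF b(1)]
    and su = H1_square_integrable[OF u] and sv = H1_square_integrable[OF v]
  note r = mass_density_square_integrable(1,2)[OF u v]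
  note rn = mass_density_square_integrable(1)[OF a(1) b(1)] mass_density_square_integrable(2)[OF a(1) b(1)]
  have fi: "integrable lborel (f n)" for n unfolding f_def using r(2) rn(2) by simp
  let ?D = "\<lambda>n. l2norm (\<lambda>x. a n x - u x) * (S + l2norm u) + l2norm (\<lambda>x. b n x - v x) * (S + l2norm v)"
  have f1: "(\<integral>x. \<bar>f n x\<bar> \<partial>lborel) \<le> ?D n" for n
  proof -
    note d = square_diff_integral_le[OF sa su, of n] square_diff_integral_le[OF sb sv, of n]
    have "(\<integral>x. \<bar>f n x\<bar> \<partial>lborel) \<le> (\<integral>x. \<bar>(a n x)\<^sup>2 - (u x)\<^sup>2\<bar> + \<bar>(b n x)\<^sup>2 - (v x)\<^sup>2\<bar> \<partial>lborel)"
    proof (rule integral_mono)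
      show "integrable lborel (\<lambda>x. \<bar>f n x\<bar>)" by (rule integrable_abs[OF fi])
      show "integrable lborel (\<lambda>x. \<bar>(a n x)\<^sup>2 - (u x)\<^sup>2\<bar> + \<bar>(b n x)\<^sup>2 - (v x)\<^sup>2\<bar>)" using d by simp
    qed (simp add: f_def mass_density_def)
    also have "\<dots> \<le> l2norm (\<lambda>x. a n x - u x) * (l2norm (a n) + l2norm u) + l2norm (\<lambda>x. b n x - v x) * (l2norm (b n) + l2norm v)"
      using d by simp
    also have "\<dots> \<le> ?D n" using a(2) b(2) by (intro add_mono mult_left_mono) auto
    finally show ?thesis .
  qed
  have bd: "norm (W_neg (a n) (b n) - W_neg u v) \<le> ln_neg_norm * ?D n * (B + l2norm ?\<rho>)" for n
  proof -
    note k1 = kernel_form_ln_neg[OF fi[of n] rn(1)[of n n]] and k2 = kernel_form_ln_neg[OF fi[of n] r(1)]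
    note k3 = kernel_form_ln_neg(1)[OF rn(2)[of n n] rn(1)[of n n]] kernel_form_ln_neg(1)[OF r(2,1)]
    \<comment> \<open>A bilinear difference telescopes into one term with the increment on the left
      and one with it on the right.\<close>
    have "W_neg (a n) (b n) - W_neg u v = kernel_form ln_neg (f n) (?\<rho>n n) + kernel_form ln_neg ?\<rho> (f n)"
      unfolding W_neg_def kernel_form_def
      using k1(1) k2(3) k3
      by (subst Bochner_Integration.integral_diff[symmetric], simp, simp,
          subst Bochner_Integration.integral_add[symmetric], simp, simp)
        (intro Bochner_Integration.integral_cong, auto simp: f_def algebra_simps)
    then have "norm (W_neg (a n) (b n) - W_neg u v)
        \<le> ln_neg_norm * (\<integral>x. \<bar>f n x\<bar> \<partial>lborel) * (l2norm (?\<rho>n n) + l2norm ?\<rho>)"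
      using k1(2) k2(4) by (simp add: distrib_left)
    also have "\<dots> \<le> ln_neg_norm * ?D n * (B + l2norm ?\<rho>)"
      using f1[of n] B[of n] order.trans[OF Bochner_Integration.integral_nonneg f1[of n]]
      by (intro mult_mono mult_nonneg_nonneg) (auto simp: add_nonneg_nonneg)
    finally show ?thesis .
  qed
  have "(\<lambda>n. ln_neg_norm * ?D n * (B + l2norm ?\<rho>)) \<longlonglongrightarrow>
      ln_neg_norm * (0 * (S + l2norm u) + 0 * (S + l2norm v)) * (B + l2norm ?\<rho>)"
    by (intro tendsto_intros lim)
  then show "(\<lambda>n. W_neg (a n) (b n) - W_neg u v) \<longlonglongrightarrow> 0"
    by (intro Lim_null_comparison[OF always_eventually[OF allI[OF bd]]]) simp
qed

text \<open>Far away the positive kernel is unbounded and the logarithmic moments need not converge,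
  so semicontinuity through nonnegativity takes the place of convergence.\<close>

lemma W_pos_Fatou:
  assumes a: "\<And>n. a n \<in> Esp" and b: "\<And>n. b n \<in> Esp" and u: "u \<in> Esp" and v: "v \<in> Esp"
    and AE: "AE x in lborel. (\<lambda>n. a n x) \<longlonglongrightarrow> u x" "AE x in lborel. (\<lambda>n. b n x) \<longlonglongrightarrow> v x"
    and lim: "(\<lambda>n. W_pos (a n) (b n)) \<longlonglongrightarrow> w"
  shows "W_pos u v \<le> w"
proof -
  note [measurable] = square_integrable_measurable[OF Esp_square_integrable[OF a]]
    square_integrable_measurable[OF Esp_square_integrable[OF b]]
    square_integrable_measurable[OF Esp_square_integrable[OF u]] square_integrable_measurable[OF Esp_square_integrable[OF v]]
  have [measurable]: "mass_density f g \<in> borel_measurable borel"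
    if [measurable]: "f \<in> borel_measurable borel" "g \<in> borel_measurable borel" for f g :: "pt \<Rightarrow> real"
    unfolding mass_density_def[abs_def] by measurable
  let ?\<rho> = "mass_density u v" and ?\<rho>n = "\<lambda>n. mass_density (a n) (b n)"
  have \<rho>: "AE x in lborel. (\<lambda>n. ?\<rho>n n x) \<longlonglongrightarrow> ?\<rho> x"
    using AE by eventually_elim (auto simp: mass_density_def intro!: tendsto_intros)
  have "ennreal (W_pos u v) = (\<integral>\<^sup>+x. \<integral>\<^sup>+y. ennreal (ln_pos (dist x y) * ?\<rho> x * ?\<rho> y) \<partial>lborel \<partial>lborel)"
    unfolding W_pos_nn_integral[OF u v] by (subst lborel.nn_integral_fst[symmetric]) auto
  also have "\<dots> = (\<integral>\<^sup>+x. \<integral>\<^sup>+y. liminf (\<lambda>n. ennreal (ln_pos (dist x y) * ?\<rho>n n x * ?\<rho>n n y)) \<partial>lborel \<partial>lborel)"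
  \<comment> \<open>Iterated integrals let a.e. convergence in one variable be used twice, so no
    null set of the product space has to be handled.\<close>
  proof (intro nn_integral_cong_AE, use \<rho> in eventually_elim, intro nn_integral_cong_AE, use \<rho> in eventually_elim)
    fix x y assume "(\<lambda>n. ?\<rho>n n x) \<longlonglongrightarrow> ?\<rho> x" "(\<lambda>n. ?\<rho>n n y) \<longlonglongrightarrow> ?\<rho> y"
    then have "(\<lambda>n. ennreal (ln_pos (dist x y) * ?\<rho>n n x * ?\<rho>n n y)) \<longlonglongrightarrow> ennreal (ln_pos (dist x y) * ?\<rho> x * ?\<rho> y)"
      by (intro tendsto_ennrealI tendsto_intros)
    then show "ennreal (ln_pos (dist x y) * ?\<rho> x * ?\<rho> y) = liminf (\<lambda>n. ennreal (ln_pos (dist x y) * ?\<rho>n n x * ?\<rho>n n y))"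
      by (intro lim_imp_Liminf[symmetric]) auto
  qed
  also have "\<dots> = (\<integral>\<^sup>+z. liminf (\<lambda>n. ennreal (ln_pos (dist (fst z) (snd z)) * ?\<rho>n n (fst z) * ?\<rho>n n (snd z))) \<partial>(lborel \<Otimes>\<^sub>M lborel))"
    by (subst lborel.nn_integral_fst[symmetric]) auto
  also have "\<dots> \<le> liminf (\<lambda>n. \<integral>\<^sup>+z. ennreal (ln_pos (dist (fst z) (snd z)) * ?\<rho>n n (fst z) * ?\<rho>n n (snd z)) \<partial>(lborel \<Otimes>\<^sub>M lborel))"
    by (rule nn_integral_liminf) measurable
  also have "\<dots> = liminf (\<lambda>n. ennreal (W_pos (a n) (b n)))"
    by (simp add: W_pos_nn_integral[OF a b])
  also have "\<dots> = ennreal w"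
    by (intro lim_imp_Liminf tendsto_ennrealI lim) simp
  finally show ?thesis
    using LIMSEQ_le_const[OF lim, of 0] W_pos_nonneg by (simp add: ennreal_le_iff)
qed

lemma exists_minimizer:
  assumes p: "1 < p" and c: "0 < c1" "0 < c2" and k: "0 < \<kappa>"
    and coercive: "\<And>u v. u \<in> Sc c1 \<Longrightarrow> v \<in> Sc c2 \<Longrightarrow> \<kappa> * (Q u + Q v) + W_pos u v / 4 - D \<le> Ifun p \<mu>1 \<mu>2 \<beta> u v"
  obtains u v where "u \<in> Sc c1" "v \<in> Sc c2"
    "\<And>w z. w \<in> Sc c1 \<Longrightarrow> z \<in> Sc c2 \<Longrightarrow> Ifun p \<mu>1 \<mu>2 \<beta> u v \<le> Ifun p \<mu>1 \<mu>2 \<beta> w z"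
proof -
  let ?I = "Ifun p \<mu>1 \<mu>2 \<beta>"
  let ?V = "(\<lambda>(u, v). ?I u v) ` (Sc c1 \<times> Sc c2)"
  define m where "m = Inf ?V"
  have ne: "?V \<noteq> {}" using Sc_nonempty[OF c(1)] Sc_nonempty[OF c(2)] by auto
  have lower: "- D \<le> ?I u v" if "u \<in> Sc c1" "v \<in> Sc c2" for u v
  proof -
    have "0 \<le> \<kappa> * (Q u + Q v)" using k Q_nonneg[of u] Q_nonneg[of v] by simp
    then show ?thesis using coercive[OF that] W_pos_nonneg[of u v] by linarith
  qed
  then have bdd: "bdd_below ?V" by (intro bdd_belowI[of _ "- D"]) auto
  have m_le: "m \<le> ?I u v" if "u \<in> Sc c1" "v \<in> Sc c2" for u v
    unfolding m_def using that by (intro cInf_lower[OF _ bdd]) auto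
  \<comment> \<open>Bounds \<kappa> (Q u + Q v) + W_pos u v / 4 once the energy is within 1 of its
    infimum; dividing by \<kappa> gives \<open>B\<close>, multiplying by 4 bounds the positive
    part.\<close>
  define M where "M = m + 1 + D"
  define B where "B = M / \<kappa>"
  define W where "W = ln 2 * (c1 + c2) + (4 * M + 1) / (c1 + c2)"
  \<comment> \<open>These bounds will hold for the translated pair; its energy, masses and Dirichlet
    energies are those of the original, and only the logarithmic moments improve.\<close>
  define good where "good n u v \<longleftrightarrow> u \<in> Sc c1 \<and> v \<in> Sc c2 \<and> ?I u v \<le> m + 1 / real (Suc n) \<and> Q u \<le> B \<and> Q v \<le> B \<and>
    W_pos u v \<le> 4 * M \<and> (\<integral>x. ln (1 + norm x) * (u x)\<^sup>2 \<partial>lborel) \<le> W \<and> (\<integral>x. ln (1 + norm x) * (v x)\<^sup>2 \<partial>lborel) \<le> W"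
    for n :: nat and u v
  have ex: "\<exists>u v. good n u v" for n
  proof -
    obtain u v where uv: "u \<in> Sc c1" "v \<in> Sc c2" "?I u v < m + 1 / real (Suc n)"
      using cInf_lessD[OF ne, of "m + 1 / real (Suc n)"] by (auto simp: m_def simp del: of_nat_Suc)
    have "?I u v \<le> m + 1" using uv(3) by (rule less_imp_le[OF less_le_trans]) simp
    then have le: "\<kappa> * (Q u + Q v) + W_pos u v / 4 \<le> M" using coercive[OF uv(1,2)] by (simp add: M_def)
    have "0 \<le> \<kappa> * Q u" "0 \<le> \<kappa> * Q v" using k by (auto simp: Q_nonneg)
    then have *: "\<kappa> * Q u \<le> M" "\<kappa> * Q v \<le> M" "W_pos u v \<le> 4 * M"
      using le W_pos_nonneg[of u v] by (auto simp: distrib_left)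
    then have QB: "Q u \<le> B" "Q v \<le> B" using k by (auto simp: B_def pos_le_divide_eq mult.commute)
    obtain y where y: "(\<integral>x. ln (1 + norm x) * (u (x + y))\<^sup>2 \<partial>lborel) \<le> W"
      "(\<integral>x. ln (1 + norm x) * (v (x + y))\<^sup>2 \<partial>lborel) \<le> W"
      by (rule recenter[OF uv(1,2) c *(3), folded W_def]) (rule that)
    note E = Sc_Esp[OF uv(1)] Sc_Esp[OF uv(2)]
    show ?thesis
      using uv(3) QB *(3) y
      by (intro exI[of _ "\<lambda>x. u (x + y)"] exI[of _ "\<lambda>x. v (x + y)"])
        (simp add: good_def Sc_shift[OF uv(1)] Sc_shift[OF uv(2)] Ifun_shift[OF E] W_pos_shift[OF E] Q_shift[OF E(1)] Q_shift[OF E(2)] del: of_nat_Suc)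
  qed
  have "\<forall>n. \<exists>u v. good n u v" using ex by blast
  from choice[OF this] obtain a where "\<forall>n. \<exists>v. good n (a n) v" by (elim exE)
  from choice[OF this] obtain b where "\<forall>n. good n (a n) (b n)" by (elim exE)
  then have ab: "\<And>n. a n \<in> Sc c1" "\<And>n. b n \<in> Sc c2" "\<And>n. ?I (a n) (b n) \<le> m + 1 / real (Suc n)"
    "\<And>n. Q (a n) \<le> B" "\<And>n. Q (b n) \<le> B" "\<And>n. W_pos (a n) (b n) \<le> 4 * M"
    "\<And>n. (\<integral>x. ln (1 + norm x) * (a n x)\<^sup>2 \<partial>lborel) \<le> W" "\<And>n. (\<integral>x. ln (1 + norm x) * (b n x)\<^sup>2 \<partial>lborel) \<le> W"
    unfolding good_def by simp_all
  note aE = Sc_Esp[OF ab(1)] and bE = Sc_Esp[OF ab(2)]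
  have B0: "0 \<le> B" using ab(4)[of 0] Q_nonneg[of "a 0"] by linarith
  have l2: "l2norm (a n) = sqrt c1" "l2norm (b n) = sqrt c2" for n
    using Sc_l2norm[OF ab(1)[of n]] Sc_l2norm[OF ab(2)[of n]] by (metis l2norm_nonneg real_sqrt_unique)+
  have W0: "0 \<le> W"
    by (rule order.trans[OF _ ab(7)[of 0]]) (auto intro!: Bochner_Integration.integral_nonneg)
  define L where "L = sqrt B + sqrt c1 + sqrt c2 + W"
  have L: "sqrt B \<le> L" "sqrt c1 \<le> L" "sqrt c2 \<le> L" "W \<le> L" using B0 c W0 by (auto simp: L_def)
  have BL: "B \<le> L\<^sup>2"
    using power_mono[OF L(1), of 2] B0 by simp
  have L0: "0 \<le> L" using L(4) W0 by linarith
  have wi: "integrable lborel (\<lambda>x. ln (1 + norm x) * (a n x)\<^sup>2)" "integrable lborel (\<lambda>x. ln (1 + norm x) * (b n x)\<^sup>2)" for n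
    using aE[of n] bE[of n] by (auto simp: Esp_iff)
  obtain r1 u where r1: "strict_mono r1" and u: "square_integrable u" and lim1: "(\<lambda>n. l2norm (\<lambda>x. a (r1 n) x - u x)) \<longlonglongrightarrow> 0"
    by (rule Rellich_compactness[of L a])
      (use H1_shift_Lipschitz[OF Esp_H1[OF aE] order.trans[OF ab(4) BL] L0] l2 L wi order.trans[OF ab(7) L(4)] in auto)
  obtain r2 v where r2: "strict_mono r2" and v: "square_integrable v" and lim2: "(\<lambda>n. l2norm (\<lambda>x. b (r1 (r2 n)) x - v x)) \<longlonglongrightarrow> 0"
    by (rule Rellich_compactness[of L "\<lambda>n. b (r1 n)"])
      (use H1_shift_Lipschitz[OF Esp_H1[OF bE] order.trans[OF ab(5) BL] L0] l2 L wi order.trans[OF ab(8) L(4)] in auto)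
  have lim1': "(\<lambda>n. l2norm (\<lambda>x. a (r1 (r2 n)) x - u x)) \<longlonglongrightarrow> 0"
    using LIMSEQ_subseq_LIMSEQ[OF lim1 r2] by (simp add: o_def)
  obtain r3 where r3: "strict_mono r3" and AE1: "AE x in lborel. (\<lambda>n. a (r1 (r2 (r3 n))) x) \<longlonglongrightarrow> u x"
    by (rule l2_tendsto_subseq_AE[of "\<lambda>n. a (r1 (r2 n))" u]) (use Esp_square_integrable[OF aE] u lim1' in auto)
  have lim2': "(\<lambda>n. l2norm (\<lambda>x. b (r1 (r2 (r3 n))) x - v x)) \<longlonglongrightarrow> 0"
    using LIMSEQ_subseq_LIMSEQ[OF lim2 r3] by (simp add: o_def)
  obtain r4 where r4: "strict_mono r4" and AE2: "AE x in lborel. (\<lambda>n. b (r1 (r2 (r3 (r4 n)))) x) \<longlonglongrightarrow> v x"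
    by (rule l2_tendsto_subseq_AE[of "\<lambda>n. b (r1 (r2 (r3 n)))" v]) (use Esp_square_integrable[OF bE] v lim2' in auto)
  define s4 where "s4 n = r1 (r2 (r3 (r4 n)))" for n
  have s4: "strict_mono s4" using r1 r2 r3 r4 by (simp add: s4_def strict_mono_def)
  \<comment> \<open>The three terms for which only lower semicontinuity is available. Along a
    subsequence on which they all converge, lower limits become limits; every index from 2 on
    repeats the third.\<close>
  define q where "q i n = (if i = 0 then Q (a (s4 n)) else if i = 1 then Q (b (s4 n)) else W_pos (a (s4 n)) (b (s4 n)))" for i n :: nat
  have "\<bar>q i n\<bar> \<le> B + 4 * M" for i n
    using ab(4)[of "s4 n"] ab(5)[of "s4 n"] ab(6)[of "s4 n"] Q_nonneg[of "a (s4 n)"] Q_nonneg[of "b (s4 n)"]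
      W_pos_nonneg[of "a (s4 n)" "b (s4 n)"] by (auto simp: q_def)
  then obtain r5 where r5: "strict_mono r5" and conv: "\<And>i. convergent (\<lambda>n. q i (r5 n))"
    by (rule bounded_sequences_common_subseq[of q "\<lambda>_. B + 4 * M"]) (rule that)
  define s where "s n = s4 (r5 n)" for n
  have s: "strict_mono s" using s4 r5 by (simp add: s_def strict_mono_def)
  obtain qa where qa: "(\<lambda>n. Q (a (s n))) \<longlonglongrightarrow> qa" using conv[of 0] by (auto simp: q_def s_def convergent_def)
  obtain qb where qb: "(\<lambda>n. Q (b (s n))) \<longlonglongrightarrow> qb" using conv[of 1] by (auto simp: q_def s_def convergent_def)
  obtain w where w: "(\<lambda>n. W_pos (a (s n)) (b (s n))) \<longlonglongrightarrow> w" using conv[of 2] by (auto simp: q_def s_def convergent_def)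
  have lu: "(\<lambda>n. l2norm (\<lambda>x. a (s n) x - u x)) \<longlonglongrightarrow> 0"
    using LIMSEQ_subseq_LIMSEQ[OF LIMSEQ_subseq_LIMSEQ[OF LIMSEQ_subseq_LIMSEQ[OF lim1' r3] r4] r5]
    by (simp add: o_def s_def s4_def)
  have lv: "(\<lambda>n. l2norm (\<lambda>x. b (s n) x - v x)) \<longlonglongrightarrow> 0"
    using LIMSEQ_subseq_LIMSEQ[OF LIMSEQ_subseq_LIMSEQ[OF lim2' r4] r5] by (simp add: o_def s_def s4_def)
  have AEu: "AE x in lborel. (\<lambda>n. a (s n) x) \<longlonglongrightarrow> u x"
    using AE1
  proof eventually_elim
    case (elim x)
    from LIMSEQ_subseq_LIMSEQ[OF LIMSEQ_subseq_LIMSEQ[OF elim r4] r5] show ?case by (simp add: o_def s_def s4_def)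
  qed
  have AEv: "AE x in lborel. (\<lambda>n. b (s n) x) \<longlonglongrightarrow> v x"
    using AE2
  proof eventually_elim
    case (elim x)
    from LIMSEQ_subseq_LIMSEQ[OF elim r5] show ?case by (simp add: o_def s_def s4_def)
  qed
  have Qu: "u \<in> H1" "Q u \<le> qa" by (rule H1_lower_semicontinuous[OF Esp_H1[OF aE] u lu qa])+
  have Qv: "v \<in> H1" "Q v \<le> qb" by (rule H1_lower_semicontinuous[OF Esp_H1[OF bE] v lv qb])+
  \<comment> \<open>Strong L^2 convergence keeps the mass, and Fatou for the weighted functions
    keeps the logarithmic moment finite: the constraint survives the limit.\<close>
  have limit_Sc: "f \<in> Sc c" if g: "\<And>n. g n \<in> Sc c" "\<And>n. (\<integral>x. ln (1 + norm x) * (g n x)\<^sup>2 \<partial>lborel) \<le> W"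
    and f: "f \<in> H1" "(\<lambda>n. l2norm (\<lambda>x. g n x - f x)) \<longlonglongrightarrow> 0" "AE x in lborel. (\<lambda>n. g n x) \<longlonglongrightarrow> f x"
    for f g c
  proof -
    note sf = H1_square_integrable[OF f(1)] and sg = Esp_square_integrable[OF Sc_Esp[OF g(1)]]
    note [measurable] = square_integrable_measurable[OF sf]
    have wm: "weighted f \<in> borel_measurable borel" unfolding weighted_def[abs_def] by measurable
    have "AE x in lborel. (\<lambda>n. weighted (g n) x) \<longlonglongrightarrow> weighted f x"
      using f(3) by eventually_elim (auto simp: weighted_def intro!: tendsto_intros)
    moreover have "l2norm (weighted (g n)) \<le> sqrt W" for n
      using g(2)[of n] by (intro real_le_rsqrt) (simp add: l2norm_sq_real weighted_sq)
    ultimately have "square_integrable (weighted f)"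
      by (rule l2norm_Fatou(1)[OF square_integrable_weighted[OF Sc_Esp[OF g(1)]] wm])
    then have fE: "f \<in> Esp" using f(1) by (simp add: Esp_iff square_integrable_def weighted_sq)
    have "(\<lambda>n. l2norm (g n) - l2norm f) \<longlonglongrightarrow> 0"
    proof (rule Lim_null_comparison[OF _ f(2)], intro always_eventually allI)
      fix n
      show "norm (l2norm (g n) - l2norm f) \<le> l2norm (\<lambda>x. g n x - f x)"
        using l2norm_triangle_sub[OF sg[of n] sf] l2norm_triangle_sub[OF sf sg[of n]] l2norm_diff_commute[of f "g n"]
        unfolding real_norm_def by linarith
    qed
    then have "(\<lambda>n. l2norm (g n)) \<longlonglongrightarrow> l2norm f" by (rule LIM_zero_cancel)
    then have "(\<lambda>n. (l2norm (g n))\<^sup>2) \<longlonglongrightarrow> (l2norm f)\<^sup>2" by (rule tendsto_power)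
    then have "(l2norm f)\<^sup>2 = c" by (simp add: Sc_l2norm[OF g(1)] LIMSEQ_const_iff)
    then show ?thesis using fE by (simp add: Sc_def l2norm_sq_real)
  qed
  have uS: "u \<in> Sc c1" by (rule limit_Sc[OF ab(1,7) Qu(1) lu AEu])
  have vS: "v \<in> Sc c2" by (rule limit_Sc[OF ab(2,8) Qv(1) lv AEv])
  note E = Sc_Esp[OF uS] Sc_Esp[OF vS]
  have Wp: "W_pos u v \<le> w" by (rule W_pos_Fatou[OF aE bE E AEu AEv w])
  obtain C where C: "0 < C" "\<And>u v c1 c2. u \<in> Sc c1 \<Longrightarrow> v \<in> Sc c2 \<Longrightarrow>
    W_neg u v \<le> C * (c1 + c2) * (sqrt (Q u * c1) + sqrt (Q v * c2))"
    "\<And>u v c1 c2. u \<in> Sc c1 \<Longrightarrow> v \<in> Sc c2 \<Longrightarrow> l2norm (mass_density u v) \<le> C * (sqrt (Q u * c1) + sqrt (Q v * c2))"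
    by (rule W_neg_le) (rule that)
  have db: "l2norm (mass_density (a n) (b n)) \<le> C * (sqrt (B * c1) + sqrt (B * c2))" for n
    using C(1) c ab(4,5)
    by (intro order.trans[OF C(3)[OF ab(1,2)]] mult_left_mono add_mono real_sqrt_le_mono mult_right_mono) auto
  have Wn: "(\<lambda>n. W_neg (a (s n)) (b (s n))) \<longlonglongrightarrow> W_neg u v"
    by (rule W_neg_tendsto[where S=L and B="C * (sqrt (B * c1) + sqrt (B * c2))"])
      (use Esp_H1[OF aE] Esp_H1[OF bE] l2 L Qu Qv lu lv db in auto)
  have Rn: "(\<lambda>n. R p \<mu>1 \<mu>2 \<beta> (a (s n)) (b (s n))) \<longlonglongrightarrow> R p \<mu>1 \<mu>2 \<beta> u v"
    by (rule R_tendsto[OF p Esp_H1[OF aE] ab(4) Esp_H1[OF bE] ab(5) Qu(1) Qv(1) lu lv])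
  have In: "(\<lambda>n. ?I (a (s n)) (b (s n))) \<longlonglongrightarrow> (qa + qb) / 2 + (w - W_neg u v) / 4 - R p \<mu>1 \<mu>2 \<beta> u v / (2 * p)"
    unfolding Ifun_def W0_eq_pos_neg[OF aE bE]
    using p by (intro tendsto_intros qa qb w Wn Rn) auto
  have "(\<lambda>n. m + 1 / real (Suc (s n))) \<longlonglongrightarrow> m + 0"
    using LIMSEQ_subseq_LIMSEQ[OF LIMSEQ_Suc[OF lim_1_over_n] s] by (intro tendsto_intros) (simp add: o_def)
  then have "(qa + qb) / 2 + (w - W_neg u v) / 4 - R p \<mu>1 \<mu>2 \<beta> u v / (2 * p) \<le> m + 0"
    by (rule LIMSEQ_le[OF In]) (use ab(3) in auto)
  moreover have "?I u v \<le> (qa + qb) / 2 + (w - W_neg u v) / 4 - R p \<mu>1 \<mu>2 \<beta> u v / (2 * p)"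
    unfolding Ifun_def W0_eq_pos_neg[OF E] using Qu(2) Qv(2) Wp by (auto intro!: add_mono divide_right_mono)
  ultimately have "?I u v \<le> m" by linarith
  then show thesis using m_le by (intro that[OF uS vS]) (meson order.trans)
qed

theorem theorem1p1:
  fixes p \<mu>1 \<mu>2 \<beta> c1 c2 :: real
  assumes "p > 1" and "\<beta> > 0" and "c1 > 0" and "c2 > 0"
    and "max (\<mu>1 + \<beta>) (\<mu>2 + \<beta>) \<le> 0 \<or> p < 2 \<or>
         (p = 2 \<and> min (2 - GN_const 4 * (\<mu>1 + \<beta>) * c1) (2 - GN_const 4 * (\<mu>2 + \<beta>) * c2) > 0)"
  shows "bdd_below ((\<lambda>(u, v). Ifun p \<mu>1 \<mu>2 \<beta> u v) ` (Sc c1 \<times> Sc c2))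
    \<and> (\<exists>u\<in>Sc c1. \<exists>v\<in>Sc c2. Ifun p \<mu>1 \<mu>2 \<beta> u v
          = Inf ((\<lambda>(u, v). Ifun p \<mu>1 \<mu>2 \<beta> u v) ` (Sc c1 \<times> Sc c2)))
    \<and> (\<exists>l1 l2 u v. crit p \<mu>1 \<mu>2 \<beta> c1 c2 l1 l2 u v
          \<and> Ifun p \<mu>1 \<mu>2 \<beta> u v
              = Inf ((\<lambda>(u, v). Ifun p \<mu>1 \<mu>2 \<beta> u v) ` Kset p \<mu>1 \<mu>2 \<beta> c1 c2))"
proof -
  let ?I = "Ifun p \<mu>1 \<mu>2 \<beta>"
  obtain \<kappa> D where k: "0 < \<kappa>" and coercive: "\<And>u v. u \<in> Sc c1 \<Longrightarrow> v \<in> Sc c2 \<Longrightarrow>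
    \<kappa> * (Q u + Q v) + W_pos u v / 4 - D \<le> ?I u v"
    by (rule Ifun_coercive[OF assms]) (rule that)
  obtain u v where uv: "u \<in> Sc c1" "v \<in> Sc c2"
    and min: "\<And>w z. w \<in> Sc c1 \<Longrightarrow> z \<in> Sc c2 \<Longrightarrow> ?I u v \<le> ?I w z"
    by (rule exists_minimizer[OF assms(1,3,4) k coercive]) (assumption | rule that)+
  obtain l1 l2 where crit: "crit p \<mu>1 \<mu>2 \<beta> c1 c2 l1 l2 u v"
    by (rule minimizer_crit[OF assms(1,3,4) uv min]) (assumption | rule that)+
  \<comment> \<open>Every subset of the constraint set that contains (u, v) has the same least
    energy; this is used for the constraint set itself and for the critical pairs.\<close>
  have Inf_eq: "?I u v = Inf ((\<lambda>(u, v). ?I u v) ` A)" if "A \<subseteq> Sc c1 \<times> Sc c2" "(u, v) \<in> A" for A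
    using that min by (intro cInf_eq_minimum[symmetric]) auto
  have "bdd_below ((\<lambda>(u, v). ?I u v) ` (Sc c1 \<times> Sc c2))"
    using min by (intro bdd_belowI[of _ "?I u v"]) auto
  moreover have "?I u v = Inf ((\<lambda>(u, v). ?I u v) ` (Sc c1 \<times> Sc c2))"
    using uv by (intro Inf_eq) auto
  moreover have "?I u v = Inf ((\<lambda>(u, v). ?I u v) ` Kset p \<mu>1 \<mu>2 \<beta> c1 c2)"
    using crit by (intro Inf_eq) (auto simp: Kset_def crit_def)
  ultimately show ?thesis using uv crit by blast
qed

end
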